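(* Suppose that $c_1(\mathbb P_{\hat\Sigma})$ is semi-positive and that $\mathcal T_{\hat\Sigma}$ is regular. Then $B_{\hat\Sigma}(a)$ modulo $J_{\hat\Sigma}$ gives a complete set of solutions to the enhanced GKZ system; that is, the coefficients $w_i$ of $B_{\hat\Sigma}$ modulo $J_{\hat\Sigma}$ with respect to a homogeneous basis $\{\alpha_i\}$ of $\mathbb C[D_0,\dots,D_p]/J_{\hat\Sigma}$ form a basis of its analytic solutions on some domain.
   Context: Enhanced GKZ system: $\Delta^*\subset\mathbb R^4$ is an integral polytope with integral points $v_i^*$ ($v_0^*=0$), and $q=(q_i)$ an integer vector indexed by these points with $\sum_iq_i=0$ (B-brane vector). Put $\hat v_i^*=(v_i^*;0)$, $w_0=(0;1)$, $w_1=(\sum_iq_iv_i^*;1)$ in $\mathbb Z^5$, and let $\hat\Delta^*$ be the enhanced polytope, their convex hull. With $\bar w=(1,w)$, the enhanced GKZ system is the GKZ $\mathcal A$-hypergeometric system for $\mathcal A=\{\bar{\hat v}_i^*\}\cup\{\bar w_0,\bar w_1\}\subset\mathbb Z^6$ and $\hat\beta=(-1,0,0,0,0,0)$, in variables $a_i$ (for $\hat v_i^*$) and $b_0,b_1$ (for $w_0,w_1$): for a function $\Phi$, $$\Big(\sum_i\bar{\hat v}_i^*a_i\tfrac{\partial}{\partial a_i}+\bar w_0b_0\tfrac{\partial}{\partial b_0}+\bar w_1b_1\tfrac{\partial}{\partial b_1}-\hat\beta\Big)\Phi=0,$$ and, for every integral relation $(l^c;l^o)$ with $\sum_il^c_i\bar{\hat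 v}_i^*+\sum_{k=0,1}l_k^o\bar w_k=0$, $$\prod_{l^c_i>0}\partial_{a_i}^{l_i^c}\prod_{l^o_k>0}\partial_{b_k}^{l_k^o}\Phi=\prod_{l^c_i<0}\partial_{a_i}^{-l_i^c}\prod_{l^o_k<0}\partial_{b_k}^{-l_k^o}\Phi .$$ The fan $\hat\Sigma$: $\Sigma^*$ is a complete regular fan in $\mathbb R^4$ whose set of generators of $1$-cones is $\Sigma^*(1)=\Delta^*$ (the set of nonzero integral points $v_i^*$). For each $\sigma\in\Sigma^*$ let $\hat\sigma\subset\mathbb R^5$ be the cone generated by $(\sigma,0)$ and $w_1$; these cones, together with $0$ (and faces), form a fan with support $\mathbb R^4\times\mathbb R_{\ge0}$. $\hat\Sigma$ is the regular (nonsingular) incomplete fan obtained by canonically subdividing this fan by inserting the ray through $w_0$ (which lies in the support), so that $\hat\Sigma(1)=\hat\Delta^*$, i.e. $\hat\Sigma(1)=\{\hat v_i^*\ (i\ne0),w_0,w_1\}$. Further notation: write $\hat\Sigma(1)=\{\mu_1,\dots,\mu_p\}$, $\mu_0=0$, and let $a=(a_0,\dots,a_p)$ denote all the variables (including $b_0,b_1$) indexed correspondingly. $c_1(\mathbb P_{\hat\Sigma})$ is semi-positive if the function on $|\hat\Sigma|$ that is linear on cones with value $1$ at each $\mu_1,\dots,\mu_p$ is convex ($\alpha(x+y)\le\alpha(x)+\alpha(y)$). In that case the simplices spanned by $\mu_0$ and the generators of the $5$-cones form a triangulation of $\nabla=\mathrm{conv}(\mu_0,\dots,\mu_p)$, denoted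 $\mathcal T_{\hat\Sigma}$, identified with the induced triangulation of $\mathrm{conv}(\mathcal A)$. Let $L\subset\mathbb Z^{p+1}$ be the lattice of relations of $\mathcal A$; $C(\mathcal T_{\hat\Sigma})\subset L^*\otimes\mathbb R$ is the cone of convex $\mathcal T_{\hat\Sigma}$-piecewise linear functions modulo linear functions, and $\mathcal T_{\hat\Sigma}$ is regular if this cone is full-dimensional. $J_{\hat\Sigma}\subset\mathbb C[D_0,\dots,D_p]$ is the ideal generated by the Stanley–Reisner ideal of $\hat\Sigma$ (in $D_1,\dots,D_p$) and the components of $\sum_{i=0}^p\bar\mu_iD_i$. The deformed Gamma series is $$B_{\hat\Sigma}(a)=\frac1{a_0}\sum_{l\in L\cap C(\mathcal T_{\hat\Sigma})^\vee}\frac{\Gamma(-l_0-D_0+1)}{\prod_{j=1}^p\Gamma(l_j+D_j+1)}\,a^{l+D},\qquad a^{l+D}=\prod_{i=0}^pa_i^{l_i+D_i}.$$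
   Formalization: The series is evaluated at (-a_0,a_1,...,a_p) instead of (a_0,...,a_p): with the stated formulas B satisfies the equation of a relation l only up to the sign (-1)^{l_0}, so the claim as written fails when some l_0 is odd (for example for P^4 with w_1=(e_1;1)). *)

theory Defs
  imports
    "HOL-Analysis.Analysis"
    "HOL-Complex_Analysis.Complex_Analysis"
    "HOL-Library.Poly_Mapping"
begin

section \<open>Lattices, cones and fans\<close>

text \<open>The lattice of a Euclidean space is spanned by its standard basis; for \<open>real^4\<close>,
  \<open>(real^4) \<times> real\<close> and \<open>real \<times> (real^4) \<times> real\<close> this gives $\mathbb Z^4$, $\mathbb Z^5$, $\mathbb Z^6$.\<close>

definition lattice_point :: "'a::euclidean_space \<Rightarrow> bool" where
  "lattice_point x \<longleftrightarrow> (\<forall>e\<in>Basis. x \<bullet> e \<in> \<int>)"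

definition lattice_points :: "'a::euclidean_space set \<Rightarrow> 'a set" where
  "lattice_points S = {x \<in> S. lattice_point x}"

definition integral_polytope :: "'a::euclidean_space set \<Rightarrow> bool" where
  "integral_polytope P \<longleftrightarrow> (\<exists>V. finite V \<and> (\<forall>v\<in>V. lattice_point v) \<and> P = convex hull V)"

definition primitive :: "'a::euclidean_space \<Rightarrow> bool" where
  "primitive v \<longleftrightarrow> lattice_point v \<and> v \<noteq> 0 \<and>
     (\<forall>t::real. 0 < t \<and> t < 1 \<longrightarrow> \<not> lattice_point (t *\<^sub>R v))"

definition lattice_basis :: "'a::euclidean_space set \<Rightarrow> bool" where
  "lattice_basis B \<longleftrightarrow> (\<forall>b\<in>B. lattice_point b) \<and> independent B \<and>
     (\<forall>x. lattice_point x \<longrightarrow> (\<exists>c::'a \<Rightarrow> int. x = (\<Sum>b\<in>B. of_int (c b) *\<^sub>R b)))"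

definition strongly_convex_rational_cone :: "'a::euclidean_space set \<Rightarrow> bool" where
  "strongly_convex_rational_cone \<sigma> \<longleftrightarrow>
     (\<exists>S. finite S \<and> (\<forall>v\<in>S. lattice_point v) \<and> \<sigma> = convex_cone hull S) \<and>
     (\<forall>x. x \<in> \<sigma> \<and> - x \<in> \<sigma> \<longrightarrow> x = 0)"

definition regular_cone :: "'a::euclidean_space set \<Rightarrow> bool" where
  "regular_cone \<sigma> \<longleftrightarrow> (\<exists>B S. lattice_basis B \<and> S \<subseteq> B \<and> \<sigma> = convex_cone hull S)"

text \<open>In the library the empty set is a face of every convex set; it is never a cone of a fan.\<close>

definition fan :: "'a::euclidean_space set set \<Rightarrow> bool" where
  "fan \<Sigma> \<longleftrightarrow> finite \<Sigma> \<and> \<Sigma> \<noteq> {} \<and> (\<forall>\<sigma>\<in>\<Sigma>. strongly_convex_rational_cone \<sigma>) \<and>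
     (\<forall>\<sigma>\<in>\<Sigma>. \<forall>\<tau>. \<tau> face_of \<sigma> \<and> \<tau> \<noteq> {} \<longrightarrow> \<tau> \<in> \<Sigma>) \<and>
     (\<forall>\<sigma>\<in>\<Sigma>. \<forall>\<tau>\<in>\<Sigma>. \<sigma> \<inter> \<tau> face_of \<sigma> \<and> \<sigma> \<inter> \<tau> face_of \<tau>)"

definition regular_fan :: "'a::euclidean_space set set \<Rightarrow> bool" where
  "regular_fan \<Sigma> \<longleftrightarrow> fan \<Sigma> \<and> (\<forall>\<sigma>\<in>\<Sigma>. regular_cone \<sigma>)"

definition complete_fan :: "'a::euclidean_space set set \<Rightarrow> bool" where
  "complete_fan \<Sigma> \<longleftrightarrow> fan \<Sigma> \<and> \<Union>\<Sigma> = UNIV"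

definition ray_generators :: "'a::euclidean_space set set \<Rightarrow> 'a set" where
  "ray_generators \<Sigma> = {v. primitive v \<and> convex_cone hull {v} \<in> \<Sigma>}"

definition star_subdivision :: "'a::euclidean_space set set \<Rightarrow> 'a \<Rightarrow> 'a set set" where
  "star_subdivision \<Sigma> v =
     {\<sigma> \<in> \<Sigma>. v \<notin> \<sigma>} \<union>
     {convex_cone hull (insert v \<tau>) | \<tau>. \<tau> \<in> \<Sigma> \<and> v \<notin> \<tau> \<and> (\<exists>\<sigma>\<in>\<Sigma>. insert v \<tau> \<subseteq> \<sigma>)}"

text \<open>Semi-positivity of $c_1$; \<open>\<alpha>\<close> is determined only on the support of the fan.\<close>

definition c1_semipositive :: "'a::euclidean_space set set \<Rightarrow> bool" where
  "c1_semipositive \<Sigma> \<longleftrightarrow> (\<exists>\<alpha>::'a \<Rightarrow> real.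
     (\<forall>\<sigma>\<in>\<Sigma>. \<exists>f. linear f \<and> (\<forall>x\<in>\<sigma>. \<alpha> x = f x)) \<and>
     (\<forall>v\<in>ray_generators \<Sigma>. \<alpha> v = 1) \<and>
     (\<forall>x\<in>\<Union>\<Sigma>. \<forall>y\<in>\<Union>\<Sigma>. \<alpha> (x + y) \<le> \<alpha> x + \<alpha> y))"


section \<open>The enhanced polytope and its fan\<close>

definition w0 :: "(real^4) \<times> real" where
  "w0 = (0, 1)"

definition w1 :: "(real^4) set \<Rightarrow> (real^4 \<Rightarrow> int) \<Rightarrow> (real^4) \<times> real" where
  "w1 \<Delta> q = ((\<Sum>v\<in>lattice_points \<Delta>. of_int (q v) *\<^sub>R v), 1)"

definition enhanced_points :: "(real^4) set \<Rightarrow> (real^4 \<Rightarrow> int) \<Rightarrow> ((real^4) \<times> real) set" where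
  "enhanced_points \<Delta> q = (\<lambda>v. (v, 0)) ` lattice_points \<Delta> \<union> {w0, w1 \<Delta> q}"

definition cone_over_fan :: "(real^4) set set \<Rightarrow> (real^4) \<times> real \<Rightarrow> ((real^4) \<times> real) set set" where
  "cone_over_fan \<Sigma> w =
     {\<tau>. \<tau> \<noteq> {} \<and> (\<exists>\<sigma>\<in>\<Sigma>. \<tau> face_of (convex_cone hull (insert w ((\<lambda>v. (v, 0)) ` \<sigma>))))}"

definition enhanced_fan ::
    "(real^4) set \<Rightarrow> (real^4 \<Rightarrow> int) \<Rightarrow> (real^4) set set \<Rightarrow> ((real^4) \<times> real) set set" where
  "enhanced_fan \<Delta> q \<Sigma> = star_subdivision (cone_over_fan \<Sigma> (w1 \<Delta> q)) w0"


section \<open>The triangulation, relations, and the cone of convex piecewise linear functions\<close>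

text \<open>From here on a point configuration is a family \<open>\<mu>\<close> over a finite index type \<open>'n\<close>, so the
  variables live in \<open>complex^'n\<close>.  The lift $\bar w=(1,w)$ is the pair \<open>(1, w)\<close>.\<close>

text \<open>Only the simplices of maximal dimension are listed.\<close>

definition fan_triangulation :: "'a::euclidean_space set set \<Rightarrow> 'a set set" where
  "fan_triangulation \<Sigma> =
     {convex hull (insert 0 (ray_generators \<Sigma> \<inter> \<sigma>)) | \<sigma>. \<sigma> \<in> \<Sigma> \<and> dim \<sigma> = DIM('a)}"

definition relation_lattice :: "('n::finite \<Rightarrow> 'a::euclidean_space) \<Rightarrow> (int^'n) set" where
  "relation_lattice \<mu> = {l. (\<Sum>i\<in>UNIV. of_int (l $ i) *\<^sub>R (1::real, \<mu> i)) = 0}"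

definition convex_pl_functions ::
    "('n::finite \<Rightarrow> 'a::euclidean_space) \<Rightarrow> 'a set set \<Rightarrow> ('a \<Rightarrow> real) set" where
  "convex_pl_functions \<mu> T =
     {\<psi>. convex_on (convex hull (range \<mu>)) \<psi> \<and>
         (\<forall>\<tau>\<in>T. \<exists>f c. linear f \<and> (\<forall>x\<in>\<tau>. \<psi> x = f x + c))}"

text \<open>$L^*\otimes\mathbb R=\mathrm{Hom}(L,\mathbb R)$, with functionals extended by \<open>0\<close> outside of
  \<open>L\<close> so that equality of functions is equality of functionals.\<close>

definition relation_dual :: "('n::finite \<Rightarrow> 'a::euclidean_space) \<Rightarrow> (int^'n \<Rightarrow> real) set" where
  "relation_dual \<mu> = {\<phi>. (\<forall>l\<in>relation_lattice \<mu>. \<forall>l'\<in>relation_lattice \<mu>. \<phi> (l + l') = \<phi> l + \<phi> l') \<and>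
                          (\<forall>l. l \<notin> relation_lattice \<mu> \<longrightarrow> \<phi> l = 0)}"

text \<open>A function \<open>\<psi>\<close> on the configuration defines the functional $l\mapsto\sum_i l_i\psi(\mu_i)$ on
  \<open>L\<close>, which vanishes exactly when the values $\psi(\mu_i)$ are those of a linear function of
  $\bar\mu_i$; passing to the functional is thus the quotient by linear functions.\<close>

definition relation_functional ::
    "('n::finite \<Rightarrow> 'a::euclidean_space) \<Rightarrow> ('a \<Rightarrow> real) \<Rightarrow> int^'n \<Rightarrow> real" where
  "relation_functional \<mu> \<psi> l =
     (if l \<in> relation_lattice \<mu> then \<Sum>i\<in>UNIV. of_int (l $ i) * \<psi> (\<mu> i) else 0)"

definition pl_cone ::
    "('n::finite \<Rightarrow> 'a::euclidean_space) \<Rightarrow> 'a set set \<Rightarrow> (int^'n \<Rightarrow> real) set" where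
  "pl_cone \<mu> T = relation_functional \<mu> ` convex_pl_functions \<mu> T"

text \<open>\<open>pl_cone \<mu> T\<close> is a convex cone, so its linear span is the set of differences of its
  elements; it is full-dimensional if that is all of $L^*\otimes\mathbb R$.\<close>

definition regular_triangulation :: "('n::finite \<Rightarrow> 'a::euclidean_space) \<Rightarrow> 'a set set \<Rightarrow> bool" where
  "regular_triangulation \<mu> T \<longleftrightarrow>
     (\<forall>\<phi>\<in>relation_dual \<mu>. \<exists>\<phi>1\<in>pl_cone \<mu> T. \<exists>\<phi>2\<in>pl_cone \<mu> T. \<phi> = (\<lambda>l. \<phi>1 l - \<phi>2 l))"

text \<open>$L\cap C(\mathcal T)^\vee$\<close>

definition dual_cone_lattice ::
    "('n::finite \<Rightarrow> 'a::euclidean_space) \<Rightarrow> 'a set set \<Rightarrow> (int^'n) set" where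
  "dual_cone_lattice \<mu> T = {l \<in> relation_lattice \<mu>. \<forall>\<phi>\<in>pl_cone \<mu> T. 0 \<le> \<phi> l}"


section \<open>The polynomial ring and the ideal J\<close>

type_synonym 'n cpoly = "('n \<Rightarrow>\<^sub>0 nat) \<Rightarrow>\<^sub>0 complex"

definition pvar :: "'n \<Rightarrow> 'n cpoly" where
  "pvar i = Poly_Mapping.single (Poly_Mapping.single i 1) 1"

definition pconst :: "complex \<Rightarrow> 'n cpoly" where
  "pconst c = Poly_Mapping.single 0 c"

definition mon_degree :: "('n::finite \<Rightarrow>\<^sub>0 nat) \<Rightarrow> nat" where
  "mon_degree m = (\<Sum>i\<in>UNIV. Poly_Mapping.lookup m i)"

definition homogeneous :: "'n::finite cpoly \<Rightarrow> bool" where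
  "homogeneous p \<longleftrightarrow> (\<exists>d. \<forall>m\<in>Poly_Mapping.keys p. mon_degree m = d)"

definition ideal_generated :: "'r::comm_ring_1 set \<Rightarrow> 'r set" where
  "ideal_generated S = {\<Sum>s\<in>F. c s * s | F c. finite F \<and> F \<subseteq> S}"

definition stanley_reisner_generators ::
    "'n::finite \<Rightarrow> ('n \<Rightarrow> 'a::euclidean_space) \<Rightarrow> 'a set set \<Rightarrow> 'n cpoly set" where
  "stanley_reisner_generators i0 \<mu> \<Sigma> =
     {\<Prod>i\<in>S. pvar i | S. i0 \<notin> S \<and> convex_cone hull (\<mu> ` S) \<notin> \<Sigma>}"

definition linear_generators :: "('n::finite \<Rightarrow> 'a::euclidean_space) \<Rightarrow> 'n cpoly set" where
  "linear_generators \<mu> =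
     {\<Sum>i\<in>UNIV. pconst (of_real ((1::real, \<mu> i) \<bullet> e)) * pvar i | e. e \<in> Basis}"

definition fan_ideal ::
    "'n::finite \<Rightarrow> ('n \<Rightarrow> 'a::euclidean_space) \<Rightarrow> 'a set set \<Rightarrow> 'n cpoly set" where
  "fan_ideal i0 \<mu> \<Sigma> = ideal_generated (stanley_reisner_generators i0 \<mu> \<Sigma> \<union> linear_generators \<mu>)"

text \<open>The classes of \<open>\<alpha> i\<close>, \<open>i \<in> I\<close>, are a basis of the vector space of polynomials modulo \<open>J\<close>.\<close>

definition basis_modulo :: "'n cpoly set \<Rightarrow> ('b \<Rightarrow> 'n cpoly) \<Rightarrow> 'b set \<Rightarrow> bool" where
  "basis_modulo J \<alpha> I \<longleftrightarrow>
     (\<forall>F c. finite F \<and> F \<subseteq> I \<and> (\<Sum>i\<in>F. pconst (c i) * \<alpha> i) \<in> J \<longrightarrow> (\<forall>i\<in>F. c i = 0)) \<and>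
     (\<forall>p. \<exists>F c. finite F \<and> F \<subseteq> I \<and> p - (\<Sum>i\<in>F. pconst (c i) * \<alpha> i) \<in> J)"

text \<open>A formal power series in the \<open>D\<^sub>i\<close> is given by its coefficients.  The classes of the \<open>D\<^sub>i\<close>
  modulo $J_{\hat\Sigma}$ are nilpotent, so its class is that of any sufficiently long truncation.\<close>

definition truncation :: "nat \<Rightarrow> (('n::finite \<Rightarrow>\<^sub>0 nat) \<Rightarrow> complex) \<Rightarrow> 'n cpoly" where
  "truncation N F = (\<Sum>m | mon_degree m \<le> N. Poly_Mapping.single m (F m))"

definition expansion_modulo ::
    "'n::finite cpoly set \<Rightarrow> ('b \<Rightarrow> 'n cpoly) \<Rightarrow> 'b set \<Rightarrow>
     (('n \<Rightarrow>\<^sub>0 nat) \<Rightarrow> complex) \<Rightarrow> ('b \<Rightarrow> complex) \<Rightarrow> bool" where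
  "expansion_modulo J \<alpha> I F w \<longleftrightarrow>
     (\<forall>\<^sub>F N in sequentially. truncation N F - (\<Sum>i\<in>I. pconst (w i) * \<alpha> i) \<in> J)"


section \<open>The deformed Gamma series\<close>

text \<open>The summand for \<open>l\<close> is a product of functions of one variable \<open>x = D\<^sub>i\<close> each.  The library's
  \<open>rGamma\<close> is the entire function $1/\Gamma$, and \<open>powr\<close> uses the principal logarithm.  For a
  semi-positive fan every \<open>l\<close> in the summation range has $l_0\le 0$, so the factor with index \<open>i0\<close>
  is holomorphic at \<open>x = 0\<close> as well.\<close>

definition B_factor :: "'n \<Rightarrow> int^'n \<Rightarrow> complex^'n \<Rightarrow> 'n \<Rightarrow> complex \<Rightarrow> complex" where
  "B_factor i0 l a i x =
     (if i = i0 then Gamma (- of_int (l $ i) - x + 1) else rGamma (of_int (l $ i) + x + 1)) *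
     (a $ i) powr (of_int (l $ i) + x)"

text \<open>The coefficient of the monomial \<open>D\<^sup>m\<close> in the summand for \<open>l\<close>, and in the whole series.\<close>

definition B_term :: "'n::finite \<Rightarrow> complex^'n \<Rightarrow> ('n \<Rightarrow>\<^sub>0 nat) \<Rightarrow> int^'n \<Rightarrow> complex" where
  "B_term i0 a m l =
     (\<Prod>i\<in>UNIV. fps_nth (fps_expansion (B_factor i0 l a i) 0) (Poly_Mapping.lookup m i))"

definition B_series ::
    "'n::finite \<Rightarrow> ('n \<Rightarrow> 'a::euclidean_space) \<Rightarrow> 'a set set \<Rightarrow> complex^'n \<Rightarrow>
     ('n \<Rightarrow>\<^sub>0 nat) \<Rightarrow> complex" where
  "B_series i0 \<mu> T a m = 1 / (a $ i0) * (\<Sum>\<^sub>\<infinity>l\<in>dual_cone_lattice \<mu> T. B_term i0 a m l)"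

text \<open>Sign of $a_0$.  As $\partial_{a_0}$ multiplies $\Gamma(1-l_0-D_0)\,a_0^{l_0+D_0-1}$ by
  $l_0+D_0-1$, it gives $-\Gamma(2-l_0-D_0)\,a_0^{l_0+D_0-2}$, whereas the other derivatives shift
  the coefficients without a sign.  Hence the series as written satisfies the box equation of a
  relation \<open>l\<close> up to the sign $(-1)^{l_0}$, and odd $l_0$ do occur.  As usual in this context, $a_0$ has
  to be replaced by $-a_0$ in one of the two: the series is evaluated at
  $(-a_0,a_1,\dots,a_p)$ when the system is in the variables $(a_0,\dots,a_p)$.\<close>

definition negate_coord :: "'n::finite \<Rightarrow> complex^'n \<Rightarrow> complex^'n" where
  "negate_coord i0 a = (\<chi> i. if i = i0 then - (a $ i) else a $ i)"


section \<open>GKZ systems\<close>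

definition holomorphic_on_several :: "(complex^'n::finite \<Rightarrow> complex) \<Rightarrow> (complex^'n) set \<Rightarrow> bool" where
  "holomorphic_on_several f U \<longleftrightarrow>
     (\<forall>a\<in>U. \<exists>f'. (f has_derivative f') (at a) \<and> (\<forall>c v. f' (c *s v) = c * f' v))"

definition partial_deriv ::
    "'n::finite \<Rightarrow> (complex^'n \<Rightarrow> complex) \<Rightarrow> complex^'n \<Rightarrow> complex" where
  "partial_deriv i f a = deriv (\<lambda>t. f (a + axis i t)) 0"

definition iterated_partial ::
    "'n::finite list \<Rightarrow> (complex^'n \<Rightarrow> complex) \<Rightarrow> complex^'n \<Rightarrow> complex" where
  "iterated_partial xs f = foldr partial_deriv xs f"

text \<open>A product of powers of partial derivatives is applied in an arbitrary order, given by a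
  list containing each index as often as the exponent requires; on holomorphic functions the
  order does not matter.\<close>

definition gkz_solution ::
    "('n::finite \<Rightarrow> 'a::euclidean_space) \<Rightarrow> real \<times> 'a \<Rightarrow> (complex^'n) set \<Rightarrow>
     (complex^'n \<Rightarrow> complex) \<Rightarrow> bool" where
  "gkz_solution \<mu> \<beta> U \<Phi> \<longleftrightarrow>
     holomorphic_on_several \<Phi> U \<and>
     (\<forall>a\<in>U. \<forall>e\<in>Basis.
        (\<Sum>i\<in>UNIV. of_real ((1::real, \<mu> i) \<bullet> e) * a $ i * partial_deriv i \<Phi> a)
          - of_real (\<beta> \<bullet> e) * \<Phi> a = 0) \<and>
     (\<forall>l\<in>relation_lattice \<mu>. \<forall>xs ys.
        (\<forall>i. count_list xs i = nat (l $ i)) \<and> (\<forall>i. count_list ys i = nat (- (l $ i))) \<longrightarrow>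
        (\<forall>a\<in>U. iterated_partial xs \<Phi> a = iterated_partial ys \<Phi> a))"

text \<open>Functions are compared on \<open>U\<close> only.\<close>

definition basis_of_gkz_solutions ::
    "('n::finite \<Rightarrow> 'a::euclidean_space) \<Rightarrow> real \<times> 'a \<Rightarrow> (complex^'n) set \<Rightarrow>
     ('b \<Rightarrow> complex^'n \<Rightarrow> complex) \<Rightarrow> 'b set \<Rightarrow> bool" where
  "basis_of_gkz_solutions \<mu> \<beta> U w I \<longleftrightarrow>
     finite I \<and> (\<forall>i\<in>I. gkz_solution \<mu> \<beta> U (w i)) \<and>
     (\<forall>c. (\<forall>a\<in>U. (\<Sum>i\<in>I. c i * w i a) = 0) \<longrightarrow> (\<forall>i\<in>I. c i = 0)) \<and>
     (\<forall>\<Phi>. gkz_solution \<mu> \<beta> U \<Phi> \<longrightarrow> (\<exists>c. \<forall>a\<in>U. \<Phi> a = (\<Sum>i\<in>I. c i * w i a)))"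

end

theory Submission
  imports Defs "HOL-Computational_Algebra.Fundamental_Theorem_Algebra"
begin

text \<open>
  Let \<open>A\<close> be the summation range of the series, \<open>L\<close> the lattice of relations and \<open>J\<close> the ideal.  A
  linear functional \<open>\<Lambda>\<close> that vanishes on \<open>J\<close> turns the deformed Gamma series into the function
  \<open>Ssum \<Lambda> 0\<close>, a sum over \<open>l \<in> A\<close> of terms \<open>tau \<Lambda> l\<close>.  The coefficients of the series with respect to
  a basis modulo \<open>J\<close> are the functions attached to the coordinate functionals of that basis.

  They are solutions.  With the sign of the apex coordinate changed, a partial derivative lowers the
  exponents of every term by a unit vector, so the derivative of order \<open>u\<close> is the sum of
  \<open>tau \<Lambda> (l - u)\<close> over \<open>l \<in> A\<close>.  Since \<open>1 / \<Gamma>(k + 1 + x)\<close> vanishes at \<open>x = 0\<close> for negative \<open>k\<close>, the term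
  with exponent \<open>k\<close> is divisible by the variables of the negative entries of \<open>k\<close>, and \<open>\<Lambda>\<close> kills it
  unless these form a face of the fan (\<open>tau_vanish\<close>).  Conversely, relations whose negative entries,
  apart from the one at the apex, sit on a face belong to \<open>A\<close>, because convex functions that are linear on the simplices of the
  triangulation are nonnegative on them (\<open>relation_in_dual_cone\<close>).  Hence \<open>A\<close> may be replaced by a
  set that depends on \<open>u\<close> only modulo \<open>L\<close>, which is the system of binomial differential equations
  (\<open>Ssum_box\<close>).  The homogeneity equations hold because \<open>\<Lambda>\<close> kills the linear generators of \<open>J\<close>.

  They converge.  Regularity of the triangulation yields a weight \<open>\<psi>\<close> whose value on every \<open>l \<in> A\<close> is at
  least the \<open>l\<^sup>1\<close>-norm of \<open>l\<close> (\<open>dual_cone_height\<close>), whereas the coefficients grow at most geometrically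
  in that norm (\<open>factorial_quotient_bound\<close>).  The domain consists of the points at which the
  logarithms of the coordinates are close to \<open>- t * \<psi>\<close> for some large \<open>t\<close>.

  They are independent.  For \<open>t\<close> tending to infinity all terms except the one of \<open>l = 0\<close> decay
  exponentially, while that one is a polynomial in \<open>t\<close>.  If the sum vanishes, so does the leading term;
  as it is \<open>\<Lambda>\<close> applied to a unit times an exponential of the logarithmic coordinates, all values of
  \<open>\<Lambda>\<close> are \<open>0\<close> (\<open>Ssum_injective\<close>).

  They span.  For an arbitrary solution consider its derivatives at one point far out in the domain
  as a functional on monomials.  The homogeneity equations say that this functional kills the linear
  generators, up to terms of lower degree.  For a non-face \<open>S\<close> semi-positivity provides an element
  \<open>1\<^sub>S - m\<close> of \<open>A\<close> (\<open>nonface_relation_exists\<close>), and the corresponding equation makes the functional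
  smaller by a factor \<open>exp (- t)\<close> on the multiples of the monomial of \<open>S\<close>: it almost kills \<open>J\<close>.  If
  it vanishes on a homogeneous basis modulo \<open>J\<close>, it is therefore bounded by a small multiple of
  itself in each degree (\<open>contraction\<close>) and vanishes (\<open>jet_vanish\<close>).  So a solution is determined by as
  many numbers as there are basis elements, and the independent solutions above span all of them.
\<close>

no_notation fps_nth (infixl "$" 75)

section \<open>Holomorphic functions of several variables\<close>

lemma norm_axis_complex: "norm (axis i z :: complex^'n::finite) = norm z"
proof -
  have "(\<Sum>j\<in>UNIV. (norm ((axis i z :: complex^'n) $ j))\<^sup>2) = (\<Sum>j\<in>UNIV. if j = i then (norm z)\<^sup>2 else 0)"
    by (intro sum.cong) (auto simp: axis_def)
  then show ?thesis by (simp add: norm_vec_def L2_set_def)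
qed

lemma axis_zero [simp]: "axis i 0 = 0"
  by (simp add: axis_def vec_eq_iff)

lemma bounded_linear_axis: "bounded_linear (axis i :: complex \<Rightarrow> complex^'n::finite)"
proof (rule bounded_linear_intro[where K=1])
  show "norm (axis i x :: complex^'n) \<le> norm x * 1" for x by (simp add: norm_axis_complex)
qed (auto simp: axis_def vec_eq_iff)

lemma has_derivative_partials:
  fixes f :: "complex^'n::finite \<Rightarrow> complex"
  assumes "holomorphic_on_several f U" "a \<in> U"
  shows "(f has_derivative (\<lambda>v. \<Sum>i\<in>UNIV. v $ i * partial_deriv i f a)) (at a)"
proof -
  obtain f' where f': "(f has_derivative f') (at a)" and lin: "\<And>c v. f' (c *s v) = c * f' v"
    using assms unfolding holomorphic_on_several_def by blast
  interpret f': bounded_linear f' using f' by (rule has_derivative_bounded_linear)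
  have p: "partial_deriv i f a = f' (axis i 1)" for i
  proof -
    have 1: "((\<lambda>t. a + axis i t) has_derivative (\<lambda>t. axis i t)) (at (0::complex))"
      by (auto intro!: derivative_eq_intros bounded_linear.has_derivative[OF bounded_linear_axis])
    have "((\<lambda>t. f (a + axis i t)) has_derivative (\<lambda>t. f' (axis i t))) (at 0)"
      using has_derivative_compose[OF 1, of f f'] f' by simp
    moreover have "(\<lambda>t. f' (axis i t)) = (*) (f' (axis i 1))"
    proof
      fix t
      have "axis i t = t *s (axis i 1 :: complex^'n)" by (auto simp: axis_def vec_eq_iff)
      then show "f' (axis i t) = f' (axis i 1) * t" by (simp only: lin mult.commute)
    qed
    ultimately have "((\<lambda>t. f (a + axis i t)) has_field_derivative f' (axis i 1)) (at 0)"
      by (simp only: has_field_derivative_def)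
    then show ?thesis unfolding partial_deriv_def by (rule DERIV_imp_deriv)
  qed
  have "f' v = (\<Sum>i\<in>UNIV. v $ i * partial_deriv i f a)" for v
  proof -
    have "f' v = f' (\<Sum>i\<in>UNIV. v $ i *s axis i 1)"
      by (simp only: basis_expansion)
    also have "\<dots> = (\<Sum>i\<in>UNIV. v $ i * partial_deriv i f a)"
      by (simp add: f'.sum lin p)
    finally show ?thesis .
  qed
  then have "f' = (\<lambda>v. \<Sum>i\<in>UNIV. v $ i * partial_deriv i f a)" by auto
  with f' show ?thesis by simp
qed

lemma holomorphic_on_severalI:
  assumes "\<And>a. a \<in> U \<Longrightarrow> (f has_derivative (\<lambda>v. \<Sum>i\<in>UNIV. v $ i * g i a)) (at a)"
  shows "holomorphic_on_several f U"
  unfolding holomorphic_on_several_def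
proof (intro ballI exI conjI allI)
  fix a assume "a \<in> U" then show "(f has_derivative (\<lambda>v. \<Sum>i\<in>UNIV. v $ i * g i a)) (at a)" by fact
qed (simp add: sum_distrib_left mult.assoc)

lemma partial_deriv_eqI:
  fixes f :: "complex^'n::finite \<Rightarrow> complex"
  assumes "(f has_derivative (\<lambda>v. \<Sum>i\<in>UNIV. v $ i * g i)) (at a)"
  shows "partial_deriv j f a = g j"
proof -
  have "holomorphic_on_several f {a}"
    using assms by (intro holomorphic_on_severalI[where g="\<lambda>i _. g i"]) auto
  then have "(f has_derivative (\<lambda>v. \<Sum>i\<in>UNIV. v $ i * partial_deriv i f a)) (at a)"
    by (rule has_derivative_partials) simp
  from has_derivative_unique[OF this assms]
  have "(\<Sum>i\<in>UNIV. (axis j 1 :: complex^'n) $ i * partial_deriv i f a) = (\<Sum>i\<in>UNIV. (axis j 1 :: complex^'n) $ i * g i)"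
    by meson
  then show ?thesis by (simp add: axis_def if_distrib if_distribR cong: if_cong)
qed

lemma has_field_derivative_line:
  assumes "holomorphic_on_several f U" "a + s *s v \<in> U"
  shows "((\<lambda>s. f (a + s *s v)) has_field_derivative (\<Sum>i\<in>UNIV. v $ i * partial_deriv i f (a + s *s v))) (at s)"
proof -
  have bl: "bounded_linear (\<lambda>s. s *s v)"
    by (rule linear_conv_bounded_linear[THEN iffD1], rule linearI)
       (auto simp: vec_eq_iff algebra_simps)
  have 1: "((\<lambda>s. a + s *s v) has_derivative (\<lambda>t. t *s v)) (at s)"
    by (auto intro!: derivative_eq_intros bounded_linear.has_derivative[OF bl])
  have der: "((\<lambda>s. f (a + s *s v)) has_derivative
      (\<lambda>t. \<Sum>i\<in>UNIV. (t *s v) $ i * partial_deriv i f (a + s *s v))) (at s)"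
    by (rule has_derivative_compose[OF 1 has_derivative_partials[OF assms]])
  have "(\<Sum>i\<in>UNIV. (t *s v) $ i * partial_deriv i f (a + s *s v))
      = (\<Sum>i\<in>UNIV. v $ i * partial_deriv i f (a + s *s v)) * t" for t
  proof -
    have "(\<Sum>i\<in>UNIV. (t *s v) $ i * partial_deriv i f (a + s *s v))
      = t * (\<Sum>i\<in>UNIV. v $ i * partial_deriv i f (a + s *s v))"
      by (simp only: vector_smult_component sum_distrib_left mult.assoc)
    also have "\<dots> = (\<Sum>i\<in>UNIV. v $ i * partial_deriv i f (a + s *s v)) * t"
      by (rule mult.commute)
    finally show ?thesis .
  qed
  then have eq: "(\<lambda>t. \<Sum>i\<in>UNIV. (t *s v) $ i * partial_deriv i f (a + s *s v))
      = (*) (\<Sum>i\<in>UNIV. v $ i * partial_deriv i f (a + s *s v))"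
    by (rule ext)
  show ?thesis
    unfolding has_field_derivative_def using der unfolding eq .
qed

lemma axis_eq_smult: "axis i t = t *s (axis i 1 :: complex^'n::finite)"
  by (auto simp: axis_def vec_eq_iff)

lemma has_field_derivative_axis:
  fixes f :: "complex^'n::finite \<Rightarrow> complex"
  assumes "holomorphic_on_several f U" "a + axis i s \<in> U"
  shows "((\<lambda>s. f (a + axis i s)) has_field_derivative partial_deriv i f (a + axis i s)) (at s)"
proof -
  have eq: "s *s axis i 1 = (axis i s :: complex^'n)" for s
    by (rule axis_eq_smult[symmetric])
  have "(\<Sum>j\<in>UNIV. vec_nth (axis i 1 :: complex^'n) j * partial_deriv j f (a + axis i s)) = partial_deriv i f (a + axis i s)"
    by (simp add: axis_def if_distrib if_distribR cong: if_cong)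
  with has_field_derivative_line[of f U a s "axis i 1"] assms show ?thesis
    by (simp only: eq)
qed

lemma holomorphic_on_several_continuous:
  "holomorphic_on_several f U \<Longrightarrow> continuous_on U f"
  by (rule continuous_at_imp_continuous_on) (blast intro: has_derivative_partials has_derivative_continuous)

lemma partial_deriv_cong:
  assumes "open U" "\<And>a. a \<in> U \<Longrightarrow> f a = g a" "a \<in> U"
  shows "partial_deriv i f a = partial_deriv i g a"
  unfolding partial_deriv_def
proof (rule deriv_cong_ev)
  have "((\<lambda>t. a + axis i t) \<longlongrightarrow> a + axis i 0) (nhds (0::complex))"
    by (intro tendsto_add tendsto_const bounded_linear.tendsto[OF bounded_linear_axis] filterlim_ident)
  then have "((\<lambda>t. a + axis i t) \<longlongrightarrow> a) (nhds (0::complex))"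
    by simp
  from topological_tendstoD[OF this assms(1,3)]
  show "\<forall>\<^sub>F t in nhds 0. f (a + axis i t) = g (a + axis i t)"
    by eventually_elim (use assms(2) in auto)
qed simp

text \<open>Cauchy's formula over a circle of fixed radius, so that the integrand depends on the base point
  only through \<open>f\<close>.\<close>

lemma partial_deriv_Cauchy:
  fixes f :: "complex^'n::finite \<Rightarrow> complex"
  assumes "holomorphic_on_several f U" "r > 0" "cball a r \<subseteq> U"
  shows "((\<lambda>t. f (a + axis i (r * exp (2 * pi * \<i> * of_real t))) / (r * exp (2 * pi * \<i> * of_real t)))
     has_integral partial_deriv i f a) {0..1}"
proof -
  have in_U: "a + axis i s \<in> U" if "s \<in> cball 0 r" for s
  proof -
    have "dist a (a + axis i s) = norm s" by (simp add: dist_norm norm_axis_complex)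
    with that assms(3) show ?thesis by auto
  qed
  define h where "h s = f (a + axis i s)" for s
  have der: "(h has_field_derivative partial_deriv i f (a + axis i s)) (at s)" if "s \<in> cball 0 r" for s
    unfolding h_def by (rule has_field_derivative_axis[OF assms(1) in_U[OF that]])
  have deriv_h: "deriv h 0 = partial_deriv i f a"
    by (simp add: h_def[abs_def] partial_deriv_def)
  have cont: "continuous_on (cball 0 r) h"
    by (rule continuous_at_imp_continuous_on) (blast intro: der DERIV_isCont)
  have hol: "h holomorphic_on ball 0 r"
  proof (rule holomorphic_onI)
    fix s assume "s \<in> ball (0::complex) r"
    then have "s \<in> cball 0 r" by simp
    from der[OF this] show "h field_differentiable at s within ball 0 r"
      using field_differentiable_at_within field_differentiable_def by blast
  qed
  have "((\<lambda>u. h u / (u - 0) ^ Suc 1) has_contour_integral ((2 * pi * \<i>) / fact 1 * (deriv ^^ 1) h 0)) (circlepath 0 r)"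
    by (rule Cauchy_has_contour_integral_higher_derivative_circlepath[OF cont hol]) (use assms in auto)
  then have "((\<lambda>t. h (circlepath 0 r t) / (circlepath 0 r t)^2 * vector_derivative (circlepath 0 r) (at t within {0..1}))
     has_integral (2 * pi * \<i> * deriv h 0)) {0..1}"
    unfolding has_contour_integral_def by (simp add: power2_eq_square)
  then have "((\<lambda>t. (1 / (2 * pi * \<i>)) * (h (circlepath 0 r t) / (circlepath 0 r t)^2 * vector_derivative (circlepath 0 r) (at t within {0..1})))
     has_integral (1 / (2 * pi * \<i>)) * (2 * pi * \<i> * deriv h 0)) {0..1}"
    by (rule has_integral_mult_right)
  then have "((\<lambda>t. h (r * exp (2 * pi * \<i> * of_real t)) / (r * exp (2 * pi * \<i> * of_real t)))
     has_integral (1 / (2 * pi * \<i>)) * (2 * pi * \<i> * deriv h 0)) {0..1}"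
  proof (rule has_integral_eq[rotated])
    fix t :: real assume "t \<in> {0..1}"
    then have v: "vector_derivative (circlepath 0 r) (at t within {0..1}) = 2 * pi * \<i> * r * exp (2 * of_real pi * \<i> * t)"
      using vector_derivative_circlepath01[of t 0 r] by auto
    show "(1 / (2 * pi * \<i>)) * (h (circlepath 0 r t) / (circlepath 0 r t)^2 * vector_derivative (circlepath 0 r) (at t within {0..1}))
       = h (r * exp (2 * pi * \<i> * of_real t)) / (r * exp (2 * pi * \<i> * of_real t))"
      unfolding v using assms(2) by (simp add: circlepath power2_eq_square field_simps)
  qed
  then show ?thesis
    using deriv_h by (simp add: h_def)
qed

lemma partial_deriv_continuous:
  fixes f :: "complex^'n::finite \<Rightarrow> complex"
  assumes f: "holomorphic_on_several f U" and U: "open U"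
  shows "continuous_on U (partial_deriv i f)"
proof (rule continuous_at_imp_continuous_on, rule ballI)
  fix a assume "a \<in> U"
  then obtain R where R: "R > 0" "cball a R \<subseteq> U" using U by (auto simp: open_contains_cball)
  define r where "r = R / 2"
  have r: "r > 0" using R by (simp add: r_def)
  define \<rho> where "\<rho> t = complex_of_real r * exp (2 * pi * \<i> * of_real t)" for t
  have \<rho>: "norm (\<rho> t) = r" "\<rho> t \<noteq> 0" for t using r by (auto simp: \<rho>_def norm_mult)
  have \<rho>_cont: "continuous_on S (\<lambda>x. \<rho> (g x))" if "continuous_on S g" for S :: "((complex^'n) \<times> real) set" and g
    unfolding \<rho>_def by (intro continuous_intros that)
  have sub: "cball x r \<subseteq> U" if "x \<in> ball a r" for x
  proof -
    have "cball x r \<subseteq> cball a R"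
    proof
      fix y assume "y \<in> cball x r"
      then show "y \<in> cball a R" using that dist_triangle[of a y x] by (auto simp: r_def dist_commute)
    qed
    with R show ?thesis by auto
  qed
  have "partial_deriv i f x = integral {0..1} (\<lambda>t. f (x + axis i (\<rho> t)) / \<rho> t)" if "x \<in> ball a r" for x
    using integral_unique[OF partial_deriv_Cauchy[OF f r sub[OF that], of i]] by (simp add: \<rho>_def)
  moreover have "continuous_on (ball a r) (\<lambda>x. integral (cbox 0 1) (\<lambda>t. f (x + axis i (\<rho> t)) / \<rho> t))"
  proof (rule integral_continuous_on_param)
    have "continuous_on (ball a r \<times> cbox 0 1) (\<lambda>z. f (fst z + axis i (\<rho> (snd z))) / \<rho> (snd z))"
    proof (intro continuous_on_divide continuous_on_compose2[OF holomorphic_on_several_continuous[OF f]])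
      show "(\<lambda>z. fst z + axis i (\<rho> (snd z))) ` (ball a r \<times> cbox 0 1) \<subseteq> U"
      proof clarify
        fix x :: "complex^'n" and t :: real assume "x \<in> ball a r" "t \<in> cbox 0 1"
        have "dist x (x + axis i (\<rho> t)) = r" by (simp add: dist_norm norm_axis_complex \<rho>)
        then have "x + axis i (\<rho> t) \<in> cball x r" by simp
        then show "fst (x, t) + axis i (\<rho> (snd (x, t))) \<in> U" using sub[OF \<open>x \<in> ball a r\<close>] by auto
      qed
      show "continuous_on (ball a r \<times> cbox 0 1) (\<lambda>z. fst z + axis i (\<rho> (snd z)))"
        by (intro continuous_intros bounded_linear.continuous_on[OF bounded_linear_axis] \<rho>_cont)
    qed (auto simp: \<rho> intro!: \<rho>_cont continuous_intros)
    then show "continuous_on (ball a r \<times> cbox 0 1) (\<lambda>(x, t). f (x + axis i (\<rho> t)) / \<rho> t)"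
      by (simp add: case_prod_unfold)
  qed
  ultimately have "continuous_on (ball a r) (partial_deriv i f)"
    by (auto cong: continuous_on_cong_simp)
  then show "continuous (at a) (partial_deriv i f)"
    using r by (simp add: continuous_on_eq_continuous_at)
qed

text \<open>Differentiating Cauchy's formula under the integral sign: a partial derivative is again
  holomorphic, and its own partial derivatives are obtained by taking those of \<open>f\<close> inside the
  integral.\<close>
lemma partial_deriv_has_derivative:
  fixes f :: "complex^'n::finite \<Rightarrow> complex"
  assumes f: "holomorphic_on_several f U" and U: "open U" and "a \<in> U"
  obtains r where "r > 0" "cball a r \<subseteq> U"
    "(partial_deriv i f has_derivative (\<lambda>v. \<Sum>j\<in>UNIV. v $ j * integral {0..1}
        (\<lambda>t. partial_deriv j f (a + axis i (r * exp (2 * pi * \<i> * of_real t))) / (r * exp (2 * pi * \<i> * of_real t))))) (at a)"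
proof -
  obtain R where R: "R > 0" "cball a R \<subseteq> U" using U \<open>a \<in> U\<close> by (auto simp: open_contains_cball)
  define r where "r = R / 2"
  have r: "r > 0" using R by (simp add: r_def)
  define \<rho> where "\<rho> t = complex_of_real r * exp (2 * pi * \<i> * of_real t)" for t
  have \<rho>: "norm (\<rho> t) = r" "\<rho> t \<noteq> 0" for t using r by (auto simp: \<rho>_def norm_mult)
  have \<rho>_cont: "continuous_on S (\<lambda>x. \<rho> (g x))" if "continuous_on S g" for S :: "((complex^'n) \<times> real) set" and g
    unfolding \<rho>_def by (intro continuous_intros that)
  have \<rho>_cont': "continuous_on S \<rho>" for S
    unfolding \<rho>_def by (intro continuous_intros)
  have sub: "cball x r \<subseteq> U" if "x \<in> ball a r" for x
  proof -
    have "cball x r \<subseteq> cball a R"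
    proof
      fix y assume "y \<in> cball x r"
      then show "y \<in> cball a R" using that dist_triangle[of a y x] by (auto simp: r_def dist_commute)
    qed
    with R show ?thesis by auto
  qed
  have inU: "x + axis i (\<rho> t) \<in> U" if "x \<in> ball a r" for x t
  proof -
    have "dist x (x + axis i (\<rho> t)) = r" by (simp add: dist_norm norm_axis_complex \<rho>)
    then have "x + axis i (\<rho> t) \<in> cball x r" by simp
    then show ?thesis using sub[OF that] by auto
  qed
  have Cauchy: "partial_deriv i f x = integral (cbox 0 1) (\<lambda>t. f (x + axis i (\<rho> t)) / \<rho> t)" if "x \<in> ball a r" for x
    using integral_unique[OF partial_deriv_Cauchy[OF f r sub[OF that], of i]] by (simp add: \<rho>_def)
  define P :: "'n \<Rightarrow> (complex^'n) \<Rightarrow>\<^sub>L complex" where "P j = Blinfun (\<lambda>v. v $ j)" for j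
  have P: "blinfun_apply (P j) v = v $ j" for j v
    unfolding P_def by (simp add: bounded_linear_Blinfun_apply bounded_linear_vec_nth)
  define B where "B x t = (\<Sum>j\<in>UNIV. blinfun_mult_left (partial_deriv j f (x + axis i (\<rho> t)) / \<rho> t) o\<^sub>L P j)" for x t
  have B: "blinfun_apply (B x t) v = (\<Sum>j\<in>UNIV. v $ j * (partial_deriv j f (x + axis i (\<rho> t)) / \<rho> t))" for x t v
    by (simp add: B_def blinfun.sum_left P)
  have pcont: "continuous_on (ball a r \<times> cbox 0 1) (\<lambda>z. partial_deriv j f (fst z + axis i (\<rho> (snd z))) / \<rho> (snd z))" for j
  proof (intro continuous_on_divide continuous_on_compose2[OF partial_deriv_continuous[OF f U]])
    show "(\<lambda>z. fst z + axis i (\<rho> (snd z))) ` (ball a r \<times> cbox 0 1) \<subseteq> U"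
      using inU by auto
    show "continuous_on (ball a r \<times> cbox 0 1) (\<lambda>z. fst z + axis i (\<rho> (snd z)))"
      by (intro continuous_intros bounded_linear.continuous_on[OF bounded_linear_axis] \<rho>_cont)
  qed (auto simp: \<rho> intro!: \<rho>_cont continuous_intros)
  have Bcont: "continuous_on (ball a r \<times> cbox 0 1) (\<lambda>(x, t). B x t)"
    unfolding B_def case_prod_unfold
    by (intro continuous_on_sum bounded_bilinear.continuous_on[OF bounded_bilinear_blinfun_compose]
        continuous_on_const bounded_linear.continuous_on[OF bounded_linear_blinfun_mult_left] pcont)
  have "((\<lambda>x. integral (cbox 0 1) (\<lambda>t. f (x + axis i (\<rho> t)) / \<rho> t))
      has_derivative blinfun_apply (integral (cbox 0 1) (B a))) (at a within ball a r)"
  proof (rule leibniz_rule[OF _ _ Bcont])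
    fix x t assume x: "x \<in> ball a r"
    have 1: "((\<lambda>x. x + axis i (\<rho> t)) has_derivative (\<lambda>v. v)) (at x)"
      by (auto intro!: derivative_eq_intros)
    have "((\<lambda>x. f (x + axis i (\<rho> t)) / \<rho> t) has_derivative
        (\<lambda>v. (\<Sum>j\<in>UNIV. v $ j * partial_deriv j f (x + axis i (\<rho> t))) / \<rho> t)) (at x)"
      by (rule bounded_linear.has_derivative[OF bounded_linear_divide has_derivative_compose[OF 1 has_derivative_partials[OF f inU[OF x]]]])
    then have "((\<lambda>x. f (x + axis i (\<rho> t)) / \<rho> t) has_derivative blinfun_apply (B x t)) (at x)"
      by (rule has_derivative_eq_rhs) (simp add: fun_eq_iff B sum_divide_distrib)
    then show "((\<lambda>x. f (x + axis i (\<rho> t)) / \<rho> t) has_derivative blinfun_apply (B x t)) (at x within ball a r)"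
      by (rule has_derivative_at_withinI)
  next
    fix x assume x: "x \<in> ball a r"
    show "(\<lambda>t. f (x + axis i (\<rho> t)) / \<rho> t) integrable_on cbox 0 1"
    proof (rule integrable_continuous, intro continuous_on_divide continuous_on_compose2[OF holomorphic_on_several_continuous[OF f]])
      show "(\<lambda>t. x + axis i (\<rho> t)) ` cbox 0 1 \<subseteq> U" using inU x by auto
    qed (auto simp: \<rho> intro!: continuous_intros bounded_linear.continuous_on[OF bounded_linear_axis] \<rho>_cont')
  qed (use r in auto)
  then have "(partial_deriv i f has_derivative blinfun_apply (integral (cbox 0 1) (B a))) (at a within ball a r)"
    by (rule has_derivative_transform[rotated 2]) (use Cauchy r in auto)
  then have der: "(partial_deriv i f has_derivative blinfun_apply (integral (cbox 0 1) (B a))) (at a)"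
    using r by (simp add: at_within_open[of a "ball a r"])
  have "blinfun_apply (integral (cbox 0 1) (B a)) v = (\<Sum>j\<in>UNIV. v $ j * integral {0..1}
        (\<lambda>t. partial_deriv j f (a + axis i (\<rho> t)) / \<rho> t))" for v
  proof -
    have a: "a \<in> ball a r" using r by simp
    have cpair: "continuous_on (cbox 0 1) (Pair a :: real \<Rightarrow> _)"
      by (intro continuous_intros)
    have img: "Pair a ` cbox 0 1 \<subseteq> ball a r \<times> cbox 0 (1::real)" using a by auto
    have "continuous_on (cbox 0 1) (B a)"
      using continuous_on_compose2[OF Bcont cpair img] by simp
    then have int: "B a integrable_on cbox 0 1" by (rule integrable_continuous)
    have pint: "(\<lambda>t. partial_deriv j f (a + axis i (\<rho> t)) / \<rho> t) integrable_on cbox 0 1" for j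
      using continuous_on_compose2[OF pcont[of j] cpair img] by (intro integrable_continuous) simp
    show ?thesis
      unfolding blinfun_apply_integral[OF int] B
      by (subst integral_sum)
         (auto simp del: times_divide_eq_right intro!: integrable_on_mult_right pint[unfolded cbox_interval])
  qed
  then have "blinfun_apply (integral (cbox 0 1) (B a)) = (\<lambda>v. \<Sum>j\<in>UNIV. v $ j * integral {0..1}
        (\<lambda>t. partial_deriv j f (a + axis i (\<rho> t)) / \<rho> t))" by auto
  with der have "(partial_deriv i f has_derivative (\<lambda>v. \<Sum>j\<in>UNIV. v $ j * integral {0..1}
        (\<lambda>t. partial_deriv j f (a + axis i (r * exp (2 * pi * \<i> * of_real t))) / (r * exp (2 * pi * \<i> * of_real t))))) (at a)"
    by (simp add: \<rho>_def)
  moreover have "cball a r \<subseteq> U" using sub[of a] r by auto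
  ultimately show ?thesis using that r by blast
qed

lemma holomorphic_on_several_partial_deriv:
  fixes f :: "complex^'n::finite \<Rightarrow> complex"
  assumes "holomorphic_on_several f U" "open U"
  shows "holomorphic_on_several (partial_deriv i f) U"
  unfolding holomorphic_on_several_def
proof
  fix a assume "a \<in> U"
  show "\<exists>f'. (partial_deriv i f has_derivative f') (at a) \<and> (\<forall>c v. f' (c *s v) = c * f' v)"
    by (rule partial_deriv_has_derivative[OF assms \<open>a \<in> U\<close>, of i], rule exI, rule conjI, assumption)
       (simp add: sum_distrib_left mult.assoc)
qed

lemma partial_deriv_commute:
  fixes f :: "complex^'n::finite \<Rightarrow> complex"
  assumes f: "holomorphic_on_several f U" and U: "open U" and a: "a \<in> U"
  shows "partial_deriv j (partial_deriv i f) a = partial_deriv i (partial_deriv j f) a"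
proof -
  obtain r where r: "r > 0" "cball a r \<subseteq> U" and der:
    "(partial_deriv i f has_derivative (\<lambda>v. \<Sum>j\<in>UNIV. v $ j * integral {0..1}
        (\<lambda>t. partial_deriv j f (a + axis i (r * exp (2 * pi * \<i> * of_real t))) / (r * exp (2 * pi * \<i> * of_real t))))) (at a)"
    using partial_deriv_has_derivative[OF assms] by blast
  have "partial_deriv j (partial_deriv i f) a = integral {0..1}
        (\<lambda>t. partial_deriv j f (a + axis i (r * exp (2 * pi * \<i> * of_real t))) / (r * exp (2 * pi * \<i> * of_real t)))"
    by (rule partial_deriv_eqI[OF der])
  also have "\<dots> = partial_deriv i (partial_deriv j f) a"
    by (rule integral_unique, rule partial_deriv_Cauchy[OF holomorphic_on_several_partial_deriv[OF f U] r])
  finally show ?thesis .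
qed

lemma iterated_partial_simps [simp]:
  "iterated_partial [] f = f"
  "iterated_partial (i # xs) f = partial_deriv i (iterated_partial xs f)"
  "iterated_partial (xs @ ys) f = iterated_partial xs (iterated_partial ys f)"
  by (simp_all add: iterated_partial_def)

lemma holomorphic_on_several_iterated_partial:
  fixes f :: "complex^'n::finite \<Rightarrow> complex"
  assumes "holomorphic_on_several f U" "open U"
  shows "holomorphic_on_several (iterated_partial xs f) U"
  by (induction xs) (simp_all add: assms holomorphic_on_several_partial_deriv)

lemma iterated_partial_cong:
  fixes f :: "complex^'n::finite \<Rightarrow> complex"
  assumes "open U" "\<And>a. a \<in> U \<Longrightarrow> f a = g a" "a \<in> U"
  shows "iterated_partial xs f a = iterated_partial xs g a"
  using assms(3)
proof (induction xs arbitrary: a)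
  case (Cons i xs)
  then show ?case
    by (simp, intro partial_deriv_cong[OF assms(1)]) auto
qed (use assms in auto)

lemma iterated_partial_shift:
  fixes f :: "complex^'n::finite \<Rightarrow> complex"
  assumes "holomorphic_on_several f U" "open U" "a \<in> U"
  shows "iterated_partial xs (partial_deriv i f) a = partial_deriv i (iterated_partial xs f) a"
  using assms(3)
proof (induction xs arbitrary: a)
  case (Cons j xs)
  have "iterated_partial (j # xs) (partial_deriv i f) a = partial_deriv j (partial_deriv i (iterated_partial xs f)) a"
    using Cons by (simp, intro partial_deriv_cong[OF assms(2)]) auto
  also have "\<dots> = partial_deriv i (partial_deriv j (iterated_partial xs f)) a"
    by (rule partial_deriv_commute[OF holomorphic_on_several_iterated_partial[OF assms(1,2)] assms(2) Cons.prems])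
  finally show ?case by simp
qed simp

lemma iterated_partial_mset_eq:
  fixes f :: "complex^'n::finite \<Rightarrow> complex"
  assumes "holomorphic_on_several f U" "open U" "a \<in> U" "\<And>i. count_list xs i = count_list ys i"
  shows "iterated_partial xs f a = iterated_partial ys f a"
  using assms(3,4)
proof (induction xs arbitrary: ys a)
  case Nil
  then have "count_list ys i = 0" for i by simp
  then have "i \<notin> set ys" for i by (simp add: count_list_0_iff)
  then have "ys = []" by (cases ys) auto
  then show ?case by simp
next
  case (Cons i xs)
  have "count_list ys i \<noteq> 0" using Cons.prems(2)[of i] by simp
  then have "i \<in> set ys" by (simp add: count_list_0_iff)
  then obtain ys1 ys2 where ys: "ys = ys1 @ i # ys2" by (auto simp: in_set_conv_decomp)
  have c: "count_list xs j = count_list (ys1 @ ys2) j" for j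
    using Cons.prems(2)[of j] by (auto simp: ys split: if_splits)
  have "iterated_partial ys f a = iterated_partial ys1 (partial_deriv i (iterated_partial ys2 f)) a"
    by (simp add: ys)
  also have "\<dots> = partial_deriv i (iterated_partial (ys1 @ ys2) f) a"
    using iterated_partial_shift[OF holomorphic_on_several_iterated_partial[OF assms(1,2)] assms(2) Cons.prems(1)]
    by simp
  also have "\<dots> = iterated_partial (i # xs) f a"
    using Cons.IH[OF _ c] Cons.prems(1) by (simp del: iterated_partial_simps(3), intro partial_deriv_cong[OF assms(2)]) auto
  finally show ?case by simp
qed

text \<open>On a line through a point where all derivatives vanish, all derivatives of the restriction
  vanish too.\<close>
lemma identity_on_ball:
  fixes f :: "complex^'n::finite \<Rightarrow> complex"
  assumes f: "holomorphic_on_several f U" and U: "open U" and ball: "ball a r \<subseteq> U"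
    and z: "\<And>xs. iterated_partial xs f a = 0" and x: "x \<in> ball a r"
  shows "f x = 0"
proof -
  define v where "v = x - a"
  define S where "S = {s. a + s *s v \<in> ball a r}"
  have bl: "bounded_linear (\<lambda>s. s *s v)"
    by (rule linear_conv_bounded_linear[THEN iffD1], rule linearI)
       (auto simp: vec_eq_iff algebra_simps)
  have S_eq: "S = (\<lambda>s. s *s v) -` ball 0 r"
    by (auto simp: S_def dist_norm norm_minus_commute)
  have "open S" unfolding S_eq
    by (intro open_vimage linear_continuous_on bl continuous_on_subset[of UNIV]) auto
  have "convex S" unfolding S_eq
    using bl by (intro convex_linear_vimage) (auto simp: bounded_linear.linear)
  then have "connected S" by (rule convex_connected)
  have mem: "0 \<in> S" "1 \<in> S" using x by (auto simp: S_def v_def intro: le_less_trans[OF zero_le_dist])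
  have hol: "(\<lambda>s. g (a + s *s v)) holomorphic_on S" if "holomorphic_on_several g U" for g
  proof (rule holomorphic_onI)
    fix s assume "s \<in> S"
    then have "a + s *s v \<in> U" using ball by (auto simp: S_def)
    from has_field_derivative_line[OF that this] show "(\<lambda>s. g (a + s *s v)) field_differentiable at s within S"
      using field_differentiable_at_within field_differentiable_def by blast
  qed
  have der0: "(deriv ^^ k) (\<lambda>s. g (a + s *s v)) 0 = 0"
    if "holomorphic_on_several g U" "\<And>xs. iterated_partial xs g a = 0" for g k
    using that
  proof (induction k arbitrary: g)
    case 0 then show ?case using "0.prems"(2)[of "[]"] by simp
  next
    case (Suc k)
    have hp: "holomorphic_on_several (partial_deriv i g) U" for i
      by (rule holomorphic_on_several_partial_deriv[OF Suc.prems(1) U])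
    have zp: "iterated_partial xs (partial_deriv i g) a = 0" for xs i
      using Suc.prems(2)[of "xs @ [i]"] by simp
    have "(deriv ^^ Suc k) (\<lambda>s. g (a + s *s v)) 0 = (deriv ^^ k) (deriv (\<lambda>s. g (a + s *s v))) 0"
      by (simp add: funpow_swap1)
    also have "\<dots> = (deriv ^^ k) (\<lambda>s. \<Sum>i\<in>UNIV. v $ i * partial_deriv i g (a + s *s v)) 0"
    proof (rule higher_deriv_cong_ev[OF _ refl])
      show "\<forall>\<^sub>F s in nhds 0. deriv (\<lambda>s. g (a + s *s v)) s = (\<Sum>i\<in>UNIV. v $ i * partial_deriv i g (a + s *s v))"
        using eventually_nhds_in_open[OF \<open>open S\<close> mem(1)]
        by eventually_elim (intro DERIV_imp_deriv has_field_derivative_line[OF Suc.prems(1)], use ball in \<open>auto simp: S_def\<close>)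
    qed
    also have "\<dots> = (\<Sum>i\<in>UNIV. v $ i * (deriv ^^ k) (\<lambda>s. partial_deriv i g (a + s *s v)) 0)"
    proof -
      have "finite I \<Longrightarrow> (deriv ^^ k) (\<lambda>s. \<Sum>i\<in>I. v $ i * partial_deriv i g (a + s *s v)) 0 = (\<Sum>i\<in>I. v $ i * (deriv ^^ k) (\<lambda>s. partial_deriv i g (a + s *s v)) 0)" for I
      proof (induction I rule: finite_induct)
        case (insert i I)
        have "(deriv ^^ k) (\<lambda>s. v $ i * partial_deriv i g (a + s *s v) + (\<Sum>i\<in>I. v $ i * partial_deriv i g (a + s *s v))) 0
          = (deriv ^^ k) (\<lambda>s. v $ i * partial_deriv i g (a + s *s v)) 0 + (deriv ^^ k) (\<lambda>s. \<Sum>i\<in>I. v $ i * partial_deriv i g (a + s *s v)) 0"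
          by (rule higher_deriv_add[OF _ _ \<open>open S\<close> mem(1)]) (intro holomorphic_on_mult holomorphic_on_sum holomorphic_on_const hol[OF hp])+
        also have "(deriv ^^ k) (\<lambda>s. v $ i * partial_deriv i g (a + s *s v)) 0 = v $ i * (deriv ^^ k) (\<lambda>s. partial_deriv i g (a + s *s v)) 0"
          by (rule higher_deriv_cmult[OF hol[OF hp] mem(1) \<open>open S\<close>])
        finally show ?case using insert by simp
      qed simp
      then show ?thesis by simp
    qed
    also have "\<dots> = 0" using Suc.IH[OF hp zp] by simp
    finally show ?case .
  qed
  have "(\<lambda>s. f (a + s *s v)) 1 = 0"
    by (rule holomorphic_fun_eq_0_on_connected[OF hol[OF f] \<open>open S\<close> \<open>connected S\<close> _ mem])
       (use der0[OF f z] in auto)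
  then show ?thesis by (simp add: v_def)
qed

text \<open>The points at which all derivatives vanish form a subset that is closed, and open because near
  such a point the function and hence all its derivatives vanish.\<close>

lemma identity_theorem_several:
  fixes f :: "complex^'n::finite \<Rightarrow> complex"
  assumes f: "holomorphic_on_several f U" and U: "open U" "connected U" and a: "a \<in> U"
    and z: "\<And>xs. iterated_partial xs f a = 0" and x: "x \<in> U"
  shows "f x = 0"
proof -
  define E where "E = {y \<in> U. \<forall>xs. iterated_partial xs f y = 0}"
  have "openin (top_of_set U) E"
  proof -
    have "open E"
      unfolding open_contains_ball
    proof
      fix y assume y: "y \<in> E"
      then obtain r where r: "r > 0" "ball y r \<subseteq> U" using U(1) unfolding E_def by (auto simp: open_contains_ball)
      have "iterated_partial xs f w = 0" if "w \<in> ball y r" for w xs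
        by (rule identity_on_ball[OF holomorphic_on_several_iterated_partial[OF f U(1)] U(1) r(2) _ that])
           (use y in \<open>auto simp: E_def simp flip: iterated_partial_simps(3)\<close>)
      then show "\<exists>e>0. ball y e \<subseteq> E" using r by (intro exI[of _ r]) (auto simp: E_def)
    qed
    then show ?thesis by (rule open_subset[rotated]) (auto simp: E_def)
  qed
  moreover have "closedin (top_of_set U) E"
  proof -
    have "E = U \<inter> (\<Inter>xs. {y \<in> U. iterated_partial xs f y = 0})" by (auto simp: E_def)
    moreover have "closedin (top_of_set U) {y \<in> U. iterated_partial xs f y = 0}" for xs
      by (rule continuous_closedin_preimage_constant[OF holomorphic_on_several_continuous[OF holomorphic_on_several_iterated_partial[OF f U(1)]]])
    ultimately show ?thesis by (auto intro!: closedin_Inter closedin_Int)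
  qed
  moreover have "a \<in> E" using a z by (simp add: E_def)
  ultimately have "E = U" using U(2) unfolding connected_clopen by blast
  then have "x \<in> E" using x by simp
  then have "iterated_partial [] f x = 0" unfolding E_def by blast
  then show ?thesis by simp
qed

text \<open>The terms are enumerated by the natural numbers; comparison with \<open>M\<close> then makes the series of
  derivatives converge uniformly.\<close>

lemma has_derivative_infsum:
  fixes f :: "'l::countable \<Rightarrow> 'a::real_normed_vector \<Rightarrow> complex"
  assumes S: "open S" "convex S" "x \<in> S"
    and der: "\<And>l x. l \<in> A \<Longrightarrow> x \<in> S \<Longrightarrow> (f l has_derivative f' l x) (at x)"
    and bd': "\<And>l x h. l \<in> A \<Longrightarrow> x \<in> S \<Longrightarrow> norm (f' l x h) \<le> M l * norm h"
    and bd: "\<And>l x. l \<in> A \<Longrightarrow> x \<in> S \<Longrightarrow> norm (f l x) \<le> M l"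
    and M: "M summable_on A"
  shows "((\<lambda>x. \<Sum>\<^sub>\<infinity>l\<in>A. f l x) has_derivative (\<lambda>h. \<Sum>\<^sub>\<infinity>l\<in>A. f' l x h)) (at x)"
proof -
  define N where "N n = (if n \<in> to_nat ` A then M (from_nat n) else 0)" for n
  have red: "(\<lambda>n. if n \<in> to_nat ` A then g (from_nat n) else 0) sums (\<Sum>\<^sub>\<infinity>l\<in>A. g l)"
    if "g summable_on A" for g :: "'l \<Rightarrow> 'c::{comm_monoid_add,t2_space}"
  proof -
    have "(g has_sum (\<Sum>\<^sub>\<infinity>l\<in>A. g l)) A" using that by simp
    then have "((g \<circ> from_nat) \<circ> to_nat has_sum (\<Sum>\<^sub>\<infinity>l\<in>A. g l)) A" by (simp add: o_def)
    then have "(g \<circ> from_nat has_sum (\<Sum>\<^sub>\<infinity>l\<in>A. g l)) (to_nat ` A)"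
      by (simp only: has_sum_reindex[OF inj_on_subset[OF inj_to_nat subset_UNIV]])
    then have "((\<lambda>n. if n \<in> to_nat ` A then g (from_nat n) else 0) has_sum (\<Sum>\<^sub>\<infinity>l\<in>A. g l)) UNIV"
      by (subst has_sum_cong_neutral[where S = UNIV and T = "to_nat ` A" and g = "g \<circ> from_nat"]) simp_all
    then show ?thesis by (rule has_sum_imp_sums)
  qed
  have sumN: "summable N" using sums_summable[OF red[OF M]] by (simp add: N_def[abs_def])
  define F where "F n y = (if n \<in> to_nat ` A then f (from_nat n) y else 0)" for n y
  define F' where "F' n y h = (if n \<in> to_nat ` A then f' (from_nat n) y h else 0)" for n y h
  have summ: "(\<lambda>l. f l y) summable_on A" if "y \<in> S" for y
    using bd[OF _ that] by (auto intro: abs_summable_summable[OF summable_on_comparison_test[OF M]])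
  have summ': "(\<lambda>l. f' l y h) summable_on A" if "y \<in> S" for y h
    using bd'[OF _ that] by (auto intro: abs_summable_summable[OF summable_on_comparison_test[OF summable_on_cmult_left[OF M, of "norm h"]]])
  have sF: "(\<lambda>n. F n y) sums (\<Sum>\<^sub>\<infinity>l\<in>A. f l y)" if "y \<in> S" for y
    using red[OF summ[OF that]] by (simp add: F_def)
  have sF': "(\<lambda>n. F' n y h) sums (\<Sum>\<^sub>\<infinity>l\<in>A. f' l y h)" if "y \<in> S" for y h
    using red[OF summ'[OF that]] by (simp add: F'_def)
  have "\<exists>g. \<forall>y\<in>S. (\<lambda>n. F n y) sums g y \<and> (g has_derivative (\<lambda>h. \<Sum>\<^sub>\<infinity>l\<in>A. f' l y h)) (at y within S)"
  proof (rule has_derivative_series[where f = F and f' = F' and x = x, OF S(2)])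
    show "x \<in> S" "(\<lambda>n. F n x) sums (\<Sum>\<^sub>\<infinity>l\<in>A. f l x)" using S(3) sF by auto
  next
    fix n y assume "y \<in> S"
    show "(F n has_derivative F' n y) (at y within S)"
    proof (cases "n \<in> to_nat ` A")
      case True
      then obtain l where l: "l \<in> A" "n = to_nat l" by blast
      have "F n = f l" "F' n y = f' l y" using True l by (simp_all add: F_def F'_def fun_eq_iff)
      then show ?thesis using has_derivative_at_withinI[OF der[OF l(1) \<open>y \<in> S\<close>]] by simp
    next
      case False
      then have "F n = (\<lambda>_. 0)" "F' n y = (\<lambda>_. 0)" by (simp_all add: F_def F'_def fun_eq_iff)
      then show ?thesis by simp
    qed
  next
    fix e :: real assume "e > 0"
    have tail: "(\<lambda>n. suminf (\<lambda>i. N (i + n))) \<longlonglongrightarrow> 0" by (rule suminf_exist_split2[OF sumN])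
    then have "\<forall>\<^sub>F n in sequentially. suminf (\<lambda>i. N (i + n)) < e" using \<open>e > 0\<close> by (rule order_tendstoD)
    then show "\<forall>\<^sub>F n in sequentially. \<forall>y\<in>S. \<forall>h. norm (sum (\<lambda>i. F' i y h) {..<n} - (\<Sum>\<^sub>\<infinity>l\<in>A. f' l y h)) \<le> e * norm h"
    proof eventually_elim
      fix n assume n: "suminf (\<lambda>i. N (i + n)) < e"
      show "\<forall>y\<in>S. \<forall>h. norm (sum (\<lambda>i. F' i y h) {..<n} - (\<Sum>\<^sub>\<infinity>l\<in>A. f' l y h)) \<le> e * norm h"
      proof (intro ballI allI)
        fix y h assume y: "y \<in> S"
        have bF: "norm (F' i y h) \<le> N i * norm h" for i using bd'[OF _ y] by (auto simp: F'_def N_def)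
        have "(\<Sum>\<^sub>\<infinity>l\<in>A. f' l y h) = suminf (\<lambda>i. F' i y h)" using sF'[OF y] by (simp add: sums_iff)
        also have "\<dots> = suminf (\<lambda>i. F' (i + n) y h) + sum (\<lambda>i. F' i y h) {..<n}"
          by (rule suminf_split_initial_segment) (use sF'[OF y] in \<open>simp add: sums_iff\<close>)
        finally have "norm (sum (\<lambda>i. F' i y h) {..<n} - (\<Sum>\<^sub>\<infinity>l\<in>A. f' l y h)) = norm (suminf (\<lambda>i. F' (i + n) y h))"
          by (simp add: norm_minus_commute)
        also have "\<dots> \<le> suminf (\<lambda>i. N (i + n) * norm h)"
          by (rule norm_suminf_le[OF bF]) (intro summable_mult2 summable_ignore_initial_segment sumN)
        also have "\<dots> = suminf (\<lambda>i. N (i + n)) * norm h"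
          by (rule suminf_mult2[symmetric]) (intro summable_ignore_initial_segment sumN)
        also have "\<dots> \<le> e * norm h" using n by (intro mult_right_mono) auto
        finally show "norm (sum (\<lambda>i. F' i y h) {..<n} - (\<Sum>\<^sub>\<infinity>l\<in>A. f' l y h)) \<le> e * norm h" .
      qed
    qed
  qed
  then obtain g where "\<forall>y\<in>S. (\<lambda>n. F n y) sums g y \<and> (g has_derivative (\<lambda>h. \<Sum>\<^sub>\<infinity>l\<in>A. f' l y h)) (at y within S)" ..
  then have g: "\<And>y. y \<in> S \<Longrightarrow> (\<lambda>n. F n y) sums g y"
    "\<And>y. y \<in> S \<Longrightarrow> (g has_derivative (\<lambda>h. \<Sum>\<^sub>\<infinity>l\<in>A. f' l y h)) (at y within S)" by auto
  have eq: "g y = (\<Sum>\<^sub>\<infinity>l\<in>A. f l y)" if "y \<in> S" for y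
    using sums_unique2[OF g(1)[OF that] sF[OF that]] .
  have "(g has_derivative (\<lambda>h. \<Sum>\<^sub>\<infinity>l\<in>A. f' l x h)) (at x)"
    using g(2)[OF S(3)] unfolding at_within_open[OF S(3) S(1)] .
  then show ?thesis
    by (rule has_derivative_transform_within_open[OF _ S(1,3)]) (simp add: eq)
qed

section \<open>Functionals on polynomials modulo an ideal\<close>

abbreviation X :: "('n \<Rightarrow>\<^sub>0 nat) \<Rightarrow> 'n cpoly" where "X m \<equiv> Poly_Mapping.single m 1"

definition ind :: "'n set \<Rightarrow> ('n::finite \<Rightarrow>\<^sub>0 nat)" where
  "ind S = (\<Sum>i\<in>S. Poly_Mapping.single i 1)"

text \<open>Functions on monomials stand for linear functionals on polynomials.\<close>

definition app :: "(('n \<Rightarrow>\<^sub>0 nat) \<Rightarrow> complex) \<Rightarrow> 'n cpoly \<Rightarrow> complex" where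
  "app \<Lambda> p = (\<Sum>m\<in>Poly_Mapping.keys p. Poly_Mapping.lookup p m * \<Lambda> m)"

lemma lookup_ind [simp]: "Poly_Mapping.lookup (ind S) i = (if i \<in> S then 1 else 0)"
proof -
  have "Poly_Mapping.lookup (ind S) i = (\<Sum>j\<in>S. if j = i then 1 else 0)"
    unfolding ind_def lookup_sum by (rule sum.cong) (auto simp: lookup_single when_def)
  then show ?thesis by (simp add: sum.delta)
qed

lemma mon_degree_add [simp]: "mon_degree (a + b) = mon_degree a + mon_degree b"
  by (simp add: mon_degree_def lookup_add sum.distrib)

lemma mon_degree_zero [simp]: "mon_degree 0 = 0"
  by (simp add: mon_degree_def)

lemma mon_degree_single [simp]: "mon_degree (Poly_Mapping.single i n) = n"
proof -
  have "mon_degree (Poly_Mapping.single i n) = (\<Sum>j\<in>UNIV. if i = j then n else 0)"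
    unfolding mon_degree_def by (rule sum.cong) (auto simp: lookup_single when_def)
  then show ?thesis by simp
qed

lemma mon_degree_ind [simp]: "mon_degree (ind S) = card S"
  by (simp add: mon_degree_def sum.If_cases)

lemma finite_mon_degree_le: "finite {m :: 'n::finite \<Rightarrow>\<^sub>0 nat. mon_degree m \<le> N}"
proof -
  have "Poly_Mapping.lookup ` {m :: 'n \<Rightarrow>\<^sub>0 nat. mon_degree m \<le> N} \<subseteq> (UNIV :: 'n set) \<rightarrow>\<^sub>E {..N}"
  proof -
    have "Poly_Mapping.lookup m i \<le> N" if "mon_degree m \<le> N" for m :: "'n \<Rightarrow>\<^sub>0 nat" and i
    proof -
      have "Poly_Mapping.lookup m i \<le> mon_degree m"
        unfolding mon_degree_def by (rule member_le_sum) auto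
      with that show ?thesis by simp
    qed
    then show ?thesis by (auto simp: PiE_def)
  qed
  then have "finite (Poly_Mapping.lookup ` {m :: 'n \<Rightarrow>\<^sub>0 nat. mon_degree m \<le> N})"
    by (rule finite_subset) (simp add: finite_PiE)
  then show ?thesis
    by (rule finite_imageD) (auto intro!: inj_onI poly_mapping_eqI)
qed

lemma poly_mapping_sum_single:
  "p = (\<Sum>m\<in>Poly_Mapping.keys p. Poly_Mapping.single m (Poly_Mapping.lookup p m))"
proof (rule poly_mapping_eqI)
  fix k
  have "Poly_Mapping.lookup (\<Sum>m\<in>Poly_Mapping.keys p. Poly_Mapping.single m (Poly_Mapping.lookup p m)) k
    = (\<Sum>m\<in>Poly_Mapping.keys p. if m = k then Poly_Mapping.lookup p k else 0)"
    unfolding lookup_sum by (rule sum.cong) (auto simp: lookup_single when_def)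
  then show "Poly_Mapping.lookup p k = Poly_Mapping.lookup (\<Sum>m\<in>Poly_Mapping.keys p. Poly_Mapping.single m (Poly_Mapping.lookup p m)) k"
    by (simp add: sum.delta' in_keys_iff)
qed

lemma app_superset:
  "finite K \<Longrightarrow> Poly_Mapping.keys p \<subseteq> K \<Longrightarrow> app \<Lambda> p = (\<Sum>m\<in>K. Poly_Mapping.lookup p m * \<Lambda> m)"
  unfolding app_def by (rule sum.mono_neutral_left) (auto simp: in_keys_iff)

lemma app_add: "app \<Lambda> (p + q) = app \<Lambda> p + app \<Lambda> q"
proof -
  let ?K = "Poly_Mapping.keys p \<union> Poly_Mapping.keys q"
  have K: "finite ?K" "Poly_Mapping.keys (p + q) \<subseteq> ?K" by (auto dest: keys_add[THEN subsetD])
  show ?thesis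
    by (simp add: app_superset[OF K] app_superset[of ?K p] app_superset[of ?K q] lookup_add
        distrib_right sum.distrib)
qed

lemma app_zero [simp]: "app \<Lambda> 0 = 0"
  by (simp add: app_def)

lemma app_sum: "app \<Lambda> (\<Sum>i\<in>A. f i) = (\<Sum>i\<in>A. app \<Lambda> (f i))"
  by (induction A rule: infinite_finite_induct) (simp_all add: app_add)

lemma app_single [simp]: "app \<Lambda> (Poly_Mapping.single m c) = c * \<Lambda> m"
  by (cases "c = 0") (simp_all add: app_def)

lemma app_mult:
  "app \<Lambda> (f * p) = (\<Sum>k\<in>Poly_Mapping.keys f. Poly_Mapping.lookup f k * app (\<lambda>m. \<Lambda> (k + m)) p)"
proof -
  have "f * p = (\<Sum>k\<in>Poly_Mapping.keys f. \<Sum>m\<in>Poly_Mapping.keys p.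
      Poly_Mapping.single (k + m) (Poly_Mapping.lookup f k * Poly_Mapping.lookup p m))"
    by (subst poly_mapping_sum_single[of f], subst poly_mapping_sum_single[of p])
       (simp add: sum_product mult_single)
  then show ?thesis
    by (simp add: app_sum app_def[of _ p] sum_distrib_left mult.assoc)
qed

lemma app_pconst_mult: "app \<Lambda> (pconst c * p) = c * app \<Lambda> p"
  by (cases "c = 0") (simp_all add: pconst_def app_mult)

lemma app_uminus: "app \<Lambda> (- p) = - app \<Lambda> p"
  by (simp add: app_def sum_negf)

lemma app_diff: "app \<Lambda> (p - q) = app \<Lambda> p - app \<Lambda> q"
  using app_add[of \<Lambda> p "- q"] by (simp add: app_uminus)

lemma app_functional_sum: "app (\<lambda>m. \<Sum>i\<in>I. c i * \<Lambda> i m) p = (\<Sum>i\<in>I. c i * app (\<Lambda> i) p)"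
  unfolding app_def sum_distrib_left by (subst sum.swap) (simp add: mult_ac)

lemma prod_pvar: "(\<Prod>i\<in>S. pvar i) = X (ind S)" for S :: "'n::finite set"
proof (induction S rule: infinite_finite_induct)
  case (insert x F)
  then show ?case by (simp add: pvar_def ind_def mult_single)
qed (simp_all add: ind_def)

lemma pconst_mult_single: "pconst c * Poly_Mapping.single m d = Poly_Mapping.single m (c * d)"
  by (simp add: pconst_def mult_single)

lemma pconst_add: "pconst (a + b) = pconst a + pconst b"
  by (simp add: pconst_def single_add)

lemma pconst_mult: "pconst (a * b) = pconst a * pconst b"
  by (simp add: pconst_def mult_single)

lemma pconst_0 [simp]: "pconst 0 = 0" and pconst_1 [simp]: "pconst 1 = 1"
  by (simp_all add: pconst_def single_one)

lemma pconst_uminus: "pconst (- a) = - pconst a"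
  by (simp add: pconst_def single_uminus)

lemma pconst_diff: "pconst (a - b) = pconst a - pconst b"
  by (simp add: pconst_def single_diff)

lemma pconst_sum: "pconst (\<Sum>i\<in>A. f i) = (\<Sum>i\<in>A. pconst (f i))"
  by (induction A rule: infinite_finite_induct) (simp_all add: pconst_add)

lemma module_mult: "module ((*) :: 'r::comm_ring_1 \<Rightarrow> 'r \<Rightarrow> 'r)"
  by unfold_locales (simp_all add: algebra_simps)

lemma ideal_generated_eq_span: "ideal_generated S = module.span (*) S"
  unfolding ideal_generated_def module.span_explicit[OF module_mult] by auto

lemma ideal_gen: "s \<in> S \<Longrightarrow> s \<in> ideal_generated S"
  unfolding ideal_generated_eq_span by (rule module.span_base[OF module_mult])

lemma ideal_zero: "0 \<in> ideal_generated S"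
  unfolding ideal_generated_eq_span by (rule module.span_zero[OF module_mult])

lemma ideal_add: "p \<in> ideal_generated S \<Longrightarrow> q \<in> ideal_generated S \<Longrightarrow> p + q \<in> ideal_generated S"
  unfolding ideal_generated_eq_span by (rule module.span_add[OF module_mult])

lemma ideal_diff: "p \<in> ideal_generated S \<Longrightarrow> q \<in> ideal_generated S \<Longrightarrow> p - q \<in> ideal_generated S"
  unfolding ideal_generated_eq_span by (rule module.span_diff[OF module_mult])

lemma ideal_mult: "p \<in> ideal_generated S \<Longrightarrow> c * p \<in> ideal_generated S"
  unfolding ideal_generated_eq_span by (rule module.span_scale[OF module_mult])

lemma ideal_sum: "(\<And>i. i \<in> A \<Longrightarrow> f i \<in> ideal_generated S) \<Longrightarrow> (\<Sum>i\<in>A. f i) \<in> ideal_generated S"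
  unfolding ideal_generated_eq_span by (rule module.span_sum[OF module_mult])

lemma single_sum: "Poly_Mapping.single k (\<Sum>b\<in>B. f b) = (\<Sum>b\<in>B. Poly_Mapping.single k (f b))"
  by (induction B rule: infinite_finite_induct) (simp_all add: single_add)

lemma linear_generator_mem:
  "e \<in> Basis \<Longrightarrow> (\<Sum>i\<in>UNIV. pconst (of_real ((1::real, \<mu> i) \<bullet> e)) * pvar i) \<in> linear_generators \<mu>"
  unfolding linear_generators_def by blast

text \<open>What the analysis needs to know about the fan.  \<open>N\<close> consists of the non-faces and \<open>A\<close> is the
  summation range of the series.  By \<open>A_face\<close> the range contains every relation whose negative
  entries sit on a face, by \<open>nonface_relation\<close> a non-face degenerates along an element of the range,
  and \<open>height\<close> puts the range inside a proper cone.\<close>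

locale toric_data =
  fixes \<mu> :: "'n::finite \<Rightarrow> 'a::euclidean_space" and i0 :: 'n
    and N :: "'n set set" and A :: "(int^'n) set" and \<psi> :: "'n \<Rightarrow> real"
  assumes apex: "\<mu> i0 = 0"
    and A_relations: "A \<subseteq> relation_lattice \<mu>"
    and A_zero: "0 \<in> A"
    and A_apex: "l \<in> A \<Longrightarrow> l $ i0 \<le> 0"
    and A_face: "l \<in> relation_lattice \<mu> \<Longrightarrow> i0 \<notin> S \<Longrightarrow> S \<notin> N \<Longrightarrow> {j. j \<noteq> i0 \<and> l $ j < 0} \<subseteq> S \<Longrightarrow> l \<in> A"
    and nonface_apex: "S \<in> N \<Longrightarrow> i0 \<notin> S"
    and nonface_relation: "S \<in> N \<Longrightarrow> \<exists>m :: 'n \<Rightarrow> nat. (\<chi> j. of_bool (j \<in> S) - int (m j)) \<in> A - {0}"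
    and height: "l \<in> A \<Longrightarrow> (\<Sum>j\<in>UNIV. \<bar>real_of_int (l $ j)\<bar>) \<le> (\<Sum>j\<in>UNIV. of_int (l $ j) * \<psi> j)"
    and face_dual: "i0 \<notin> S \<Longrightarrow> S \<notin> N \<Longrightarrow> j \<in> S \<Longrightarrow> \<exists>e. \<mu> j \<bullet> e = 1 \<and> (\<forall>i\<in>S - {j}. \<mu> i \<bullet> e = 0)"
begin

definition J :: "'n cpoly set" where
  "J = ideal_generated ((\<lambda>S. \<Prod>i\<in>S. pvar i) ` N \<union> linear_generators \<mu>)"

definition linear_annihilator :: "(('n \<Rightarrow>\<^sub>0 nat) \<Rightarrow> complex) \<Rightarrow> bool" where
  "linear_annihilator \<Lambda> \<longleftrightarrow> (\<forall>e\<in>Basis. \<forall>k.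
     (\<Sum>i\<in>UNIV. of_real ((1::real, \<mu> i) \<bullet> e) * \<Lambda> (k + Poly_Mapping.single i 1)) = 0)"

definition annihilator :: "(('n \<Rightarrow>\<^sub>0 nat) \<Rightarrow> complex) \<Rightarrow> bool" where
  "annihilator \<Lambda> \<longleftrightarrow> linear_annihilator \<Lambda> \<and> (\<forall>S\<in>N. \<forall>k. \<Lambda> (k + ind S) = 0)"

lemma linear_annihilator_shift:
  "linear_annihilator \<Lambda> \<Longrightarrow> linear_annihilator (\<lambda>k. \<Lambda> (k' + k))"
  unfolding linear_annihilator_def by (simp add: add.assoc[symmetric])

lemma linear_generator_eq:
  "(\<Sum>i\<in>UNIV. pconst (of_real ((1, \<mu> i) \<bullet> e)) * pvar i)
     = (\<Sum>i\<in>UNIV. Poly_Mapping.single (Poly_Mapping.single i 1) (of_real ((1::real, \<mu> i) \<bullet> e)))"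
  by (simp add: pvar_def pconst_mult_single)

text \<open>In a representation of \<open>p\<close> by generators the linear ones contribute nothing, and the multiples
  of a non-face monomial contribute at most the bound times the size of their coefficients.\<close>

lemma ideal_bound:
  assumes "p \<in> J"
  shows "\<exists>C\<ge>0. \<forall>\<Lambda> B. linear_annihilator \<Lambda> \<longrightarrow> B \<ge> 0 \<longrightarrow> (\<forall>S\<in>N. \<forall>k. norm (\<Lambda> (k + ind S)) \<le> B)
     \<longrightarrow> norm (app \<Lambda> p) \<le> C * B"
proof -
  let ?P = "\<lambda>p. \<exists>C\<ge>0. \<forall>\<Lambda> B. linear_annihilator \<Lambda> \<longrightarrow> B \<ge> 0 \<longrightarrow> (\<forall>S\<in>N. \<forall>k. norm (\<Lambda> (k + ind S)) \<le> B)
     \<longrightarrow> norm (app \<Lambda> p) \<le> C * B"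
  have add: "?P (p + q)" if p: "?P p" and q: "?P q" for p q
  proof -
    obtain C D where "C \<ge> 0" "D \<ge> 0" and
      C: "\<And>\<Lambda> B. linear_annihilator \<Lambda> \<Longrightarrow> B \<ge> 0 \<Longrightarrow> (\<forall>S\<in>N. \<forall>k. norm (\<Lambda> (k + ind S)) \<le> B) \<Longrightarrow> norm (app \<Lambda> p) \<le> C * B" and
      D: "\<And>\<Lambda> B. linear_annihilator \<Lambda> \<Longrightarrow> B \<ge> 0 \<Longrightarrow> (\<forall>S\<in>N. \<forall>k. norm (\<Lambda> (k + ind S)) \<le> B) \<Longrightarrow> norm (app \<Lambda> q) \<le> D * B"
      using p q by blast
    show ?thesis
    proof (intro exI[of _ "C + D"] conjI allI impI)
      fix \<Lambda> :: "('n \<Rightarrow>\<^sub>0 nat) \<Rightarrow> complex" and B :: real assume "linear_annihilator \<Lambda>" "B \<ge> 0" "\<forall>S\<in>N. \<forall>k. norm (\<Lambda> (k + ind S)) \<le> B"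
      from C[OF this] D[OF this] show "norm (app \<Lambda> (p + q)) \<le> (C + D) * B"
        unfolding app_add distrib_right by (intro order_trans[OF norm_triangle_ineq] add_mono)
    qed (use \<open>C \<ge> 0\<close> \<open>D \<ge> 0\<close> in simp)
  qed
  have gen: "?P (c * s)" if s: "s \<in> (\<lambda>S. \<Prod>i\<in>S. pvar i) ` N \<union> linear_generators \<mu>" for c s
    using s
  proof
    assume "s \<in> (\<lambda>S. \<Prod>i\<in>S. pvar i) ` N"
    then obtain S where S: "S \<in> N" "s = X (ind S)" by (auto simp: prod_pvar)
    show ?thesis
    proof (intro exI[of _ "\<Sum>k\<in>Poly_Mapping.keys c. norm (Poly_Mapping.lookup c k)"] conjI allI impI sum_nonneg norm_ge_zero)
      fix \<Lambda> :: "('n \<Rightarrow>\<^sub>0 nat) \<Rightarrow> complex" and B :: real assume B: "\<forall>S\<in>N. \<forall>k. norm (\<Lambda> (k + ind S)) \<le> B"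
      have "norm (app \<Lambda> (c * s)) \<le> (\<Sum>k\<in>Poly_Mapping.keys c. norm (Poly_Mapping.lookup c k) * norm (\<Lambda> (k + ind S)))"
        unfolding app_mult S(2) app_single by (rule sum_norm_le) (simp add: norm_mult)
      also have "\<dots> \<le> (\<Sum>k\<in>Poly_Mapping.keys c. norm (Poly_Mapping.lookup c k) * B)"
        using B S(1) by (intro sum_mono mult_left_mono) auto
      finally show "norm (app \<Lambda> (c * s)) \<le> (\<Sum>k\<in>Poly_Mapping.keys c. norm (Poly_Mapping.lookup c k)) * B"
        by (simp add: sum_distrib_right)
    qed
  next
    assume "s \<in> linear_generators \<mu>"
    then obtain e where e: "e \<in> Basis" "s = (\<Sum>i\<in>UNIV. Poly_Mapping.single (Poly_Mapping.single i 1) (of_real ((1::real, \<mu> i) \<bullet> e)))"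
      unfolding linear_generators_def linear_generator_eq by blast
    have "app \<Lambda> (c * s) = 0" if "linear_annihilator \<Lambda>" for \<Lambda>
    proof -
      have "app (\<lambda>m. \<Lambda> (k + m)) s = 0" for k
        unfolding e(2) app_sum app_single using that e(1) unfolding linear_annihilator_def by blast
      then show ?thesis unfolding app_mult by simp
    qed
    then show ?thesis by (intro exI[of _ 0]) simp
  qed
  from assms obtain F c where F: "finite F" "F \<subseteq> (\<lambda>S. \<Prod>i\<in>S. pvar i) ` N \<union> linear_generators \<mu>"
    and p: "p = (\<Sum>s\<in>F. c s * s)"
    unfolding J_def ideal_generated_def by blast
  from F show ?thesis unfolding p
  proof (induction F rule: finite_induct)
    case empty
    show ?case by (intro exI[of _ 0]) simp
  next
    case (insert s F)
    have "?P (c s * s + (\<Sum>s\<in>F. c s * s))" using insert by (intro add gen) auto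
    then show ?case using insert.hyps by simp
  qed
qed

lemma app_ideal:
  assumes "annihilator \<Lambda>" "p \<in> J"
  shows "app \<Lambda> p = 0"
proof -
  obtain C where "\<And>\<Lambda> B. linear_annihilator \<Lambda> \<Longrightarrow> B \<ge> 0 \<Longrightarrow> (\<forall>S\<in>N. \<forall>k. norm (\<Lambda> (k + ind S)) \<le> B) \<Longrightarrow> norm (app \<Lambda> p) \<le> C * B"
    using ideal_bound[OF assms(2)] by blast
  from this[of \<Lambda> 0] show ?thesis using assms(1) by (simp add: annihilator_def)
qed

lemma annihilatorI:
  assumes "\<And>p. p \<in> J \<Longrightarrow> app \<Lambda> p = 0"
  shows "annihilator \<Lambda>"
  unfolding annihilator_def linear_annihilator_def
proof (intro conjI ballI allI)
  fix e :: "real \<times> 'a" and k :: "'n \<Rightarrow>\<^sub>0 nat" assume e: "e \<in> Basis"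
  have "X k * (\<Sum>i\<in>UNIV. pconst (of_real ((1, \<mu> i) \<bullet> e)) * pvar i) \<in> J"
    unfolding J_def by (rule ideal_mult, rule ideal_gen) (use linear_generator_mem[OF e, of \<mu>] in blast)
  from assms[OF this] show "(\<Sum>i\<in>UNIV. of_real ((1, \<mu> i) \<bullet> e) * \<Lambda> (k + Poly_Mapping.single i 1)) = 0"
    unfolding linear_generator_eq by (simp add: app_mult app_sum)
next
  fix S k assume "S \<in> N"
  then have "X k * (\<Prod>i\<in>S. pvar i) \<in> J"
    unfolding J_def by (intro ideal_mult ideal_gen) auto
  from assms[OF this] show "\<Lambda> (k + ind S) = 0" by (simp add: prod_pvar mult_single)
qed

lemma linear_in_J:
  "(\<Sum>i\<in>UNIV. Poly_Mapping.single (k + Poly_Mapping.single i 1) (of_real ((1::real, \<mu> i) \<bullet> e))) \<in> J"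
proof -
  define g :: "real \<times> 'a \<Rightarrow> 'n cpoly" where "g b = (\<Sum>i\<in>UNIV. Poly_Mapping.single (Poly_Mapping.single i 1) (complex_of_real ((1::real, \<mu> i) \<bullet> b)))" for b
  have "g b \<in> J" if "b \<in> Basis" for b
    unfolding J_def g_def linear_generator_eq[symmetric]
    by (rule ideal_gen) (use linear_generator_mem[OF that, of \<mu>] in blast)
  then have 1: "X k * (\<Sum>b\<in>Basis. pconst (of_real (e \<bullet> b)) * g b) \<in> J"
    unfolding J_def by (intro ideal_mult ideal_sum)
  have "(\<Sum>b\<in>Basis. pconst (of_real (e \<bullet> b)) * g b)
     = (\<Sum>i\<in>UNIV. \<Sum>b\<in>Basis. Poly_Mapping.single (Poly_Mapping.single i 1) (complex_of_real ((e \<bullet> b) * ((1::real, \<mu> i) \<bullet> b))))"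
    unfolding g_def sum_distrib_left pconst_mult_single by (subst sum.swap) simp
  also have "\<dots> = (\<Sum>i\<in>UNIV. Poly_Mapping.single (Poly_Mapping.single i 1) (complex_of_real ((1::real, \<mu> i) \<bullet> e)))"
  proof (rule sum.cong[OF refl])
    fix i
    have "(\<Sum>b\<in>Basis. Poly_Mapping.single (Poly_Mapping.single i 1) (complex_of_real ((e \<bullet> b) * ((1::real, \<mu> i) \<bullet> b))))
       = Poly_Mapping.single (Poly_Mapping.single i 1) (\<Sum>b\<in>Basis. complex_of_real ((e \<bullet> b) * ((1::real, \<mu> i) \<bullet> b)))"
      by (simp only: single_sum)
    also have "(\<Sum>b\<in>Basis. complex_of_real ((e \<bullet> b) * ((1::real, \<mu> i) \<bullet> b))) = complex_of_real (e \<bullet> (1, \<mu> i))"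
      unfolding of_real_sum[symmetric] euclidean_inner[of e "(1, \<mu> i)"] ..
    finally show "(\<Sum>b\<in>Basis. Poly_Mapping.single (Poly_Mapping.single i 1) (complex_of_real ((e \<bullet> b) * ((1::real, \<mu> i) \<bullet> b))))
       = Poly_Mapping.single (Poly_Mapping.single i 1) (complex_of_real ((1, \<mu> i) \<bullet> e))"
      by (simp only: inner_commute)
  qed
  finally show ?thesis using 1 by (simp add: sum_distrib_left mult_single)
qed

lemma linear_rewrite:
  assumes "(1::real, \<mu> j) \<bullet> e = 1" "\<And>i. i \<noteq> j \<Longrightarrow> (1::real, \<mu> i) \<bullet> e = 0 \<or> X (k + Poly_Mapping.single i 1) \<in> J"
  shows "X (k + Poly_Mapping.single j 1) \<in> J"
proof -
  let ?f = "\<lambda>i. Poly_Mapping.single (k + Poly_Mapping.single i 1) (complex_of_real ((1::real, \<mu> i) \<bullet> e))"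
  have "?f j = (\<Sum>i\<in>UNIV. ?f i) - (\<Sum>i\<in>UNIV-{j}. ?f i)"
    unfolding eq_diff_eq by (rule sum.remove[of UNIV j ?f, symmetric]) simp_all
  moreover have "(\<Sum>i\<in>UNIV-{j}. ?f i) \<in> J"
    unfolding J_def
  proof (rule ideal_sum)
    fix i assume "i \<in> UNIV - {j}"
    then consider "(1::real, \<mu> i) \<bullet> e = 0" | "X (k + Poly_Mapping.single i 1) \<in> J" using assms(2)[of i] by blast
    then have "pconst (of_real ((1, \<mu> i) \<bullet> e)) * X (k + Poly_Mapping.single i 1) \<in> J"
    proof cases
      case 1 then show ?thesis by (simp only: of_real_0 pconst_0 mult_zero_left J_def ideal_zero)
    next
      case 2 then show ?thesis unfolding J_def by (rule ideal_mult)
    qed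
    then show "?f i \<in> ideal_generated ((\<lambda>S. \<Prod>i\<in>S. pvar i) ` N \<union> linear_generators \<mu>)"
      by (simp add: pconst_mult_single J_def)
  qed
  ultimately have "?f j \<in> J" using linear_in_J[of k e] unfolding J_def by (simp only: ideal_diff)
  then show ?thesis unfolding assms(1) of_real_1 .
qed

text \<open>If the support of the monomial is a face, some variable occurs at least twice because the degree
  is large.  The linear form dual to that variable on the face replaces one of its occurrences by
  variables outside the face.  This enlarges the support, which after finitely many steps is no face
  any more.\<close>

lemma monomial_in_J_apexfree:
  assumes "Poly_Mapping.lookup m i0 = 0" "mon_degree m > CARD('n)"
  shows "X m \<in> J"
  using assms
proof (induction "card (- Poly_Mapping.keys m)" arbitrary: m rule: less_induct)
  case less
  let ?S = "Poly_Mapping.keys m"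
  have i0: "i0 \<notin> ?S" using less.prems by (simp add: in_keys_iff)
  show ?case
  proof (cases "?S \<in> N")
    case True
    have m: "(m - ind ?S) + ind ?S = m"
      by (rule poly_mapping_eqI) (auto simp: lookup_add lookup_minus in_keys_iff)
    have "X m = X (m - ind ?S) * (\<Prod>i\<in>?S. pvar i)"
      by (simp only: prod_pvar mult_single m mult_1)
    also have "\<dots> \<in> J" using True unfolding J_def by (intro ideal_mult ideal_gen) auto
    finally show ?thesis .
  next
    case False
    have "\<exists>j\<in>?S. Poly_Mapping.lookup m j \<ge> 2"
    proof (rule ccontr)
      assume "\<not> ?thesis"
      then have le: "\<forall>j\<in>?S. Poly_Mapping.lookup m j < 2" by (simp add: not_le)
      have "Poly_Mapping.lookup m j \<le> 1" for j
      proof (cases "j \<in> ?S")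
        case True
        with le have "Poly_Mapping.lookup m j < 2" by blast
        then show ?thesis by linarith
      qed (simp add: in_keys_iff)
      then have "mon_degree m \<le> (\<Sum>j\<in>(UNIV::'n set). 1)" unfolding mon_degree_def by (intro sum_mono)
      with less.prems show False by simp
    qed
    then obtain j where j: "j \<in> ?S" "Poly_Mapping.lookup m j \<ge> 2" by blast
    define k where "k = m - Poly_Mapping.single j 1"
    have lk: "Poly_Mapping.lookup k i = Poly_Mapping.lookup m i - (if i = j then 1 else 0)" for i
      by (auto simp: k_def lookup_minus lookup_single when_def)
    have m: "m = k + Poly_Mapping.single j 1"
    proof (rule poly_mapping_eqI)
      fix i show "Poly_Mapping.lookup m i = Poly_Mapping.lookup (k + Poly_Mapping.single j 1) i"
        unfolding lookup_add lk lookup_single when_def using j(2) by (cases "i = j") simp_all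
    qed
    have keysk: "Poly_Mapping.keys k = ?S"
    proof (rule set_eqI)
      fix i show "i \<in> Poly_Mapping.keys k \<longleftrightarrow> i \<in> ?S"
        unfolding in_keys_iff lk using j(2) by (cases "i = j") simp_all
    qed
    obtain e where e: "\<mu> j \<bullet> e = 1" "\<forall>i\<in>?S - {j}. \<mu> i \<bullet> e = 0"
      using face_dual[OF i0 False j(1)] by blast
    show ?thesis unfolding m
    proof (rule linear_rewrite[where e = "(0, e)"])
      show "(1::real, \<mu> j) \<bullet> (0, e) = 1" using e by simp
      fix i assume "i \<noteq> j"
      show "(1::real, \<mu> i) \<bullet> (0, e) = 0 \<or> X (k + Poly_Mapping.single i 1) \<in> J"
      proof (cases "i = i0 \<or> i \<in> ?S")
        case True
        then have "\<mu> i \<bullet> e = 0" using e(2) apex \<open>i \<noteq> j\<close> by auto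
        then show ?thesis by (simp add: inner_Pair)
      next
        case False
        have keys: "Poly_Mapping.keys (k + Poly_Mapping.single i 1) = insert i ?S"
        proof (rule set_eqI)
          fix x show "x \<in> Poly_Mapping.keys (k + Poly_Mapping.single i 1) \<longleftrightarrow> x \<in> insert i ?S"
            unfolding keysk[symmetric] in_keys_iff lookup_add lookup_single insert_iff when_def by auto
        qed
        have "X (k + Poly_Mapping.single i 1) \<in> J"
        proof (rule less.hyps)
          show "card (- Poly_Mapping.keys (k + Poly_Mapping.single i 1)) < card (- ?S)"
            unfolding keys using False by (intro psubset_card_mono) auto
          show "Poly_Mapping.lookup (k + Poly_Mapping.single i 1) i0 = 0"
            unfolding lookup_add lk lookup_single when_def using less.prems(1) False by simp
          show "CARD('n) < mon_degree (k + Poly_Mapping.single i 1)"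
            using less.prems(2) unfolding m by simp
        qed
        then show ?thesis ..
      qed
    qed
  qed
qed

text \<open>The sum of all variables is one of the linear generators; it trades the apex variable for the
  others.\<close>

lemma monomial_in_J:
  assumes "mon_degree m > CARD('n)"
  shows "X m \<in> J"
  using assms
proof (induction "Poly_Mapping.lookup m i0" arbitrary: m)
  case 0
  then show ?case by (intro monomial_in_J_apexfree) auto
next
  case (Suc n)
  define k where "k = m - Poly_Mapping.single i0 1"
  have m: "m = k + Poly_Mapping.single i0 1"
    by (rule poly_mapping_eqI) (use Suc in \<open>auto simp: k_def lookup_minus lookup_add lookup_single when_def\<close>)
  show ?case unfolding m
  proof (rule linear_rewrite[where e = "(1, 0)"])
    fix i assume "i \<noteq> i0"
    have "X (k + Poly_Mapping.single i 1) \<in> J"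
    proof (rule Suc.hyps(1))
      show "n = Poly_Mapping.lookup (k + Poly_Mapping.single i 1) i0"
        using Suc.hyps(2) \<open>i \<noteq> i0\<close> by (simp add: k_def lookup_add lookup_minus lookup_single when_def)
      show "CARD('n) < mon_degree (k + Poly_Mapping.single i 1)"
        using Suc.prems unfolding m by simp
    qed
    then show "(1::real, \<mu> i) \<bullet> (1, 0) = 0 \<or> X (k + Poly_Mapping.single i 1) \<in> J" ..
  qed simp
qed

lemma annihilator_degree:
  assumes "annihilator \<Lambda>" "mon_degree m > CARD('n)"
  shows "\<Lambda> m = 0"
  using app_ideal[OF assms(1) monomial_in_J[OF assms(2)]] by simp

lemma J_diff: "p \<in> J \<Longrightarrow> q \<in> J \<Longrightarrow> p - q \<in> J" unfolding J_def by (rule ideal_diff)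
lemma J_mult: "p \<in> J \<Longrightarrow> c * p \<in> J" unfolding J_def by (rule ideal_mult)
lemma J_zero: "0 \<in> J" unfolding J_def by (rule ideal_zero)
lemma J_sum: "(\<And>i. i \<in> K \<Longrightarrow> f i \<in> J) \<Longrightarrow> (\<Sum>i\<in>K. f i) \<in> J" unfolding J_def by (rule ideal_sum)

lemma monomial_sum: "p = (\<Sum>m\<in>Poly_Mapping.keys p. pconst (Poly_Mapping.lookup p m) * X m)"
  by (simp only: pconst_mult_single mult_1_right) (rule poly_mapping_sum_single)

lemma combination_of_monomials:
  assumes "\<And>m. X m - (\<Sum>i\<in>F. pconst (\<Lambda> i m) * \<alpha> i) \<in> J"
  shows "p - (\<Sum>i\<in>F. pconst (app (\<Lambda> i) p) * \<alpha> i) \<in> J"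
proof -
  let ?c = "\<lambda>m. pconst (Poly_Mapping.lookup p m)"
  let ?K = "Poly_Mapping.keys p"
  have "(\<Sum>i\<in>F. pconst (app (\<Lambda> i) p) * \<alpha> i) = (\<Sum>i\<in>F. \<Sum>m\<in>?K. ?c m * (pconst (\<Lambda> i m) * \<alpha> i))"
    unfolding app_def pconst_sum pconst_mult sum_distrib_right by (simp only: mult.assoc)
  also have "\<dots> = (\<Sum>m\<in>?K. ?c m * (\<Sum>i\<in>F. pconst (\<Lambda> i m) * \<alpha> i))"
    unfolding sum_distrib_left by (rule sum.swap)
  finally have "p - (\<Sum>i\<in>F. pconst (app (\<Lambda> i) p) * \<alpha> i)
     = (\<Sum>m\<in>?K. ?c m * X m) - (\<Sum>m\<in>?K. ?c m * (\<Sum>i\<in>F. pconst (\<Lambda> i m) * \<alpha> i))"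
    using monomial_sum[of p] by (simp only:)
  also have "\<dots> = (\<Sum>m\<in>?K. ?c m * (X m - (\<Sum>i\<in>F. pconst (\<Lambda> i m) * \<alpha> i)))"
    by (simp only: sum_subtractf right_diff_distrib)
  also have "\<dots> \<in> J" by (intro J_sum J_mult assms)
  finally show ?thesis .
qed

lemma basis_finite:
  assumes "basis_modulo J \<alpha> I"
  shows "finite I"
proof -
  let ?M = "{m :: 'n \<Rightarrow>\<^sub>0 nat. mon_degree m \<le> CARD('n)}"
  have ind: "\<And>F c. finite F \<and> F \<subseteq> I \<and> (\<Sum>i\<in>F. pconst (c i) * \<alpha> i) \<in> J \<Longrightarrow> \<forall>i\<in>F. c i = 0"
    and span: "\<forall>p. \<exists>F c. finite F \<and> F \<subseteq> I \<and> p - (\<Sum>i\<in>F. pconst (c i) * \<alpha> i) \<in> J"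
    using assms unfolding basis_modulo_def by simp_all
  have "\<forall>m. \<exists>F. \<exists>c. finite F \<and> F \<subseteq> I \<and> X m - (\<Sum>i\<in>F. pconst (c i) * \<alpha> i) \<in> J"
    using span by simp
  from choice[OF this] obtain G where
    "\<forall>m. \<exists>c. finite (G m) \<and> G m \<subseteq> I \<and> X m - (\<Sum>i\<in>G m. pconst (c i) * \<alpha> i) \<in> J" ..
  from choice[OF this] obtain c where
    "\<forall>m. finite (G m) \<and> G m \<subseteq> I \<and> X m - (\<Sum>i\<in>G m. pconst (c m i) * \<alpha> i) \<in> J" ..
  then have G: "\<And>m. finite (G m)" "\<And>m. G m \<subseteq> I"
    "\<And>m. X m - (\<Sum>i\<in>G m. pconst (c m i) * \<alpha> i) \<in> J" by simp_all
  define F where "F = (\<Union>m\<in>?M. G m)"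
  have F: "finite F" "F \<subseteq> I"
    using G(1,2) by (simp_all add: F_def finite_mon_degree_le UN_subset_iff)
  define \<Lambda> where "\<Lambda> i m = (if mon_degree m \<le> CARD('n) \<and> i \<in> G m then c m i else 0)" for i m
  have mon: "X m - (\<Sum>i\<in>F. pconst (\<Lambda> i m) * \<alpha> i) \<in> J" for m
  proof (cases "mon_degree m \<le> CARD('n)")
    case True
    have "(\<Sum>i\<in>F. pconst (\<Lambda> i m) * \<alpha> i) = (\<Sum>i\<in>G m. pconst (c m i) * \<alpha> i)"
      by (rule sum.mono_neutral_cong_right) (use F True in \<open>auto simp: \<Lambda>_def F_def\<close>)
    then show ?thesis using G(3)[of m] by (simp only:)
  next
    case False
    then have "(\<Sum>i\<in>F. pconst (\<Lambda> i m) * \<alpha> i) = 0" by (simp add: \<Lambda>_def)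
    then show ?thesis using monomial_in_J[of m] False by simp
  qed
  have "I \<subseteq> F"
  proof
    fix j assume j: "j \<in> I"
    show "j \<in> F"
    proof (rule ccontr)
      assume nj: "j \<notin> F"
      define d where "d i = (if i = j then 1 else - app (\<Lambda> i) (\<alpha> j))" for i
      have "(\<Sum>i\<in>insert j F. pconst (d i) * \<alpha> i) = \<alpha> j + (\<Sum>i\<in>F. pconst (d i) * \<alpha> i)"
        using F nj by (simp add: d_def)
      also have "(\<Sum>i\<in>F. pconst (d i) * \<alpha> i) = - (\<Sum>i\<in>F. pconst (app (\<Lambda> i) (\<alpha> j)) * \<alpha> i)"
        unfolding sum_negf[symmetric] by (rule sum.cong) (use nj in \<open>auto simp: d_def pconst_uminus\<close>)
      finally have "(\<Sum>i\<in>insert j F. pconst (d i) * \<alpha> i) \<in> J"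
        using combination_of_monomials[OF mon, of "\<alpha> j"] by simp
      with F j have "\<forall>i\<in>insert j F. d i = 0" by (intro ind) simp
      then have "d j = 0" by simp
      then show False by (simp add: d_def)
    qed
  qed
  then show ?thesis using F finite_subset by blast
qed

lemma basis_unique:
  assumes "basis_modulo J \<alpha> I" "p - (\<Sum>i\<in>I. pconst (c i) * \<alpha> i) \<in> J" "p - (\<Sum>i\<in>I. pconst (d i) * \<alpha> i) \<in> J" "i \<in> I"
  shows "c i = d i"
proof -
  have "(p - (\<Sum>i\<in>I. pconst (d i) * \<alpha> i)) - (p - (\<Sum>i\<in>I. pconst (c i) * \<alpha> i)) \<in> J"
    by (rule J_diff[OF assms(3,2)])
  moreover have "(p - (\<Sum>i\<in>I. pconst (d i) * \<alpha> i)) - (p - (\<Sum>i\<in>I. pconst (c i) * \<alpha> i)) = (\<Sum>i\<in>I. pconst (c i - d i) * \<alpha> i)"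
  proof -
    have "(q - D) - (q - C) = C - D" for q C D :: "'n cpoly" by simp
    then show ?thesis by (simp only: pconst_diff left_diff_distrib sum_subtractf)
  qed
  ultimately have 1: "(\<Sum>i\<in>I. pconst (c i - d i) * \<alpha> i) \<in> J" by (simp only:)
  have 2: "\<And>F c. finite F \<and> F \<subseteq> I \<and> (\<Sum>i\<in>F. pconst (c i) * \<alpha> i) \<in> J \<Longrightarrow> \<forall>i\<in>F. c i = 0"
    using assms(1) unfolding basis_modulo_def by simp
  have "\<forall>i\<in>I. c i - d i = 0"
    by (rule 2) (use 1 basis_finite[OF assms(1)] in simp)
  then show ?thesis using assms(4) by simp
qed

text \<open>The coordinates of monomials determine functionals; these give the coordinates of every polynomial
  and vanish on the ideal because coordinates modulo the ideal are unique.\<close>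

lemma coordinate_functionals:
  assumes basis: "basis_modulo J \<alpha> I"
  shows "\<exists>\<Lambda>. (\<forall>i\<in>I. annihilator (\<Lambda> i)) \<and>
    (\<forall>i\<in>I. \<forall>j\<in>I. app (\<Lambda> i) (\<alpha> j) = (if i = j then 1 else 0)) \<and>
    (\<forall>p. p - (\<Sum>i\<in>I. pconst (app (\<Lambda> i) p) * \<alpha> i) \<in> J)"
proof -
  have fin: "finite I" by (rule basis_finite[OF basis])
  have "\<exists>c. p - (\<Sum>i\<in>I. pconst (c i) * \<alpha> i) \<in> J" for p
  proof -
    obtain F c where F: "finite F" "F \<subseteq> I" "p - (\<Sum>i\<in>F. pconst (c i) * \<alpha> i) \<in> J"
      using basis unfolding basis_modulo_def by blast
    have "(\<Sum>i\<in>I. pconst (if i \<in> F then c i else 0) * \<alpha> i) = (\<Sum>i\<in>F. pconst (c i) * \<alpha> i)"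
      by (rule sum.mono_neutral_cong_right) (use fin F in auto)
    then show ?thesis using F(3) by (intro exI[of _ "\<lambda>i. if i \<in> F then c i else 0"]) (simp only:)
  qed
  then have "\<forall>p. \<exists>c. p - (\<Sum>i\<in>I. pconst (c i) * \<alpha> i) \<in> J" by simp
  from choice[OF this] obtain cf where "\<forall>p. p - (\<Sum>i\<in>I. pconst (cf p i) * \<alpha> i) \<in> J" ..
  then have cf: "p - (\<Sum>i\<in>I. pconst (cf p i) * \<alpha> i) \<in> J" for p by simp
  define \<Lambda> where "\<Lambda> i m = cf (X m) i" for i m
  have mem: "p - (\<Sum>i\<in>I. pconst (app (\<Lambda> i) p) * \<alpha> i) \<in> J" for p
    by (rule combination_of_monomials) (simp add: \<Lambda>_def cf)
  show ?thesis
  proof (intro exI[of _ \<Lambda>] conjI ballI allI)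
    fix i assume i: "i \<in> I"
    show "annihilator (\<Lambda> i)"
    proof (rule annihilatorI)
      fix p assume "p \<in> J"
      then have "p - (\<Sum>i\<in>I. pconst ((\<lambda>_. 0) i) * \<alpha> i) \<in> J" by simp
      from basis_unique[OF basis mem this i] show "app (\<Lambda> i) p = 0" .
    qed
  next
    fix i j assume i: "i \<in> I" and j: "j \<in> I"
    have "(\<Sum>i\<in>I. pconst ((\<lambda>i. if i = j then 1 else 0) i) * \<alpha> i) = (\<Sum>i\<in>I. if i = j then \<alpha> j else 0)"
      by (rule sum.cong) auto
    also have "\<dots> = \<alpha> j" using fin j by simp
    finally have "\<alpha> j - (\<Sum>i\<in>I. pconst ((\<lambda>i. if i = j then 1 else 0) i) * \<alpha> i) \<in> J"
      by (simp add: J_zero)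
    from basis_unique[OF basis mem this i] show "app (\<Lambda> i) (\<alpha> j) = (if i = j then 1 else 0)" .
  qed (rule mem)
qed

lemma expansion_moduloI:
  assumes "\<And>i. i \<in> I \<Longrightarrow> annihilator (\<Lambda> i)" "\<And>p. p - (\<Sum>i\<in>I. pconst (app (\<Lambda> i) p) * \<alpha> i) \<in> J"
  shows "expansion_modulo J \<alpha> I F (\<lambda>i. \<Sum>m | mon_degree m \<le> CARD('n). \<Lambda> i m * F m)"
  unfolding expansion_modulo_def
proof (rule eventually_sequentiallyI[of "CARD('n)"])
  fix N assume N: "CARD('n) \<le> N"
  have "app (\<Lambda> i) (truncation N F) = (\<Sum>m | mon_degree m \<le> CARD('n). \<Lambda> i m * F m)" if "i \<in> I" for i
  proof -
    have "app (\<Lambda> i) (truncation N F) = (\<Sum>m | mon_degree m \<le> N. \<Lambda> i m * F m)"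
      unfolding truncation_def app_sum app_single by (simp only: mult.commute)
    also have "\<dots> = (\<Sum>m | mon_degree m \<le> CARD('n). \<Lambda> i m * F m)"
    proof (rule sum.mono_neutral_right[OF finite_mon_degree_le])
      show "\<forall>m\<in>{m. mon_degree m \<le> N} - {m. mon_degree m \<le> CARD('n)}. \<Lambda> i m * F m = 0"
        using annihilator_degree[OF assms(1)[OF that]] by auto
    qed (use N in auto)
    finally show ?thesis .
  qed
  then have "(\<Sum>i\<in>I. pconst (app (\<Lambda> i) (truncation N F)) * \<alpha> i)
      = (\<Sum>i\<in>I. pconst (\<Sum>m | mon_degree m \<le> CARD('n). \<Lambda> i m * F m) * \<alpha> i)"
    by (intro sum.cong) auto
  with assms(2)[of "truncation N F"]
  show "truncation N F - (\<Sum>i\<in>I. pconst (\<Sum>m | mon_degree m \<le> CARD('n). \<Lambda> i m * F m) * \<alpha> i) \<in> J"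
    by (simp only:)
qed

lemma exists_degree_part:
  assumes "mon_degree m \<ge> d"
  shows "\<exists>m' m''. m = m' + m'' \<and> mon_degree m'' = d"
  using assms
proof (induction d)
  case 0
  then show ?case by (intro exI[of _ m] exI[of _ 0]) simp
next
  case (Suc d)
  then obtain m' m'' where m: "m = m' + m''" "mon_degree m'' = d" by auto
  have "mon_degree m' \<noteq> 0" using Suc.prems m by simp
  then obtain i where i: "Poly_Mapping.lookup m' i \<noteq> 0" unfolding mon_degree_def by (meson sum.neutral)
  have "m' = (m' - Poly_Mapping.single i 1) + Poly_Mapping.single i 1"
    by (rule poly_mapping_eqI) (use i in \<open>auto simp: lookup_add lookup_minus lookup_single when_def\<close>)
  then have "m = (m' - Poly_Mapping.single i 1) + (Poly_Mapping.single i 1 + m'')"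
    unfolding m by (metis add.assoc)
  moreover have "mon_degree (Poly_Mapping.single i 1 + m'') = Suc d" using m by simp
  ultimately show ?case by blast
qed

text \<open>Modulo the ideal a monomial is a combination of the basis, on which the functional vanishes, so
  \<open>ideal_bound\<close> applies to the difference.  The constant can be chosen uniformly: a monomial of
  large degree is a multiple of one of degree \<open>CARD('n) + 1\<close>, and already that one lies in the
  ideal.\<close>

lemma contraction:
  assumes basis: "basis_modulo J \<alpha> I"
  shows "\<exists>C\<ge>0. \<forall>\<Lambda> B m. linear_annihilator \<Lambda> \<longrightarrow> B \<ge> 0 \<longrightarrow> (\<forall>S\<in>N. \<forall>k. norm (\<Lambda> (k + ind S)) \<le> B)
     \<longrightarrow> (\<forall>i\<in>I. app \<Lambda> (\<alpha> i) = 0) \<longrightarrow> norm (\<Lambda> m) \<le> C * B"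
proof -
  from coordinate_functionals[OF basis] obtain \<Lambda>0 where "(\<forall>i\<in>I. annihilator (\<Lambda>0 i)) \<and>
    (\<forall>i\<in>I. \<forall>j\<in>I. app (\<Lambda>0 i) (\<alpha> j) = (if i = j then 1 else 0)) \<and>
    (\<forall>p. p - (\<Sum>i\<in>I. pconst (app (\<Lambda>0 i) p) * \<alpha> i) \<in> J)" ..
  then have \<Lambda>0: "\<And>i. i \<in> I \<Longrightarrow> annihilator (\<Lambda>0 i)"
    "\<And>p. p - (\<Sum>i\<in>I. pconst (app (\<Lambda>0 i) p) * \<alpha> i) \<in> J" by simp_all
  have ex: "\<exists>C\<ge>0. \<forall>\<Lambda> B. linear_annihilator \<Lambda> \<longrightarrow> B \<ge> 0 \<longrightarrow> (\<forall>S\<in>N. \<forall>k. norm (\<Lambda> (k + ind S)) \<le> B)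
     \<longrightarrow> norm (app \<Lambda> (X m - (\<Sum>i\<in>I. pconst (app (\<Lambda>0 i) (X m)) * \<alpha> i))) \<le> C * B" for m
    by (rule ideal_bound[OF \<Lambda>0(2)])
  from choice[OF allI[OF ex]] obtain C where CC: "\<forall>m. C m \<ge> 0 \<and> (\<forall>\<Lambda> B. linear_annihilator \<Lambda> \<longrightarrow> B \<ge> 0 \<longrightarrow> (\<forall>S\<in>N. \<forall>k. norm (\<Lambda> (k + ind S)) \<le> B)
     \<longrightarrow> norm (app \<Lambda> (X m - (\<Sum>i\<in>I. pconst (app (\<Lambda>0 i) (X m)) * \<alpha> i))) \<le> C m * B)" ..
  then have C0: "C m \<ge> 0" for m by simp
  have C: "norm (app \<Lambda> (X m - (\<Sum>i\<in>I. pconst (app (\<Lambda>0 i) (X m)) * \<alpha> i))) \<le> C m * B"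
    if "linear_annihilator \<Lambda>" "B \<ge> 0" "\<forall>S\<in>N. \<forall>k. norm (\<Lambda> (k + ind S)) \<le> B" for m \<Lambda> B
    using CC that by simp
  let ?M = "{m :: 'n \<Rightarrow>\<^sub>0 nat. mon_degree m \<le> Suc CARD('n)}"
  have fin: "finite ?M" by (rule finite_mon_degree_le)
  define D where "D = (\<Sum>m\<in>?M. C m)"
  have CD: "C m \<le> D" if "m \<in> ?M" for m
    unfolding D_def by (rule member_le_sum) (use that fin C0 in auto)
  have D0: "D \<ge> 0" unfolding D_def by (intro sum_nonneg C0)
  show ?thesis
  proof (intro exI[of _ D] conjI D0 allI impI)
    fix \<Lambda> :: "('n \<Rightarrow>\<^sub>0 nat) \<Rightarrow> complex" and B :: real and m
    assume lin: "linear_annihilator \<Lambda>" and B: "B \<ge> 0" and bd: "\<forall>S\<in>N. \<forall>k. norm (\<Lambda> (k + ind S)) \<le> B"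
      and \<alpha>: "\<forall>i\<in>I. app \<Lambda> (\<alpha> i) = 0"
    show "norm (\<Lambda> m) \<le> D * B"
    proof (cases "mon_degree m \<le> CARD('n)")
      case True
      have "app \<Lambda> (X m - (\<Sum>i\<in>I. pconst (app (\<Lambda>0 i) (X m)) * \<alpha> i)) = \<Lambda> m"
        using \<alpha> by (simp add: app_diff app_sum app_pconst_mult)
      then have "norm (\<Lambda> m) \<le> C m * B" using C[OF lin B bd, of m] by simp
      also have "\<dots> \<le> D * B" using CD[of m] True B by (intro mult_right_mono) auto
      finally show ?thesis .
    next
      case False
      then obtain m' m'' where m: "m = m' + m''" "mon_degree m'' = Suc CARD('n)"
        using exists_degree_part[of "Suc CARD('n)" m] by auto
      have bd': "\<forall>S\<in>N. \<forall>k. norm (\<Lambda> (m' + (k + ind S))) \<le> B"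
        using bd by (simp flip: add.assoc)
      have "app (\<Lambda>0 i) (X m'') = 0" if "i \<in> I" for i
        using annihilator_degree[OF \<Lambda>0(1)[OF that], of m''] m(2) by simp
      then have "app (\<lambda>k. \<Lambda> (m' + k)) (X m'' - (\<Sum>i\<in>I. pconst (app (\<Lambda>0 i) (X m'')) * \<alpha> i)) = \<Lambda> m"
        by (simp add: m)
      then have "norm (\<Lambda> m) \<le> C m'' * B"
        using C[OF linear_annihilator_shift[OF lin, of m'] B bd', of m''] by simp
      also have "\<dots> \<le> D * B" using CD[of m''] m(2) B by (intro mult_right_mono) auto
      finally show ?thesis .
    qed
  qed
qed

end

section \<open>Expansions of the Gamma factors\<close>

definition rGamma_fps :: "int \<Rightarrow> complex fps" where
  "rGamma_fps k = fps_expansion (\<lambda>x. rGamma (of_int k + x + 1)) 0"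

definition Gamma_fps :: "int \<Rightarrow> complex fps" where
  "Gamma_fps k = fps_expansion (\<lambda>x. Gamma (- of_int k - x + 1)) 0"

lemma rGamma_fps_expansion: "(\<lambda>x. rGamma (of_int k + x + 1)) has_fps_expansion rGamma_fps k"
  unfolding rGamma_fps_def
  by (rule has_fps_expansion_fps_expansion[where A = UNIV]) (auto intro!: holomorphic_intros)

lemma Gamma_fps_domain: "k \<le> 0 \<Longrightarrow> x \<in> ball 0 1 \<Longrightarrow> - of_int k - x + 1 \<notin> (\<int>\<^sub>\<le>\<^sub>0 :: complex set)"
proof
  assume k: "k \<le> 0" and x: "x \<in> ball (0::complex) 1" and n: "- of_int k - x + 1 \<in> (\<int>\<^sub>\<le>\<^sub>0 :: complex set)"
  have "\<bar>Re x\<bar> < 1" using x abs_Re_le_cmod[of x] by simp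
  moreover obtain i where i: "- of_int k - x + 1 = (of_int i :: complex)" "i \<le> 0"
    using n by (auto elim!: nonpos_Ints_cases)
  have "Re (- of_int k - x + 1) = Re (of_int i)" by (simp only: i(1))
  then have "- real_of_int k - Re x + 1 = real_of_int i" by simp
  moreover have "real_of_int k \<le> 0" "real_of_int i \<le> 0" using k \<open>i \<le> 0\<close> by simp_all
  ultimately show False by linarith
qed

lemma Gamma_fps_expansion:
  assumes "k \<le> 0"
  shows "(\<lambda>x. Gamma (- of_int k - x + 1)) has_fps_expansion Gamma_fps k"
  unfolding Gamma_fps_def
proof (rule has_fps_expansion_fps_expansion[where A = "ball 0 1"])
  show "(\<lambda>x::complex. Gamma (- of_int k - x + 1)) holomorphic_on ball 0 1"
    using Gamma_fps_domain[OF assms] by (intro holomorphic_intros) auto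
qed auto

lemma rGamma_fps_rec: "(fps_const (of_int k) + fps_X) * rGamma_fps k = rGamma_fps (k - 1)"
proof (rule fps_expansion_unique_complex)
  have "(\<lambda>x. (of_int k + x) * rGamma (of_int k + x + 1)) has_fps_expansion (fps_const (of_int k) + fps_X) * rGamma_fps k"
    by (intro fps_expansion_intros rGamma_fps_expansion)
  then show "(\<lambda>x. rGamma (of_int (k - 1) + x + 1)) has_fps_expansion (fps_const (of_int k) + fps_X) * rGamma_fps k"
    by (simp add: rGamma_plus1)
qed (rule rGamma_fps_expansion)

lemma Gamma_fps_rec:
  assumes "k \<le> 0"
  shows "(fps_const (of_int (k - 1)) + fps_X) * Gamma_fps k = - Gamma_fps (k - 1)"
proof (rule fps_expansion_unique_complex)
  show "(\<lambda>x. (of_int (k - 1) + x) * Gamma (- of_int k - x + 1)) has_fps_expansion (fps_const (of_int (k - 1)) + fps_X) * Gamma_fps k"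
    by (intro fps_expansion_intros Gamma_fps_expansion assms)
  have "(\<lambda>x. - Gamma (- of_int (k - 1) - x + 1)) has_fps_expansion - Gamma_fps (k - 1)"
    using assms by (intro fps_expansion_intros Gamma_fps_expansion) auto
  moreover have "\<forall>\<^sub>F x in nhds 0. - Gamma (- of_int (k - 1) - x + 1) = (of_int (k - 1) + x) * Gamma (- of_int k - x + 1 :: complex)"
  proof -
    have "\<forall>\<^sub>F x in nhds 0. x \<in> ball (0::complex) 1" by (rule eventually_nhds_in_open) auto
    then show ?thesis
    proof eventually_elim
      case (elim x)
      have eq: "- of_int (k - 1) - x + 1 = (- of_int k - x + 1) + 1" by simp
      show ?case unfolding eq Gamma_plus1[OF Gamma_fps_domain[OF assms elim]] by (simp add: algebra_simps)
    qed
  qed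
  ultimately show "(\<lambda>x. (of_int (k - 1) + x) * Gamma (- of_int k - x + 1)) has_fps_expansion - Gamma_fps (k - 1)"
    by (subst (asm) has_fps_expansion_cong) auto
qed

lemma rGamma_fps_nth_0: "fps_nth (rGamma_fps k) 0 = rGamma (of_int k + 1)"
  using has_fps_expansion_imp_0_eq_fps_nth_0[OF rGamma_fps_expansion[of k]] by simp

lemma rGamma_fps_neg: "k < 0 \<Longrightarrow> fps_nth (rGamma_fps k) 0 = 0"
proof -
  assume "k < 0"
  then have "of_int (k + 1) \<in> (\<int>\<^sub>\<le>\<^sub>0 :: complex set)" by (intro nonpos_Ints_of_int) simp
  then show ?thesis by (simp add: rGamma_fps_nth_0 rGamma_eq_zero_iff)
qed

lemma rGamma_fps_0: "fps_nth (rGamma_fps 0) 0 = 1"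
  by (simp add: rGamma_fps_nth_0)

lemma Gamma_fps_0: "fps_nth (Gamma_fps 0) 0 = 1"
  using has_fps_expansion_imp_0_eq_fps_nth_0[OF Gamma_fps_expansion[of 0]] by simp

text \<open>The weights are chosen such that multiplication by \<open>fps_X\<close> halves the norm.  Multiplication by
  \<open>k + fps_X\<close>, which is the recursion of the Gamma factors, then costs a factor close to \<open>\<bar>k\<bar>\<close>, as
  for the factorials themselves.\<close>

definition fps_norm :: "nat \<Rightarrow> complex fps \<Rightarrow> real" where
  "fps_norm M F = (\<Sum>m\<le>M. norm (fps_nth F m) / 2 ^ m)"

lemma fps_norm_nonneg [simp]: "0 \<le> fps_norm M F"
  by (simp add: fps_norm_def sum_nonneg)

lemma fps_norm_add: "fps_norm M (F + G) \<le> fps_norm M F + fps_norm M G"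
  unfolding fps_norm_def sum.distrib[symmetric] add_divide_distrib[symmetric]
  by (intro sum_mono divide_right_mono) (simp_all add: norm_triangle_ineq)

lemma fps_norm_uminus [simp]: "fps_norm M (- F) = fps_norm M F"
  by (simp add: fps_norm_def)

lemma fps_norm_cmult: "fps_norm M (fps_const c * F) = norm c * fps_norm M F"
  by (simp add: fps_norm_def norm_mult sum_distrib_left)

lemma fps_norm_X_mult: "fps_norm M (fps_X * F) \<le> fps_norm M F / 2"
proof (cases M)
  case (Suc N)
  have "fps_norm M (fps_X * F) = (\<Sum>m\<le>N. norm (fps_nth F m) / 2 ^ Suc m)"
    unfolding fps_norm_def Suc by (subst sum.atMost_Suc_shift) simp
  also have "\<dots> = fps_norm N F / 2"
    by (simp add: fps_norm_def sum_divide_distrib mult.commute)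
  also have "\<dots> \<le> fps_norm M F / 2"
    unfolding fps_norm_def Suc by simp
  finally show ?thesis .
qed (simp add: fps_norm_def)

lemma fps_norm_linear_mult: "fps_norm M ((fps_const c + fps_X) * F) \<le> (norm c + 1/2) * fps_norm M F"
proof -
  have "fps_norm M ((fps_const c + fps_X) * F) \<le> fps_norm M (fps_const c * F) + fps_norm M (fps_X * F)"
    using fps_norm_add[of M "fps_const c * F" "fps_X * F"] by (simp add: distrib_right)
  also have "\<dots> \<le> norm c * fps_norm M F + fps_norm M F / 2"
    by (intro add_mono fps_norm_X_mult) (simp add: fps_norm_cmult)
  finally show ?thesis by (simp add: algebra_simps)
qed

lemma rGamma_fps_norm_pos: "fps_norm M (rGamma_fps (int k)) \<le> fps_norm M (rGamma_fps 0) * 2 ^ k / fact k"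
proof (induction k)
  case (Suc k)
  let ?F = "rGamma_fps (int (Suc k))"
  have rec: "fps_const (of_nat (Suc k)) * ?F = rGamma_fps (int k) + - (fps_X * ?F)"
    using rGamma_fps_rec[of "int (Suc k)"] by (simp add: distrib_right eq_diff_eq)
  have "real (Suc k) * fps_norm M ?F = fps_norm M (fps_const (of_nat (Suc k)) * ?F)"
    unfolding fps_norm_cmult norm_of_nat ..
  also have "\<dots> \<le> fps_norm M (rGamma_fps (int k)) + fps_norm M (fps_X * ?F)"
    unfolding rec using fps_norm_add[of M "rGamma_fps (int k)" "- (fps_X * ?F)"] by simp
  also have "\<dots> \<le> fps_norm M (rGamma_fps (int k)) + fps_norm M ?F / 2"
    by (intro add_left_mono fps_norm_X_mult)
  finally have "(real k + 1/2) * fps_norm M ?F \<le> fps_norm M (rGamma_fps (int k))"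
    by (simp add: algebra_simps)
  moreover have "real (Suc k) / 2 * fps_norm M ?F \<le> (real k + 1/2) * fps_norm M ?F"
    by (intro mult_right_mono) auto
  ultimately have "real (Suc k) / 2 * fps_norm M ?F \<le> fps_norm M (rGamma_fps 0) * 2 ^ k / fact k"
    using Suc.IH by linarith
  then show ?case by (simp add: field_simps del: of_nat_Suc)
qed simp

lemma rGamma_fps_norm_neg: "fps_norm M (rGamma_fps (- int k)) \<le> fps_norm M (rGamma_fps 0) * fact k"
proof (induction k)
  case (Suc k)
  have eq: "rGamma_fps (- int (Suc k)) = (fps_const (of_int (- int k)) + fps_X) * rGamma_fps (- int k)"
  proof -
    have "- int (Suc k) = - int k - 1" by simp
    then show ?thesis unfolding rGamma_fps_rec by (simp only:)
  qed
  have "fps_norm M (rGamma_fps (- int (Suc k))) \<le> (norm (of_int (- int k) :: complex) + 1/2) * fps_norm M (rGamma_fps (- int k))"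
    unfolding eq by (rule fps_norm_linear_mult)
  also have "\<dots> \<le> real (Suc k) * (fps_norm M (rGamma_fps 0) * fact k)"
    using Suc.IH by (intro mult_mono) simp_all
  finally show ?case by (simp add: algebra_simps)
qed simp

lemma Gamma_fps_norm: "fps_norm M (Gamma_fps (- int k)) \<le> fps_norm M (Gamma_fps 0) * fact (k + 1)"
proof (induction k)
  case (Suc k)
  have eq: "- Gamma_fps (- int k - 1) = (fps_const (of_int (- int k - 1)) + fps_X) * Gamma_fps (- int k)"
    by (subst Gamma_fps_rec) simp_all
  have "fps_norm M (- Gamma_fps (- int k - 1)) \<le> (norm (of_int (- int k - 1) :: complex) + 1/2) * fps_norm M (Gamma_fps (- int k))"
    unfolding eq by (rule fps_norm_linear_mult)
  also have "norm (of_int (- int k - 1) :: complex) = real (Suc k)"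
    unfolding norm_of_int by simp
  also have "(real (Suc k) + 1/2) * fps_norm M (Gamma_fps (- int k)) \<le> real (Suc (Suc k)) * (fps_norm M (Gamma_fps 0) * fact (k + 1))"
    using Suc.IH by (intro mult_mono) simp_all
  finally have "fps_norm M (Gamma_fps (- int k - 1)) \<le> real (Suc (Suc k)) * (fps_norm M (Gamma_fps 0) * fact (k + 1))"
    by simp
  moreover have "- int (Suc k) = - int k - 1" by simp
  moreover have "real (Suc (Suc k)) * (fps_norm M (Gamma_fps 0) * fact (k + 1)) = fps_norm M (Gamma_fps 0) * fact (Suc k + 1)"
    by (simp add: algebra_simps)
  ultimately show ?case by (simp only:)
qed simp

lemma fps_nth_exp: "fps_nth (fps_exp z) n = z ^ n / fact n" for z :: complex
  by (simp add: fps_exp_def)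

lemma fps_nth_mult_exp_bound:
  "norm (fps_nth (F * fps_exp z) m) \<le> 2 ^ m * fps_norm m F * (1 + norm z) ^ m"
proof -
  have "norm (fps_nth (F * fps_exp z) m) \<le> (\<Sum>i\<le>m. norm (fps_nth F i * (z ^ (m - i) / fact (m - i))))"
    unfolding fps_mult_nth atLeast0AtMost fps_nth_exp by (rule norm_sum)
  also have "\<dots> \<le> (\<Sum>i\<le>m. 2 ^ m * (norm (fps_nth F i) / 2 ^ i) * (1 + norm z) ^ m)"
  proof (rule sum_mono)
    fix i assume "i \<in> {..m}"
    then have i: "i \<le> m" by simp
    have "norm z ^ (m - i) \<le> (1 + norm z) ^ (m - i)" by (intro power_mono) auto
    also have "\<dots> \<le> (1 + norm z) ^ m" by (intro power_increasing) auto
    finally have 1: "norm z ^ (m - i) \<le> (1 + norm z) ^ m" .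
    have "norm (z ^ (m - i) / fact (m - i)) = norm z ^ (m - i) / fact (m - i)"
      by (simp add: norm_divide norm_power)
    also have "\<dots> \<le> norm z ^ (m - i) / 1" by (intro divide_left_mono) (auto simp: fact_ge_1)
    finally have 2: "norm (z ^ (m - i) / fact (m - i)) \<le> (1 + norm z) ^ m" using 1 by simp
    have "norm (fps_nth F i) = 2 ^ i * (norm (fps_nth F i) / 2 ^ i)" by simp
    also have "\<dots> \<le> 2 ^ m * (norm (fps_nth F i) / 2 ^ i)" using i by (intro mult_right_mono power_increasing) auto
    finally show "norm (fps_nth F i * (z ^ (m - i) / fact (m - i))) \<le> 2 ^ m * (norm (fps_nth F i) / 2 ^ i) * (1 + norm z) ^ m"
      unfolding norm_mult using 2 by (intro mult_mono) auto
  qed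
  also have "\<dots> = 2 ^ m * fps_norm m F * (1 + norm z) ^ m"
    by (simp add: fps_norm_def sum_distrib_left sum_distrib_right)
  finally show ?thesis .
qed

lemma has_field_derivative_fps_nth_mult_exp:
  fixes z :: complex
  shows "((\<lambda>z. fps_nth (F * fps_exp z) m) has_field_derivative fps_nth (fps_X * F * fps_exp z) m) (at z)"
proof -
  have 1: "((\<lambda>z. fps_nth (fps_exp z) n) has_field_derivative fps_nth (fps_X * fps_exp z) n) (at z)" for n
  proof (cases n)
    case (Suc k)
    have d: "((\<lambda>z. z ^ Suc k / fact (Suc k)) has_field_derivative (of_nat (Suc k) * z ^ k) / fact (Suc k)) (at z)"
      by (rule DERIV_cdivide) (use DERIV_power[OF DERIV_ident[of "at z"], of "Suc k"] in simp)
    have eq: "(of_nat (Suc k) * z ^ k) / fact (Suc k) = z ^ k / fact k"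
      by (simp add: field_simps del: of_nat_Suc)
    from DERIV_cong[OF d eq] show ?thesis unfolding Suc fps_X_mult_nth fps_nth_exp by (simp del: fact_Suc of_nat_Suc power_Suc)
  qed (simp add: fps_nth_exp)
  have "((\<lambda>z. \<Sum>i=0..m. fps_nth F i * fps_nth (fps_exp z) (m - i)) has_field_derivative
      (\<Sum>i=0..m. fps_nth F i * fps_nth (fps_X * fps_exp z) (m - i))) (at z)"
    by (intro DERIV_sum DERIV_cmult 1)
  moreover have "fps_X * F * fps_exp z = F * (fps_X * fps_exp z)" by (simp only: mult.commute mult.left_commute)
  ultimately show ?thesis by (simp only: fps_mult_nth)
qed

lemma fact_sum_le:
  "fact (\<Sum>j\<in>S. k j) \<le> (2 ^ card S) ^ (\<Sum>j\<in>S. k j) * (\<Prod>j\<in>S. fact (k j) :: real)"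
  if "finite S"
  using that
proof (induction S rule: finite_induct)
  case (insert x S)
  let ?a = "k x" and ?b = "\<Sum>j\<in>S. k j"
  have "fact (?a + ?b) = real (?a + ?b choose ?a) * fact ?a * (fact ?b :: real)"
    using binomial_fact[of ?a "?a + ?b", where 'a = real] by simp
  also have "\<dots> \<le> 2 ^ (?a + ?b) * fact ?a * ((2 ^ card S) ^ ?b * (\<Prod>j\<in>S. fact (k j)))"
  proof (intro mult_mono insert.IH)
    have "real (?a + ?b choose ?a) \<le> real (2 ^ (?a + ?b))"
      by (rule of_nat_mono[OF binomial_le_pow2])
    then show "real (?a + ?b choose ?a) \<le> 2 ^ (?a + ?b)" by simp
  qed (auto intro: prod_nonneg)
  also have "\<dots> \<le> 2 ^ (?a + ?b) * fact ?a * ((2 ^ card S) ^ (?a + ?b) * (\<Prod>j\<in>S. fact (k j)))"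
    by (intro mult_left_mono mult_right_mono power_increasing) (auto intro: prod_nonneg)
  also have "\<dots> = (2 ^ card (insert x S)) ^ (\<Sum>j\<in>insert x S. k j) * (\<Prod>j\<in>insert x S. fact (k j))"
    using insert.hyps by (simp add: power_mult_distrib mult_ac)
  finally show ?case using insert.hyps by simp
qed simp

lemma prod_fact_le_fact_sum: "finite S \<Longrightarrow> (\<Prod>j\<in>S. fact (k j) :: real) \<le> fact (\<Sum>j\<in>S. k j)"
proof (induction S rule: finite_induct)
  case (insert x S)
  let ?a = "k x" and ?b = "\<Sum>j\<in>S. k j"
  have "fact ?a * (\<Prod>j\<in>S. fact (k j) :: real) \<le> fact ?a * fact ?b"
    by (intro mult_left_mono insert.IH) simp
  also have "\<dots> \<le> real (?a + ?b choose ?a) * (fact ?a * (fact ?b :: real))"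
  proof -
    have "1 \<le> real (?a + ?b choose ?a)" by (simp add: Suc_leI)
    then have "1 * (fact ?a * (fact ?b :: real)) \<le> real (?a + ?b choose ?a) * (fact ?a * (fact ?b :: real))"
      by (intro mult_right_mono) auto
    then show ?thesis by simp
  qed
  also have "\<dots> = fact (?a + ?b)"
    using binomial_fact[of ?a "?a + ?b", where 'a = real] by simp
  finally show ?case using insert.hyps by simp
qed simp

text \<open>The arguments of the factorials in the numerator and in the denominator have the same sum up to
  \<open>d + 1\<close>, and products of factorials with the same sum of arguments differ by a geometric factor.\<close>

lemma factorial_quotient_bound:
  fixes k :: "'n::finite \<Rightarrow> int"
  assumes "k i0 \<le> 0" "(\<Sum>j\<in>UNIV. k j) = - int d"
  shows "(\<Prod>j\<in>UNIV. if j = i0 \<or> k j < 0 then fact (nat (- k j) + of_bool (j = i0)) else 2 ^ nat (k j) / fact (nat (k j)) :: real)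
     \<le> fact (d + 1) * 2 ^ (d + 1) * (2 ^ (CARD('n) + 2)) ^ nat (\<Sum>j\<in>UNIV. \<bar>k j\<bar>)"
proof -
  define Q where "Q = {j. j = i0 \<or> k j < 0}"
  define P where "P = (\<Sum>j\<in>-Q. nat (k j))"
  have split: "(\<Sum>j\<in>UNIV. f j) = (\<Sum>j\<in>Q. f j) + (\<Sum>j\<in>-Q. f j)" for f :: "'n \<Rightarrow> int"
    using sum.union_disjoint[of Q "-Q" f] by (simp add: Compl_partition)
  have neg: "k j \<le> 0" if "j \<in> Q" for j using that assms(1) by (auto simp: Q_def)
  have pos: "k j \<ge> 0" if "j \<in> -Q" for j using that by (auto simp: Q_def)
  have P: "int P = (\<Sum>j\<in>-Q. k j)" unfolding P_def of_nat_sum by (rule sum.cong) (use pos in auto)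
  have nn: "(\<Sum>j\<in>Q. nat (- k j) + of_bool (j = i0)) = P + d + 1"
  proof -
    have "int (\<Sum>j\<in>Q. nat (- k j)) = - (\<Sum>j\<in>Q. k j)"
      unfolding of_nat_sum sum_negf[symmetric] by (rule sum.cong) (use neg in auto)
    then have "(\<Sum>j\<in>Q. nat (- k j)) = P + d" using P assms(2) split[of k] by linarith
    moreover have "(\<Sum>j\<in>Q. of_bool (j = i0)) = (1::nat)"
    proof -
      have "(\<Sum>j\<in>Q. of_bool (j = i0)) = (\<Sum>j\<in>Q. if j = i0 then 1 else (0::nat))" by (rule sum.cong) auto
      also have "\<dots> = 1" by (simp add: Q_def)
      finally show ?thesis .
    qed
    ultimately show ?thesis by (simp add: sum.distrib)
  qed
  have PK: "P \<le> nat (\<Sum>j\<in>UNIV. \<bar>k j\<bar>)"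
  proof -
    have "(\<Sum>j\<in>-Q. k j) \<le> (\<Sum>j\<in>-Q. \<bar>k j\<bar>)" by (intro sum_mono) auto
    also have "\<dots> \<le> (\<Sum>j\<in>UNIV. \<bar>k j\<bar>)" by (intro sum_mono2) auto
    finally show ?thesis using P by linarith
  qed
  define D where "D = (\<Prod>j\<in>-Q. fact (nat (k j)) :: real)"
  have D: "D > 0" unfolding D_def by (intro prod_pos) simp
  have "(\<Prod>j\<in>UNIV. if j = i0 \<or> k j < 0 then fact (nat (- k j) + of_bool (j = i0)) else 2 ^ nat (k j) / fact (nat (k j)) :: real)
    = (\<Prod>j\<in>Q. fact (nat (- k j) + of_bool (j = i0))) * (\<Prod>j\<in>-Q. 2 ^ nat (k j) / fact (nat (k j)))"
  proof -
    have "(\<Prod>j\<in>UNIV. f j) = (\<Prod>j\<in>Q. f j) * (\<Prod>j\<in>-Q. f j)" for f :: "'n \<Rightarrow> real"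
      using prod.union_disjoint[of Q "-Q" f] by (simp add: Compl_partition)
    then show ?thesis
      by (simp only:) (intro arg_cong2[where f = "(*)"] prod.cong, auto simp: Q_def)
  qed
  also have "(\<Prod>j\<in>-Q. 2 ^ nat (k j) / fact (nat (k j)) :: real) = 2 ^ P / D"
    by (simp add: prod_dividef P_def power_sum D_def)
  also have "(\<Prod>j\<in>Q. fact (nat (- k j) + of_bool (j = i0))) * (2 ^ P / D)
      \<le> 2 ^ (P + d + 1) * ((2 ^ CARD('n)) ^ P * D * fact (d + 1)) * (2 ^ P / D)"
  proof (rule mult_right_mono)
    have "(\<Prod>j\<in>Q. fact (nat (- k j) + of_bool (j = i0)) :: real) \<le> fact (P + d + 1)"
      using prod_fact_le_fact_sum[of Q "\<lambda>j. nat (- k j) + of_bool (j = i0)"] unfolding nn by simp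
    also have "fact (P + d + 1) = real (P + (d + 1) choose P) * (fact P * (fact (d + 1) :: real))"
      using binomial_fact[of P "P + (d + 1)", where 'a = real] by simp
    also have "\<dots> \<le> 2 ^ (P + d + 1) * ((2 ^ CARD('n)) ^ P * D * fact (d + 1))"
    proof (intro mult_mono)
      have "real (P + (d + 1) choose P) \<le> real (2 ^ (P + (d + 1)))"
        by (rule of_nat_mono[OF binomial_le_pow2])
      then show "real (P + (d + 1) choose P) \<le> 2 ^ (P + d + 1)" by simp
      have "fact P \<le> (2 ^ card (-Q)) ^ P * D"
        unfolding P_def D_def by (rule fact_sum_le) simp
      also have "\<dots> \<le> (2 ^ CARD('n)) ^ P * D"
        using D by (intro mult_right_mono power_mono power_increasing card_mono) auto
      finally show "fact P \<le> (2 ^ CARD('n)) ^ P * D" .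
    qed (use D in auto)
    finally show "(\<Prod>j\<in>Q. fact (nat (- k j) + of_bool (j = i0))) \<le> 2 ^ (P + d + 1) * ((2 ^ CARD('n)) ^ P * D * fact (d + 1))" .
  qed (use D in simp)
  also have "\<dots> = fact (d + 1) * (2 ^ (P + d + 1) * (2 ^ CARD('n)) ^ P * 2 ^ P)"
  proof -
    have "a * (b * D * f) * (c / D) = f * (a * b * c)" for a b c f :: real using D by (simp add: field_simps)
    then show ?thesis .
  qed
  also have "(2::real) ^ (P + d + 1) * (2 ^ CARD('n)) ^ P * 2 ^ P = 2 ^ (d + 1) * (2 ^ (CARD('n) + 2)) ^ P"
    by (simp only: power_add power_mult_distrib power2_eq_square mult_ac)
  also have "fact (d + 1) * (2 ^ (d + 1) * (2 ^ (CARD('n) + 2)) ^ P)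
      \<le> fact (d + 1) * (2 ^ (d + 1) * (2 ^ (CARD('n) + 2)) ^ nat (\<Sum>j\<in>UNIV. \<bar>k j\<bar>) :: real)"
  proof -
    have "1 \<le> (2::real) ^ (CARD('n) + 2)" by (rule one_le_power) simp
    then show ?thesis by (intro mult_left_mono power_increasing PK) simp_all
  qed
  finally show ?thesis by (simp only: mult.assoc)
qed

lemma summable_on_exp_l1:
  fixes c :: real
  assumes "c > 0"
  shows "(\<lambda>l :: int^'n::finite. exp (- c * (\<Sum>j\<in>UNIV. \<bar>real_of_int (l $ j)\<bar>))) summable_on UNIV"
proof -
  define g where "g k = exp (- c * \<bar>real_of_int k\<bar>)" for k
  have g: "g summable_on (UNIV :: int set)"
  proof -
    have "(\<lambda>n. exp (- c) ^ n) summable_on (UNIV :: nat set)"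
      by (rule norm_summable_imp_summable_on) (use assms in \<open>simp add: norm_power summable_geometric\<close>)
    then have nat: "(\<lambda>n. exp (- c * real n)) summable_on (UNIV :: nat set)"
      by (simp add: exp_of_nat_mult[symmetric] mult.commute)
    have "(g \<circ> int) summable_on UNIV" "(g \<circ> (\<lambda>n. - int n)) summable_on UNIV"
      using nat by (simp_all add: o_def g_def)
    moreover have "inj (\<lambda>n. - int n)" by (rule injI) simp
    ultimately have "g summable_on range int" "g summable_on range (\<lambda>n. - int n)"
      by (simp_all only: summable_on_reindex inj_of_nat)
    then have "g summable_on (range int \<union> range (\<lambda>n. - int n))" by (rule summable_on_union)
    moreover have "range int \<union> range (\<lambda>n. - int n) = UNIV"
    proof (rule UNIV_eq_I[symmetric])
      fix x :: int show "x \<in> range int \<union> range (\<lambda>n. - int n)" by (cases x rule: int_cases2) auto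
    qed
    ultimately show ?thesis by simp
  qed
  have gs: "sum g F \<le> infsum g UNIV" if "finite F" for F
    by (rule finite_sum_le_infsum[OF g that]) (auto simp: g_def)
  have "(\<lambda>l :: int^'n. \<Prod>j\<in>UNIV. g (l $ j)) summable_on UNIV"
  proof (rule nonneg_bounded_partial_sums_imp_summable_on[where C = "infsum g UNIV ^ CARD('n)"])
    show "eventually (\<lambda>F :: (int^'n) set. (\<Sum>l\<in>F. \<Prod>j\<in>UNIV. g (l $ j)) \<le> infsum g UNIV ^ CARD('n)) (finite_subsets_at_top UNIV)"
    proof (rule eventually_finite_subsets_at_top_weakI)
      fix F :: "(int^'n) set" assume F: "finite F"
      define G where "G = (\<Union>l\<in>F. range (\<lambda>j. l $ j))"
      have G: "finite G" using F by (simp add: G_def)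
      have "(\<Sum>l\<in>F. \<Prod>j\<in>UNIV. g (l $ j)) = (\<Sum>f\<in>vec_nth ` F. \<Prod>j\<in>UNIV. g (f j))"
        by (subst sum.reindex) (auto simp: inj_on_def vec_nth_inject)
      also have "\<dots> \<le> (\<Sum>f\<in>PiE (UNIV :: 'n set) (\<lambda>_. G). \<Prod>j\<in>UNIV. g (f j))"
        by (rule sum_mono2) (use G F in \<open>auto simp: finite_PiE G_def g_def intro!: prod_nonneg\<close>)
      also have "\<dots> = (\<Prod>j\<in>(UNIV::'n set). \<Sum>k\<in>G. g k)"
        by (rule prod_sum_PiE[symmetric]) (use G in auto)
      also have "\<dots> \<le> infsum g UNIV ^ CARD('n)"
        using gs[OF G] by (simp add: power_mono sum_nonneg g_def)
      finally show "(\<Sum>l\<in>F. \<Prod>j\<in>UNIV. g (l $ j)) \<le> infsum g UNIV ^ CARD('n)" .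
    qed
  qed (auto simp: g_def intro: prod_nonneg)
  then show ?thesis
    by (simp add: g_def exp_sum[symmetric] sum_distrib_left)
qed

section \<open>The summands of the series and a domain of convergence\<close>

lemma power_int_pred: "y \<noteq> 0 \<Longrightarrow> y powi q * inverse y = y powi (q - 1)" for y :: complex
  using power_int_diff[of y q 1] by (simp only: power_int_1_right divide_inverse simp_thms)

lemma power_int_pred': "y \<noteq> 0 \<Longrightarrow> y powi q = y * y powi (q - 1)" for y :: complex
  using power_int_pred[of y q] by (metis left_inverse mult.assoc mult.commute mult_1)

lemma sub_swap: "k - 1 - e = k - e - (1::int)"
  by linarith

context toric_data begin

definition sg :: "'n \<Rightarrow> complex" where "sg j = (if j = i0 then -1 else 1)"
definition ep :: "'n \<Rightarrow> int" where "ep j = of_bool (j = i0)"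
definition coord_fps :: "'n \<Rightarrow> int \<Rightarrow> complex fps" where
  "coord_fps j k = (if j = i0 then Gamma_fps k else rGamma_fps k)"

text \<open>The coefficient of \<open>x^m\<close> in the factor with index \<open>j\<close> and exponent \<open>k\<close> of a summand; \<open>ep\<close> absorbs
  the factor \<open>1 / a\<^sub>0\<close> in front of the series.\<close>

definition coord :: "'n \<Rightarrow> int \<Rightarrow> nat \<Rightarrow> complex \<Rightarrow> complex" where
  "coord j k m a = (sg j * a) powi (k - ep j) * fps_nth (coord_fps j k * fps_exp (Ln (sg j * a))) m"
definition slit :: "(complex^'n) set" where
  "slit = {a. \<forall>j. sg j * a $ j \<notin> \<real>\<^sub>\<le>\<^sub>0}"

text \<open>The coefficient of a monomial in a summand, for arbitrary integral exponents: the derivatives of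
  the series involve exponents that are not relations.\<close>

definition Emon :: "int^'n \<Rightarrow> ('n \<Rightarrow>\<^sub>0 nat) \<Rightarrow> complex^'n \<Rightarrow> complex" where
  "Emon k m a = (\<Prod>j\<in>UNIV. coord j (k $ j) (Poly_Mapping.lookup m j) (a $ j))"

lemma sg_sq [simp]: "sg j * sg j = 1" "sg j \<noteq> 0" "norm (sg j) = 1"
  by (simp_all add: sg_def)

lemma sg_sg [simp]: "sg j * (sg j * x) = x"
  by (simp add: sg_def)

lemma negate_coord_nth: "negate_coord i0 a $ j = sg j * a $ j"
  by (simp add: negate_coord_def sg_def)

lemma slit_nz: "a \<in> slit \<Longrightarrow> sg j * a $ j \<noteq> 0"
proof -
  assume "a \<in> slit"
  then have "sg j * a $ j \<notin> \<real>\<^sub>\<le>\<^sub>0" unfolding slit_def by blast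
  then show "sg j * a $ j \<noteq> 0" by (rule contrapos_nn) (simp only: complex_nonpos_Reals_iff, simp)
qed

lemma coord_fps_rec:
  assumes "j = i0 \<longrightarrow> k \<le> 0"
  shows "(fps_const (of_int (k - ep j)) + fps_X) * coord_fps j k = fps_const (sg j) * coord_fps j (k - 1)"
proof (cases "j = i0")
  case True
  then have "(fps_const (of_int (k - 1)) + fps_X) * Gamma_fps k = - Gamma_fps (k - 1)"
    using Gamma_fps_rec assms by blast
  moreover have "fps_const (-1) * Gamma_fps (k - 1) = - Gamma_fps (k - 1)"
    by (rule fps_ext) simp
  ultimately show ?thesis using True unfolding coord_fps_def ep_def sg_def by simp
next
  case False
  then show ?thesis using rGamma_fps_rec[of k] unfolding coord_fps_def ep_def sg_def by simp
qed

lemma coord_fps_rec_exp: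
  assumes "j = i0 \<longrightarrow> k \<le> 0"
  shows "of_int (k - ep j) * fps_nth (coord_fps j k * E) m + fps_nth (fps_X * coord_fps j k * E) m
    = sg j * fps_nth (coord_fps j (k - 1) * E) m"
proof -
  have "fps_const (of_int (k - ep j)) * (coord_fps j k * E) + fps_X * coord_fps j k * E
     = ((fps_const (of_int (k - ep j)) + fps_X) * coord_fps j k) * E"
    by (simp only: distrib_right mult.assoc)
  also have "\<dots> = fps_const (sg j) * (coord_fps j (k - 1) * E)"
    unfolding coord_fps_rec[OF assms] by (simp only: mult.assoc)
  finally have "fps_nth (fps_const (of_int (k - ep j)) * (coord_fps j k * E) + fps_X * coord_fps j k * E) m
     = fps_nth (fps_const (sg j) * (coord_fps j (k - 1) * E)) m" by (simp only:)
  then show ?thesis by (simp only: fps_add_nth fps_mult_left_const_nth)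
qed

text \<open>By the recursion of the Gamma function a derivative only lowers the exponent; the change of sign
  of the apex coordinate removes the sign that would occur there.\<close>

lemma coord_deriv:
  assumes "j = i0 \<longrightarrow> k \<le> 0" "sg j * a \<notin> \<real>\<^sub>\<le>\<^sub>0"
  shows "(coord j k m has_field_derivative coord j (k - 1) m a) (at a)"
proof -
  let ?y = "sg j * a" and ?q = "k - ep j" and ?F = "coord_fps j k"
  have nz: "?y \<noteq> 0" using assms(2) by auto
  have y: "((\<lambda>a. sg j * a) has_field_derivative sg j) (at a)"
    by (auto intro!: derivative_eq_intros)
  have d1: "((\<lambda>a. (sg j * a) powi ?q) has_field_derivative of_int ?q * ?y powi (?q - 1) * sg j) (at a)"
    by (rule DERIV_power_int[OF y disjI2[OF nz]])
  have L: "((\<lambda>a. Ln (sg j * a)) has_field_derivative inverse ?y * sg j) (at a)"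
    by (rule DERIV_chain2[OF has_field_derivative_Ln[OF assms(2)] y])
  have d2: "((\<lambda>a. fps_nth (?F * fps_exp (Ln (sg j * a))) m) has_field_derivative
      fps_nth (fps_X * ?F * fps_exp (Ln ?y)) m * (inverse ?y * sg j)) (at a)"
    by (rule DERIV_chain2[OF has_field_derivative_fps_nth_mult_exp L])
  have q: "?y powi ?q * inverse ?y = ?y powi (?q - 1)"
    by (rule power_int_pred[OF nz])
  have q': "?y powi (k - 1 - ep j) = ?y powi (?q - 1)" by (simp only: sub_swap)
  have "of_int ?q * ?y powi (?q - 1) * sg j * fps_nth (?F * fps_exp (Ln ?y)) m
     + fps_nth (fps_X * ?F * fps_exp (Ln ?y)) m * (inverse ?y * sg j) * ?y powi ?q
     = sg j * ?y powi (?q - 1) * (of_int ?q * fps_nth (?F * fps_exp (Ln ?y)) m + fps_nth (fps_X * ?F * fps_exp (Ln ?y)) m)"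
    unfolding q[symmetric] by (simp only: distrib_left mult_ac)
  also have "\<dots> = coord j (k - 1) m a"
    unfolding coord_fps_rec_exp[OF assms(1)] coord_def q' by (simp add: mult_ac)
  finally show ?thesis
    using DERIV_mult[OF d1 d2] unfolding coord_def[abs_def] by (simp only:)
qed

lemma coord_euler:
  assumes "j = i0 \<longrightarrow> k \<le> 0" "sg j * a \<noteq> 0"
  shows "a * coord j (k - 1) m a = of_int (k - ep j) * coord j k m a + (if m = 0 then 0 else coord j k (m - 1) a)"
proof -
  let ?y = "sg j * a" and ?q = "k - ep j" and ?F = "coord_fps j k"
  have q': "?y powi (k - 1 - ep j) = ?y powi (?q - 1)" by (simp only: sub_swap)
  have q: "a * ?y powi (?q - 1) = sg j * ?y powi ?q"
  proof -
    have "sg j * ?y powi ?q = sg j * (?y * ?y powi (?q - 1))" using power_int_pred'[OF assms(2), of ?q] by (simp only:)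
    then show ?thesis by (simp only: mult.assoc sg_sg)
  qed
  have X: "fps_nth (fps_X * ?F * fps_exp (Ln ?y)) m = (if m = 0 then 0 else fps_nth (?F * fps_exp (Ln ?y)) (m - 1))"
    by (simp only: mult.assoc fps_X_mult_nth)
  have "a * coord j (k - 1) m a = (a * ?y powi (?q - 1)) * fps_nth (coord_fps j (k - 1) * fps_exp (Ln ?y)) m"
    unfolding coord_def q' by (simp only: mult.assoc)
  also have "\<dots> = ?y powi ?q * (sg j * fps_nth (coord_fps j (k - 1) * fps_exp (Ln ?y)) m)"
    unfolding q by (simp only: mult_ac)
  also have "\<dots> = ?y powi ?q * (of_int ?q * fps_nth (?F * fps_exp (Ln ?y)) m + (if m = 0 then 0 else fps_nth (?F * fps_exp (Ln ?y)) (m - 1)))"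
    unfolding coord_fps_rec_exp[OF assms(1), symmetric] X ..
  also have "\<dots> = of_int ?q * coord j k m a + (if m = 0 then 0 else coord j k (m - 1) a)"
  proof -
    have "P * (c * f + (if b then 0 else g)) = c * (P * f) + (if b then 0 else P * g)" for P c f g :: complex and b
      by (simp add: distrib_left mult.left_commute)
    then show ?thesis unfolding coord_def by this
  qed
  finally show ?thesis .
qed

lemma coord_vanish: "j \<noteq> i0 \<Longrightarrow> k < 0 \<Longrightarrow> coord j k 0 a = 0"
  by (simp add: coord_def coord_fps_def rGamma_fps_neg)

lemma coord_B_factor:
  assumes "j = i0 \<longrightarrow> l $ j \<le> 0" "sg j * a $ j \<noteq> 0"
  shows "fps_nth (fps_expansion (B_factor i0 l (negate_coord i0 a) j) 0) m
    = (sg j * a $ j) powi (l $ j) * fps_nth (coord_fps j (l $ j) * fps_exp (Ln (sg j * a $ j))) m"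
proof -
  let ?y = "sg j * a $ j"
  define g where "g x = (if j = i0 then Gamma (- of_int (l $ j) - x + 1) else rGamma (of_int (l $ j) + x + 1))" for x :: complex
  have g: "g has_fps_expansion coord_fps j (l $ j)"
    using assms(1) Gamma_fps_expansion[of "l $ j"] rGamma_fps_expansion[of "l $ j"]
    unfolding g_def[abs_def] coord_fps_def by (cases "j = i0") simp_all
  have e: "(\<lambda>x. exp (Ln ?y * x)) has_fps_expansion fps_exp (Ln ?y)"
    by (rule has_fps_expansion_exp)
  have "(\<lambda>x. ?y powi (l $ j) * (g x * exp (Ln ?y * x))) has_fps_expansion fps_const (?y powi (l $ j)) * (coord_fps j (l $ j) * fps_exp (Ln ?y))"
    by (rule has_fps_expansion_cmult_left, rule has_fps_expansion_mult[OF g e])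
  moreover have "(\<lambda>x. ?y powi (l $ j) * (g x * exp (Ln ?y * x))) = B_factor i0 l (negate_coord i0 a) j"
  proof
    fix x
    have "?y powr (of_int (l $ j) + x) = exp (of_int (l $ j) * Ln ?y) * exp (Ln ?y * x)"
      using assms(2) by (simp add: powr_def distrib_right exp_add mult.commute)
    also have "exp (of_int (l $ j) * Ln ?y) = ?y powi (l $ j)"
      using assms(2) unfolding exp_power_int[symmetric] by simp
    finally show "?y powi (l $ j) * (g x * exp (Ln ?y * x)) = B_factor i0 l (negate_coord i0 a) j x"
      unfolding B_factor_def negate_coord_nth g_def by (simp only: mult_ac)
  qed
  ultimately have "fps_expansion (B_factor i0 l (negate_coord i0 a) j) 0 = fps_const (?y powi (l $ j)) * (coord_fps j (l $ j) * fps_exp (Ln ?y))"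
    by (intro fps_expansion_eqI) simp
  then show ?thesis by (simp only: fps_mult_left_const_nth)
qed

lemma Emon_B_term:
  assumes "a \<in> slit" "l $ i0 \<le> 0"
  shows "1 / (negate_coord i0 a $ i0) * B_term i0 (negate_coord i0 a) m l = Emon l m a"
proof -
  have "coord j (l $ j) (Poly_Mapping.lookup m j) (a $ j)
    = (sg j * a $ j) powi (- ep j) * fps_nth (fps_expansion (B_factor i0 l (negate_coord i0 a) j) 0) (Poly_Mapping.lookup m j)" for j
  proof -
    have "(sg j * a $ j) powi (l $ j - ep j) = (sg j * a $ j) powi (- ep j) * (sg j * a $ j) powi (l $ j)"
      using slit_nz[OF assms(1), of j] power_int_add[of "sg j * a $ j" "- ep j" "l $ j"] by simp
    moreover have "fps_nth (fps_expansion (B_factor i0 l (negate_coord i0 a) j) 0) (Poly_Mapping.lookup m j)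
      = (sg j * a $ j) powi (l $ j) * fps_nth (coord_fps j (l $ j) * fps_exp (Ln (sg j * a $ j))) (Poly_Mapping.lookup m j)"
      by (rule coord_B_factor) (use assms slit_nz in auto)
    ultimately show ?thesis unfolding coord_def by (simp only: mult.assoc)
  qed
  then have "Emon l m a = (\<Prod>j\<in>UNIV. (sg j * a $ j) powi (- ep j)) * B_term i0 (negate_coord i0 a) m l"
    unfolding Emon_def B_term_def by (simp only: prod.distrib)
  also have "(\<Prod>j\<in>UNIV. (sg j * a $ j) powi (- ep j)) = (\<Prod>j\<in>UNIV. if j = i0 then 1 / (sg i0 * a $ i0) else 1)"
    by (rule prod.cong) (auto simp: ep_def power_int_minus inverse_eq_divide)
  also have "\<dots> = 1 / (sg i0 * a $ i0)" by simp
  finally show ?thesis by (simp only: negate_coord_nth)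
qed

lemma axis_nth_int: "(k - axis j 1 :: int^'n) $ i = k $ i - (if i = j then 1 else 0)"
  by (simp add: axis_def)

lemma Emon_deriv:
  assumes "a \<in> slit" "k $ i0 \<le> 0"
  shows "(Emon k m has_derivative (\<lambda>v. \<Sum>j\<in>UNIV. v $ j * Emon (k - axis j 1) m a)) (at a)"
proof -
  let ?m = "Poly_Mapping.lookup m"
  have d: "((\<lambda>a. coord j (k $ j) (?m j) (a $ j)) has_derivative (\<lambda>v. coord j (k $ j - 1) (?m j) (a $ j) * v $ j)) (at a)" for j
  proof -
    have "(coord j (k $ j) (?m j) has_field_derivative coord j (k $ j - 1) (?m j) (a $ j)) (at (a $ j))"
      by (rule coord_deriv) (use assms in \<open>auto simp: slit_def\<close>)
    then have "(coord j (k $ j) (?m j) has_derivative (\<lambda>x. coord j (k $ j - 1) (?m j) (a $ j) * x)) (at (a $ j))"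
      by (simp only: has_field_derivative_def)
    from has_derivative_compose[OF bounded_linear.has_derivative[OF bounded_linear_vec_nth[of j] has_derivative_ident] this]
    show ?thesis .
  qed
  have "((\<lambda>a. \<Prod>j\<in>UNIV. coord j (k $ j) (?m j) (a $ j)) has_derivative
      (\<lambda>v. \<Sum>j\<in>UNIV. (coord j (k $ j - 1) (?m j) (a $ j) * v $ j) * (\<Prod>i\<in>UNIV - {j}. coord i (k $ i) (?m i) (a $ i)))) (at a)"
    by (rule has_derivative_prod[OF d])
  moreover have "(\<lambda>v. \<Sum>j\<in>UNIV. (coord j (k $ j - 1) (?m j) (a $ j) * v $ j) * (\<Prod>i\<in>UNIV - {j}. coord i (k $ i) (?m i) (a $ i)))
     = (\<lambda>v. \<Sum>j\<in>UNIV. v $ j * Emon (k - axis j 1) m a)"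
  proof (intro ext sum.cong refl)
    fix v :: "complex^'n" and j
    have "Emon (k - axis j 1) m a = coord j (k $ j - 1) (?m j) (a $ j) * (\<Prod>i\<in>UNIV - {j}. coord i (k $ i) (?m i) (a $ i))"
      unfolding Emon_def axis_nth_int by (subst prod.remove[of UNIV j]) simp_all
    then show "(coord j (k $ j - 1) (?m j) (a $ j) * v $ j) * (\<Prod>i\<in>UNIV - {j}. coord i (k $ i) (?m i) (a $ i)) = v $ j * Emon (k - axis j 1) m a"
      by (simp only: mult_ac)
  qed
  ultimately show ?thesis unfolding Emon_def[abs_def] by (simp only:)
qed

text \<open>The logarithm is the rate of growth in \<open>factorial_quotient_bound\<close>; the summand \<open>2\<close> leaves room for
  the perturbation of the coordinates allowed in the domain.\<close>

definition t0 :: real where "t0 = ln (2 ^ (CARD('n) + 2)) + 2"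
definition l1 :: "int^'n \<Rightarrow> real" where "l1 l = (\<Sum>j\<in>UNIV. \<bar>real_of_int (l $ j)\<bar>)"
definition Gfac :: "int^'n \<Rightarrow> ('n \<Rightarrow>\<^sub>0 nat) \<Rightarrow> complex^'n \<Rightarrow> real" where
  "Gfac u m a = (\<Prod>j\<in>UNIV. exp (- (of_int (u $ j + ep j) * Re (Ln (sg j * a $ j)))) * (1 + norm (Ln (sg j * a $ j))) ^ Poly_Mapping.lookup m j)"

lemma l1_nonneg: "0 \<le> l1 l" by (simp add: l1_def sum_nonneg)

lemma coord_fps_norm:
  assumes "j = i0 \<longrightarrow> k \<le> 0"
  shows "fps_norm m (coord_fps j k) \<le> fps_norm m (coord_fps j 0) *
    (if j = i0 \<or> k < 0 then fact (nat (- k) + of_bool (j = i0)) else 2 ^ nat k / fact (nat k))"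
proof -
  consider "j = i0" | "j \<noteq> i0" "k < 0" | "j \<noteq> i0" "k \<ge> 0" by linarith
  then show ?thesis
  proof cases
    case 1
    with assms have k: "- int (nat (- k)) = k" by simp
    show ?thesis using Gamma_fps_norm[of m "nat (- k)"] 1 unfolding k coord_fps_def by simp
  next
    case 2
    then have k: "- int (nat (- k)) = k" by simp
    show ?thesis using rGamma_fps_norm_neg[of m "nat (- k)"] 2 unfolding k coord_fps_def by simp
  next
    case 3
    then have k: "int (nat k) = k" by simp
    show ?thesis using rGamma_fps_norm_pos[of m "nat k"] 3 unfolding k coord_fps_def by simp
  qed
qed

lemma coord_bound:
  assumes "sg j * a \<noteq> 0"
  shows "norm (coord j k m a) \<le> exp (of_int (k - ep j) * Re (Ln (sg j * a))) * (2 ^ m * fps_norm m (coord_fps j k) * (1 + norm (Ln (sg j * a))) ^ m)"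
proof -
  have "(sg j * a) powi (k - ep j) = exp (of_int (k - ep j) * Ln (sg j * a))"
    using assms unfolding exp_power_int[symmetric] by simp
  then have "norm ((sg j * a) powi (k - ep j)) = exp (of_int (k - ep j) * Re (Ln (sg j * a)))"
    by (simp only: norm_exp_eq_Re) simp
  then show ?thesis unfolding coord_def norm_mult
    by (intro mult_mono fps_nth_mult_exp_bound) auto
qed

end

lemma relation_lattice_iff:
  "l \<in> relation_lattice \<mu> \<longleftrightarrow> (\<Sum>j\<in>UNIV. l $ j) = 0 \<and> (\<Sum>j\<in>UNIV. of_int (l $ j) *\<^sub>R \<mu> j) = 0"
proof -
  have eq: "(\<Sum>i\<in>UNIV. of_int (l $ i) *\<^sub>R (1::real, \<mu> i)) = (of_int (\<Sum>j\<in>UNIV. l $ j), \<Sum>j\<in>UNIV. of_int (l $ j) *\<^sub>R \<mu> j)"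
    by (simp add: prod_eq_iff fst_sum snd_sum)
  show ?thesis
    unfolding relation_lattice_def mem_Collect_eq eq by (simp only: zero_prod_def prod.inject of_int_eq_0_iff)
qed

context toric_data begin

lemma A_sum: "l \<in> A \<Longrightarrow> (\<Sum>j\<in>UNIV. l $ j) = 0"
  using A_relations relation_lattice_iff by blast

lemma t0_nonneg: "0 \<le> t0"
proof -
  have "1 \<le> (2::real) ^ (CARD('n) + 2)" by (rule one_le_power) simp
  from ln_ge_zero[OF this] show ?thesis unfolding t0_def by linarith
qed

text \<open>If the logarithms of the coordinates are close to \<open>- t * \<psi>\<close>, then \<open>height\<close> bounds the power with
  exponent \<open>l\<close> by a multiple of \<open>exp (- t * l1 l)\<close>, up to the perturbation; for large \<open>t\<close> this
  outweighs the geometric growth of the coefficients.\<close>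

lemma Emon_bound:
  assumes u: "\<forall>j. 0 \<le> u $ j"
  shows "\<exists>K\<ge>0. \<forall>l\<in>A. \<forall>a\<in>slit. \<forall>t\<ge>0. (\<forall>j. norm (Ln (sg j * a $ j) + of_real (t * \<psi> j)) \<le> 1) \<longrightarrow>
    norm (Emon (l - u) m a) \<le> K * Gfac u m a * exp (- (t - t0 + 1) * l1 l)"
proof -
  define d where "d = nat (\<Sum>j\<in>UNIV. u $ j)"
  have d: "int d = (\<Sum>j\<in>UNIV. u $ j)" using u by (simp add: d_def sum_nonneg)
  define R :: real where "R = 2 ^ (CARD('n) + 2)"
  have R1: "1 \<le> R" unfolding R_def by (rule one_le_power) simp
  define c where "c j = 2 ^ Poly_Mapping.lookup m j * fps_norm (Poly_Mapping.lookup m j) (coord_fps j 0)" for j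
  define K where "K = (\<Prod>j\<in>UNIV. c j) * (fact (d + 1) * 2 ^ (d + 1)) * R ^ d"
  have c0: "0 \<le> c j" for j by (simp add: c_def)
  have K0: "0 \<le> K" unfolding K_def using c0 R1 by (intro mult_nonneg_nonneg prod_nonneg) auto
  show ?thesis
  proof (intro exI[of _ K] conjI ballI allI impI K0)
    fix l a and t :: real assume l: "l \<in> A" and a: "a \<in> slit" and t: "0 \<le> t"
      and z: "\<forall>j. norm (Ln (sg j * a $ j) + of_real (t * \<psi> j)) \<le> 1"
    define k where "k = l - u"
    define Z where "Z j = Ln (sg j * a $ j)" for j
    define fac :: "'n \<Rightarrow> real" where "fac j = (if j = i0 \<or> k $ j < 0 then fact (nat (- (k $ j)) + of_bool (j = i0)) else 2 ^ nat (k $ j) / fact (nat (k $ j)))" for j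
    have kj: "k $ j = l $ j - u $ j" for j by (simp add: k_def)
    have ki0: "k $ i0 \<le> 0" using A_apex[OF l] u[rule_format, of i0] unfolding kj by linarith
    have ksum: "(\<Sum>j\<in>UNIV. k $ j) = - int d" unfolding kj sum_subtractf A_sum[OF l] d by simp
    have fac0: "0 \<le> fac j" for j by (simp add: fac_def)
    have fac: "(\<Prod>j\<in>UNIV. fac j) \<le> fact (d + 1) * 2 ^ (d + 1) * R ^ nat (\<Sum>j\<in>UNIV. \<bar>k $ j\<bar>)"
      unfolding fac_def R_def by (rule factorial_quotient_bound[OF ki0 ksum])
    define g where "g j = exp (- (of_int (u $ j + ep j) * Re (Z j))) * (1 + norm (Z j)) ^ Poly_Mapping.lookup m j" for j
    have g0: "0 \<le> g j" for j by (simp add: g_def)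
    have each: "norm (coord j (k $ j) (Poly_Mapping.lookup m j) (a $ j)) \<le> exp (of_int (l $ j) * Re (Z j)) * (g j * (c j * fac j))" for j
    proof -
      have nz: "sg j * a $ j \<noteq> 0" by (rule slit_nz[OF a])
      have 1: "norm (coord j (k $ j) (Poly_Mapping.lookup m j) (a $ j))
        \<le> exp (of_int (k $ j - ep j) * Re (Z j)) * (2 ^ Poly_Mapping.lookup m j * fps_norm (Poly_Mapping.lookup m j) (coord_fps j (k $ j)) * (1 + norm (Z j)) ^ Poly_Mapping.lookup m j)"
        unfolding Z_def by (rule coord_bound[OF nz])
      have 2: "fps_norm (Poly_Mapping.lookup m j) (coord_fps j (k $ j)) \<le> fps_norm (Poly_Mapping.lookup m j) (coord_fps j 0) * fac j"
        unfolding fac_def by (rule coord_fps_norm) (use ki0 in auto)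
      have 3: "exp (of_int (k $ j - ep j) * Re (Z j)) \<le> exp (of_int (l $ j) * Re (Z j)) * exp (- (of_int (u $ j + ep j) * Re (Z j)))"
        unfolding exp_add[symmetric] exp_le_cancel_iff kj by (simp add: left_diff_distrib distrib_right)
      have "norm (coord j (k $ j) (Poly_Mapping.lookup m j) (a $ j)) \<le>
         (exp (of_int (l $ j) * Re (Z j)) * exp (- (of_int (u $ j + ep j) * Re (Z j)))) *
         (2 ^ Poly_Mapping.lookup m j * (fps_norm (Poly_Mapping.lookup m j) (coord_fps j 0) * fac j) * (1 + norm (Z j)) ^ Poly_Mapping.lookup m j)"
        by (rule order_trans[OF 1], rule mult_mono[OF 3], intro mult_right_mono mult_left_mono 2) (simp_all add: mult_nonneg_nonneg)
      then show ?thesis unfolding g_def c_def by (simp only: mult_ac)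
    qed
    have "norm (Emon (l - u) m a) = (\<Prod>j\<in>UNIV. norm (coord j (k $ j) (Poly_Mapping.lookup m j) (a $ j)))"
      unfolding Emon_def k_def by (rule prod_norm[symmetric])
    also have "\<dots> \<le> (\<Prod>j\<in>UNIV. exp (of_int (l $ j) * Re (Z j)) * (g j * (c j * fac j)))"
      by (intro prod_mono conjI each norm_ge_zero)
    also have "\<dots> = exp (\<Sum>j\<in>UNIV. of_int (l $ j) * Re (Z j)) * (Gfac u m a * ((\<Prod>j\<in>UNIV. c j) * (\<Prod>j\<in>UNIV. fac j)))"
      unfolding prod.distrib exp_sum[OF finite_class.finite_UNIV] Gfac_def g_def Z_def by (simp only: mult_ac)
    also have "\<dots> \<le> exp (- (t - 1) * l1 l) * (Gfac u m a * ((\<Prod>j\<in>UNIV. c j) * (fact (d + 1) * 2 ^ (d + 1) * (R ^ d * exp (ln R * l1 l)))))"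
    proof (intro mult_mono)
      have Re: "of_int (l $ j) * Re (Z j) \<le> - t * (of_int (l $ j) * \<psi> j) + \<bar>real_of_int (l $ j)\<bar>" for j
      proof -
        have "\<bar>Re (Z j + of_real (t * \<psi> j))\<bar> \<le> 1"
          using z abs_Re_le_cmod[of "Z j + of_real (t * \<psi> j)"] unfolding Z_def by (meson order_trans)
        then have 1: "\<bar>Re (Z j) + t * \<psi> j\<bar> \<le> 1" by simp
        have "real_of_int (l $ j) * (Re (Z j) + t * \<psi> j) \<le> \<bar>real_of_int (l $ j) * (Re (Z j) + t * \<psi> j)\<bar>" by linarith
        also have "\<dots> \<le> \<bar>real_of_int (l $ j)\<bar>" using 1 unfolding abs_mult by (simp add: mult_left_le)
        finally have "real_of_int (l $ j) * (Re (Z j) + t * \<psi> j) \<le> \<bar>real_of_int (l $ j)\<bar>" .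
        moreover have "x * (y + s * w) = x * y - (- s * (x * w))" for x y s w :: real
          by (simp add: distrib_left mult.left_commute)
        ultimately have "real_of_int (l $ j) * Re (Z j) - (- t * (real_of_int (l $ j) * \<psi> j)) \<le> \<bar>real_of_int (l $ j)\<bar>"
          by (simp only:)
        then show ?thesis by (simp only: diff_le_eq add.commute)
      qed
      have "(\<Sum>j\<in>UNIV. of_int (l $ j) * Re (Z j)) \<le> (\<Sum>j\<in>UNIV. - t * (of_int (l $ j) * \<psi> j) + \<bar>real_of_int (l $ j)\<bar>)"
        by (intro sum_mono Re)
      also have "\<dots> = - t * (\<Sum>j\<in>UNIV. of_int (l $ j) * \<psi> j) + l1 l"
        by (simp only: sum.distrib sum_distrib_left l1_def)
      also have "\<dots> \<le> - t * l1 l + l1 l"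
        using mult_left_mono[OF height[OF l] t] unfolding l1_def by linarith
      also have "\<dots> = - (t - 1) * l1 l" by (simp add: left_diff_distrib)
      finally show "exp (\<Sum>j\<in>UNIV. of_int (l $ j) * Re (Z j)) \<le> exp (- (t - 1) * l1 l)" by simp
      have "(\<Sum>j\<in>UNIV. \<bar>k $ j\<bar>) \<le> (\<Sum>j\<in>UNIV. \<bar>l $ j\<bar> + u $ j)"
      proof (rule sum_mono)
        fix j show "\<bar>k $ j\<bar> \<le> \<bar>l $ j\<bar> + u $ j" using u[rule_format, of j] unfolding kj by linarith
      qed
      also have "\<dots> = (\<Sum>j\<in>UNIV. \<bar>l $ j\<bar>) + int d" by (simp add: sum.distrib d)
      finally have le: "nat (\<Sum>j\<in>UNIV. \<bar>k $ j\<bar>) \<le> d + nat (\<Sum>j\<in>UNIV. \<bar>l $ j\<bar>)"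
        by linarith
      have l1: "real (nat (\<Sum>j\<in>UNIV. \<bar>l $ j\<bar>)) = l1 l"
        by (simp add: l1_def sum_nonneg)
      have "R ^ nat (\<Sum>j\<in>UNIV. \<bar>k $ j\<bar>) \<le> R ^ (d + nat (\<Sum>j\<in>UNIV. \<bar>l $ j\<bar>))"
        by (rule power_increasing[OF le R1])
      also have "\<dots> = R ^ d * R ^ nat (\<Sum>j\<in>UNIV. \<bar>l $ j\<bar>)" by (rule power_add)
      also have "R ^ nat (\<Sum>j\<in>UNIV. \<bar>l $ j\<bar>) = exp (ln R * l1 l)"
        using R1 exp_of_nat_mult[of "nat (\<Sum>j\<in>UNIV. \<bar>l $ j\<bar>)" "ln R"] unfolding l1 by (simp add: mult.commute)
      finally have "R ^ nat (\<Sum>j\<in>UNIV. \<bar>k $ j\<bar>) \<le> R ^ d * exp (ln R * l1 l)" .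
      then have "fact (d + 1) * 2 ^ (d + 1) * R ^ nat (\<Sum>j\<in>UNIV. \<bar>k $ j\<bar>) \<le> fact (d + 1) * 2 ^ (d + 1) * (R ^ d * exp (ln R * l1 l))"
        by (intro mult_left_mono) auto
      with fac show "(\<Prod>j\<in>UNIV. fac j) \<le> fact (d + 1) * 2 ^ (d + 1) * (R ^ d * exp (ln R * l1 l))" by linarith
    qed (use c0 fac0 g0 R1 in \<open>auto intro!: mult_nonneg_nonneg prod_nonneg simp: Gfac_def\<close>)
    also have "\<dots> = K * Gfac u m a * (exp (- (t - 1) * l1 l) * exp (ln R * l1 l))"
      unfolding K_def by (simp only: mult_ac)
    also have "exp (- (t - 1) * l1 l) * exp (ln R * l1 l) = exp (- (t - t0 + 1) * l1 l)"
      unfolding exp_add[symmetric] t0_def R_def[symmetric] by (simp add: algebra_simps)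
    finally show "norm (Emon (l - u) m a) \<le> K * Gfac u m a * exp (- (t - t0 + 1) * l1 l)" .
  qed
qed

text \<open>A tube around the end of the ray spanned by \<open>- \<psi>\<close> in logarithmic coordinates.\<close>

definition dom :: "(complex^'n) set" where
  "dom = {a \<in> slit. \<exists>t>t0. \<forall>j. norm (Ln (sg j * a $ j) + of_real (t * \<psi> j)) < 1}"

lemma dom_slit: "a \<in> dom \<Longrightarrow> a \<in> slit" by (simp add: dom_def)

lemma open_slit: "open slit"
proof -
  have "slit = (\<Inter>j. (\<lambda>a. sg j * a $ j) -` (- \<real>\<^sub>\<le>\<^sub>0))" by (auto simp: slit_def)
  moreover have "open ((\<lambda>a :: complex^'n. sg j * a $ j) -` (- \<real>\<^sub>\<le>\<^sub>0))" for j
    by (intro open_vimage) (auto intro!: continuous_intros)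
  ultimately show ?thesis by auto
qed

lemma continuous_on_Ln_coord: "continuous_on slit (\<lambda>a. Ln (sg j * a $ j))"
proof (rule continuous_on_Ln')
  show "continuous_on slit (\<lambda>a. sg j * a $ j)" by (intro continuous_intros)
qed (auto simp: slit_def)

lemma open_dom: "open dom"
proof -
  let ?S = "\<lambda>t j. {a \<in> slit. norm (Ln (sg j * a $ j) + of_real (t * \<psi> j)) < 1}"
  have openS: "open (?S t j)" for t j
  proof -
    have "continuous_on slit (\<lambda>a. norm (Ln (sg j * a $ j) + of_real (t * \<psi> j)))"
      by (intro continuous_intros continuous_on_Ln_coord)
    from continuous_open_preimage[OF this open_slit open_lessThan]
    have "open (slit \<inter> (\<lambda>a. norm (Ln (sg j * a $ j) + of_real (t * \<psi> j))) -` {..<1})" .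
    moreover have "?S t j = slit \<inter> (\<lambda>a. norm (Ln (sg j * a $ j) + of_real (t * \<psi> j))) -` {..<1}"
      by (rule set_eqI) (simp only: mem_Collect_eq Int_iff vimage_eq lessThan_iff)
    ultimately show ?thesis by (simp only:)
  qed
  have "open (\<Union>t\<in>{t0<..}. \<Inter>j. ?S t j)"
    by (rule open_UN, rule ballI, rule open_INT, rule finite_class.finite_UNIV, rule ballI, rule openS)
  moreover have "dom = (\<Union>t\<in>{t0<..}. \<Inter>j. ?S t j)"
    unfolding dom_def by (rule set_eqI) (simp, blast)
  ultimately show ?thesis by simp
qed

text \<open>Logarithmic coordinates; the domain is the image of a convex set.\<close>

definition param :: "real \<times> (complex^'n) \<Rightarrow> complex^'n" where
  "param p = (\<chi> j. sg j * exp (snd p $ j - of_real (fst p * \<psi> j)))"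

lemma Ln_param:
  assumes "norm (w $ j) < 1"
  shows "Ln (sg j * param (t, w) $ j) = w $ j - of_real (t * \<psi> j)"
    and "sg j * param (t, w) $ j \<notin> \<real>\<^sub>\<le>\<^sub>0"
proof -
  have p: "sg j * param (t, w) $ j = exp (w $ j - of_real (t * \<psi> j))"
    by (simp add: param_def)
  have "\<bar>Im (w $ j - of_real (t * \<psi> j))\<bar> < 1" using assms abs_Im_le_cmod[of "w $ j"] by simp
  then have Im: "- pi < Im (w $ j - of_real (t * \<psi> j))" "Im (w $ j - of_real (t * \<psi> j)) < pi"
    using pi_gt3 by linarith+
  show 1: "Ln (sg j * param (t, w) $ j) = w $ j - of_real (t * \<psi> j)"
    unfolding p by (rule Ln_exp) (use Im in simp_all)
  show "sg j * param (t, w) $ j \<notin> \<real>\<^sub>\<le>\<^sub>0"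
  proof
    assume "sg j * param (t, w) $ j \<in> \<real>\<^sub>\<le>\<^sub>0"
    moreover have "sg j * param (t, w) $ j \<noteq> 0" unfolding p by simp
    ultimately have "Im (Ln (sg j * param (t, w) $ j)) = pi"
      by (subst Im_Ln_eq_pi) (auto simp: complex_nonpos_Reals_iff complex_eq_iff less_le)
    then show False using Im(2) unfolding 1 by simp
  qed
qed

lemma dom_eq_param: "dom = param ` ({t0<..} \<times> {w. \<forall>j. norm (w $ j) < 1})"
proof (intro set_eqI iffI)
  fix a assume "a \<in> dom"
  then obtain t where t: "t > t0" "\<And>j. norm (Ln (sg j * a $ j) + of_real (t * \<psi> j)) < 1" and a: "a \<in> slit"
    unfolding dom_def by blast
  define w :: "complex^'n" where "w = (\<chi> j. Ln (sg j * a $ j) + of_real (t * \<psi> j))"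
  have "param (t, w) = a"
    unfolding param_def by (simp add: vec_eq_iff w_def exp_Ln[OF slit_nz[OF a]])
  moreover have "norm (w $ j) < 1" for j using t(2)[of j] by (simp add: w_def)
  ultimately show "a \<in> param ` ({t0<..} \<times> {w. \<forall>j. norm (w $ j) < 1})" using t(1) by force
next
  fix a assume "a \<in> param ` ({t0<..} \<times> {w. \<forall>j. norm (w $ j) < 1})"
  then obtain t w where tw: "t > t0" "\<And>j. norm (w $ j) < 1" "a = param (t, w)" by auto
  show "a \<in> dom"
    unfolding dom_def slit_def tw(3) mem_Collect_eq
  proof (intro conjI allI exI[of _ t] Ln_param(2) tw(1,2))
    fix j show "norm (Ln (sg j * param (t, w) $ j) + of_real (t * \<psi> j)) < 1"
      unfolding Ln_param(1)[OF tw(2)] using tw(2)[of j] by simp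
  qed
qed

lemma connected_dom: "connected dom"
  unfolding dom_eq_param
proof (rule connected_continuous_image)
  show "continuous_on ({t0<..} \<times> {w. \<forall>j. norm (w $ j) < 1}) param"
    unfolding param_def by (intro continuous_intros)
  have "{w :: complex^'n. \<forall>j. norm (w $ j) < 1} = (\<Inter>j. (\<lambda>w. w $ j) -` ball 0 1)" by auto
  moreover have "convex ((\<lambda>w :: complex^'n. w $ j) -` ball 0 1)" for j
    by (intro convex_linear_vimage bounded_linear.linear[OF bounded_linear_vec_nth]) simp
  ultimately have "convex {w :: complex^'n. \<forall>j. norm (w $ j) < 1}" by (simp add: convex_INT)
  then show "connected ({t0<..} \<times> {w :: complex^'n. \<forall>j. norm (w $ j) < 1})"
    by (intro convex_connected convex_Times) auto
qed

lemma dom_nonempty: "dom \<noteq> {}"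
proof -
  have "(t0 + 1, 0) \<in> {t0<..} \<times> {w :: complex^'n. \<forall>j. norm (w $ j) < 1}" by simp
  then show ?thesis unfolding dom_eq_param by blast
qed

end

section \<open>The series solves the system\<close>

lemma infsum_finite_sum:
  fixes f :: "'i \<Rightarrow> 'l \<Rightarrow> complex"
  assumes "finite I" "\<And>i. i \<in> I \<Longrightarrow> f i summable_on A"
  shows "(\<Sum>\<^sub>\<infinity>l\<in>A. \<Sum>i\<in>I. f i l) = (\<Sum>i\<in>I. \<Sum>\<^sub>\<infinity>l\<in>A. f i l) \<and> (\<lambda>l. \<Sum>i\<in>I. f i l) summable_on A"
  using assms
proof (induction I rule: finite_induct)
  case (insert i I)
  then have "f i summable_on A" "(\<lambda>l. \<Sum>i\<in>I. f i l) summable_on A" by auto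
  from infsum_add[OF this] summable_on_add[OF this] insert show ?case by simp
qed simp

context toric_data begin

abbreviation D :: "('n \<Rightarrow>\<^sub>0 nat) set" where "D \<equiv> {m. mon_degree m \<le> CARD('n)}"

lemma finite_D: "finite D" by (rule finite_mon_degree_le)

lemma Gfac_continuous: "continuous_on slit (Gfac u m)"
  unfolding Gfac_def[abs_def]
  by (intro continuous_on_prod continuous_on_mult continuous_on_exp continuous_on_power continuous_on_add
      continuous_on_minus continuous_on_Re continuous_on_const continuous_on_norm continuous_on_Ln_coord)

lemma Emon_local_bound:
  assumes "a0 \<in> dom"
  shows "\<exists>r>0. ball a0 r \<subseteq> dom \<and> (\<forall>u m. (\<forall>j. 0 \<le> u $ j) \<longrightarrow>
    (\<exists>K\<ge>0. \<forall>a\<in>ball a0 r. \<forall>l\<in>A. norm (Emon (l - u) m a) \<le> K * exp (- l1 l)))"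
proof -
  obtain r where r: "r > 0" "cball a0 r \<subseteq> dom"
    using open_dom assms unfolding open_contains_cball by blast
  show ?thesis
  proof (rule exI[of _ r], intro conjI allI impI)
    show "0 < r" by fact
    show "ball a0 r \<subseteq> dom" using r(2) ball_subset_cball[of a0 r] by (rule order_trans[rotated])
    fix u :: "int^'n" and m assume u: "\<forall>j. 0 \<le> u $ j"
    have "cball a0 r \<subseteq> slit" using r(2) dom_slit by blast
    then have "continuous_on (cball a0 r) (Gfac u m)"
      by (rule continuous_on_subset[OF Gfac_continuous])
    moreover have "cball a0 r \<noteq> {}" using r(1) by simp
    ultimately obtain x where x: "\<forall>y\<in>cball a0 r. Gfac u m y \<le> Gfac u m x"
      using continuous_attains_sup[OF compact_cball] by blast
    obtain K where K: "K \<ge> 0" "\<forall>l\<in>A. \<forall>a\<in>slit. \<forall>t\<ge>0. (\<forall>j. norm (Ln (sg j * a $ j) + of_real (t * \<psi> j)) \<le> 1) \<longrightarrow>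
      norm (Emon (l - u) m a) \<le> K * Gfac u m a * exp (- (t - t0 + 1) * l1 l)"
      using Emon_bound[OF u, of m] by blast
    have G0: "0 \<le> Gfac u m y" for y by (simp add: Gfac_def prod_nonneg)
    show "\<exists>K\<ge>0. \<forall>a\<in>ball a0 r. \<forall>l\<in>A. norm (Emon (l - u) m a) \<le> K * exp (- l1 l)"
    proof (intro exI[of _ "K * Gfac u m x"] conjI ballI)
      show "0 \<le> K * Gfac u m x" using K(1) G0 by simp
      fix a l assume a: "a \<in> ball a0 r" and l: "l \<in> A"
      have ac: "a \<in> cball a0 r" using a by simp
      with r(2) have "a \<in> dom" by blast
      then obtain t where t: "t > t0" "\<forall>j. norm (Ln (sg j * a $ j) + of_real (t * \<psi> j)) < 1" and sl: "a \<in> slit"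
        unfolding dom_def by blast
      have t': "0 \<le> t" "\<forall>j. norm (Ln (sg j * a $ j) + of_real (t * \<psi> j)) \<le> 1"
        using t t0_nonneg by (auto intro: less_imp_le)
      have "norm (Emon (l - u) m a) \<le> K * Gfac u m a * exp (- (t - t0 + 1) * l1 l)"
        using K(2) l sl t' by blast
      also have "\<dots> \<le> K * Gfac u m x * exp (- l1 l)"
      proof (intro mult_mono mult_left_mono)
        show "Gfac u m a \<le> Gfac u m x" using x ac by blast
        have "1 * l1 l \<le> (t - t0 + 1) * l1 l" using t(1) l1_nonneg[of l] by (intro mult_right_mono) auto
        then show "exp (- (t - t0 + 1) * l1 l) \<le> exp (- l1 l)"
          unfolding exp_le_cancel_iff mult_minus_left by linarith
      qed (use K(1) G0 in auto)
      finally show "norm (Emon (l - u) m a) \<le> K * Gfac u m x * exp (- l1 l)" .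
    qed
  qed
qed

text \<open>The value of the functional on a summand.  Monomials of higher degree are omitted because they
  lie in the ideal.\<close>

definition tau :: "(('n \<Rightarrow>\<^sub>0 nat) \<Rightarrow> complex) \<Rightarrow> int^'n \<Rightarrow> complex^'n \<Rightarrow> complex" where
  "tau \<Lambda> k a = (\<Sum>m\<in>D. \<Lambda> m * Emon k m a)"

text \<open>Each partial derivative lowers all exponents by a unit vector, so the derivative of order \<open>u\<close> of
  \<open>Ssum \<Lambda> 0\<close> is \<open>Ssum \<Lambda> u\<close>.\<close>

definition Ssum :: "(('n \<Rightarrow>\<^sub>0 nat) \<Rightarrow> complex) \<Rightarrow> int^'n \<Rightarrow> complex^'n \<Rightarrow> complex" where
  "Ssum \<Lambda> u a = (\<Sum>\<^sub>\<infinity>l\<in>A. tau \<Lambda> (l - u) a)"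

lemma exp_l1_summable: "(\<lambda>l. K * exp (- l1 l)) summable_on A"
proof -
  have "(\<lambda>l. exp (- l1 l)) summable_on UNIV"
    using summable_on_exp_l1[of 1, where 'n = 'n] unfolding l1_def by simp
  then have "(\<lambda>l. exp (- l1 l)) summable_on A" by (rule summable_on_subset_banach) simp
  then show ?thesis by (rule summable_on_cmult_right)
qed

lemma summable_if_bounded:
  fixes f :: "int^'n \<Rightarrow> complex"
  assumes "\<And>l. l \<in> A \<Longrightarrow> norm (f l) \<le> K * exp (- l1 l)"
  shows "f summable_on A"
  by (rule abs_summable_summable, rule summable_on_comparison_test[OF exp_l1_summable]) (use assms in auto)

lemma Emon_summable:
  assumes "a \<in> dom" "\<forall>j. 0 \<le> u $ j"
  shows "(\<lambda>l. Emon (l - u) m a) summable_on A"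
proof -
  from Emon_local_bound[OF assms(1)] obtain r where r: "r > 0 \<and> ball a r \<subseteq> dom \<and> (\<forall>u m. (\<forall>j. 0 \<le> u $ j) \<longrightarrow>
    (\<exists>K\<ge>0. \<forall>a\<in>ball a r. \<forall>l\<in>A. norm (Emon (l - u) m a) \<le> K * exp (- l1 l)))" ..
  from mp[OF spec[OF spec[OF conjunct2[OF conjunct2[OF r]]]] assms(2)]
  obtain K where K: "K \<ge> 0 \<and> (\<forall>x\<in>ball a r. \<forall>l\<in>A. norm (Emon (l - u) m x) \<le> K * exp (- l1 l))" ..
  show ?thesis by (rule summable_if_bounded[of _ K]) (use K r in simp)
qed

lemma tau_local_bound:
  assumes "a0 \<in> dom"
  shows "\<exists>r>0. ball a0 r \<subseteq> dom \<and> (\<forall>u. (\<forall>j. 0 \<le> u $ j) \<longrightarrow>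
    (\<exists>K\<ge>0. \<forall>a\<in>ball a0 r. \<forall>l\<in>A. norm (tau \<Lambda> (l - u) a) \<le> K * exp (- l1 l)))"
proof -
  from Emon_local_bound[OF assms] obtain r where r': "r > 0 \<and> ball a0 r \<subseteq> dom \<and> (\<forall>u m. (\<forall>j. 0 \<le> u $ j) \<longrightarrow>
    (\<exists>K\<ge>0. \<forall>a\<in>ball a0 r. \<forall>l\<in>A. norm (Emon (l - u) m a) \<le> K * exp (- l1 l)))" ..
  note r = conjunct1[OF r'] conjunct1[OF conjunct2[OF r']] conjunct2[OF conjunct2[OF r']]
  show ?thesis
  proof (rule exI[of _ r], intro conjI allI impI r(1,2))
    fix u :: "int^'n" assume u: "\<forall>j. 0 \<le> u $ j"
    have "\<forall>m. \<exists>K. K \<ge> 0 \<and> (\<forall>a\<in>ball a0 r. \<forall>l\<in>A. norm (Emon (l - u) m a) \<le> K * exp (- l1 l))"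
      using mp[OF spec[OF spec[OF r(3)]] u] by (intro allI)
    from choice[OF this] obtain K where K: "\<forall>m. K m \<ge> 0 \<and> (\<forall>a\<in>ball a0 r. \<forall>l\<in>A. norm (Emon (l - u) m a) \<le> K m * exp (- l1 l))" ..
    show "\<exists>K\<ge>0. \<forall>a\<in>ball a0 r. \<forall>l\<in>A. norm (tau \<Lambda> (l - u) a) \<le> K * exp (- l1 l)"
    proof (intro exI[of _ "\<Sum>m\<in>D. norm (\<Lambda> m) * K m"] conjI ballI)
      show "0 \<le> (\<Sum>m\<in>D. norm (\<Lambda> m) * K m)" using K by (intro sum_nonneg mult_nonneg_nonneg) auto
      fix a l assume a: "a \<in> ball a0 r" and l: "l \<in> A"
      have "norm (tau \<Lambda> (l - u) a) \<le> (\<Sum>m\<in>D. norm (\<Lambda> m) * K m * exp (- l1 l))"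
        unfolding tau_def
      proof (rule sum_norm_le)
        fix m
        have "norm (Emon (l - u) m a) \<le> K m * exp (- l1 l)" using K a l by blast
        then show "norm (\<Lambda> m * Emon (l - u) m a) \<le> norm (\<Lambda> m) * K m * exp (- l1 l)"
          unfolding norm_mult mult.assoc by (rule mult_left_mono) simp
      qed
      then show "norm (tau \<Lambda> (l - u) a) \<le> (\<Sum>m\<in>D. norm (\<Lambda> m) * K m) * exp (- l1 l)"
        by (simp only: sum_distrib_right)
    qed
  qed
qed

lemma tau_summable:
  assumes "a \<in> dom" "\<forall>j. 0 \<le> u $ j"
  shows "(\<lambda>l. tau \<Lambda> (l - u) a) summable_on A"
  unfolding tau_def
  by (rule infsum_finite_sum[THEN conjunct2, OF finite_D]) (intro summable_on_cmult_right Emon_summable assms)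

lemma tau_deriv:
  assumes "a \<in> slit" "k $ i0 \<le> 0"
  shows "(tau \<Lambda> k has_derivative (\<lambda>v. \<Sum>j\<in>UNIV. v $ j * tau \<Lambda> (k - axis j 1) a)) (at a)"
proof -
  have "(tau \<Lambda> k has_derivative (\<lambda>v. \<Sum>m\<in>D. \<Lambda> m * (\<Sum>j\<in>UNIV. v $ j * Emon (k - axis j 1) m a))) (at a)"
    unfolding tau_def[abs_def]
    by (rule has_derivative_sum, rule has_derivative_mult_right, rule Emon_deriv[OF assms])
  moreover have "(\<Sum>m\<in>D. \<Lambda> m * (\<Sum>j\<in>UNIV. v $ j * Emon (k - axis j 1) m a))
    = (\<Sum>j\<in>UNIV. v $ j * tau \<Lambda> (k - axis j 1) a)" for v :: "complex^'n"
  proof -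
    have "(\<Sum>m\<in>D. \<Lambda> m * (\<Sum>j\<in>UNIV. v $ j * Emon (k - axis j 1) m a))
      = (\<Sum>m\<in>D. \<Sum>j\<in>UNIV. v $ j * (\<Lambda> m * Emon (k - axis j 1) m a))"
      unfolding sum_distrib_left by (simp only: mult.left_commute)
    also have "\<dots> = (\<Sum>j\<in>UNIV. \<Sum>m\<in>D. v $ j * (\<Lambda> m * Emon (k - axis j 1) m a))" by (rule sum.swap)
    finally show ?thesis unfolding tau_def sum_distrib_left .
  qed
  ultimately show ?thesis by (simp only:)
qed

lemma Ssum_deriv:
  assumes "a0 \<in> dom" and u: "\<forall>j. 0 \<le> u $ j"
  shows "(Ssum \<Lambda> u has_derivative (\<lambda>v. \<Sum>j\<in>UNIV. v $ j * Ssum \<Lambda> (u + axis j 1) a0)) (at a0)"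
proof -
  from tau_local_bound[OF assms(1)] obtain r where r': "r > 0 \<and> ball a0 r \<subseteq> dom \<and> (\<forall>u. (\<forall>j. 0 \<le> u $ j) \<longrightarrow>
    (\<exists>K\<ge>0. \<forall>a\<in>ball a0 r. \<forall>l\<in>A. norm (tau \<Lambda> (l - u) a) \<le> K * exp (- l1 l)))" ..
  note r = conjunct1[OF r'] conjunct1[OF conjunct2[OF r']] conjunct2[OF conjunct2[OF r']]
  have u': "\<forall>i. 0 \<le> (u + axis j 1) $ i" for j using u by (simp add: axis_def)
  from mp[OF spec[OF r(3)] u] obtain K0 where
    K0': "K0 \<ge> 0 \<and> (\<forall>a\<in>ball a0 r. \<forall>l\<in>A. norm (tau \<Lambda> (l - u) a) \<le> K0 * exp (- l1 l))" ..
  note K0 = conjunct1[OF K0'] conjunct2[OF K0']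
  have "\<forall>j. \<exists>K. K \<ge> 0 \<and> (\<forall>a\<in>ball a0 r. \<forall>l\<in>A. norm (tau \<Lambda> (l - (u + axis j 1)) a) \<le> K * exp (- l1 l))"
    using mp[OF spec[OF r(3)] u'] by (intro allI)
  from choice[OF this] obtain K where K: "\<forall>j. K j \<ge> 0 \<and> (\<forall>a\<in>ball a0 r. \<forall>l\<in>A. norm (tau \<Lambda> (l - (u + axis j 1)) a) \<le> K j * exp (- l1 l))" ..
  define M where "M = K0 + (\<Sum>j\<in>UNIV. K j)"
  have KM: "K0 \<le> M" "(\<Sum>j\<in>UNIV. K j) \<le> M" using K0(1) K by (auto simp: M_def intro: sum_nonneg)
  have "(Ssum \<Lambda> u has_derivative (\<lambda>v. \<Sum>\<^sub>\<infinity>l\<in>A. \<Sum>j\<in>UNIV. v $ j * tau \<Lambda> (l - (u + axis j 1)) a0)) (at a0)"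
    unfolding Ssum_def[abs_def]
  proof (rule has_derivative_infsum[where S = "ball a0 r" and M = "\<lambda>l. M * exp (- l1 l)"
        and f' = "\<lambda>l x v. \<Sum>j\<in>UNIV. v $ j * tau \<Lambda> (l - (u + axis j 1)) x"])
    show "open (ball a0 r)" "convex (ball a0 r)" "a0 \<in> ball a0 r" using r(1) by simp_all
    show "(\<lambda>l. M * exp (- l1 l)) summable_on A" by (rule exp_l1_summable)
    fix l x assume l: "l \<in> A" and x: "x \<in> ball a0 r"
    have "x \<in> slit" using x r(2) dom_slit by blast
    moreover have "(l - u) $ i0 \<le> 0" using A_apex[OF l] u[rule_format, of i0] by simp
    ultimately show "(tau \<Lambda> (l - u) has_derivative (\<lambda>v. \<Sum>j\<in>UNIV. v $ j * tau \<Lambda> (l - (u + axis j 1)) x)) (at x)"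
      using tau_deriv[of x "l - u" \<Lambda>] by (simp only: diff_diff_eq)
    have "norm (tau \<Lambda> (l - u) x) \<le> K0 * exp (- l1 l)" using K0(2) x l by blast
    also have "\<dots> \<le> M * exp (- l1 l)" using KM(1) by (intro mult_right_mono) auto
    finally show "norm (tau \<Lambda> (l - u) x) \<le> M * exp (- l1 l)" .
    fix v :: "complex^'n"
    have "norm (\<Sum>j\<in>UNIV. v $ j * tau \<Lambda> (l - (u + axis j 1)) x) \<le> (\<Sum>j\<in>UNIV. norm v * (K j * exp (- l1 l)))"
    proof (rule sum_norm_le)
      fix j
      have "norm (tau \<Lambda> (l - (u + axis j 1)) x) \<le> K j * exp (- l1 l)" using K x l by blast
      then show "norm (v $ j * tau \<Lambda> (l - (u + axis j 1)) x) \<le> norm v * (K j * exp (- l1 l))"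
        unfolding norm_mult by (intro mult_mono Finite_Cartesian_Product.norm_nth_le) auto
    qed
    also have "\<dots> = (\<Sum>j\<in>UNIV. K j) * exp (- l1 l) * norm v"
      unfolding sum_distrib_right by (simp only: mult_ac)
    also have "\<dots> \<le> M * exp (- l1 l) * norm v"
      using KM(2) by (intro mult_right_mono) auto
    finally show "norm (\<Sum>j\<in>UNIV. v $ j * tau \<Lambda> (l - (u + axis j 1)) x) \<le> M * exp (- l1 l) * norm v" .
  qed
  moreover have "(\<Sum>\<^sub>\<infinity>l\<in>A. \<Sum>j\<in>UNIV. v $ j * tau \<Lambda> (l - (u + axis j 1)) a0) = (\<Sum>j\<in>UNIV. v $ j * Ssum \<Lambda> (u + axis j 1) a0)" for v :: "complex^'n"
  proof -
    have "(\<Sum>\<^sub>\<infinity>l\<in>A. \<Sum>j\<in>UNIV. v $ j * tau \<Lambda> (l - (u + axis j 1)) a0) = (\<Sum>j\<in>UNIV. \<Sum>\<^sub>\<infinity>l\<in>A. v $ j * tau \<Lambda> (l - (u + axis j 1)) a0)"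
      by (rule infsum_finite_sum[THEN conjunct1]) (simp, intro summable_on_cmult_right tau_summable assms(1) u')
    then show ?thesis unfolding Ssum_def by (simp only: infsum_cmult_right')
  qed
  ultimately show ?thesis by (simp only:)
qed

lemma Ssum_holomorphic: "\<forall>j. 0 \<le> u $ j \<Longrightarrow> holomorphic_on_several (Ssum \<Lambda> u) dom"
  by (rule holomorphic_on_severalI[where g = "\<lambda>j. Ssum \<Lambda> (u + axis j 1)"]) (rule Ssum_deriv)

lemma Ssum_partial: "a \<in> dom \<Longrightarrow> \<forall>j. 0 \<le> u $ j \<Longrightarrow> partial_deriv j (Ssum \<Lambda> u) a = Ssum \<Lambda> (u + axis j 1) a"
  by (rule partial_deriv_eqI) (rule Ssum_deriv)

lemma Ssum_iterated:
  assumes "a \<in> dom"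
  shows "iterated_partial xs (Ssum \<Lambda> 0) a = Ssum \<Lambda> (\<chi> j. int (count_list xs j)) a"
  using assms
proof (induction xs arbitrary: a)
  case Nil
  have "(\<chi> j. int (count_list [] j)) = (0 :: int^'n)" by (simp add: vec_eq_iff)
  then show ?case by (simp only: iterated_partial_simps)
next
  case (Cons i xs)
  have "iterated_partial (i # xs) (Ssum \<Lambda> 0) a = partial_deriv i (Ssum \<Lambda> (\<chi> j. int (count_list xs j))) a"
    unfolding iterated_partial_simps by (rule partial_deriv_cong[OF open_dom Cons.IH Cons.prems])
  also have "\<dots> = Ssum \<Lambda> ((\<chi> j. int (count_list xs j)) + axis i 1) a"
    by (rule Ssum_partial[OF Cons.prems]) simp
  also have "(\<chi> j. int (count_list xs j)) + axis i 1 = (\<chi> j. int (count_list (i # xs) j))"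
    by (simp add: vec_eq_iff axis_def)
  finally show ?case .
qed

text \<open>The reciprocal Gamma factor of a negative exponent vanishes at \<open>0\<close> and is divisible by its variable, so the whole
  summand is divisible by a non-face monomial.\<close>

lemma tau_vanish:
  assumes "annihilator \<Lambda>" "{j. j \<noteq> i0 \<and> k $ j < 0} \<in> N"
  shows "tau \<Lambda> k a = 0"
  unfolding tau_def
proof (rule sum.neutral, rule ballI)
  fix m
  let ?S = "{j. j \<noteq> i0 \<and> k $ j < 0}"
  show "\<Lambda> m * Emon k m a = 0"
  proof (cases "\<forall>j\<in>?S. Poly_Mapping.lookup m j \<noteq> 0")
    case True
    have "(m - ind ?S) + ind ?S = m"
      by (rule poly_mapping_eqI) (use True in \<open>auto simp: lookup_add lookup_minus\<close>)
    moreover have "\<Lambda> ((m - ind ?S) + ind ?S) = 0"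
      using assms unfolding annihilator_def by blast
    ultimately show ?thesis by simp
  next
    case False
    then obtain j where j: "j \<noteq> i0" "k $ j < 0" "Poly_Mapping.lookup m j = 0" by blast
    have "coord j (k $ j) (Poly_Mapping.lookup m j) (a $ j) = 0"
      unfolding j(3) by (rule coord_vanish[OF j(1,2)])
    then have "Emon k m a = 0" unfolding Emon_def by (intro prod_zero) auto
    then show ?thesis by simp
  qed
qed

text \<open>Up to terms that vanish, the range of summation may be replaced by the set of relations \<open>l\<close> for
  which the negative entries of \<open>l - u\<close> off the apex sit on a face.  In this form the sum only depends on the
  class of \<open>u\<close> modulo relations.\<close>

lemma Ssum_box:
  assumes ann: "annihilator \<Lambda>" and l': "u - v \<in> relation_lattice \<mu>" and u: "\<forall>j. 0 \<le> u $ j" and v: "\<forall>j. 0 \<le> v $ j"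
  shows "Ssum \<Lambda> u a = Ssum \<Lambda> v a"
proof -
  define T where "T w = {l \<in> relation_lattice \<mu>. {j. j \<noteq> i0 \<and> (l - w) $ j < 0} \<notin> N}" for w
  have T: "Ssum \<Lambda> w a = (\<Sum>\<^sub>\<infinity>l\<in>T w. tau \<Lambda> (l - w) a)" if w: "\<forall>j. 0 \<le> w $ j" for w
    unfolding Ssum_def
  proof (rule infsum_cong_neutral)
    have "T w \<subseteq> A"
    proof
      fix l assume l: "l \<in> T w"
      have "{j. j \<noteq> i0 \<and> l $ j < 0} \<subseteq> {j. j \<noteq> i0 \<and> (l - w) $ j < 0}"
      proof
        fix j assume "j \<in> {j. j \<noteq> i0 \<and> l $ j < 0}"
        then show "j \<in> {j. j \<noteq> i0 \<and> (l - w) $ j < 0}" using w[rule_format, of j] by simp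
      qed
      then show "l \<in> A" using l unfolding T_def by (intro A_face[of l "{j. j \<noteq> i0 \<and> (l - w) $ j < 0}"]) auto
    qed
    then show "tau \<Lambda> (l - w) a = 0" if "l \<in> T w - A" for l using that by blast
    fix l assume l: "l \<in> A - T w"
    then have "l \<in> relation_lattice \<mu>" using A_relations by blast
    with l have "{j. j \<noteq> i0 \<and> (l - w) $ j < 0} \<in> N" unfolding T_def by blast
    then show "tau \<Lambda> (l - w) a = 0" by (rule tau_vanish[OF ann])
  qed simp
  have rel_diff: "l - l' \<in> relation_lattice \<mu>" "l + l' \<in> relation_lattice \<mu>"
    if "l \<in> relation_lattice \<mu>" "l' \<in> relation_lattice \<mu>" for l l'
    using that unfolding relation_lattice_iff
    by (simp_all add: sum_subtractf sum.distrib scaleR_left_diff_distrib scaleR_left_distrib)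
  have "bij_betw (\<lambda>l. l - (u - v)) (T u) (T v)"
  proof (rule bij_betw_byWitness[where f' = "\<lambda>l. l + (u - v)"])
    show "(\<lambda>l. l - (u - v)) ` T u \<subseteq> T v"
    proof (rule image_subsetI)
      fix l assume "l \<in> T u"
      moreover have "l - (u - v) - v = l - u" by simp
      ultimately show "l - (u - v) \<in> T v" using rel_diff(1)[OF _ l'] unfolding T_def by simp
    qed
    show "(\<lambda>l. l + (u - v)) ` T v \<subseteq> T u"
    proof (rule image_subsetI)
      fix l assume "l \<in> T v"
      moreover have "l + (u - v) - u = l - v" by simp
      ultimately show "l + (u - v) \<in> T u" using rel_diff(2)[OF _ l'] unfolding T_def by simp
    qed
  qed simp_all
  from infsum_reindex_bij_betw[OF this, of "\<lambda>l. tau \<Lambda> (l - v) a"]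
  have "(\<Sum>\<^sub>\<infinity>l\<in>T u. tau \<Lambda> (l - (u - v) - v) a) = (\<Sum>\<^sub>\<infinity>l\<in>T v. tau \<Lambda> (l - v) a)" .
  then show ?thesis unfolding T[OF u] T[OF v] by simp
qed

end

lemma poly_tendsto_0_imp_0:
  fixes p :: "complex poly"
  assumes "((\<lambda>t. poly p (of_real t)) \<longlongrightarrow> 0) at_top"
  shows "p = 0"
proof (cases p)
  case (pCons a q)
  show ?thesis
  proof (cases "q = 0")
    case True
    then have "((\<lambda>t::real. a) \<longlongrightarrow> 0) at_top" using assms pCons by simp
    then have "a = 0" by (simp add: tendsto_const_iff)
    then show ?thesis using True pCons by simp
  next
    case False
    obtain r where r: "\<forall>z. r \<le> norm z \<longrightarrow> 1 \<le> norm (poly (pCons a q) z)"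
      using poly_infinity[OF False, of 1 a] by blast
    have "\<forall>\<^sub>F t in at_top. norm (poly p (of_real t)) < 1"
      using tendstoD[OF assms, of 1] by simp
    moreover have "\<forall>\<^sub>F t in at_top. t \<ge> max r 0" by (rule eventually_ge_at_top)
    ultimately have "\<forall>\<^sub>F t :: real in at_top. False"
    proof eventually_elim
      case (elim t)
      then have "r \<le> norm (complex_of_real t)" by simp
      with r elim(1) pCons show ?case by fastforce
    qed
    then show ?thesis by simp
  qed
qed

context toric_data begin

lemma Emon_remove:
  "Emon k m a = coord i (k $ i) (Poly_Mapping.lookup m i) (a $ i) * (\<Prod>j\<in>UNIV - {i}. coord j (k $ j) (Poly_Mapping.lookup m j) (a $ j))"
  unfolding Emon_def by (rule prod.remove) simp_all

lemma Emon_euler: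
  assumes "a \<in> slit" "l $ i0 \<le> 0"
  shows "a $ i * Emon (l - axis i 1) m a = of_int (l $ i - ep i) * Emon l m a
    + (if Poly_Mapping.lookup m i = 0 then 0 else Emon l (m - Poly_Mapping.single i 1) a)"
proof -
  define R where "R = (\<Prod>j\<in>UNIV - {i}. coord j (l $ j) (Poly_Mapping.lookup m j) (a $ j))"
  have 1: "Emon (l - axis i 1) m a = coord i (l $ i - 1) (Poly_Mapping.lookup m i) (a $ i) * R"
  proof -
    have P: "(\<Prod>j\<in>UNIV - {i}. coord j ((l - axis i 1) $ j) (Poly_Mapping.lookup m j) (a $ j)) = R"
      unfolding R_def by (rule prod.cong) (simp_all add: axis_def)
    show ?thesis unfolding Emon_remove[of "l - axis i 1" m a i] P by (simp add: axis_def)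
  qed
  have 2: "Emon l m a = coord i (l $ i) (Poly_Mapping.lookup m i) (a $ i) * R"
    unfolding R_def by (rule Emon_remove)
  have 3: "Emon l (m - Poly_Mapping.single i 1) a = coord i (l $ i) (Poly_Mapping.lookup m i - 1) (a $ i) * R"
  proof -
    have P: "(\<Prod>j\<in>UNIV - {i}. coord j (l $ j) (Poly_Mapping.lookup (m - Poly_Mapping.single i 1) j) (a $ j)) = R"
      unfolding R_def by (rule prod.cong) (simp_all add: lookup_minus lookup_single when_def)
    show ?thesis unfolding Emon_remove[of l "m - Poly_Mapping.single i 1" a i] P by (simp add: lookup_minus lookup_single when_def)
  qed
  have c: "a $ i * coord i (l $ i - 1) (Poly_Mapping.lookup m i) (a $ i) = of_int (l $ i - ep i) * coord i (l $ i) (Poly_Mapping.lookup m i) (a $ i)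
     + (if Poly_Mapping.lookup m i = 0 then 0 else coord i (l $ i) (Poly_Mapping.lookup m i - 1) (a $ i))"
    by (rule coord_euler) (use assms slit_nz in auto)
  have "a $ i * Emon (l - axis i 1) m a = (a $ i * coord i (l $ i - 1) (Poly_Mapping.lookup m i) (a $ i)) * R"
    unfolding 1 by (simp only: mult.assoc)
  also have "\<dots> = of_int (l $ i - ep i) * Emon l m a + (if Poly_Mapping.lookup m i = 0 then 0 else Emon l (m - Poly_Mapping.single i 1) a)"
    unfolding c 2 3 by (simp add: distrib_right)
  finally show ?thesis .
qed

lemma D_shift:
  fixes E :: "('n \<Rightarrow>\<^sub>0 nat) \<Rightarrow> complex"
  assumes \<Lambda>: "\<And>m. mon_degree m > CARD('n) \<Longrightarrow> \<Lambda> m = 0"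
  shows "(\<Sum>m\<in>D. \<Lambda> m * (if Poly_Mapping.lookup m i = 0 then 0 else E (m - Poly_Mapping.single i 1)))
    = (\<Sum>m\<in>D. \<Lambda> (m + Poly_Mapping.single i 1) * E m)"
proof -
  define s where "s = Poly_Mapping.single i (1::nat)"
  have shift_back: "(m + s) - s = m" for m :: "'n \<Rightarrow>\<^sub>0 nat"
    by (rule poly_mapping_eqI) (simp add: lookup_add lookup_minus)
  have "(\<Sum>m\<in>D. \<Lambda> (m + s) * E m) = (\<Sum>m\<in>(\<lambda>m. m + s) ` D. \<Lambda> m * E (m - s))"
    by (subst sum.reindex) (auto simp: shift_back intro: inj_onI)
  also have "\<dots> = (\<Sum>m\<in>D. \<Lambda> m * (if Poly_Mapping.lookup m i = 0 then 0 else E (m - s)))"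
  proof (rule sum.mono_neutral_cong)
    show "finite D" "finite ((\<lambda>m. m + s) ` D)" using finite_D by auto
    fix m
    { assume m: "m \<in> D - (\<lambda>m. m + s) ` D"
      have "Poly_Mapping.lookup m i = 0"
      proof (rule ccontr)
        assume nz: "Poly_Mapping.lookup m i \<noteq> 0"
        have e: "m = (m - s) + s"
          by (rule poly_mapping_eqI) (use nz in \<open>auto simp: lookup_add lookup_minus lookup_single when_def s_def\<close>)
        then have "mon_degree m = mon_degree (m - s) + 1" by (metis mon_degree_add mon_degree_single s_def)
        then have "m - s \<in> D" using m by simp
        with e have "m \<in> (\<lambda>m. m + s) ` D" by (rule image_eqI)
        with m show False by blast
      qed
      then show "\<Lambda> m * (if Poly_Mapping.lookup m i = 0 then 0 else E (m - s)) = 0" by simp }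
    { assume "m \<in> (\<lambda>m. m + s) ` D - D"
      then show "\<Lambda> m * E (m - s) = 0" using \<Lambda>[of m] by auto }
    { assume "m \<in> (\<lambda>m. m + s) ` D \<inter> D"
      then have "Poly_Mapping.lookup m i \<noteq> 0" by (auto simp: lookup_add s_def)
      then show "\<Lambda> m * E (m - s) = \<Lambda> m * (if Poly_Mapping.lookup m i = 0 then 0 else E (m - s))" by simp }
  qed
  finally show ?thesis unfolding s_def ..
qed

text \<open>On a summand the operator \<open>a\<^sub>j \<partial>\<^sub>j\<close> multiplies by the exponent plus the variable with index \<open>j\<close>.
  The exponents cancel in the weighted sum over a relation, except for the shift by \<open>1\<close> at the apex,
  which is the parameter of the system; the variables form a linear generator, which the functional
  kills.\<close>

lemma tau_euler:
  assumes ann: "annihilator \<Lambda>" and l: "l \<in> relation_lattice \<mu>" "l $ i0 \<le> 0" and a: "a \<in> slit" and e: "e \<in> Basis"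
  shows "(\<Sum>i\<in>UNIV. of_real ((1::real, \<mu> i) \<bullet> e) * (a $ i * tau \<Lambda> (l - axis i 1) a))
    = of_real ((-1::real, 0::'a) \<bullet> e) * tau \<Lambda> l a"
proof -
  define c :: "'n \<Rightarrow> complex" where "c i = of_real ((1::real, \<mu> i) \<bullet> e)" for i
  have each: "a $ i * tau \<Lambda> (l - axis i 1) a = of_int (l $ i - ep i) * tau \<Lambda> l a
     + (\<Sum>m\<in>D. \<Lambda> (m + Poly_Mapping.single i 1) * Emon l m a)" for i
  proof -
    have "a $ i * tau \<Lambda> (l - axis i 1) a = (\<Sum>m\<in>D. \<Lambda> m * (a $ i * Emon (l - axis i 1) m a))"
      unfolding tau_def sum_distrib_left by (simp only: mult.left_commute)
    also have "\<dots> = (\<Sum>m\<in>D. of_int (l $ i - ep i) * (\<Lambda> m * Emon l m a)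
        + \<Lambda> m * (if Poly_Mapping.lookup m i = 0 then 0 else Emon l (m - Poly_Mapping.single i 1) a))"
      unfolding Emon_euler[OF a l(2)] distrib_left by (simp only: mult.left_commute)
    also have "\<dots> = of_int (l $ i - ep i) * tau \<Lambda> l a + (\<Sum>m\<in>D. \<Lambda> (m + Poly_Mapping.single i 1) * Emon l m a)"
    proof -
      have sh: "(\<Sum>m\<in>D. \<Lambda> m * (if Poly_Mapping.lookup m i = 0 then 0 else Emon l (m - Poly_Mapping.single i 1) a))
        = (\<Sum>m\<in>D. \<Lambda> (m + Poly_Mapping.single i 1) * Emon l m a)"
        by (rule D_shift) (rule annihilator_degree[OF ann])
      show ?thesis unfolding sum.distrib tau_def sum_distrib_left sh ..
    qed
    finally show ?thesis .
  qed
  have c1: "(\<Sum>i\<in>UNIV. c i * of_int (l $ i)) = 0"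
  proof -
    have "(\<Sum>i\<in>UNIV. c i * of_int (l $ i)) = of_real ((\<Sum>i\<in>UNIV. of_int (l $ i) *\<^sub>R (1::real, \<mu> i)) \<bullet> e)"
      unfolding c_def inner_sum_left of_real_sum by (intro sum.cong refl) (simp only: inner_scaleR_left of_real_mult of_real_of_int_eq mult.commute)
    also have "\<dots> = 0" using l(1) unfolding relation_lattice_def mem_Collect_eq by (simp only: inner_zero_left of_real_0)
    finally show ?thesis .
  qed
  have c2: "(\<Sum>i\<in>UNIV. c i * of_int (ep i)) = c i0"
  proof -
    have "(\<Sum>i\<in>UNIV. c i * of_int (ep i)) = (\<Sum>i\<in>UNIV. if i = i0 then c i0 else 0)"
      by (rule sum.cong) (auto simp: ep_def)
    then show ?thesis by simp
  qed
  have c3: "(\<Sum>i\<in>UNIV. c i * \<Lambda> (m + Poly_Mapping.single i 1)) = 0" for m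
    using ann e unfolding annihilator_def linear_annihilator_def c_def by blast
  have "(\<Sum>i\<in>UNIV. c i * (a $ i * tau \<Lambda> (l - axis i 1) a))
     = (\<Sum>i\<in>UNIV. (c i * of_int (l $ i) - c i * of_int (ep i)) * tau \<Lambda> l a) + (\<Sum>i\<in>UNIV. \<Sum>m\<in>D. Emon l m a * (c i * \<Lambda> (m + Poly_Mapping.single i 1)))"
  proof -
    have "x * ((y - z) * t + (\<Sum>m\<in>D. F m * E m)) = (x * y - x * z) * t + (\<Sum>m\<in>D. E m * (x * F m))"
      for x y z t :: complex and F E :: "('n \<Rightarrow>\<^sub>0 nat) \<Rightarrow> complex"
    proof -
      have 1: "x * ((y - z) * t) = (x * y - x * z) * t" by (simp only: mult.assoc[symmetric] right_diff_distrib)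
      have "x * (F m * E m) = E m * (x * F m)" for m by (simp only: mult.commute mult.left_commute)
      then have "x * (\<Sum>m\<in>D. F m * E m) = (\<Sum>m\<in>D. E m * (x * F m))" by (simp only: sum_distrib_left)
      with 1 show ?thesis by (simp only: distrib_left)
    qed
    then show ?thesis unfolding each of_int_diff sum.distrib[symmetric] by (simp only:)
  qed
  also have "(\<Sum>i\<in>UNIV. (c i * of_int (l $ i) - c i * of_int (ep i)) * tau \<Lambda> l a) = - c i0 * tau \<Lambda> l a"
    unfolding sum_distrib_right[symmetric] sum_subtractf c1 c2 by simp
  also have "(\<Sum>i\<in>UNIV. \<Sum>m\<in>D. Emon l m a * (c i * \<Lambda> (m + Poly_Mapping.single i 1))) = 0"
    by (subst sum.swap) (simp only: sum_distrib_left[symmetric] c3 mult_zero_right sum.neutral_const)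
  also have "- c i0 = of_real ((-1::real, 0::'a) \<bullet> e)"
    unfolding c_def apex by (simp add: inner_prod_def)
  finally show ?thesis unfolding c_def by simp
qed

lemma gkz_solution_Ssum:
  assumes ann: "annihilator \<Lambda>"
  shows "gkz_solution \<mu> (-1, 0) dom (Ssum \<Lambda> 0)"
  unfolding gkz_solution_def
proof (intro conjI ballI allI impI)
  show "holomorphic_on_several (Ssum \<Lambda> 0) dom" by (rule Ssum_holomorphic) simp
next
  fix a and e :: "real \<times> 'a" assume a: "a \<in> dom" and e: "e \<in> Basis"
  have ax: "\<forall>j. 0 \<le> (axis i 1 :: int^'n) $ j" for i by (simp add: axis_def)
  have pd: "partial_deriv i (Ssum \<Lambda> 0) a = (\<Sum>\<^sub>\<infinity>l\<in>A. tau \<Lambda> (l - axis i 1) a)" for i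
    using Ssum_partial[OF a, of 0 i \<Lambda>] unfolding Ssum_def by simp
  have "(\<Sum>i\<in>UNIV. of_real ((1::real, \<mu> i) \<bullet> e) * a $ i * partial_deriv i (Ssum \<Lambda> 0) a)
      = (\<Sum>i\<in>UNIV. \<Sum>\<^sub>\<infinity>l\<in>A. of_real ((1::real, \<mu> i) \<bullet> e) * (a $ i * tau \<Lambda> (l - axis i 1) a))"
    unfolding pd by (simp only: infsum_cmult_right' mult.assoc)
  also have "\<dots> = (\<Sum>\<^sub>\<infinity>l\<in>A. \<Sum>i\<in>UNIV. of_real ((1::real, \<mu> i) \<bullet> e) * (a $ i * tau \<Lambda> (l - axis i 1) a))"
    by (rule infsum_finite_sum[THEN conjunct1, symmetric]) (simp, intro summable_on_cmult_right tau_summable a ax)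
  also have "\<dots> = (\<Sum>\<^sub>\<infinity>l\<in>A. of_real ((-1::real, 0::'a) \<bullet> e) * tau \<Lambda> l a)"
  proof (rule infsum_cong)
    fix l assume "l \<in> A"
    then show "(\<Sum>i\<in>UNIV. of_real ((1::real, \<mu> i) \<bullet> e) * (a $ i * tau \<Lambda> (l - axis i 1) a)) = of_real ((-1::real, 0::'a) \<bullet> e) * tau \<Lambda> l a"
      using A_relations A_apex by (intro tau_euler[OF ann _ _ dom_slit[OF a] e]) auto
  qed
  also have "\<dots> = of_real ((-1::real, 0::'a) \<bullet> e) * Ssum \<Lambda> 0 a"
    unfolding Ssum_def by (simp only: infsum_cmult_right' diff_0_right)
  finally show "(\<Sum>i\<in>UNIV. of_real ((1::real, \<mu> i) \<bullet> e) * a $ i * partial_deriv i (Ssum \<Lambda> 0) a)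
      - of_real ((-1, 0) \<bullet> e) * Ssum \<Lambda> 0 a = 0" by simp
next
  fix l xs ys a assume l: "l \<in> relation_lattice \<mu>" and a: "a \<in> dom"
    and c: "(\<forall>i. count_list xs i = nat (l $ i)) \<and> (\<forall>i. count_list ys i = nat (- (l $ i)))"
  have "(\<chi> j. int (count_list xs j)) - (\<chi> j. int (count_list ys j)) = l"
    using c by (simp add: vec_eq_iff)
  then have "(\<chi> j. int (count_list xs j)) - (\<chi> j. int (count_list ys j)) \<in> relation_lattice \<mu>" using l by (simp only:)
  then show "iterated_partial xs (Ssum \<Lambda> 0) a = iterated_partial ys (Ssum \<Lambda> 0) a"
    unfolding Ssum_iterated[OF a] by (rule Ssum_box[OF ann]) simp_all
qed

lemma B_term_summable:
  assumes "a \<in> dom"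
  shows "B_term i0 (negate_coord i0 a) m summable_on A"
proof -
  have nz: "negate_coord i0 a $ i0 \<noteq> 0"
    unfolding negate_coord_nth by (rule slit_nz[OF dom_slit[OF assms]])
  have "(\<lambda>l. Emon (l - 0) m a) summable_on A" by (rule Emon_summable[OF assms]) simp
  then have "(\<lambda>l. negate_coord i0 a $ i0 * Emon (l - 0) m a) summable_on A"
    by (rule summable_on_cmult_right)
  moreover have "negate_coord i0 a $ i0 * Emon (l - 0) m a = B_term i0 (negate_coord i0 a) m l" if "l \<in> A" for l
    using Emon_B_term[OF dom_slit[OF assms] A_apex[OF that], of m] nz by (simp add: field_simps)
  ultimately show ?thesis by (simp cong: summable_on_cong)
qed

lemma Ssum_B_series:
  assumes "a \<in> dom"
  shows "Ssum \<Lambda> 0 a = (\<Sum>m\<in>D. \<Lambda> m * (1 / (negate_coord i0 a $ i0) * (\<Sum>\<^sub>\<infinity>l\<in>A. B_term i0 (negate_coord i0 a) m l)))"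
proof -
  have "Ssum \<Lambda> 0 a = (\<Sum>\<^sub>\<infinity>l\<in>A. \<Sum>m\<in>D. \<Lambda> m * Emon (l - 0) m a)"
    unfolding Ssum_def tau_def ..
  also have "\<dots> = (\<Sum>m\<in>D. \<Sum>\<^sub>\<infinity>l\<in>A. \<Lambda> m * Emon (l - 0) m a)"
    by (rule infsum_finite_sum[THEN conjunct1, OF finite_D])
       (intro summable_on_cmult_right Emon_summable[OF assms], simp)
  also have "\<dots> = (\<Sum>m\<in>D. \<Lambda> m * (1 / (negate_coord i0 a $ i0) * (\<Sum>\<^sub>\<infinity>l\<in>A. B_term i0 (negate_coord i0 a) m l)))"
  proof (rule sum.cong[OF refl])
    fix m
    have "(\<Sum>\<^sub>\<infinity>l\<in>A. Emon (l - 0) m a) = (\<Sum>\<^sub>\<infinity>l\<in>A. 1 / (negate_coord i0 a $ i0) * B_term i0 (negate_coord i0 a) m l)"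
      by (rule infsum_cong) (simp only: diff_0_right Emon_B_term[OF dom_slit[OF assms] A_apex])
    then show "(\<Sum>\<^sub>\<infinity>l\<in>A. \<Lambda> m * Emon (l - 0) m a) = \<Lambda> m * (1 / (negate_coord i0 a $ i0) * (\<Sum>\<^sub>\<infinity>l\<in>A. B_term i0 (negate_coord i0 a) m l))"
      by (simp only: infsum_cmult_right')
  qed
  finally show ?thesis .
qed

section \<open>Linear independence of the series\<close>

text \<open>The summand of the zero relation without the factor \<open>1 / a\<^sub>0\<close>, in logarithmic coordinates.\<close>

definition lead :: "('n \<Rightarrow>\<^sub>0 nat) \<Rightarrow> ('n \<Rightarrow> complex) \<Rightarrow> complex" where
  "lead m w = (\<Prod>j\<in>UNIV. fps_nth (coord_fps j 0 * fps_exp (w j)) (Poly_Mapping.lookup m j))"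

lemma lead_Emon:
  assumes "a \<in> slit"
  shows "sg i0 * a $ i0 * Emon 0 m a = lead m (\<lambda>j. Ln (sg j * a $ j))"
proof -
  have c: "coord j 0 n (a $ j) = (if j = i0 then 1 / (sg i0 * a $ i0) else 1) * fps_nth (coord_fps j 0 * fps_exp (Ln (sg j * a $ j))) n" for j n
    unfolding coord_def ep_def by (cases "j = i0") (simp_all add: power_int_minus inverse_eq_divide)
  have "Emon 0 m a = (\<Prod>j\<in>UNIV. if j = i0 then 1 / (sg i0 * a $ i0) else 1) * lead m (\<lambda>j. Ln (sg j * a $ j))"
    unfolding Emon_def lead_def zero_index c prod.distrib ..
  also have "(\<Prod>j\<in>UNIV. if j = i0 then 1 / (sg i0 * a $ i0) else 1) = 1 / (sg i0 * a $ i0)" by simp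
  finally show ?thesis using slit_nz[OF assms, of i0] by simp
qed

lemma lead_polynomial:
  "\<exists>P. \<forall>t. poly P (of_real t) = (\<Sum>m\<in>D. \<Lambda> m * lead m (\<lambda>j. w j - of_real (t * \<psi> j)))"
proof (intro exI allI)
  fix t
  let ?Q = "\<lambda>m j. \<Sum>i\<le>Poly_Mapping.lookup m j. smult (fps_nth (coord_fps j 0) i / fact (Poly_Mapping.lookup m j - i)) ([:w j, - of_real (\<psi> j):] ^ (Poly_Mapping.lookup m j - i))"
  have Q: "poly (?Q m j) (of_real t) = fps_nth (coord_fps j 0 * fps_exp (w j - of_real (t * \<psi> j))) (Poly_Mapping.lookup m j)" for m j
  proof -
    have e: "poly [:w j, - of_real (\<psi> j):] (of_real t) = w j - of_real (t * \<psi> j)" by simp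
    show ?thesis unfolding fps_mult_nth atLeast0AtMost fps_nth_exp poly_sum poly_smult poly_power e by simp
  qed
  show "poly (\<Sum>m\<in>D. smult (\<Lambda> m) (\<Prod>j\<in>UNIV. ?Q m j)) (of_real t) = (\<Sum>m\<in>D. \<Lambda> m * lead m (\<lambda>j. w j - of_real (t * \<psi> j)))"
    unfolding poly_sum[of _ D] poly_smult[of "\<Lambda> _"] poly_prod Q lead_def ..
qed

lemma l1_ge_1:
  assumes "l \<noteq> 0"
  shows "1 \<le> l1 l"
proof -
  obtain j where "l $ j \<noteq> 0" using assms by (auto simp: vec_eq_iff)
  then have "1 \<le> \<bar>real_of_int (l $ j)\<bar>" by linarith
  also have "\<dots> \<le> l1 l" unfolding l1_def by (rule member_le_sum) auto
  finally show ?thesis .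
qed

text \<open>If the series vanishes, its leading term equals the negative of the remaining ones, which decay
  exponentially along the domain since \<open>l1 l \<ge> 1\<close> for \<open>l \<noteq> 0\<close>.\<close>

lemma lead_tendsto_0:
  assumes zero: "\<And>a. a \<in> dom \<Longrightarrow> Ssum \<Lambda> 0 a = 0" and w: "\<And>j. norm (w $ j) < 1"
  shows "((\<lambda>t. \<Sum>m\<in>D. \<Lambda> m * lead m (\<lambda>j. w $ j - of_real (t * \<psi> j))) \<longlongrightarrow> 0) at_top"
proof -
  define R where "R t = (\<Sum>m\<in>D. \<Lambda> m * lead m (\<lambda>j. w $ j - of_real (t * \<psi> j)))" for t
  define c where "c = 2 + (\<Sum>j\<in>UNIV. \<bar>\<psi> j\<bar>)"
  have c2: "2 \<le> c" by (simp add: c_def sum_nonneg)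
  define n where "n = CARD('n)"
  define S where "S = (\<Sum>\<^sub>\<infinity>l\<in>A - {0}. exp (- l1 l))"
  have sumE: "(\<lambda>l. exp (- l1 l)) summable_on A - {0}"
    by (rule summable_on_subset_banach[of _ A]) (use exp_l1_summable[of 1] in auto)
  have u0: "\<forall>j. 0 \<le> (0 :: int^'n) $ j" by simp
  have "\<forall>m. \<exists>K. K \<ge> 0 \<and> (\<forall>l\<in>A. \<forall>a\<in>slit. \<forall>t\<ge>0. (\<forall>j. norm (Ln (sg j * a $ j) + of_real (t * \<psi> j)) \<le> 1) \<longrightarrow>
    norm (Emon (l - 0) m a) \<le> K * Gfac 0 m a * exp (- (t - t0 + 1) * l1 l))"
    by (intro allI) (rule Emon_bound[OF u0])
  from choice[OF this] obtain K where K': "\<forall>m. K m \<ge> 0 \<and> (\<forall>l\<in>A. \<forall>a\<in>slit. \<forall>t\<ge>0. (\<forall>j. norm (Ln (sg j * a $ j) + of_real (t * \<psi> j)) \<le> 1) \<longrightarrow>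
    norm (Emon (l - 0) m a) \<le> K m * Gfac 0 m a * exp (- (t - t0 + 1) * l1 l))" ..
  have K0: "K m \<ge> 0" for m using K' by simp
  have K: "norm (Emon l m a) \<le> K m * Gfac 0 m a * exp (- (t - t0 + 1) * l1 l)"
    if "l \<in> A" "a \<in> slit" "t \<ge> 0" "\<forall>j. norm (Ln (sg j * a $ j) + of_real (t * \<psi> j)) \<le> 1" for l a t m
    using K' that by simp
  define H where "H = (\<Sum>m\<in>D. norm (\<Lambda> m) * K m)"
  have H0: "0 \<le> H" unfolding H_def using K0 by (intro sum_nonneg mult_nonneg_nonneg) auto
  have bound: "norm (R t) \<le> H * (c * (1 + t)) ^ n * exp (- (t - t0)) * S" if t: "t > t0" for t
  proof -
    define a where "a = param (t, w)"
    have t': "0 \<le> t" using t t0_nonneg by linarith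
    have a: "a \<in> dom" unfolding a_def dom_eq_param using t w by (intro imageI) auto
    have Z: "Ln (sg j * a $ j) = w $ j - of_real (t * \<psi> j)" for j
      unfolding a_def by (rule Ln_param(1)[OF w])
    have sl: "a \<in> slit" by (rule dom_slit[OF a])
    define y where "y = sg i0 * a $ i0"
    have yne: "y \<noteq> 0" unfolding y_def by (rule slit_nz[OF sl])
    have ny: "norm y = exp (Re (Ln y))" using yne by (simp flip: norm_exp_eq_Re)
    have G: "norm y * Gfac 0 m a \<le> (c * (1 + t)) ^ n" if m: "m \<in> D" for m
    proof -
      have "Gfac 0 m a = (\<Prod>j\<in>UNIV. (if j = i0 then exp (- Re (Ln y)) else 1) * (1 + norm (w $ j - of_real (t * \<psi> j))) ^ Poly_Mapping.lookup m j)"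
        unfolding Gfac_def by (rule prod.cong) (auto simp: Z ep_def y_def)
      also have "\<dots> = exp (- Re (Ln y)) * (\<Prod>j\<in>UNIV. (1 + norm (w $ j - of_real (t * \<psi> j))) ^ Poly_Mapping.lookup m j)"
        unfolding prod.distrib by simp
      finally have "norm y * Gfac 0 m a = (\<Prod>j\<in>UNIV. (1 + norm (w $ j - of_real (t * \<psi> j))) ^ Poly_Mapping.lookup m j)"
        unfolding ny by (simp add: exp_minus)
      also have "\<dots> \<le> (\<Prod>j\<in>UNIV. (c * (1 + t)) ^ Poly_Mapping.lookup m j)"
      proof (intro prod_mono conjI power_mono)
        fix j
        have "norm (w $ j - of_real (t * \<psi> j)) \<le> norm (w $ j) + norm (of_real (t * \<psi> j) :: complex)" by (rule norm_triangle_ineq4)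
        also have "norm (of_real (t * \<psi> j) :: complex) = t * \<bar>\<psi> j\<bar>" using t' by (simp add: norm_mult)
        also have "t * \<bar>\<psi> j\<bar> \<le> t * (\<Sum>j\<in>UNIV. \<bar>\<psi> j\<bar>)" by (intro mult_left_mono member_le_sum t') auto
        finally have "1 + norm (w $ j - of_real (t * \<psi> j)) \<le> 2 + t * (\<Sum>j\<in>UNIV. \<bar>\<psi> j\<bar>)" using w[of j] by linarith
        also have "\<dots> \<le> c * (1 + t)"
        proof -
          have "0 \<le> (\<Sum>j\<in>UNIV. \<bar>\<psi> j\<bar>)" by (simp add: sum_nonneg)
          then show ?thesis unfolding c_def distrib_left distrib_right using t' by simp
        qed
        finally show "1 + norm (w $ j - of_real (t * \<psi> j)) \<le> c * (1 + t)" .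
      qed auto
      also have "\<dots> = (c * (1 + t)) ^ mon_degree m" unfolding mon_degree_def by (rule power_sum[symmetric])
      also have "\<dots> \<le> (c * (1 + t)) ^ n"
      proof (rule power_increasing)
        have "1 * 1 \<le> c * (1 + t)" using c2 t' by (intro mult_mono) auto
        then show "1 \<le> c * (1 + t)" by simp
      qed (use m in \<open>simp add: n_def\<close>)
      finally show ?thesis .
    qed
    have each: "norm (y * tau \<Lambda> l a) \<le> H * (c * (1 + t)) ^ n * exp (- (t - t0)) * exp (- l1 l)" if l: "l \<in> A - {0}" for l
    proof -
      have ex: "exp (- (t - t0 + 1) * l1 l) \<le> exp (- (t - t0)) * exp (- l1 l)"
      proof -
        have "(t - t0) * 1 \<le> (t - t0) * l1 l" using t l1_ge_1[of l] l by (intro mult_left_mono) auto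
        then show ?thesis unfolding exp_add[symmetric] exp_le_cancel_iff by (simp add: left_diff_distrib distrib_right)
      qed
      have le1: "norm (Ln (sg j * a $ j) + of_real (t * \<psi> j)) \<le> 1" for j
        unfolding Z using w[of j] by simp
      have "norm (y * tau \<Lambda> l a) \<le> (\<Sum>m\<in>D. norm (\<Lambda> m) * K m * ((c * (1 + t)) ^ n * (exp (- (t - t0)) * exp (- l1 l))))"
        unfolding tau_def sum_distrib_left
      proof (rule sum_norm_le)
        fix m assume m: "m \<in> D"
        have "norm (Emon l m a) \<le> K m * Gfac 0 m a * exp (- (t - t0 + 1) * l1 l)"
          by (rule K) (use l sl t' le1 in auto)
        then have "norm (y * (\<Lambda> m * Emon l m a)) \<le> norm y * (norm (\<Lambda> m) * (K m * Gfac 0 m a * exp (- (t - t0 + 1) * l1 l)))"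
          unfolding norm_mult by (intro mult_left_mono) auto
        also have "\<dots> = norm (\<Lambda> m) * K m * ((norm y * Gfac 0 m a) * exp (- (t - t0 + 1) * l1 l))"
          by (simp only: mult_ac)
        also have "\<dots> \<le> norm (\<Lambda> m) * K m * ((c * (1 + t)) ^ n * (exp (- (t - t0)) * exp (- l1 l)))"
          using G[OF m] ex K0[of m] c2 t' by (intro mult_left_mono mult_mono) auto
        finally show "norm (y * (\<Lambda> m * Emon l m a)) \<le> norm (\<Lambda> m) * K m * ((c * (1 + t)) ^ n * (exp (- (t - t0)) * exp (- l1 l)))" .
      qed
      then show ?thesis unfolding H_def sum_distrib_right[symmetric] by (simp only: mult.assoc)
    qed
    define C where "C = H * (c * (1 + t)) ^ n * exp (- (t - t0))"
    have sumC: "(\<lambda>l. C * exp (- l1 l)) summable_on A - {0}" by (rule summable_on_cmult_right[OF sumE])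
    have abs: "(\<lambda>l. norm (y * tau \<Lambda> l a)) summable_on A - {0}"
      by (rule summable_on_comparison_test[OF sumC]) (use each in \<open>auto simp: C_def\<close>)
    have sumt: "(\<lambda>l. tau \<Lambda> l a) summable_on A" using tau_summable[OF a u0, of \<Lambda>] by simp
    have "0 = Ssum \<Lambda> 0 a" using zero[OF a] by simp
    also have "\<dots> = (\<Sum>\<^sub>\<infinity>l\<in>{0} \<union> (A - {0}). tau \<Lambda> l a)"
      unfolding Ssum_def using A_zero by (simp add: insert_absorb)
    also have "\<dots> = (\<Sum>\<^sub>\<infinity>l\<in>{0}. tau \<Lambda> l a) + (\<Sum>\<^sub>\<infinity>l\<in>A - {0}. tau \<Lambda> l a)"
      by (rule infsum_Un_disjoint) (use summable_on_subset_banach[OF sumt, of "A - {0}"] in auto)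
    finally have "tau \<Lambda> 0 a = - (\<Sum>\<^sub>\<infinity>l\<in>A - {0}. tau \<Lambda> l a)"
      by (simp add: eq_neg_iff_add_eq_0)
    then have "y * tau \<Lambda> 0 a = - (\<Sum>\<^sub>\<infinity>l\<in>A - {0}. y * tau \<Lambda> l a)"
      by (simp add: infsum_cmult_right')
    moreover have "y * tau \<Lambda> 0 a = R t"
      unfolding tau_def R_def sum_distrib_left
    proof (rule sum.cong[OF refl])
      fix m
      have e: "y * Emon 0 m a = lead m (\<lambda>j. w $ j - of_real (t * \<psi> j))"
        unfolding y_def lead_Emon[OF sl] Z ..
      show "y * (\<Lambda> m * Emon 0 m a) = \<Lambda> m * lead m (\<lambda>j. w $ j - of_real (t * \<psi> j))"
        unfolding e[symmetric] by (rule mult.left_commute)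
    qed
    ultimately have "norm (R t) = norm (\<Sum>\<^sub>\<infinity>l\<in>A - {0}. y * tau \<Lambda> l a)" by simp
    also have "\<dots> \<le> (\<Sum>\<^sub>\<infinity>l\<in>A - {0}. norm (y * tau \<Lambda> l a))" by (rule norm_infsum_bound[OF abs])
    also have "\<dots> \<le> (\<Sum>\<^sub>\<infinity>l\<in>A - {0}. C * exp (- l1 l))"
      by (rule infsum_mono[OF abs sumC]) (use each in \<open>auto simp: C_def\<close>)
    also have "\<dots> = C * S" unfolding S_def by (rule infsum_cmult_right')
    finally show ?thesis unfolding C_def .
  qed
  have "((\<lambda>t. (1 + t) ^ n / exp (1 + t)) \<longlongrightarrow> (0::real)) at_top"
    by (rule filterlim_compose[OF tendsto_power_div_exp_0]) (rule filterlim_tendsto_add_at_top[OF tendsto_const filterlim_ident])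
  then have "((\<lambda>t. H * c ^ n * exp (t0 + 1) * S * ((1 + t) ^ n / exp (1 + t))) \<longlongrightarrow> H * c ^ n * exp (t0 + 1) * S * 0) at_top"
    by (rule tendsto_mult_left)
  moreover have "H * c ^ n * exp (t0 + 1) * S * ((1 + t) ^ n / exp (1 + t)) = H * (c * (1 + t)) ^ n * exp (- (t - t0)) * S" for t
  proof -
    have "exp (- (t - t0)) = exp (t0 + 1) / exp (1 + t)" by (simp flip: exp_diff)
    then show ?thesis by (simp add: power_mult_distrib)
  qed
  ultimately have lim: "((\<lambda>t. H * (c * (1 + t)) ^ n * exp (- (t - t0)) * S) \<longlongrightarrow> 0) at_top" by simp
  have "\<forall>\<^sub>F t in at_top. norm (R t) \<le> H * (c * (1 + t)) ^ n * exp (- (t - t0)) * S"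
    using eventually_gt_at_top[of t0] by eventually_elim (rule bound)
  from Lim_null_comparison[OF this lim] show ?thesis unfolding R_def .
qed

text \<open>Along the domain the leading term is a polynomial in the parameter, and a polynomial that tends
  to \<open>0\<close> vanishes.\<close>

lemma lead_sum_zero:
  assumes zero: "\<And>a. a \<in> dom \<Longrightarrow> Ssum \<Lambda> 0 a = 0" and w: "\<And>j. norm (w j) < 1"
  shows "(\<Sum>m\<in>D. \<Lambda> m * lead m w) = 0"
proof -
  obtain P where P: "\<forall>t. poly P (of_real t) = (\<Sum>m\<in>D. \<Lambda> m * lead m (\<lambda>j. w j - of_real (t * \<psi> j)))"
    using lead_polynomial[of \<Lambda> w] ..
  have "((\<lambda>t. \<Sum>m\<in>D. \<Lambda> m * lead m (\<lambda>j. (\<chi> j. w j) $ j - of_real (t * \<psi> j))) \<longlongrightarrow> 0) at_top"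
    by (rule lead_tendsto_0[OF zero]) (simp_all add: w)
  then have "((\<lambda>t. poly P (of_real t)) \<longlongrightarrow> 0) at_top" by (simp only: P vec_lambda_beta)
  then have "P = 0" by (rule poly_tendsto_0_imp_0)
  then show ?thesis using spec[OF P, of 0] by simp
qed

text \<open>Differentiating the leading term with respect to a logarithmic coordinate multiplies the
  functional by a variable.\<close>

lemma lead_sum_shift:
  assumes deg: "\<And>m. mon_degree m > CARD('n) \<Longrightarrow> \<Lambda> m = 0"
    and zero: "\<And>w. (\<And>j. norm (w j) < 1) \<Longrightarrow> (\<Sum>m\<in>D. \<Lambda> m * lead m w) = 0"
    and w: "\<And>j. norm (w j) < 1"
  shows "(\<Sum>m\<in>D. \<Lambda> (m + Poly_Mapping.single i 1) * lead m w) = 0"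
proof -
  define F where "F = coord_fps i 0"
  define Rest where "Rest m = (\<Prod>j\<in>UNIV - {i}. fps_nth (coord_fps j 0 * fps_exp (w j)) (Poly_Mapping.lookup m j))" for m
  have lead_upd: "lead m (w(i := w i + s)) = Rest m * fps_nth (F * fps_exp (w i + s)) (Poly_Mapping.lookup m i)" for m s
  proof -
    have "lead m (w(i := w i + s)) = fps_nth (F * fps_exp (w i + s)) (Poly_Mapping.lookup m i)
      * (\<Prod>j\<in>UNIV - {i}. fps_nth (coord_fps j 0 * fps_exp ((w(i := w i + s)) j)) (Poly_Mapping.lookup m j))"
      unfolding lead_def F_def by (subst prod.remove[of UNIV i]) simp_all
    also have "(\<Prod>j\<in>UNIV - {i}. fps_nth (coord_fps j 0 * fps_exp ((w(i := w i + s)) j)) (Poly_Mapping.lookup m j)) = Rest m"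
      unfolding Rest_def by (rule prod.cong) simp_all
    finally show ?thesis by (simp only: mult.commute)
  qed
  have low: "lead (m - Poly_Mapping.single i 1) w = Rest m * fps_nth (F * fps_exp (w i)) (Poly_Mapping.lookup m i - 1)" for m
  proof -
    have "lead (m - Poly_Mapping.single i 1) w = fps_nth (F * fps_exp (w i)) (Poly_Mapping.lookup m i - 1)
      * (\<Prod>j\<in>UNIV - {i}. fps_nth (coord_fps j 0 * fps_exp (w j)) (Poly_Mapping.lookup (m - Poly_Mapping.single i 1) j))"
      unfolding lead_def F_def by (subst prod.remove[of UNIV i]) (simp_all add: lookup_minus)
    also have "(\<Prod>j\<in>UNIV - {i}. fps_nth (coord_fps j 0 * fps_exp (w j)) (Poly_Mapping.lookup (m - Poly_Mapping.single i 1) j)) = Rest m"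
      unfolding Rest_def by (rule prod.cong) (simp_all add: lookup_minus lookup_single when_def)
    finally show ?thesis by (simp only: mult.commute)
  qed
  have der: "((\<lambda>s. lead m (w(i := w i + s))) has_field_derivative
      (if Poly_Mapping.lookup m i = 0 then 0 else lead (m - Poly_Mapping.single i 1) w)) (at 0)" for m
  proof -
    have s: "((\<lambda>s. w i + s) has_field_derivative 1) (at 0)" by (auto intro!: derivative_eq_intros)
    have "((\<lambda>s. Rest m * fps_nth (F * fps_exp (w i + s)) (Poly_Mapping.lookup m i)) has_field_derivative
        Rest m * (fps_nth (fps_X * F * fps_exp (w i + 0)) (Poly_Mapping.lookup m i) * 1)) (at 0)"
      by (rule DERIV_cmult, rule DERIV_chain2[OF has_field_derivative_fps_nth_mult_exp s])
    moreover have "Rest m * (fps_nth (fps_X * F * fps_exp (w i + 0)) (Poly_Mapping.lookup m i) * 1)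
       = (if Poly_Mapping.lookup m i = 0 then 0 else lead (m - Poly_Mapping.single i 1) w)"
      unfolding low mult.assoc fps_X_mult_nth by simp
    ultimately show ?thesis unfolding lead_upd by (simp only:)
  qed
  have "((\<lambda>s. \<Sum>m\<in>D. \<Lambda> m * lead m (w(i := w i + s))) has_field_derivative
      (\<Sum>m\<in>D. \<Lambda> m * (if Poly_Mapping.lookup m i = 0 then 0 else lead (m - Poly_Mapping.single i 1) w))) (at 0)"
    by (intro DERIV_sum DERIV_cmult der)
  moreover have "((\<lambda>s. \<Sum>m\<in>D. \<Lambda> m * lead m (w(i := w i + s))) has_field_derivative 0) (at 0)"
  proof (rule has_field_derivative_transform_within_open[where S = "ball 0 (1 - norm (w i))" and f = "\<lambda>_. 0"])
    show "0 \<in> ball (0::complex) (1 - norm (w i))" using w[of i] by simp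
    fix s assume s: "s \<in> ball (0::complex) (1 - norm (w i))"
    show "0 = (\<Sum>m\<in>D. \<Lambda> m * lead m (w(i := w i + s)))"
    proof (rule zero[symmetric])
      fix j
      have "norm (w i + s) < 1" using s norm_triangle_ineq[of "w i" s] by simp
      then show "norm ((w(i := w i + s)) j) < 1" using w[of j] by (cases "j = i") simp_all
    qed
  qed simp_all
  ultimately have "(\<Sum>m\<in>D. \<Lambda> m * (if Poly_Mapping.lookup m i = 0 then 0 else lead (m - Poly_Mapping.single i 1) w)) = 0"
    by (rule DERIV_unique)
  moreover have "(\<Sum>m\<in>D. \<Lambda> m * (if Poly_Mapping.lookup m i = 0 then 0 else lead (m - Poly_Mapping.single i 1) w))
    = (\<Sum>m\<in>D. \<Lambda> (m + Poly_Mapping.single i 1) * lead m w)"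
    by (rule D_shift[where E = "\<lambda>m. lead m w"]) (rule deg)
  ultimately show ?thesis by simp
qed

lemma lead_sum_multiple:
  assumes deg: "\<And>m. mon_degree m > CARD('n) \<Longrightarrow> \<Lambda> m = 0"
    and zero: "\<And>w. (\<And>j. norm (w j) < 1) \<Longrightarrow> (\<Sum>m\<in>D. \<Lambda> m * lead m w) = 0"
    and w: "\<And>j. norm (w j) < 1"
  shows "(\<Sum>m\<in>D. \<Lambda> (m + k) * lead m w) = 0"
  using w
proof (induction "mon_degree k" arbitrary: k w)
  case 0
  then have "k = 0" by (intro poly_mapping_eqI) (simp add: mon_degree_def)
  then show ?case using zero[of w] "0.prems" by simp
next
  case (Suc d)
  then obtain k' k'' where k: "k = k' + k''" "mon_degree k'' = d"
    using exists_degree_part[of d k] by auto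
  have d1: "mon_degree k' = 1" using Suc.hyps(2) k by simp
  then obtain i where i: "Poly_Mapping.lookup k' i \<noteq> 0" unfolding mon_degree_def by (metis sum.neutral zero_neq_one)
  have "k' = (k' - Poly_Mapping.single i 1) + Poly_Mapping.single i 1"
    by (rule poly_mapping_eqI) (use i in \<open>auto simp: lookup_add lookup_minus lookup_single when_def\<close>)
  then have "mon_degree (k' - Poly_Mapping.single i 1) = 0" "k' = (k' - Poly_Mapping.single i 1) + Poly_Mapping.single i 1"
    using d1 by (metis add_eq_self_zero mon_degree_add mon_degree_single add.commute)+
  moreover from this(1) have "k' - Poly_Mapping.single i 1 = 0"
    by (intro poly_mapping_eqI) (simp add: mon_degree_def)
  ultimately have k': "k' = Poly_Mapping.single i 1" by simp
  have "(\<Sum>m\<in>D. (\<lambda>m. \<Lambda> (m + k'')) (m + Poly_Mapping.single i 1) * lead m w) = 0"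
  proof (rule lead_sum_shift)
    show "\<Lambda> (m + k'') = 0" if "mon_degree m > CARD('n)" for m using that by (intro deg) simp
    show "(\<Sum>m\<in>D. \<Lambda> (m + k'') * lead m w) = 0" if "\<And>j. norm (w j) < 1" for w
      by (rule Suc.hyps(1)[OF k(2)[symmetric] that])
  qed (rule Suc.prems)
  then show ?case unfolding k(1) k' by (simp only: add.assoc add.commute add.left_commute)
qed

text \<open>At the origin of the logarithmic coordinates the leading term is the value of the functional on
  \<open>1\<close> plus values on monomials of positive degree; hence the downward induction on the degree.\<close>

lemma Ssum_injective:
  assumes ann: "annihilator \<Lambda>" and zero: "\<And>a. a \<in> dom \<Longrightarrow> Ssum \<Lambda> 0 a = 0"
  shows "\<Lambda> k = 0"
proof (induction "Suc CARD('n) - mon_degree k" arbitrary: k rule: less_induct)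
  case less
  show ?case
  proof (cases "mon_degree k > CARD('n)")
    case True
    then show ?thesis by (rule annihilator_degree[OF ann])
  next
    case False
    have lead0: "lead 0 (\<lambda>_. 0) = 1"
      unfolding lead_def by (rule prod.neutral) (simp add: coord_fps_def rGamma_fps_0 Gamma_fps_0)
    have "0 = (\<Sum>m\<in>D. \<Lambda> (m + k) * lead m (\<lambda>_. 0))"
      by (rule lead_sum_multiple[OF annihilator_degree[OF ann] lead_sum_zero[OF zero], symmetric]) auto
    also have "\<dots> = (\<Sum>m\<in>D. if m = 0 then \<Lambda> k else 0)"
    proof (rule sum.cong[OF refl])
      fix m
      show "\<Lambda> (m + k) * lead m (\<lambda>_. 0) = (if m = 0 then \<Lambda> k else 0)"
      proof (cases "m = 0")
        case False
        then have "mon_degree m \<noteq> 0"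
          by (metis (no_types, lifting) mon_degree_def finite_class.finite_UNIV lookup_zero poly_mapping_eqI sum_eq_0_iff UNIV_I)
        then have "\<Lambda> (m + k) = 0" using \<open>\<not> mon_degree k > CARD('n)\<close> by (intro less.hyps) auto
        then show ?thesis using False by simp
      qed (simp add: lead0)
    qed
    also have "\<dots> = \<Lambda> k" using finite_D by simp
    finally show ?thesis ..
  qed
qed

end

section \<open>Jets of solutions\<close>

lemma underdetermined_system:
  fixes M :: "'r \<Rightarrow> 'e \<Rightarrow> 'k::field"
  assumes "finite E" "finite R" "card E < card R"
  shows "\<exists>c. (\<exists>r\<in>R. c r \<noteq> 0) \<and> (\<forall>e\<in>E. (\<Sum>r\<in>R. c r * M r e) = 0)"
  using assms
proof (induction E arbitrary: R M rule: finite_induct)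
  case empty
  then obtain r where "r \<in> R" by (metis card.empty less_irrefl ex_in_conv)
  then show ?case by (intro exI[of _ "\<lambda>_. 1"]) auto
next
  case (insert e E)
  show ?case
  proof (cases "\<forall>r\<in>R. M r e = 0")
    case True
    have "card E < card R" using insert by simp
    from insert.IH[OF insert.prems(1) this, of M] obtain c
      where "\<exists>r\<in>R. c r \<noteq> 0" "\<forall>e\<in>E. (\<Sum>r\<in>R. c r * M r e) = 0" by auto
    then show ?thesis using True by (intro exI[of _ c]) auto
  next
    case False
    then obtain r0 where r0: "r0 \<in> R" "M r0 e \<noteq> 0" by blast
    let ?R = "R - {r0}"
    have "card E < card ?R" "finite ?R" using insert r0 by simp_all
    from insert.IH[OF this(2,1), of "\<lambda>r x. M r x - M r e / M r0 e * M r0 x"] obtain c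
      where c: "\<exists>r\<in>?R. c r \<noteq> 0" "\<forall>x\<in>E. (\<Sum>r\<in>?R. c r * (M r x - M r e / M r0 e * M r0 x)) = 0" by auto
    define s where "s = (\<Sum>r\<in>?R. c r * (M r e / M r0 e))"
    define d where "d r = (if r = r0 then - s else c r)" for r
    have sum: "(\<Sum>r\<in>R. d r * M r x) = - s * M r0 x + (\<Sum>r\<in>?R. c r * M r x)" for x
    proof -
      have "(\<Sum>r\<in>R. d r * M r x) = d r0 * M r0 x + (\<Sum>r\<in>?R. d r * M r x)"
        by (rule sum.remove[OF insert.prems(1) r0(1)])
      also have "(\<Sum>r\<in>?R. d r * M r x) = (\<Sum>r\<in>?R. c r * M r x)"
        by (rule sum.cong) (auto simp: d_def)
      finally show ?thesis by (simp add: d_def)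
    qed
    have red: "(\<Sum>r\<in>?R. c r * (M r x - M r e / M r0 e * M r0 x)) = (\<Sum>r\<in>?R. c r * M r x) - s * M r0 x" for x
      unfolding s_def sum_distrib_right sum_subtractf[symmetric] by (rule sum.cong) (simp_all add: right_diff_distrib)
    have "(\<Sum>r\<in>R. d r * M r x) = 0" if "x \<in> insert e E" for x
    proof (cases "x = e")
      case True
      have "(\<Sum>r\<in>?R. c r * M r e) = s * M r0 e"
        unfolding s_def sum_distrib_right by (rule sum.cong) (use r0 in simp_all)
      then show ?thesis unfolding True sum by simp
    next
      case False
      then have "(\<Sum>r\<in>?R. c r * M r x) - s * M r0 x = 0" using c(2) that unfolding red by blast
      then show ?thesis unfolding sum by simp
    qed
    moreover have "\<exists>r\<in>R. d r \<noteq> 0" using c(1) by (auto simp: d_def)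
    ultimately show ?thesis by (intro exI[of _ d] conjI ballI)
  qed
qed

lemma injective_square_system_solvable:
  fixes M :: "'b \<Rightarrow> 'b \<Rightarrow> 'k::field"
  assumes fin: "finite I" and inj: "\<And>c. (\<forall>j\<in>I. (\<Sum>i\<in>I. c i * M i j) = 0) \<Longrightarrow> (\<forall>i\<in>I. c i = 0)"
  shows "\<exists>c. \<forall>j\<in>I. (\<Sum>i\<in>I. c i * M i j) = v j"
proof -
  let ?R = "insert None (Some ` I)"
  define M' where "M' r j = (case r of None \<Rightarrow> v j | Some i \<Rightarrow> M i j)" for r j
  have "card I < card ?R" using fin by (simp add: card_image)
  from underdetermined_system[OF fin _ this, of M'] fin obtain c where
    c: "\<exists>r\<in>?R. c r \<noteq> 0" "\<forall>j\<in>I. (\<Sum>r\<in>?R. c r * M' r j) = 0" by auto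
  have sum: "(\<Sum>r\<in>?R. c r * M' r j) = c None * v j + (\<Sum>i\<in>I. c (Some i) * M i j)" for j
    using fin by (simp add: M'_def sum.reindex)
  have nz: "c None \<noteq> 0"
  proof
    assume z: "c None = 0"
    then have "\<forall>j\<in>I. (\<Sum>i\<in>I. c (Some i) * M i j) = 0" using c(2) unfolding sum by simp
    from inj[OF this] z c(1) show False by auto
  qed
  have "(\<Sum>i\<in>I. (- (c (Some i) / c None)) * M i j) = v j" if "j \<in> I" for j
  proof -
    have "c None * v j + (\<Sum>i\<in>I. c (Some i) * M i j) = 0" using c(2) that unfolding sum by blast
    then have "(\<Sum>i\<in>I. c (Some i) * M i j) = - (c None * v j)" by (simp add: eq_neg_iff_add_eq_0 add.commute)
    moreover have "(\<Sum>i\<in>I. (- (c (Some i) / c None)) * M i j) = (- 1 / c None) * (\<Sum>i\<in>I. c (Some i) * M i j)"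
      unfolding sum_distrib_left by (rule sum.cong) simp_all
    ultimately show ?thesis using nz by simp
  qed
  then show ?thesis by (intro exI[of _ "\<lambda>i. - (c (Some i) / c None)"] ballI)
qed

lemma partial_deriv_linear_combination:
  fixes f :: "'i \<Rightarrow> complex^'n::finite \<Rightarrow> complex"
  assumes "finite I" "\<And>i. i \<in> I \<Longrightarrow> holomorphic_on_several (f i) U" "a \<in> U"
  shows "((\<lambda>a. \<Sum>i\<in>I. c i * f i a) has_derivative (\<lambda>v. \<Sum>j\<in>UNIV. v $ j * (\<Sum>i\<in>I. c i * partial_deriv j (f i) a))) (at a)"
    and "partial_deriv j (\<lambda>a. \<Sum>i\<in>I. c i * f i a) a = (\<Sum>i\<in>I. c i * partial_deriv j (f i) a)"
proof -
  have "((\<lambda>a. c i * f i a) has_derivative (\<lambda>v. c i * (\<Sum>j\<in>UNIV. v $ j * partial_deriv j (f i) a))) (at a)" if "i \<in> I" for i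
    by (rule has_derivative_mult_right[OF has_derivative_partials[OF assms(2)[OF that] assms(3)]])
  then have "((\<lambda>a. \<Sum>i\<in>I. c i * f i a) has_derivative (\<lambda>v. \<Sum>i\<in>I. c i * (\<Sum>j\<in>UNIV. v $ j * partial_deriv j (f i) a))) (at a)"
    by (rule has_derivative_sum)
  moreover have "(\<Sum>i\<in>I. c i * (\<Sum>j\<in>UNIV. v $ j * partial_deriv j (f i) a)) = (\<Sum>j\<in>UNIV. v $ j * (\<Sum>i\<in>I. c i * partial_deriv j (f i) a))" for v :: "complex^'n"
  proof -
    have "c i * (v $ j * p) = v $ j * (c i * p)" for i j p by (rule mult.left_commute)
    then have "(\<Sum>i\<in>I. c i * (\<Sum>j\<in>UNIV. v $ j * partial_deriv j (f i) a)) = (\<Sum>i\<in>I. \<Sum>j\<in>UNIV. v $ j * (c i * partial_deriv j (f i) a))"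
      by (simp only: sum_distrib_left)
    also have "\<dots> = (\<Sum>j\<in>UNIV. \<Sum>i\<in>I. v $ j * (c i * partial_deriv j (f i) a))" by (rule sum.swap)
    finally show ?thesis by (simp only: sum_distrib_left)
  qed
  ultimately show d: "((\<lambda>a. \<Sum>i\<in>I. c i * f i a) has_derivative (\<lambda>v. \<Sum>j\<in>UNIV. v $ j * (\<Sum>i\<in>I. c i * partial_deriv j (f i) a))) (at a)"
    by (simp only:)
  show "partial_deriv j (\<lambda>a. \<Sum>i\<in>I. c i * f i a) a = (\<Sum>i\<in>I. c i * partial_deriv j (f i) a)"
    by (rule partial_deriv_eqI[OF d])
qed

lemma iterated_partial_linear_combination:
  fixes f :: "'i \<Rightarrow> complex^'n::finite \<Rightarrow> complex"
  assumes "finite I" "\<And>i. i \<in> I \<Longrightarrow> holomorphic_on_several (f i) U" "open U" "a \<in> U"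
  shows "iterated_partial xs (\<lambda>a. \<Sum>i\<in>I. c i * f i a) a = (\<Sum>i\<in>I. c i * iterated_partial xs (f i) a)"
  using assms(4)
proof (induction xs arbitrary: a)
  case (Cons x xs)
  have "iterated_partial (x # xs) (\<lambda>a. \<Sum>i\<in>I. c i * f i a) a = partial_deriv x (\<lambda>a. \<Sum>i\<in>I. c i * iterated_partial xs (f i) a) a"
    unfolding iterated_partial_simps by (rule partial_deriv_cong[OF assms(3) Cons.IH Cons.prems])
  also have "\<dots> = (\<Sum>i\<in>I. c i * partial_deriv x (iterated_partial xs (f i)) a)"
    by (rule partial_deriv_linear_combination(2)[OF assms(1) _ Cons.prems])
       (rule holomorphic_on_several_iterated_partial[OF assms(2) assms(3)])
  finally show ?case by simp
qed simp

lemma gkz_solution_linear_combination: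
  fixes \<mu> :: "'n::finite \<Rightarrow> 'a::euclidean_space"
  assumes fin: "finite I" and sol: "\<And>i. i \<in> I \<Longrightarrow> gkz_solution \<mu> \<beta> U (f i)" and U: "open U"
  shows "gkz_solution \<mu> \<beta> U (\<lambda>a. \<Sum>i\<in>I. c i * f i a)"
  unfolding gkz_solution_def
proof (intro conjI ballI allI impI)
  have hol: "holomorphic_on_several (f i) U" if "i \<in> I" for i using sol[OF that] unfolding gkz_solution_def by (rule conjunct1)
  show "holomorphic_on_several (\<lambda>a. \<Sum>i\<in>I. c i * f i a) U"
  proof (rule holomorphic_on_severalI)
    fix a assume a: "a \<in> U"
    show "((\<lambda>a. \<Sum>i\<in>I. c i * f i a) has_derivative (\<lambda>v. \<Sum>j\<in>UNIV. v $ j * (\<Sum>i\<in>I. c i * partial_deriv j (f i) a))) (at a)"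
      by (rule partial_deriv_linear_combination(1)[OF fin _ a]) (rule hol)
  qed
  have pd: "partial_deriv j (\<lambda>a. \<Sum>i\<in>I. c i * f i a) a = (\<Sum>i\<in>I. c i * partial_deriv j (f i) a)" if "a \<in> U" for a j
    by (rule partial_deriv_linear_combination(2)[OF fin _ that]) (rule hol)
  have ip: "iterated_partial xs (\<lambda>a. \<Sum>i\<in>I. c i * f i a) a = (\<Sum>i\<in>I. c i * iterated_partial xs (f i) a)" if "a \<in> U" for a xs
    by (rule iterated_partial_linear_combination[OF fin _ U that]) (rule hol)
  { fix a and e :: "real \<times> 'a" assume a: "a \<in> U" and e: "e \<in> Basis"
    have eq: "(\<Sum>j\<in>UNIV. of_real ((1::real, \<mu> j) \<bullet> e) * a $ j * partial_deriv j (f i) a) = of_real (\<beta> \<bullet> e) * f i a" if "i \<in> I" for i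
      using sol[OF that] a e unfolding gkz_solution_def by simp
    have "(\<Sum>j\<in>UNIV. of_real ((1::real, \<mu> j) \<bullet> e) * a $ j * partial_deriv j (\<lambda>a. \<Sum>i\<in>I. c i * f i a) a)
       = (\<Sum>j\<in>UNIV. \<Sum>i\<in>I. c i * (of_real ((1::real, \<mu> j) \<bullet> e) * a $ j * partial_deriv j (f i) a))"
      unfolding pd[OF a] sum_distrib_left by (simp only: mult.left_commute)
    also have "\<dots> = (\<Sum>i\<in>I. c i * (\<Sum>j\<in>UNIV. of_real ((1::real, \<mu> j) \<bullet> e) * a $ j * partial_deriv j (f i) a))"
      unfolding sum_distrib_left by (rule sum.swap)
    also have "\<dots> = (\<Sum>i\<in>I. c i * (of_real (\<beta> \<bullet> e) * f i a))"
      by (rule sum.cong) (simp_all only: eq)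
    also have "\<dots> = of_real (\<beta> \<bullet> e) * (\<Sum>i\<in>I. c i * f i a)"
      unfolding sum_distrib_left by (simp only: mult.left_commute)
    finally show "(\<Sum>j\<in>UNIV. of_real ((1::real, \<mu> j) \<bullet> e) * a $ j * partial_deriv j (\<lambda>a. \<Sum>i\<in>I. c i * f i a) a)
        - of_real (\<beta> \<bullet> e) * (\<Sum>i\<in>I. c i * f i a) = 0" by simp }
  { fix l xs ys a assume l: "l \<in> relation_lattice \<mu>" and a: "a \<in> U"
      and cnt: "(\<forall>i. count_list xs i = nat (l $ i)) \<and> (\<forall>i. count_list ys i = nat (- (l $ i)))"
    have "iterated_partial xs (f i) a = iterated_partial ys (f i) a" if "i \<in> I" for i
      using sol[OF that] l a cnt unfolding gkz_solution_def by blast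
    then show "iterated_partial xs (\<lambda>a. \<Sum>i\<in>I. c i * f i a) a = iterated_partial ys (\<lambda>a. \<Sum>i\<in>I. c i * f i a) a"
      unfolding ip[OF a] by (intro sum.cong refl) simp }
qed

lemma exists_list_of_exponents: "\<exists>xs. \<forall>i. count_list xs i = Poly_Mapping.lookup (k :: 'n::finite \<Rightarrow>\<^sub>0 nat) i"
proof (induction "mon_degree k" arbitrary: k)
  case 0
  then show ?case by (intro exI[of _ "[]"]) (simp add: mon_degree_def)
next
  case (Suc d)
  then obtain i where i: "Poly_Mapping.lookup k i \<noteq> 0" unfolding mon_degree_def by (metis sum.neutral nat.distinct(1))
  let ?k = "k - Poly_Mapping.single i 1"
  have k: "?k + Poly_Mapping.single i 1 = k"
    by (rule poly_mapping_eqI) (use i in \<open>auto simp: lookup_add lookup_minus lookup_single when_def\<close>)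
  have "mon_degree ?k + 1 = mon_degree k" by (subst (2) k[symmetric]) simp
  then have "d = mon_degree ?k" using Suc.hyps(2) by simp
  from Suc.hyps(1)[OF this] obtain xs where xs: "\<forall>j. count_list xs j = Poly_Mapping.lookup ?k j" ..
  have "count_list (i # xs) j = Poly_Mapping.lookup k j" for j
  proof -
    have "Poly_Mapping.lookup k j = Poly_Mapping.lookup ?k j + (if i = j then 1 else 0)"
      by (subst k[symmetric]) (simp only: lookup_add lookup_single when_def)
    then show ?thesis using xs by simp
  qed
  then show ?case by blast
qed

definition exponent_list :: "('n::finite \<Rightarrow>\<^sub>0 nat) \<Rightarrow> 'n list" where
  "exponent_list k = (SOME xs. \<forall>i. count_list xs i = Poly_Mapping.lookup k i)"

lemma count_exponent_list [simp]: "count_list (exponent_list k) i = Poly_Mapping.lookup k i"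
  using someI_ex[OF exists_list_of_exponents[of k]] unfolding exponent_list_def by blast

text \<open>The derivatives at \<open>a\<close>, weighted by powers of the coordinates, as a functional on monomials.  The
  homogeneity equations then say that it kills the linear generators up to lower degree, and the
  other equations compare its values at two monomials whose exponents differ by a relation.\<close>

definition jet :: "(complex^'n::finite \<Rightarrow> complex) \<Rightarrow> complex^'n \<Rightarrow> ('n \<Rightarrow>\<^sub>0 nat) \<Rightarrow> complex" where
  "jet \<Phi> a k = (\<Prod>j\<in>UNIV. (a $ j) ^ Poly_Mapping.lookup k j) * iterated_partial (exponent_list k) \<Phi> a"

lemma gkz_box_derivative:
  fixes k1 k2 :: "'n::finite \<Rightarrow>\<^sub>0 nat"
  assumes sol: "gkz_solution \<mu> \<beta> U \<Phi>" and U: "open U" "a \<in> U"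
    and rel: "(\<chi> j. int (Poly_Mapping.lookup k1 j) - int (Poly_Mapping.lookup k2 j)) \<in> relation_lattice \<mu>" (is "?l \<in> _")
  shows "iterated_partial (exponent_list k1) \<Phi> a = iterated_partial (exponent_list k2) \<Phi> a"
proof -
  have hol: "holomorphic_on_several \<Phi> U" using sol unfolding gkz_solution_def by (rule conjunct1)
  define xs where "xs = exponent_list (k1 - k2)"
  define ys where "ys = exponent_list (k2 - k1)"
  define zs where "zs = exponent_list (k1 - (k1 - k2))"
  have box: "iterated_partial xs \<Phi> b = iterated_partial ys \<Phi> b" if "b \<in> U" for b
  proof -
    have "(\<forall>i. count_list xs i = nat (?l $ i)) \<and> (\<forall>i. count_list ys i = nat (- (?l $ i)))"
      by (simp add: xs_def ys_def lookup_minus nat_diff_distrib')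
    then show ?thesis using sol rel that unfolding gkz_solution_def by blast
  qed
  have "iterated_partial (exponent_list k1) \<Phi> a = iterated_partial (zs @ xs) \<Phi> a"
    by (rule iterated_partial_mset_eq[OF hol U]) (simp add: zs_def xs_def lookup_minus)
  also have "\<dots> = iterated_partial zs (iterated_partial ys \<Phi>) a"
    unfolding iterated_partial_simps by (rule iterated_partial_cong[OF U(1) box U(2)])
  also have "\<dots> = iterated_partial (zs @ ys) \<Phi> a" by simp
  also have "\<dots> = iterated_partial (exponent_list k2) \<Phi> a"
    by (rule iterated_partial_mset_eq[OF hol U]) (simp add: zs_def ys_def lookup_minus)
  finally show ?thesis .
qed

text \<open>Commuting the operators past a derivative only changes the parameter of the homogeneity
  equations.\<close>

lemma gkz_euler_derivative:
  fixes \<mu> :: "'n::finite \<Rightarrow> 'a::euclidean_space" and e :: "real \<times> 'a"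
  fixes \<Phi> :: "complex^'n::finite \<Rightarrow> complex"
  assumes sol: "gkz_solution \<mu> \<beta> U \<Phi>" and U: "open U" and e: "e \<in> Basis"
  shows "\<exists>K. \<forall>a\<in>U. (\<Sum>i\<in>UNIV. of_real ((1::real, \<mu> i) \<bullet> e) * (a $ i * partial_deriv i (iterated_partial xs \<Phi>) a)) = K * iterated_partial xs \<Phi> a"
proof (induction xs)
  case Nil
  have "\<forall>a\<in>U. (\<Sum>i\<in>UNIV. of_real ((1::real, \<mu> i) \<bullet> e) * (a $ i * partial_deriv i \<Phi> a)) = of_real (\<beta> \<bullet> e) * \<Phi> a"
    using sol e unfolding gkz_solution_def mult.assoc[symmetric] by simp
  then show ?case unfolding iterated_partial_simps by blast
next
  case (Cons j xs)
  define c :: "'n \<Rightarrow> complex" where "c i = of_real ((1::real, \<mu> i) \<bullet> e)" for i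
  define \<Psi> where "\<Psi> = iterated_partial xs \<Phi>"
  obtain K where K: "\<forall>a\<in>U. (\<Sum>i\<in>UNIV. c i * (a $ i * partial_deriv i \<Psi> a)) = K * \<Psi> a"
    using Cons unfolding c_def \<Psi>_def by blast
  have "holomorphic_on_several \<Phi> U" using sol unfolding gkz_solution_def by (rule conjunct1)
  then have hol: "holomorphic_on_several \<Psi> U" unfolding \<Psi>_def using U by (rule holomorphic_on_several_iterated_partial)
  have hol': "holomorphic_on_several (partial_deriv i \<Psi>) U" for i
    by (rule holomorphic_on_several_partial_deriv[OF hol U])
  have "(\<Sum>i\<in>UNIV. c i * (a $ i * partial_deriv i (partial_deriv j \<Psi>) a)) = (K - c j) * partial_deriv j \<Psi> a" if a: "a \<in> U" for a
  proof -
    have a0: "a + axis j 0 \<in> U" using a by simp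
    have der: "((\<lambda>s. g (a + axis j s)) has_field_derivative partial_deriv j g a) (at 0)" if "holomorphic_on_several g U" for g
      using has_field_derivative_axis[OF that a0] by simp
    have lin: "((\<lambda>s. (a + axis j s) $ i) has_field_derivative (if i = j then 1 else 0)) (at 0)" for i
      by (cases "i = j") (auto simp: axis_def intro!: derivative_eq_intros)
    have "((\<lambda>s. \<Sum>i\<in>UNIV. c i * ((a + axis j s) $ i * partial_deriv i \<Psi> (a + axis j s))) has_field_derivative
      (\<Sum>i\<in>UNIV. c i * ((if i = j then 1 else 0) * partial_deriv i \<Psi> (a + axis j 0) + partial_deriv j (partial_deriv i \<Psi>) a * (a + axis j 0) $ i))) (at 0)"
      by (intro DERIV_sum DERIV_cmult DERIV_mult lin der hol')
    then have 1: "partial_deriv j (\<lambda>a. \<Sum>i\<in>UNIV. c i * (a $ i * partial_deriv i \<Psi> a)) a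
       = (\<Sum>i\<in>UNIV. c i * ((if i = j then 1 else 0) * partial_deriv i \<Psi> (a + axis j 0) + partial_deriv j (partial_deriv i \<Psi>) a * (a + axis j 0) $ i))"
      unfolding partial_deriv_def[of j "\<lambda>a. \<Sum>i\<in>UNIV. c i * (a $ i * partial_deriv i \<Psi> a)"] by (rule DERIV_imp_deriv)
    have 2: "partial_deriv j (\<lambda>a. K * \<Psi> a) a = K * partial_deriv j \<Psi> a"
      unfolding partial_deriv_def[of j "\<lambda>a. K * \<Psi> a"] by (rule DERIV_imp_deriv) (rule DERIV_cmult[OF der[OF hol]])
    have 3: "partial_deriv j (\<lambda>a. \<Sum>i\<in>UNIV. c i * (a $ i * partial_deriv i \<Psi> a)) a = partial_deriv j (\<lambda>a. K * \<Psi> a) a"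
      by (rule partial_deriv_cong[OF U _ a]) (use K in blast)
    have "(\<Sum>i\<in>UNIV. c i * ((if i = j then 1 else 0) * partial_deriv i \<Psi> (a + axis j 0) + partial_deriv j (partial_deriv i \<Psi>) a * (a + axis j 0) $ i))
       = (\<Sum>i\<in>UNIV. (if i = j then c j * partial_deriv j \<Psi> a else 0) + c i * (a $ i * partial_deriv i (partial_deriv j \<Psi>) a))"
      by (rule sum.cong) (auto simp: partial_deriv_commute[OF hol U a, of j] distrib_left mult.commute)
    also have "\<dots> = c j * partial_deriv j \<Psi> a + (\<Sum>i\<in>UNIV. c i * (a $ i * partial_deriv i (partial_deriv j \<Psi>) a))"
      by (simp add: sum.distrib)
    finally have "c j * partial_deriv j \<Psi> a + (\<Sum>i\<in>UNIV. c i * (a $ i * partial_deriv i (partial_deriv j \<Psi>) a)) = K * partial_deriv j \<Psi> a"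
      using 1 2 3 by (simp only:)
    then show ?thesis by (simp add: left_diff_distrib eq_diff_eq add.commute)
  qed
  then show ?case unfolding iterated_partial_simps \<Psi>_def c_def by blast
qed

context toric_data begin

text \<open>At a point far out in the domain, a relation \<open>1\<^sub>S - m\<close> of a non-face \<open>S\<close> shows that the jet at a
  multiple of the monomial of \<open>S\<close> is at most \<open>exp (- t)\<close> times the jet at another monomial of the same
  degree.  If the jets of lower degree vanish, those of the given degree thus form a functional to
  which \<open>contraction\<close> applies, and their maximum is at most \<open>C * exp (- t) < 1\<close> times itself.\<close>

lemma jet_vanish:
  assumes basis: "basis_modulo J \<alpha> I" and hom: "\<forall>i\<in>I. homogeneous (\<alpha> i)"
  shows "\<exists>a\<in>dom. \<forall>\<Phi>. gkz_solution \<mu> (-1, 0) dom \<Phi> \<longrightarrow> (\<forall>i\<in>I. app (jet \<Phi> a) (\<alpha> i) = 0) \<longrightarrow> (\<forall>k. jet \<Phi> a k = 0)"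
proof -
  from contraction[OF basis] obtain C where C': "C \<ge> 0 \<and> (\<forall>\<Lambda> B m. linear_annihilator \<Lambda> \<longrightarrow> B \<ge> 0 \<longrightarrow> (\<forall>S\<in>N. \<forall>k. norm (\<Lambda> (k + ind S)) \<le> B)
     \<longrightarrow> (\<forall>i\<in>I. app \<Lambda> (\<alpha> i) = 0) \<longrightarrow> norm (\<Lambda> m) \<le> C * B)" ..
  then have C0: "C \<ge> 0" and C: "norm (\<Lambda> m) \<le> C * B" if "linear_annihilator \<Lambda>" "B \<ge> 0" "\<forall>S\<in>N. \<forall>k. norm (\<Lambda> (k + ind S)) \<le> B"
     "\<forall>i\<in>I. app \<Lambda> (\<alpha> i) = 0" for \<Lambda> B m using that by simp_all
  have C0: "C \<ge> 0" using C' ..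
  define t where "t = max (t0 + 1) C"
  have t: "t > t0" "t \<ge> 0" "C \<le> t" using t0_nonneg by (auto simp: t_def)
  have small: "C * exp (- t) < 1"
  proof -
    have "C < exp t" using t(3) exp_ge_add_one_self[of t] by linarith
    then show ?thesis by (simp add: exp_minus field_simps)
  qed
  define a where "a = param (t, 0)"
  have a: "a \<in> dom" unfolding a_def dom_eq_param using t(1) by (intro imageI) simp
  have norm_a: "norm (a $ j) = exp (- (t * \<psi> j))" for j
    by (simp add: a_def param_def norm_mult norm_exp_eq_Re)
  define mono where "mono k = (\<Prod>j\<in>UNIV. (a $ j) ^ Poly_Mapping.lookup k j)" for k :: "'n \<Rightarrow>\<^sub>0 nat"
  have norm_mono: "norm (mono k) = exp (\<Sum>j\<in>UNIV. - (t * \<psi> j) * real (Poly_Mapping.lookup k j))" for k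
    unfolding mono_def prod_norm[symmetric] norm_power norm_a exp_sum[OF finite_class.finite_UNIV]
    by (rule prod.cong) (simp_all only: exp_of_nat2_mult)
  have mono_single: "mono (k + Poly_Mapping.single i 1) = a $ i * mono k" for k i
  proof -
    have "mono (k + Poly_Mapping.single i 1) = (\<Prod>j\<in>UNIV. (if j = i then a $ i else 1) * (a $ j) ^ Poly_Mapping.lookup k j)"
      unfolding mono_def by (rule prod.cong) (auto simp: lookup_add lookup_single when_def power_add)
    then show ?thesis by (simp add: prod.distrib mono_def)
  qed
  have jet_mono: "jet \<Phi> a k = mono k * iterated_partial (exponent_list k) \<Phi> a" for \<Phi> k
    by (simp add: jet_def mono_def)
  have main: "jet \<Phi> a k = 0" if sol: "gkz_solution \<mu> (-1, 0) dom \<Phi>" and van: "\<forall>i\<in>I. app (jet \<Phi> a) (\<alpha> i) = 0" for \<Phi> k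
  proof (induction "mon_degree k" arbitrary: k rule: less_induct)
    case less
    define d where "d = mon_degree k"
    define T where "T = {k' :: 'n \<Rightarrow>\<^sub>0 nat. mon_degree k' = d}"
    have finT: "finite T" by (rule finite_subset[OF _ finite_mon_degree_le[of d]]) (auto simp: T_def)
    have lower: "jet \<Phi> a k' = 0" if "mon_degree k' < d" for k' using less[of k'] that by (simp add: d_def)
    define B where "B = Max ((\<lambda>k'. norm (jet \<Phi> a k')) ` T)"
    have kT: "k \<in> T" by (simp add: T_def d_def)
    have leB: "norm (jet \<Phi> a k') \<le> B" if "k' \<in> T" for k' unfolding B_def using finT that by (intro Max_ge) auto
    have B0: "B \<ge> 0" using leB[OF kT] norm_ge_zero order_trans by blast
    define \<Lambda> where "\<Lambda> k' = (if mon_degree k' = d then jet \<Phi> a k' else 0)" for k'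
    have lin: "linear_annihilator \<Lambda>"
      unfolding linear_annihilator_def
    proof (intro ballI allI)
      fix e :: "real \<times> 'a" and k' :: "'n \<Rightarrow>\<^sub>0 nat" assume e: "e \<in> Basis"
      show "(\<Sum>i\<in>UNIV. of_real ((1, \<mu> i) \<bullet> e) * \<Lambda> (k' + Poly_Mapping.single i 1)) = 0"
      proof (cases "mon_degree k' + 1 = d")
        case True
        obtain K where K: "\<forall>a\<in>dom. (\<Sum>i\<in>UNIV. of_real ((1::real, \<mu> i) \<bullet> e) * (a $ i * partial_deriv i (iterated_partial (exponent_list k') \<Phi>) a)) = K * iterated_partial (exponent_list k') \<Phi> a"
          using gkz_euler_derivative[OF sol open_dom e, of "exponent_list k'"] ..
        have hol: "holomorphic_on_several \<Phi> dom" using sol unfolding gkz_solution_def by (rule conjunct1)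
        have it: "iterated_partial (exponent_list (k' + Poly_Mapping.single i 1)) \<Phi> a = partial_deriv i (iterated_partial (exponent_list k') \<Phi>) a" for i
        proof -
          have "iterated_partial (exponent_list (k' + Poly_Mapping.single i 1)) \<Phi> a = iterated_partial (i # exponent_list k') \<Phi> a"
            by (rule iterated_partial_mset_eq[OF hol open_dom a]) (auto simp: lookup_add lookup_single when_def)
          then show ?thesis by simp
        qed
        have "of_real ((1, \<mu> i) \<bullet> e) * \<Lambda> (k' + Poly_Mapping.single i 1)
          = mono k' * (of_real ((1, \<mu> i) \<bullet> e) * (a $ i * partial_deriv i (iterated_partial (exponent_list k') \<Phi>) a))" for i
        proof -
          have "\<Lambda> (k' + Poly_Mapping.single i 1) = a $ i * mono k' * partial_deriv i (iterated_partial (exponent_list k') \<Phi>) a"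
            using True unfolding \<Lambda>_def jet_mono mono_single it by simp
          then show ?thesis by (simp only: mult_ac)
        qed
        then have "(\<Sum>i\<in>UNIV. of_real ((1, \<mu> i) \<bullet> e) * \<Lambda> (k' + Poly_Mapping.single i 1))
          = mono k' * (K * iterated_partial (exponent_list k') \<Phi> a)"
          using K a by (simp only: sum_distrib_left[symmetric])
        also have "\<dots> = K * jet \<Phi> a k'" unfolding jet_mono by (simp only: mult.left_commute)
        also have "\<dots> = 0" using lower[of k'] True by simp
        finally show ?thesis .
      qed (simp add: \<Lambda>_def)
    qed
    have bd: "\<forall>S\<in>N. \<forall>k'. norm (\<Lambda> (k' + ind S)) \<le> exp (- t) * B"
    proof (intro ballI allI)
      fix S k' assume S: "S \<in> N"
      show "norm (\<Lambda> (k' + ind S)) \<le> exp (- t) * B"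
      proof (cases "mon_degree (k' + ind S) = d")
        case True
        obtain m :: "'n \<Rightarrow> nat" where m: "(\<chi> j. of_bool (j \<in> S) - int (m j)) \<in> A - {0}"
          using nonface_relation[OF S] by blast
        define l :: "int^'n" where "l = (\<chi> j. of_bool (j \<in> S) - int (m j))"
        have l: "l \<in> A" "l \<noteq> 0" using m unfolding l_def by blast+
        define M where "M = Abs_poly_mapping m"
        have M: "Poly_Mapping.lookup M j = m j" for j unfolding M_def by (subst lookup_Abs_poly_mapping) simp_all
        have lj: "l $ j = int (Poly_Mapping.lookup (k' + ind S) j) - int (Poly_Mapping.lookup (k' + M) j)" for j
          by (simp add: l_def lookup_add M)
        have it: "iterated_partial (exponent_list (k' + ind S)) \<Phi> a = iterated_partial (exponent_list (k' + M)) \<Phi> a"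
        proof (rule gkz_box_derivative[OF sol open_dom a])
          have "(\<chi> j. int (Poly_Mapping.lookup (k' + ind S) j) - int (Poly_Mapping.lookup (k' + M) j)) = l"
            by (simp add: vec_eq_iff lj)
          then show "(\<chi> j. int (Poly_Mapping.lookup (k' + ind S) j) - int (Poly_Mapping.lookup (k' + M) j)) \<in> relation_lattice \<mu>"
            using l(1) A_relations by auto
        qed
        have "int (mon_degree (k' + ind S)) - int (mon_degree (k' + M)) = (\<Sum>j\<in>UNIV. l $ j)"
          unfolding lj sum_subtractf mon_degree_def of_nat_sum ..
        then have degM: "mon_degree (k' + M) = d" using A_sum[OF l(1)] True by simp
        have "norm (mono (k' + ind S)) \<le> exp (- t) * norm (mono (k' + M))"
        proof -
          have "(\<Sum>j\<in>UNIV. - (t * \<psi> j) * real (Poly_Mapping.lookup (k' + ind S) j))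
            - (\<Sum>j\<in>UNIV. - (t * \<psi> j) * real (Poly_Mapping.lookup (k' + M) j)) = (\<Sum>j\<in>UNIV. - t * (of_int (l $ j) * \<psi> j))"
            unfolding sum_subtractf[symmetric] lj by (rule sum.cong) (simp_all add: algebra_simps)
          also have "\<dots> = - t * (\<Sum>j\<in>UNIV. of_int (l $ j) * \<psi> j)" by (rule sum_distrib_left[symmetric])
          also have "\<dots> \<le> - t * 1"
          proof -
            have "1 \<le> (\<Sum>j\<in>UNIV. of_int (l $ j) * \<psi> j)" using height[OF l(1)] l1_ge_1[OF l(2)] unfolding l1_def by linarith
            from mult_left_mono[OF this t(2)] show ?thesis by simp
          qed
          finally have "(\<Sum>j\<in>UNIV. - (t * \<psi> j) * real (Poly_Mapping.lookup (k' + ind S) j))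
            \<le> - t + (\<Sum>j\<in>UNIV. - (t * \<psi> j) * real (Poly_Mapping.lookup (k' + M) j))" by linarith
          then show ?thesis unfolding norm_mono exp_add[symmetric] by simp
        qed
        then have "norm (jet \<Phi> a (k' + ind S)) \<le> exp (- t) * norm (jet \<Phi> a (k' + M))"
          unfolding jet_mono it norm_mult mult.assoc[symmetric] by (rule mult_right_mono) simp
        also have "\<dots> \<le> exp (- t) * B" using leB[of "k' + M"] degM by (intro mult_left_mono) (simp_all add: T_def)
        finally show ?thesis using True by (simp add: \<Lambda>_def)
      qed (use B0 in \<open>simp add: \<Lambda>_def\<close>)
    qed
    have van\<Lambda>: "\<forall>i\<in>I. app \<Lambda> (\<alpha> i) = 0"
    proof
      fix i assume i: "i \<in> I"
      obtain d' where d': "\<forall>m\<in>Poly_Mapping.keys (\<alpha> i). mon_degree m = d'" using hom i unfolding homogeneous_def by blast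
      show "app \<Lambda> (\<alpha> i) = 0"
      proof (cases "d' = d")
        case True
        have "app \<Lambda> (\<alpha> i) = app (jet \<Phi> a) (\<alpha> i)"
          unfolding app_def by (rule sum.cong) (use d' True in \<open>simp_all add: \<Lambda>_def\<close>)
        then show ?thesis using van i by simp
      next
        case False
        then show ?thesis unfolding app_def by (intro sum.neutral ballI) (use d' in \<open>simp add: \<Lambda>_def\<close>)
      qed
    qed
    have le: "norm (jet \<Phi> a k') \<le> C * (exp (- t) * B)" if "k' \<in> T" for k'
      using C[OF lin _ bd van\<Lambda>, of k'] B0 that by (simp add: \<Lambda>_def T_def)
    have "B \<in> (\<lambda>k'. norm (jet \<Phi> a k')) ` T" unfolding B_def using finT kT by (intro Max_in) auto
    then have "B \<le> (C * exp (- t)) * B" using le by (auto simp: mult.assoc)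
    then have "B * (1 - C * exp (- t)) \<le> 0" by (simp add: algebra_simps)
    then have "B \<le> 0" using small by (simp add: mult_le_0_iff)
    then have "norm (jet \<Phi> a k) \<le> 0" using leB[OF kT] by (rule order_trans[rotated])
    then show "jet \<Phi> a k = 0" by (simp only: norm_le_zero_iff)
  qed
  show ?thesis using main a by blast
qed

lemma annihilator_linear_combination:
  assumes "\<And>i. i \<in> I \<Longrightarrow> annihilator (\<Lambda> i)"
  shows "annihilator (\<lambda>m. \<Sum>i\<in>I. c i * \<Lambda> i m)"
  by (rule annihilatorI) (simp add: app_functional_sum app_ideal[OF assms])

lemma Ssum_linear_combination:
  assumes "a \<in> dom"
  shows "(\<Sum>i\<in>I. c i * Ssum (\<Lambda> i) 0 a) = Ssum (\<lambda>m. \<Sum>i\<in>I. c i * \<Lambda> i m) 0 a"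
  unfolding Ssum_B_series[OF assms] sum_distrib_left sum_distrib_right
  by (subst sum.swap) (simp only: mult.assoc)

text \<open>A solution is determined by the values of its jet on the basis.  The series attached to the
  coordinate functionals are as many as the basis elements and independent, so the square system
  that prescribes these values has a solution among their combinations.\<close>

lemma basis_of_solutions:
  assumes basis: "basis_modulo J \<alpha> I" and hom: "\<forall>i\<in>I. homogeneous (\<alpha> i)"
  shows "\<exists>w. (\<forall>a\<in>dom. expansion_modulo J \<alpha> I
      (\<lambda>m. 1 / (negate_coord i0 a $ i0) * (\<Sum>\<^sub>\<infinity>l\<in>A. B_term i0 (negate_coord i0 a) m l)) (\<lambda>i. w i a)) \<and>
    basis_of_gkz_solutions \<mu> (-1, 0) dom w I"
proof -
  have fin: "finite I" by (rule basis_finite[OF basis])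
  from coordinate_functionals[OF basis] obtain \<Lambda> where \<Lambda>': "(\<forall>i\<in>I. annihilator (\<Lambda> i)) \<and>
    (\<forall>i\<in>I. \<forall>j\<in>I. app (\<Lambda> i) (\<alpha> j) = (if i = j then 1 else 0)) \<and>
    (\<forall>p. p - (\<Sum>i\<in>I. pconst (app (\<Lambda> i) p) * \<alpha> i) \<in> J)" ..
  then have ann: "annihilator (\<Lambda> i)" if "i \<in> I" for i using that by blast
  have delta: "app (\<Lambda> i) (\<alpha> j) = (if i = j then 1 else 0)" if "i \<in> I" "j \<in> I" for i j using \<Lambda>' that by blast
  have mem: "p - (\<Sum>i\<in>I. pconst (app (\<Lambda> i) p) * \<alpha> i) \<in> J" for p using \<Lambda>' by blast
  define w where "w i = Ssum (\<Lambda> i) 0" for i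
  have sol: "gkz_solution \<mu> (-1, 0) dom (w i)" if "i \<in> I" for i
    unfolding w_def by (rule gkz_solution_Ssum[OF ann[OF that]])
  have indep: "c j = 0" if z: "\<And>a. a \<in> dom \<Longrightarrow> (\<Sum>i\<in>I. c i * w i a) = 0" and j: "j \<in> I" for c j
  proof -
    have "(\<lambda>m. \<Sum>i\<in>I. c i * \<Lambda> i m) k = 0" for k
    proof (rule Ssum_injective)
      show "annihilator (\<lambda>m. \<Sum>i\<in>I. c i * \<Lambda> i m)" by (rule annihilator_linear_combination[OF ann])
      show "Ssum (\<lambda>m. \<Sum>i\<in>I. c i * \<Lambda> i m) 0 a = 0" if "a \<in> dom" for a
        using z[OF that] unfolding w_def Ssum_linear_combination[OF that] .
    qed
    then have "0 = app (\<lambda>m. \<Sum>i\<in>I. c i * \<Lambda> i m) (\<alpha> j)" by (simp add: app_def)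
    also have "\<dots> = (\<Sum>i\<in>I. if i = j then c j else 0)"
      unfolding app_functional_sum by (rule sum.cong) (auto simp: delta[OF _ j])
    also have "\<dots> = c j" using fin j by simp
    finally show ?thesis ..
  qed
  from jet_vanish[OF basis hom] obtain a where a: "a \<in> dom" and
    jv: "\<forall>\<Phi>. gkz_solution \<mu> (-1, 0) dom \<Phi> \<longrightarrow> (\<forall>i\<in>I. app (jet \<Phi> a) (\<alpha> i) = 0) \<longrightarrow> (\<forall>k. jet \<Phi> a k = 0)" ..
  have zero_comb: "(\<Sum>r\<in>R. c r * g r x) = 0"
    if R: "finite R" and g: "\<And>r. r \<in> R \<Longrightarrow> gkz_solution \<mu> (-1, 0) dom (g r)"
      and z: "\<And>j. j \<in> I \<Longrightarrow> (\<Sum>r\<in>R. c r * app (jet (g r) a) (\<alpha> j)) = 0" and x: "x \<in> dom"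
    for R :: "'b option set" and c g x
  proof -
    let ?F = "\<lambda>x. \<Sum>r\<in>R. c r * g r x"
    have F: "gkz_solution \<mu> (-1, 0) dom ?F" by (rule gkz_solution_linear_combination[OF R g open_dom])
    have hol: "holomorphic_on_several (g r) dom" if "r \<in> R" for r
      using g[OF that] unfolding gkz_solution_def by (rule conjunct1)
    have holF: "holomorphic_on_several ?F dom" using F unfolding gkz_solution_def by (rule conjunct1)
    have jet: "jet ?F a = (\<lambda>k. \<Sum>r\<in>R. c r * jet (g r) a k)"
    proof
      fix k
      have "iterated_partial (exponent_list k) ?F a = (\<Sum>r\<in>R. c r * iterated_partial (exponent_list k) (g r) a)"
        by (rule iterated_partial_linear_combination[OF R _ open_dom a]) (rule hol)
      then show "jet ?F a k = (\<Sum>r\<in>R. c r * jet (g r) a k)"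
        unfolding jet_def by (simp only: sum_distrib_left mult.left_commute)
    qed
    have "\<forall>j\<in>I. app (jet ?F a) (\<alpha> j) = 0" unfolding jet app_functional_sum using z by blast
    with jv F have jz: "jet ?F a k = 0" for k by blast
    have "iterated_partial xs ?F a = 0" for xs
    proof -
      define k where "k = Abs_poly_mapping (count_list xs)"
      have k: "Poly_Mapping.lookup k i = count_list xs i" for i unfolding k_def by (subst lookup_Abs_poly_mapping) simp_all
      have "iterated_partial xs ?F a = iterated_partial (exponent_list k) ?F a"
        by (rule iterated_partial_mset_eq[OF holF open_dom a]) (simp add: k)
      moreover have "(\<Prod>j\<in>UNIV. (a $ j) ^ Poly_Mapping.lookup k j) \<noteq> 0"
        using slit_nz[OF dom_slit[OF a]] by (auto simp: prod_zero_iff)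
      moreover have "(\<Prod>j\<in>UNIV. (a $ j) ^ Poly_Mapping.lookup k j) * iterated_partial (exponent_list k) ?F a = 0"
        using jz[of k] unfolding jet_def .
      ultimately have "iterated_partial (exponent_list k) ?F a = 0" by (simp only: mult_eq_0_iff simp_thms)
      with \<open>iterated_partial xs ?F a = _\<close> show ?thesis by (rule trans)
    qed
    from identity_theorem_several[OF holF open_dom connected_dom a this x] show ?thesis .
  qed
  define M where "M i j = app (jet (w i) a) (\<alpha> j)" for i j
  have inj: "\<forall>i\<in>I. c i = 0" if "\<forall>j\<in>I. (\<Sum>i\<in>I. c i * M i j) = 0" for c
  proof
    fix j assume j: "j \<in> I"
    show "c j = 0"
    proof (rule indep[OF _ j])
      fix x assume x: "x \<in> dom"
      have "(\<Sum>r\<in>Some ` I. c (the r) * w (the r) x) = 0"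
      proof (rule zero_comb[OF _ _ _ x])
        show "(\<Sum>r\<in>Some ` I. c (the r) * app (jet (w (the r)) a) (\<alpha> j)) = 0" if "j \<in> I" for j
          using \<open>\<forall>j\<in>I. (\<Sum>i\<in>I. c i * M i j) = 0\<close> that by (simp add: sum.reindex M_def)
      qed (use fin sol in auto)
      then show "(\<Sum>i\<in>I. c i * w i x) = 0" by (simp add: sum.reindex)
    qed
  qed
  have span: "\<exists>c. \<forall>x\<in>dom. \<Phi> x = (\<Sum>i\<in>I. c i * w i x)" if \<Phi>: "gkz_solution \<mu> (-1, 0) dom \<Phi>" for \<Phi>
  proof -
    have "\<exists>c. \<forall>j\<in>I. (\<Sum>i\<in>I. c i * M i j) = app (jet \<Phi> a) (\<alpha> j)"
    proof (rule injective_square_system_solvable[OF fin])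
      fix c assume *: "\<forall>j\<in>I. (\<Sum>i\<in>I. c i * M i j) = 0"
      from inj[of c, OF *] show "\<forall>i\<in>I. c i = 0" .
    qed
    then obtain c where c: "\<forall>j\<in>I. (\<Sum>i\<in>I. c i * M i j) = app (jet \<Phi> a) (\<alpha> j)" ..
    let ?R = "insert None (Some ` I)"
    define c' where "c' r = (case r of None \<Rightarrow> - 1 | Some i \<Rightarrow> c i)" for r
    define g where "g r = (case r of None \<Rightarrow> \<Phi> | Some i \<Rightarrow> w i)" for r
    have "\<Phi> x = (\<Sum>i\<in>I. c i * w i x)" if x: "x \<in> dom" for x
    proof -
      have "(\<Sum>r\<in>?R. c' r * g r x) = 0"
      proof (rule zero_comb[OF _ _ _ x])
        show "finite ?R" using fin by simp
        show "gkz_solution \<mu> (-1, 0) dom (g r)" if "r \<in> ?R" for r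
          using that sol \<Phi> unfolding g_def by auto
        show "(\<Sum>r\<in>?R. c' r * app (jet (g r) a) (\<alpha> j)) = 0" if "j \<in> I" for j
        proof -
          have "(\<Sum>r\<in>?R. c' r * app (jet (g r) a) (\<alpha> j)) = - app (jet \<Phi> a) (\<alpha> j) + (\<Sum>i\<in>I. c i * M i j)"
            using fin by (simp add: sum.reindex c'_def g_def M_def)
          then show ?thesis using c that by simp
        qed
      qed
      moreover have "(\<Sum>r\<in>?R. c' r * g r x) = - \<Phi> x + (\<Sum>i\<in>I. c i * w i x)"
        using fin by (simp add: sum.reindex c'_def g_def)
      ultimately show ?thesis by simp
    qed
    then show ?thesis by (intro exI[of _ c] ballI)
  qed
  show ?thesis
  proof (intro exI[of _ w] conjI ballI)
    fix x assume x: "x \<in> dom"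
    define F where "F m = 1 / (negate_coord i0 x $ i0) * (\<Sum>\<^sub>\<infinity>l\<in>A. B_term i0 (negate_coord i0 x) m l)" for m
    have "expansion_modulo J \<alpha> I F (\<lambda>i. \<Sum>m\<in>D. \<Lambda> i m * F m)"
      by (rule expansion_moduloI[OF ann mem])
    moreover have "(\<Sum>m\<in>D. \<Lambda> i m * F m) = w i x" for i
      unfolding w_def F_def by (rule Ssum_B_series[OF x, symmetric])
    ultimately show "expansion_modulo J \<alpha> I
      (\<lambda>m. 1 / (negate_coord i0 x $ i0) * (\<Sum>\<^sub>\<infinity>l\<in>A. B_term i0 (negate_coord i0 x) m l)) (\<lambda>i. w i x)"
      unfolding F_def by (simp only:)
    next
    show "basis_of_gkz_solutions \<mu> (-1, 0) dom w I"
      unfolding basis_of_gkz_solutions_def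
      using fin sol span indep by (intro conjI allI impI ballI) auto
  qed
qed

theorem solutions_on_domain:
  assumes "basis_modulo (ideal_generated ((\<lambda>S. \<Prod>i\<in>S. pvar i) ` N \<union> linear_generators \<mu>)) \<alpha> I"
    and hom: "\<forall>i\<in>I. homogeneous (\<alpha> i)"
  shows "\<exists>U w. open U \<and> connected U \<and> U \<noteq> {} \<and>
    (\<forall>a\<in>U. \<forall>i. negate_coord i0 a $ i \<notin> \<real>\<^sub>\<le>\<^sub>0) \<and>
    (\<forall>a\<in>U. \<forall>m. B_term i0 (negate_coord i0 a) m summable_on A) \<and>
    (\<forall>a\<in>U. expansion_modulo (ideal_generated ((\<lambda>S. \<Prod>i\<in>S. pvar i) ` N \<union> linear_generators \<mu>)) \<alpha> I
      (\<lambda>m. 1 / (negate_coord i0 a $ i0) * (\<Sum>\<^sub>\<infinity>l\<in>A. B_term i0 (negate_coord i0 a) m l)) (\<lambda>i. w i a)) \<and>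
    basis_of_gkz_solutions \<mu> (-1, 0) U w I"
proof -
  have basis: "basis_modulo J \<alpha> I" using assms(1) unfolding J_def .
  from basis_of_solutions[OF basis hom] obtain w where w:
    "\<forall>a\<in>dom. expansion_modulo J \<alpha> I
      (\<lambda>m. 1 / (negate_coord i0 a $ i0) * (\<Sum>\<^sub>\<infinity>l\<in>A. B_term i0 (negate_coord i0 a) m l)) (\<lambda>i. w i a)"
    "basis_of_gkz_solutions \<mu> (-1, 0) dom w I" by (elim exE conjE)
  show ?thesis
  proof (intro exI[of _ dom] exI[of _ w] conjI)
    show "open dom" by (rule open_dom)
    show "connected dom" by (rule connected_dom)
    show "dom \<noteq> {}" by (rule dom_nonempty)
    show "\<forall>a\<in>dom. \<forall>i. negate_coord i0 a $ i \<notin> \<real>\<^sub>\<le>\<^sub>0"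
      using dom_slit unfolding negate_coord_nth slit_def by blast
    show "\<forall>a\<in>dom. \<forall>m. B_term i0 (negate_coord i0 a) m summable_on A"
      by (intro ballI allI B_term_summable)
  qed (use w in \<open>simp_all only: J_def\<close>)
qed

end

section \<open>Cones and regular fans\<close>

lemma convex_cone_hull_finite_iff:
  assumes "finite S"
  shows "x \<in> convex_cone hull S \<longleftrightarrow> (\<exists>c. (\<forall>s\<in>S. 0 \<le> c s) \<and> x = (\<Sum>s\<in>S. c s *\<^sub>R s))"
proof
  define K where "K = {x. \<exists>c. (\<forall>s\<in>S. 0 \<le> c s) \<and> x = (\<Sum>s\<in>S. c s *\<^sub>R s)}"
  have "convex_cone K"
    unfolding convex_cone_iff
  proof (intro conjI ballI allI impI)
    show "0 \<in> K" unfolding K_def by (auto intro!: exI[of _ "\<lambda>_. 0"])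
    show "x + y \<in> K" if x: "x \<in> K" and y: "y \<in> K" for x y
    proof -
      obtain c where "\<forall>s\<in>S. 0 \<le> c s" "x = (\<Sum>s\<in>S. c s *\<^sub>R s)" using x unfolding K_def by blast
      moreover obtain d where "\<forall>s\<in>S. 0 \<le> d s" "y = (\<Sum>s\<in>S. d s *\<^sub>R s)" using y unfolding K_def by blast
      ultimately show ?thesis unfolding K_def
        by (auto intro!: exI[of _ "\<lambda>s. c s + d s"] simp: scaleR_add_left sum.distrib)
    qed
    show "t *\<^sub>R x \<in> K" if x: "x \<in> K" and t: "0 \<le> t" for x t
    proof -
      obtain c where "\<forall>s\<in>S. 0 \<le> c s" "x = (\<Sum>s\<in>S. c s *\<^sub>R s)" using x unfolding K_def by blast
      then show ?thesis unfolding K_def using t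
        by (auto intro!: exI[of _ "\<lambda>s. t * c s"] simp: scaleR_sum_right)
    qed
  qed
  moreover have "S \<subseteq> K"
  proof
    fix s assume "s \<in> S"
    then have "s = (\<Sum>r\<in>S. (if r = s then 1 else 0) *\<^sub>R r)" using assms
      by (simp add: if_distrib[of "\<lambda>c. c *\<^sub>R _"] sum.delta' cong: if_cong)
    then show "s \<in> K" unfolding K_def by (intro CollectI exI[of _ "\<lambda>r. if r = s then 1 else 0"]) auto
  qed
  ultimately have "convex_cone hull S \<subseteq> K" by (rule hull_minimal[rotated])
  then show "\<exists>c. (\<forall>s\<in>S. 0 \<le> c s) \<and> x = (\<Sum>s\<in>S. c s *\<^sub>R s)" if "x \<in> convex_cone hull S"
    using that unfolding K_def by blast
next
  assume "\<exists>c. (\<forall>s\<in>S. 0 \<le> c s) \<and> x = (\<Sum>s\<in>S. c s *\<^sub>R s)"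
  then obtain c where c: "\<forall>s\<in>S. 0 \<le> c s" "x = (\<Sum>s\<in>S. c s *\<^sub>R s)" by blast
  have "(\<Sum>s\<in>F. c s *\<^sub>R s) \<in> convex_cone hull S" if "F \<subseteq> S" for F
    using finite_subset[OF that assms] that
    by (induction F rule: finite_induct)
       (auto intro!: convex_cone_hull_add convex_cone_hull_mul convex_cone_hull_contains_0 simp: c(1) hull_inc)
  then show "x \<in> convex_cone hull S" using c(2) by simp
qed

lemma sum_in_convex_cone:
  assumes "convex_cone C" "finite F" "\<And>s. s \<in> F \<Longrightarrow> g s \<in> C"
  shows "sum g F \<in> C"
  using assms(2,3) by (induction F rule: finite_induct)
    (auto intro: convex_cone_add[OF assms(1)] convex_cone_contains_0[OF assms(1)])

lemma face_scaleR:
  assumes F: "F face_of C" and C: "convex_cone C" and z: "z \<in> F" and t: "0 \<le> t"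
  shows "t *\<^sub>R z \<in> F"
proof (cases "t = 1 \<or> z = 0")
  case True then show ?thesis using z by auto
next
  case False
  have zC: "z \<in> C" using F z face_of_imp_subset by blast
  define s where "s = (if t \<le> 1 then 2 - t else 0)"
  have tC: "t *\<^sub>R z \<in> C" "s *\<^sub>R z \<in> C" using convex_cone_scaleR[OF C _ zC] t by (auto simp: s_def)
  define u where "u = (if t \<le> 1 then 1/2 else 1/t)"
  have "z = (1 - u) *\<^sub>R (s *\<^sub>R z) + u *\<^sub>R (t *\<^sub>R z)"
  proof -
    have "(1 - u) * s + u * t = 1" using False by (auto simp: u_def s_def field_simps)
    then show ?thesis unfolding scaleR_scaleR scaleR_add_left[symmetric] by simp
  qed
  moreover have "0 < u" "u < 1" "s *\<^sub>R z \<noteq> t *\<^sub>R z" using False t by (auto simp: u_def s_def)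
  ultimately have "z \<in> open_segment (s *\<^sub>R z) (t *\<^sub>R z)"
    unfolding in_segment by blast
  then show ?thesis using face_ofD[OF F _ tC(2,1) z] by blast
qed

lemma face_add:
  assumes F: "F face_of C" and C: "convex_cone C" and x: "x \<in> C" and y: "y \<in> C" and z: "x + y \<in> F"
  shows "x \<in> F"
proof -
  have "2 *\<^sub>R x \<in> F"
  proof (cases "x = y")
    case True then show ?thesis using z by (simp add: scaleR_2)
  next
    case False
    have "midpoint (2 *\<^sub>R x) (2 *\<^sub>R y) \<in> open_segment (2 *\<^sub>R x) (2 *\<^sub>R y)" using False by simp
    then have "x + y \<in> open_segment (2 *\<^sub>R x) (2 *\<^sub>R y)"
      by (simp add: midpoint_def scaleR_add_right)
    then show ?thesis using face_ofD[OF F _ _ _ z] convex_cone_scaleR[OF C _ x, of 2] convex_cone_scaleR[OF C _ y, of 2]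
      by simp
  qed
  from face_scaleR[OF F C this, of "1/2"] show ?thesis by simp
qed

lemma face_sum:
  assumes F: "F face_of C" and C: "convex_cone C" and fin: "finite S" and g: "\<And>s. s \<in> S \<Longrightarrow> g s \<in> C"
    and z: "sum g S \<in> F" and s: "s \<in> S"
  shows "g s \<in> F"
proof (rule face_add[OF F C])
  show "g s \<in> C" by (rule g[OF s])
  show "sum g (S - {s}) \<in> C" using fin g by (intro sum_in_convex_cone[OF C]) auto
  show "g s + sum g (S - {s}) \<in> F" using z fin s by (simp add: sum.remove)
qed

text \<open>A cone spanned by part of a linearly independent set is cut out by the functional that
  vanishes on that part and is \<open>1\<close> on the rest.\<close>

lemma subcone_face_of:
  fixes G :: "'a::euclidean_space set"
  assumes ind: "independent G" and H: "H \<subseteq> G"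
  shows "convex_cone hull H face_of convex_cone hull G"
proof -
  have fin: "finite G" using independent_bound[OF ind] by blast
  obtain f :: "'a \<Rightarrow> real" where f: "linear f" "\<forall>x\<in>G. f x = (if x \<in> H then 0 else 1)"
    using linear_independent_extend[OF ind, of "\<lambda>x. if x \<in> H then 0 else 1 :: real"] by (elim exE conjE)
  define a where "a = adjoint f 1"
  have a: "a \<bullet> x = f x" for x using adjoint_works[OF f(1), of x 1] by (simp add: a_def inner_commute)
  have val: "a \<bullet> (\<Sum>s\<in>G. c s *\<^sub>R s) = (\<Sum>s\<in>G - H. c s)" for c
  proof -
    have "a \<bullet> (\<Sum>s\<in>G. c s *\<^sub>R s) = (\<Sum>s\<in>G. c s * (if s \<in> H then 0 else 1))"
      unfolding inner_sum_right using f(2) by (intro sum.cong) (auto simp: a)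
    also have "\<dots> = (\<Sum>s\<in>G - H. c s * (if s \<in> H then 0 else 1))"
      using fin by (intro sum.mono_neutral_right) auto
    also have "\<dots> = (\<Sum>s\<in>G - H. c s)" by (rule sum.cong) auto
    finally show ?thesis .
  qed
  have "convex_cone hull G \<inter> {x. a \<bullet> x = 0} face_of convex_cone hull G"
  proof (rule face_of_Int_supporting_hyperplane_ge[OF convex_convex_cone_hull])
    fix x assume "x \<in> convex_cone hull G"
    then obtain c where "\<forall>s\<in>G. 0 \<le> c s" "x = (\<Sum>s\<in>G. c s *\<^sub>R s)"
      using convex_cone_hull_finite_iff[OF fin] by blast
    then show "0 \<le> a \<bullet> x" using val by (auto intro: sum_nonneg)
  qed
  moreover have "convex_cone hull G \<inter> {x. a \<bullet> x = 0} = convex_cone hull H"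
  proof
    show "convex_cone hull H \<subseteq> convex_cone hull G \<inter> {x. a \<bullet> x = 0}"
    proof
      fix x assume x: "x \<in> convex_cone hull H"
      then obtain c where "x = (\<Sum>s\<in>H. c s *\<^sub>R s)"
        using convex_cone_hull_finite_iff[OF finite_subset[OF H fin]] by blast
      then have "a \<bullet> x = 0" using f(2) H by (auto simp: inner_sum_right a intro!: sum.neutral)
      then show "x \<in> convex_cone hull G \<inter> {x. a \<bullet> x = 0}" using x hull_mono[OF H, of convex_cone] by blast
    qed
    show "convex_cone hull G \<inter> {x. a \<bullet> x = 0} \<subseteq> convex_cone hull H"
    proof
      fix x assume x: "x \<in> convex_cone hull G \<inter> {x. a \<bullet> x = 0}"
      then obtain c where c: "\<forall>s\<in>G. 0 \<le> c s" "x = (\<Sum>s\<in>G. c s *\<^sub>R s)"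
        using convex_cone_hull_finite_iff[OF fin] by blast
      then have "(\<Sum>s\<in>G - H. c s) = 0" using x val by auto
      then have "\<forall>s\<in>G - H. c s = 0" using c(1) fin by (subst (asm) sum_nonneg_eq_0_iff) auto
      then have "x = (\<Sum>s\<in>H. c s *\<^sub>R s)" unfolding c(2) using fin H by (intro sum.mono_neutral_right) auto
      then show "x \<in> convex_cone hull H"
        using convex_cone_hull_finite_iff[OF finite_subset[OF H fin]] c(1) H by blast
    qed
  qed
  ultimately show ?thesis by simp
qed

lemma lattice_basis_primitive:
  assumes B: "lattice_basis B" and b: "b \<in> B"
  shows "primitive b"
proof -
  have ind: "independent B" and lp: "lattice_point b" using B b unfolding lattice_basis_def by auto
  have fin: "finite B" using independent_bound[OF ind] by blast
  have "b \<noteq> 0" using ind b dependent_zero by blast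
  moreover have False if t: "0 < t" "t < 1" and l: "lattice_point (t *\<^sub>R b)" for t :: real
  proof -
    obtain c :: "_ \<Rightarrow> int" where c: "t *\<^sub>R b = (\<Sum>b\<in>B. of_int (c b) *\<^sub>R b)"
      using B l unfolding lattice_basis_def by blast
    have "(\<Sum>b'\<in>B. (of_int (c b') - (if b' = b then t else 0)) *\<^sub>R b') = 0"
      using fin b by (simp add: scaleR_diff_left sum_subtractf c[symmetric] if_distrib[of "\<lambda>c. c *\<^sub>R _"] sum.delta cong: if_cong)
    from independentD[OF ind fin order_refl this b] have "of_int (c b) = t" by simp
    with t have "0 < c b" "c b < 1" by auto
    then show False by simp
  qed
  ultimately show ?thesis using lp unfolding primitive_def by blast
qed

lemma primitive_multiple_eq:
  assumes u: "primitive u" and v: "primitive v" and uv: "u = t *\<^sub>R v" and t: "0 \<le> t"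
  shows "u = v"
proof -
  have t0: "t > 0" using u uv t unfolding primitive_def by (cases "t = 0") auto
  have "\<not> t < 1" using v u uv t0 unfolding primitive_def by blast
  moreover have "\<not> t > 1"
  proof
    assume "t > 1"
    then have "0 < 1/t" "1/t < 1" "v = (1/t) *\<^sub>R u" using uv by auto
    moreover have "lattice_point v" using v unfolding primitive_def by (rule conjunct1)
    ultimately have "0 < 1/t \<and> 1/t < 1 \<and> lattice_point ((1/t) *\<^sub>R u)" by (simp only:)
    moreover have "\<forall>t::real. 0 < t \<and> t < 1 \<longrightarrow> \<not> lattice_point (t *\<^sub>R u)" using u unfolding primitive_def by (elim conjE)
    ultimately show False by blast
  qed
  ultimately have "t = 1" by simp
  then show ?thesis using uv by simp
qed

lemma ray_member: "x \<in> convex_cone hull {v} \<longleftrightarrow> (\<exists>t\<ge>0. x = t *\<^sub>R v)"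
proof -
  have "x \<in> convex_cone hull {v} \<longleftrightarrow> (\<exists>c. 0 \<le> c v \<and> x = c v *\<^sub>R v)"
    by (subst convex_cone_hull_finite_iff) simp_all
  also have "\<dots> \<longleftrightarrow> (\<exists>t\<ge>0. x = t *\<^sub>R v)"
    by (auto intro: exI[of _ "\<lambda>_. _"])
  finally show ?thesis .
qed

text \<open>A nonzero term of a representation of \<open>v\<close> by the generators stays in the face, so its generator
  is a positive multiple of \<open>v\<close>.\<close>

lemma ray_generates_face:
  assumes fin: "finite H" and H: "\<And>h. h \<in> H \<Longrightarrow> primitive h" and v: "primitive v"
    and F: "F face_of convex_cone hull H" and sub: "F \<subseteq> convex_cone hull {v}" and vF: "v \<in> F"
  shows "v \<in> H"
proof -
  obtain c where c: "\<forall>s\<in>H. 0 \<le> c s" "v = (\<Sum>s\<in>H. c s *\<^sub>R s)"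
    using face_of_imp_subset[OF F] vF convex_cone_hull_finite_iff[OF fin, of v] by blast
  have "v \<noteq> 0" using v unfolding primitive_def by blast
  have "\<exists>s\<in>H. c s \<noteq> 0"
  proof (rule ccontr)
    assume "\<not> ?thesis"
    then have "v = 0" unfolding c(2) by (intro sum.neutral) simp
    with \<open>v \<noteq> 0\<close> show False ..
  qed
  then obtain s where s: "s \<in> H" "c s \<noteq> 0" ..
  have "c s *\<^sub>R s \<in> F"
  proof (rule face_sum[OF F convex_cone_convex_cone_hull fin _ _ s(1)])
    show "c s *\<^sub>R s \<in> convex_cone hull H" if "s \<in> H" for s
      using c(1) that hull_inc[of s H] by (intro convex_cone_hull_mul) auto
    show "(\<Sum>s\<in>H. c s *\<^sub>R s) \<in> F" using vF unfolding c(2)[symmetric] .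
  qed
  then have "c s *\<^sub>R s \<in> convex_cone hull {v}" using sub by blast
  then obtain t where t: "t \<ge> 0" "c s *\<^sub>R s = t *\<^sub>R v" using ray_member by blast
  have "s = (1 / c s) *\<^sub>R (c s *\<^sub>R s)" using s(2) by simp
  then have "s = (t / c s) *\<^sub>R v" unfolding t(2) by simp
  moreover have "t / c s \<ge> 0" using t(1) c(1) s(1) by simp
  ultimately have "s = v" by (rule primitive_multiple_eq[OF H[OF s(1)] v])
  then show ?thesis using s(1) by simp
qed

text \<open>The generators of a cone span faces, which belong to the fan; conversely, a ray of the fan that
  lies in the cone is a face of it.\<close>

lemma regular_fan_cone:
  assumes fan: "regular_fan \<Sigma>" and \<sigma>: "\<sigma> \<in> \<Sigma>"
  shows "\<exists>B G. lattice_basis B \<and> G \<subseteq> B \<and> \<sigma> = convex_cone hull G \<and> G = ray_generators \<Sigma> \<inter> \<sigma>"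
proof -
  have "regular_cone \<sigma>" using fan \<sigma> unfolding regular_fan_def by blast
  then obtain B G where B: "lattice_basis B" "G \<subseteq> B" "\<sigma> = convex_cone hull G"
    unfolding regular_cone_def by blast
  have ind: "independent G" using B independent_mono unfolding lattice_basis_def by blast
  have fin: "finite G" using independent_bound[OF ind] by blast
  have "g \<in> ray_generators \<Sigma> \<inter> \<sigma>" if g: "g \<in> G" for g
  proof -
    have "convex_cone hull {g} face_of \<sigma>" unfolding B(3) using subcone_face_of[OF ind, of "{g}"] g by simp
    moreover have "convex_cone hull {g} \<noteq> {}" by (rule convex_cone_hull_nonempty)
    ultimately have "convex_cone hull {g} \<in> \<Sigma>" using fan \<sigma> unfolding regular_fan_def fan_def by blast
    then show ?thesis using lattice_basis_primitive[OF B(1)] B(2,3) g hull_inc[of g G] unfolding ray_generators_def by blast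
  qed
  moreover have "v \<in> G" if v: "v \<in> ray_generators \<Sigma>" "v \<in> \<sigma>" for v
  proof -
    have v': "primitive v" "convex_cone hull {v} \<in> \<Sigma>" using v(1) unfolding ray_generators_def by auto
    have face: "\<sigma> \<inter> convex_cone hull {v} face_of \<sigma>" using fan \<sigma> v'(2) unfolding regular_fan_def fan_def by blast
    show ?thesis
    proof (rule ray_generates_face[OF fin _ v'(1)])
      show "\<sigma> \<inter> convex_cone hull {v} face_of convex_cone hull G" using face B(3) by simp
      show "v \<in> \<sigma> \<inter> convex_cone hull {v}" using v(2) by (simp add: hull_inc)
    qed (use B(1,2) lattice_basis_primitive in auto)
  qed
  ultimately have "G = ray_generators \<Sigma> \<inter> \<sigma>" by blast
  then show ?thesis by (intro exI[of _ B] exI[of _ G] conjI B)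
qed

lemma regular_fan_full_cone:
  fixes \<sigma> :: "'a::euclidean_space set"
  assumes fan: "regular_fan \<Sigma>" and \<sigma>: "\<sigma> \<in> \<Sigma>" and dim: "dim \<sigma> = DIM('a)"
  shows "lattice_basis (ray_generators \<Sigma> \<inter> \<sigma>) \<and> \<sigma> = convex_cone hull (ray_generators \<Sigma> \<inter> \<sigma>)"
proof -
  obtain B G where B: "lattice_basis B" "G \<subseteq> B" "\<sigma> = convex_cone hull G" "G = ray_generators \<Sigma> \<inter> \<sigma>"
    using regular_fan_cone[OF fan \<sigma>] by (elim exE conjE)
  have indB: "independent B" using B unfolding lattice_basis_def by blast
  have ind: "independent G" using indB B(2) independent_mono by blast
  have "convex_cone hull G \<subseteq> span G"
    by (rule hull_minimal) (auto simp: span_superset convex_cone_span)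
  then have "DIM('a) \<le> card G" using dim dim_subset[of \<sigma> "span G"] dim_eq_card_independent[OF ind] B(3) by simp
  then have "G = B" using card_seteq[of B G] B(2) independent_bound[OF indB] by auto
  then show ?thesis using B(1,3) unfolding B(4)[symmetric] by (intro conjI) (simp, assumption)
qed

section \<open>Relations of a semi-positive fan\<close>

lemma relation_functional_eq:
  "l \<in> relation_lattice \<mu> \<Longrightarrow> relation_functional \<mu> \<psi> l = (\<Sum>i\<in>UNIV. of_int (l $ i) * \<psi> (\<mu> i))"
  unfolding relation_functional_def by simp

lemma relation_lattice_parts:
  fixes \<mu> :: "'n::finite \<Rightarrow> 'a::euclidean_space"
  assumes "l \<in> relation_lattice \<mu>"
  shows "(\<Sum>j\<in>UNIV. real_of_int (l $ j)) = 0" "(\<Sum>j\<in>UNIV. of_int (l $ j) *\<^sub>R \<mu> j) = 0"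
  using assms unfolding relation_lattice_def by (simp_all add: sum_prod zero_prod_def)

locale fan_configuration =
  fixes \<mu> :: "'n::finite \<Rightarrow> 'a::euclidean_space" and i0 :: 'n and \<Sigma> :: "'a set set"
  assumes regular: "regular_fan \<Sigma>"
    and support_add: "x \<in> \<Union>\<Sigma> \<Longrightarrow> y \<in> \<Union>\<Sigma> \<Longrightarrow> x + y \<in> \<Union>\<Sigma>"
    and full_cones_cover: "x \<in> \<Union>\<Sigma> \<Longrightarrow> \<exists>\<sigma>\<in>\<Sigma>. dim \<sigma> = DIM('a) \<and> x \<in> \<sigma>"
    and rays: "ray_generators \<Sigma> = \<mu> ` (UNIV - {i0})"
    and inj_points: "inj \<mu>"
    and apex: "\<mu> i0 = 0"
    and semipositive: "c1_semipositive \<Sigma>"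
    and regular_subdivision: "regular_triangulation \<mu> (fan_triangulation \<Sigma>)"
begin

lemma cone_convex: "\<sigma> \<in> \<Sigma> \<Longrightarrow> convex_cone \<sigma>"
  using regular convex_cone_convex_cone_hull unfolding regular_fan_def regular_cone_def by metis

lemma face_in_fan: "\<sigma> \<in> \<Sigma> \<Longrightarrow> F face_of \<sigma> \<Longrightarrow> F \<noteq> {} \<Longrightarrow> F \<in> \<Sigma>"
  using regular unfolding regular_fan_def fan_def by blast

lemma cones_meet: "\<sigma> \<in> \<Sigma> \<Longrightarrow> \<tau> \<in> \<Sigma> \<Longrightarrow> \<sigma> \<inter> \<tau> face_of \<tau>"
  using regular unfolding regular_fan_def fan_def by blast

lemma point_primitive: "j \<noteq> i0 \<Longrightarrow> primitive (\<mu> j)"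
  using rays unfolding ray_generators_def by blast

lemma point_in_support: "\<mu> j \<in> \<Union>\<Sigma>"
proof (cases "j = i0")
  case True
  have "\<Sigma> \<noteq> {}" using regular unfolding regular_fan_def fan_def by (elim conjE)
  then obtain \<sigma> where \<sigma>: "\<sigma> \<in> \<Sigma>" by blast
  then show ?thesis using True apex convex_cone_contains_0[OF cone_convex[OF \<sigma>]] by auto
next
  case False
  then have "\<mu> j \<in> ray_generators \<Sigma>" unfolding rays by blast
  then have "convex_cone hull {\<mu> j} \<in> \<Sigma>" unfolding ray_generators_def by simp
  then show ?thesis using hull_inc[of "\<mu> j" "{\<mu> j}" convex_cone] by blast
qed

lemma support_cone: "convex_cone (\<Union>\<Sigma>)"
  unfolding convex_cone_iff
proof (intro conjI ballI allI impI)
  show "0 \<in> \<Union>\<Sigma>" using point_in_support[of i0] apex by simp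
  show "x + y \<in> \<Union>\<Sigma>" if "x \<in> \<Union>\<Sigma>" "y \<in> \<Union>\<Sigma>" for x y by (rule support_add[OF that])
  show "c *\<^sub>R x \<in> \<Union>\<Sigma>" if x: "x \<in> \<Union>\<Sigma>" and c: "0 \<le> c" for x c
  proof -
    obtain \<sigma> where \<sigma>: "\<sigma> \<in> \<Sigma>" "x \<in> \<sigma>" using x by blast
    then show ?thesis using convex_cone_scaleR[OF cone_convex[OF \<sigma>(1)] c \<sigma>(2)] by blast
  qed
qed

text \<open>The negative part of such a relation expresses, after normalisation, a point of one simplex
  of the triangulation as a convex combination of vertices of that simplex, and the positive part
  expresses the same point as another convex combination; a convex function that is affine on the
  simplex is at least as large on the second one.\<close>

lemma relation_in_dual_cone:
  assumes l: "l \<in> relation_lattice \<mu>" and \<sigma>: "\<sigma> \<in> \<Sigma>" "dim \<sigma> = DIM('a)"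
    and neg: "\<And>j. j \<noteq> i0 \<Longrightarrow> l $ j < 0 \<Longrightarrow> \<mu> j \<in> \<sigma>"
  shows "l \<in> dual_cone_lattice \<mu> (fan_triangulation \<Sigma>)"
proof -
  define \<tau> where "\<tau> = convex hull (insert 0 (ray_generators \<Sigma> \<inter> \<sigma>))"
  have \<tau>: "\<tau> \<in> fan_triangulation \<Sigma>" unfolding fan_triangulation_def \<tau>_def using \<sigma> by blast
  have zero_\<tau>: "0 \<in> \<tau>" unfolding \<tau>_def by (simp add: hull_inc)
  define p where "p j = max 0 (real_of_int (l $ j))" for j
  define n where "n j = max 0 (- real_of_int (l $ j))" for j
  have pn: "real_of_int (l $ j) = p j - n j" for j by (simp add: p_def n_def)
  have pos: "p j \<ge> 0" "n j \<ge> 0" for j by (auto simp: p_def n_def)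
  define s where "s = sum p UNIV"
  have s_n: "sum n UNIV = s" using relation_lattice_parts(1)[OF l] unfolding pn s_def by (simp add: sum_subtractf)
  have eq: "(\<Sum>j\<in>UNIV. p j *\<^sub>R \<mu> j) = (\<Sum>j\<in>UNIV. n j *\<^sub>R \<mu> j)"
    using relation_lattice_parts(2)[OF l] unfolding pn by (simp add: scaleR_diff_left sum_subtractf)
  have "0 \<le> (\<Sum>j\<in>UNIV. of_int (l $ j) * \<psi> (\<mu> j))" if \<psi>: "\<psi> \<in> convex_pl_functions \<mu> (fan_triangulation \<Sigma>)" for \<psi>
  proof (cases "s = 0")
    case True
    then have "p j = 0" "n j = 0" for j
      using s_n pos sum_nonneg_eq_0_iff[of UNIV p] sum_nonneg_eq_0_iff[of UNIV n] unfolding s_def by auto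
    then show ?thesis unfolding pn by simp
  next
    case False
    then have s: "s > 0" using sum_nonneg[of UNIV p] pos(1) unfolding s_def by (simp add: less_le)
    note \<psi>' = \<psi>[unfolded convex_pl_functions_def, THEN CollectD]
    have conv: "convex_on (convex hull range \<mu>) \<psi>" by (rule conjunct1[OF \<psi>'])
    from bspec[OF conjunct2[OF \<psi>'] \<tau>] obtain f c where f: "linear f" and fc': "\<forall>x\<in>\<tau>. \<psi> x = f x + c"
      by (elim exE conjE)
    have fc: "\<psi> x = f x + c" if "x \<in> \<tau>" for x using fc' that by (rule bspec)
    define z where "z j = (if n j = 0 then 0 else \<mu> j)" for j
    have z: "z j \<in> \<tau>" for j
    proof (cases "n j = 0 \<or> j = i0")
      case True then show ?thesis using zero_\<tau> apex by (auto simp: z_def)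
    next
      case False
      then have "l $ j < 0" by (auto simp: n_def max_def split: if_splits)
      then have "\<mu> j \<in> ray_generators \<Sigma> \<inter> \<sigma>" using neg[of j] False unfolding rays by blast
      then show ?thesis unfolding \<tau>_def z_def using False by (simp add: hull_inc)
    qed
    define y where "y = (\<Sum>j\<in>UNIV. (n j / s) *\<^sub>R z j)"
    have nz: "n j *\<^sub>R z j = n j *\<^sub>R \<mu> j" "n j * \<psi> (z j) = n j * \<psi> (\<mu> j)" for j by (auto simp: z_def)
    have "y \<in> \<tau>" unfolding y_def
    proof (rule convex_sum)
      show "convex \<tau>" unfolding \<tau>_def by (rule convex_convex_hull)
      show "(\<Sum>j\<in>UNIV. n j / s) = 1" using s s_n by (simp add: sum_divide_distrib[symmetric])
    qed (use z pos s in auto)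
    have y_p: "y = (\<Sum>j\<in>UNIV. (p j / s) *\<^sub>R \<mu> j)"
    proof -
      have "y = (1 / s) *\<^sub>R (\<Sum>j\<in>UNIV. n j *\<^sub>R z j)" unfolding y_def by (simp add: scaleR_sum_right)
      also have "\<dots> = (1 / s) *\<^sub>R (\<Sum>j\<in>UNIV. p j *\<^sub>R \<mu> j)" unfolding eq nz ..
      finally show ?thesis by (simp add: scaleR_sum_right)
    qed
    have "(\<Sum>j\<in>UNIV. (n j / s) * \<psi> (z j)) = (\<Sum>j\<in>UNIV. (n j / s) * (f (z j) + c))"
      by (simp only: fc[OF z])
    also have "\<dots> = f y + c"
    proof -
      have "f y = (\<Sum>j\<in>UNIV. (n j / s) * f (z j))"
        unfolding y_def linear_sum[OF f] linear_scale[OF f] by simp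
      moreover have "(\<Sum>j\<in>UNIV. (n j / s) * c) = c"
        using s s_n by (simp add: sum_distrib_right[symmetric] sum_divide_distrib[symmetric])
      ultimately show ?thesis by (simp only: distrib_left sum.distrib)
    qed
    also have "\<dots> = \<psi> y" by (rule fc[OF \<open>y \<in> \<tau>\<close>, symmetric])
    also have "\<psi> y \<le> (\<Sum>j\<in>UNIV. (p j / s) * \<psi> (\<mu> j))" unfolding y_p
    proof (rule convex_on_sum[OF _ _ conv])
      show "(\<Sum>j\<in>UNIV. p j / s) = 1" using s by (simp add: sum_divide_distrib[symmetric] s_def)
    qed (use pos s in \<open>auto simp: hull_inc\<close>)
    finally have "(\<Sum>j\<in>UNIV. n j * \<psi> (z j)) / s \<le> (\<Sum>j\<in>UNIV. p j * \<psi> (\<mu> j)) / s"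
      by (simp add: sum_divide_distrib)
    then have "(\<Sum>j\<in>UNIV. n j * \<psi> (\<mu> j)) \<le> (\<Sum>j\<in>UNIV. p j * \<psi> (\<mu> j))"
      using s unfolding nz by (simp add: divide_le_cancel)
    then show ?thesis unfolding pn by (simp add: left_diff_distrib sum_subtractf)
  qed
  then show ?thesis using l unfolding dual_cone_lattice_def pl_cone_def by (auto simp: relation_functional_eq)
qed

text \<open>The sum of the points of the face lies in some maximal cone; since cones meet along faces, so do
  all points of the face.\<close>

lemma face_relation_in_dual_cone:
  assumes l: "l \<in> relation_lattice \<mu>" and S: "convex_cone hull (\<mu> ` S) \<in> \<Sigma>"
    and neg: "{j. j \<noteq> i0 \<and> l $ j < 0} \<subseteq> S"
  shows "l \<in> dual_cone_lattice \<mu> (fan_triangulation \<Sigma>)"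
proof -
  let ?C = "convex_cone hull (\<mu> ` S)"
  have C: "convex_cone ?C" by (rule convex_cone_convex_cone_hull)
  have mem: "\<mu> j \<in> ?C" if "j \<in> S" for j using that by (simp add: hull_inc)
  have x: "(\<Sum>j\<in>S. \<mu> j) \<in> ?C" by (rule sum_in_convex_cone[OF C]) (auto simp: mem)
  then obtain \<sigma> where \<sigma>: "\<sigma> \<in> \<Sigma>" "dim \<sigma> = DIM('a)" "(\<Sum>j\<in>S. \<mu> j) \<in> \<sigma>"
    using full_cones_cover S by blast
  have "\<mu> j \<in> \<sigma> \<inter> ?C" if "j \<in> S" for j
    by (rule face_sum[OF cones_meet[OF \<sigma>(1) S] C _ mem _ that]) (use \<sigma>(3) x in auto)
  then show ?thesis using neg by (intro relation_in_dual_cone[OF l \<sigma>(1,2)]) auto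
qed

text \<open>The function given by semi-positivity is positively homogeneous, and so its subadditivity makes it
  one of the convex piecewise linear functions of the triangulation.\<close>

lemma support_function:
  "\<exists>\<alpha> :: 'a \<Rightarrow> real. (\<forall>\<sigma>\<in>\<Sigma>. \<exists>f. linear f \<and> (\<forall>x\<in>\<sigma>. \<alpha> x = f x)) \<and>
    (\<forall>j. j \<noteq> i0 \<longrightarrow> \<alpha> (\<mu> j) = 1) \<and> \<alpha> 0 = 0 \<and>
    (\<forall>x\<in>\<Union>\<Sigma>. \<forall>y\<in>\<Union>\<Sigma>. \<alpha> (x + y) \<le> \<alpha> x + \<alpha> y) \<and>
    \<alpha> \<in> convex_pl_functions \<mu> (fan_triangulation \<Sigma>)"
proof -
  from semipositive obtain \<alpha> :: "'a \<Rightarrow> real" where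
    lin': "\<forall>\<sigma>\<in>\<Sigma>. \<exists>f. linear f \<and> (\<forall>x\<in>\<sigma>. \<alpha> x = f x)" and one: "\<forall>v\<in>ray_generators \<Sigma>. \<alpha> v = 1"
    and sub': "\<forall>x\<in>\<Union>\<Sigma>. \<forall>y\<in>\<Union>\<Sigma>. \<alpha> (x + y) \<le> \<alpha> x + \<alpha> y"
    unfolding c1_semipositive_def by (elim exE conjE)
  note lin = bspec[OF lin'] and sub = bspec[OF bspec[OF sub']]
  have scale: "\<alpha> (c *\<^sub>R x) = c * \<alpha> x" if x: "x \<in> \<Union>\<Sigma>" and c: "0 \<le> c" for c x
  proof -
    obtain \<sigma> where \<sigma>: "\<sigma> \<in> \<Sigma>" "x \<in> \<sigma>" using x by blast
    obtain f where f: "linear f" "\<forall>x\<in>\<sigma>. \<alpha> x = f x" using lin[OF \<sigma>(1)] by (elim exE conjE)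
    then show ?thesis using \<sigma>(2) convex_cone_scaleR[OF cone_convex[OF \<sigma>(1)] c \<sigma>(2)] by (simp add: linear_scale)
  qed
  have zero: "0 \<in> \<Union>\<Sigma>" by (rule convex_cone_contains_0[OF support_cone])
  have hull: "convex hull range \<mu> \<subseteq> \<Union>\<Sigma>"
    using point_in_support support_cone by (intro hull_minimal) (auto simp: convex_cone_def)
  have "convex_on (convex hull range \<mu>) \<alpha>"
    unfolding convex_on_def
  proof (intro conjI ballI allI impI)
    fix x y and u v :: real
    assume "x \<in> convex hull range \<mu>" "y \<in> convex hull range \<mu>" and uv: "0 \<le> u" "0 \<le> v" "u + v = 1"
    then have xy: "x \<in> \<Union>\<Sigma>" "y \<in> \<Union>\<Sigma>" using hull by auto
    have "\<alpha> (u *\<^sub>R x + v *\<^sub>R y) \<le> \<alpha> (u *\<^sub>R x) + \<alpha> (v *\<^sub>R y)"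
      using convex_cone_scaleR[OF support_cone] xy uv by (intro sub)
    then show "\<alpha> (u *\<^sub>R x + v *\<^sub>R y) \<le> u * \<alpha> x + v * \<alpha> y"
      by (simp only: scale[OF xy(1) uv(1)] scale[OF xy(2) uv(2)])
  qed (rule convex_convex_hull)
  moreover have "\<exists>f c. linear f \<and> (\<forall>x\<in>\<tau>. \<alpha> x = f x + c)" if tri: "\<tau> \<in> fan_triangulation \<Sigma>" for \<tau>
  proof -
    obtain \<sigma> where \<sigma>: "\<sigma> \<in> \<Sigma>" "\<tau> = convex hull (insert 0 (ray_generators \<Sigma> \<inter> \<sigma>))"
      using tri unfolding fan_triangulation_def by blast
    have sub\<sigma>: "\<tau> \<subseteq> \<sigma>" unfolding \<sigma>(2) using cone_convex[OF \<sigma>(1)] convex_cone_contains_0[OF cone_convex[OF \<sigma>(1)]]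
      by (intro hull_minimal) (auto simp: convex_cone_def)
    obtain f where f: "linear f" "\<forall>x\<in>\<sigma>. \<alpha> x = f x" using lin[OF \<sigma>(1)] by (elim exE conjE)
    have "\<forall>x\<in>\<tau>. \<alpha> x = f x + 0" using f(2) sub\<sigma> by auto
    with f(1) show ?thesis by (intro exI[of _ f] exI[of _ 0] conjI)
  qed
  ultimately have "\<alpha> \<in> convex_pl_functions \<mu> (fan_triangulation \<Sigma>)"
    unfolding convex_pl_functions_def by (intro CollectI conjI ballI)
  moreover have "\<alpha> 0 = 0" using scale[OF zero, of 0] by simp
  moreover have "\<alpha> (\<mu> j) = 1" if "j \<noteq> i0" for j using one that unfolding rays by blast
  ultimately show ?thesis using lin' sub' by (intro exI[of _ \<alpha>] conjI allI impI)
qed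

text \<open>The functional of the support function is minus the apex coordinate, as the coordinates of a
  relation sum to \<open>0\<close>.\<close>

lemma dual_cone_apex:
  assumes l: "l \<in> dual_cone_lattice \<mu> (fan_triangulation \<Sigma>)"
  shows "l $ i0 \<le> 0"
proof -
  have L: "l \<in> relation_lattice \<mu>" using l unfolding dual_cone_lattice_def by blast
  from support_function obtain \<alpha> where \<alpha>: "\<forall>j. j \<noteq> i0 \<longrightarrow> \<alpha> (\<mu> j) = 1" "\<alpha> 0 = (0::real)"
    "\<alpha> \<in> convex_pl_functions \<mu> (fan_triangulation \<Sigma>)" by (elim exE conjE)
  have "0 \<le> relation_functional \<mu> \<alpha> l" using l \<alpha>(3) unfolding dual_cone_lattice_def pl_cone_def by auto
  also have "\<dots> = (\<Sum>j\<in>UNIV - {i0}. of_int (l $ j))"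
    unfolding relation_functional_eq[OF L] using \<alpha>(1,2) apex by (subst sum.remove[of _ i0]) (auto intro: sum.cong)
  also have "\<dots> = - of_int (l $ i0)"
    using relation_lattice_parts(1)[OF L] by (subst (asm) sum.remove[of _ i0]) (auto simp: add_eq_0_iff)
  finally show ?thesis by simp
qed

text \<open>Each coordinate function on relations is a difference of two functionals that are nonnegative
  on the summation range, so their sum dominates its absolute value.\<close>

lemma dual_cone_height:
  "\<exists>\<psi> :: 'n \<Rightarrow> real. \<forall>l\<in>dual_cone_lattice \<mu> (fan_triangulation \<Sigma>).
     (\<Sum>j\<in>UNIV. \<bar>real_of_int (l $ j)\<bar>) \<le> (\<Sum>j\<in>UNIV. of_int (l $ j) * \<psi> j)"
proof -
  let ?A = "dual_cone_lattice \<mu> (fan_triangulation \<Sigma>)"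
  have "\<exists>g :: 'n \<Rightarrow> real. \<forall>l\<in>?A. \<bar>real_of_int (l $ i)\<bar> \<le> (\<Sum>j\<in>UNIV. of_int (l $ j) * g j)" for i
  proof -
    define \<phi> where "\<phi> l = (if l \<in> relation_lattice \<mu> then real_of_int (l $ i) else 0)" for l
    have "l + l' \<in> relation_lattice \<mu>" if "l \<in> relation_lattice \<mu>" "l' \<in> relation_lattice \<mu>" for l l'
      using that unfolding relation_lattice_def
      by (simp del: scaleR_Pair add: scaleR_add_left sum.distrib)
    then have "\<phi> \<in> relation_dual \<mu>" unfolding relation_dual_def \<phi>_def by auto
    from bspec[OF regular_subdivision[unfolded regular_triangulation_def] this]
    obtain \<phi>1 \<phi>2 where \<phi>12: "\<phi>1 \<in> pl_cone \<mu> (fan_triangulation \<Sigma>)" "\<phi>2 \<in> pl_cone \<mu> (fan_triangulation \<Sigma>)"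
      "\<phi> = (\<lambda>l. \<phi>1 l - \<phi>2 l)" by (elim bexE)
    obtain \<psi>1 where \<psi>1: "\<phi>1 = relation_functional \<mu> \<psi>1" using \<phi>12(1) unfolding pl_cone_def by (elim imageE)
    obtain \<psi>2 where \<psi>2: "\<phi>2 = relation_functional \<mu> \<psi>2" using \<phi>12(2) unfolding pl_cone_def by (elim imageE)
    have "\<bar>real_of_int (l $ i)\<bar> \<le> (\<Sum>j\<in>UNIV. of_int (l $ j) * (\<psi>1 (\<mu> j) + \<psi>2 (\<mu> j)))" if l: "l \<in> ?A" for l
    proof -
      have L: "l \<in> relation_lattice \<mu>" and nn: "0 \<le> \<phi>1 l" "0 \<le> \<phi>2 l" using l \<phi>12(1,2) unfolding dual_cone_lattice_def by auto
      have "real_of_int (l $ i) = \<phi>1 l - \<phi>2 l" using fun_cong[OF \<phi>12(3), of l] L by (simp add: \<phi>_def)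
      then have "\<bar>real_of_int (l $ i)\<bar> \<le> \<phi>1 l + \<phi>2 l" using nn by linarith
      also have "\<dots> = (\<Sum>j\<in>UNIV. of_int (l $ j) * (\<psi>1 (\<mu> j) + \<psi>2 (\<mu> j)))"
        unfolding \<psi>1 \<psi>2 relation_functional_eq[OF L] by (simp add: distrib_left sum.distrib)
      finally show ?thesis .
    qed
    then show ?thesis by (intro exI[of _ "\<lambda>j. \<psi>1 (\<mu> j) + \<psi>2 (\<mu> j)"] ballI)
  qed
  then have "\<forall>i. \<exists>g :: 'n \<Rightarrow> real. \<forall>l\<in>?A. \<bar>real_of_int (l $ i)\<bar> \<le> (\<Sum>j\<in>UNIV. of_int (l $ j) * g j)" ..
  from choice[OF this] obtain G :: "'n \<Rightarrow> 'n \<Rightarrow> real" where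
    G: "\<forall>i. \<forall>l\<in>?A. \<bar>real_of_int (l $ i)\<bar> \<le> (\<Sum>j\<in>UNIV. of_int (l $ j) * G i j)" ..
  have "(\<Sum>i\<in>UNIV. \<bar>real_of_int (l $ i)\<bar>) \<le> (\<Sum>j\<in>UNIV. of_int (l $ j) * (\<Sum>i\<in>UNIV. G i j))" if "l \<in> ?A" for l
  proof -
    have "(\<Sum>i\<in>UNIV. \<bar>real_of_int (l $ i)\<bar>) \<le> (\<Sum>i\<in>UNIV. \<Sum>j\<in>UNIV. of_int (l $ j) * G i j)"
      using G that by (intro sum_mono) blast
    also have "\<dots> = (\<Sum>j\<in>UNIV. of_int (l $ j) * (\<Sum>i\<in>UNIV. G i j))"
      unfolding sum_distrib_left by (rule sum.swap)
    finally show ?thesis .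
  qed
  then show ?thesis by (intro exI[of _ "\<lambda>j. \<Sum>i\<in>UNIV. G i j"] ballI)
qed

lemma cone_generators_independent: "\<sigma> \<in> \<Sigma> \<Longrightarrow> independent (ray_generators \<Sigma> \<inter> \<sigma>)"
proof -
  assume "\<sigma> \<in> \<Sigma>"
  from regular_fan_cone[OF regular this] obtain B G where
    "lattice_basis B" "G \<subseteq> B" "G = ray_generators \<Sigma> \<inter> \<sigma>" by (elim exE conjE)
  then show ?thesis using independent_mono[of B G] unfolding lattice_basis_def by metis
qed

lemma points_of_face_dual:
  assumes S: "i0 \<notin> S" "convex_cone hull (\<mu> ` S) \<in> \<Sigma>" and j: "j \<in> S"
  shows "\<exists>e. \<mu> j \<bullet> e = 1 \<and> (\<forall>i\<in>S - {j}. \<mu> i \<bullet> e = 0)"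
proof -
  have "\<mu> ` S \<subseteq> ray_generators \<Sigma> \<inter> convex_cone hull (\<mu> ` S)" using S(1) unfolding rays by (auto simp: hull_inc)
  then have ind: "independent (\<mu> ` S)" using cone_generators_independent[OF S(2)] independent_mono by blast
  obtain f :: "'a \<Rightarrow> real" where f: "linear f" "\<forall>x\<in>\<mu> ` S. f x = (if x = \<mu> j then 1 else 0)"
    using linear_independent_extend[OF ind, of "\<lambda>x. if x = \<mu> j then 1 else 0 :: real"] by (elim exE conjE)
  have "\<mu> i \<bullet> adjoint f 1 = (if i = j then 1 else 0)" if "i \<in> S" for i
    using adjoint_works[OF f(1), of "\<mu> i" 1] f(2) that inj_points by (auto simp: inj_eq)
  then show ?thesis using j by (intro exI[of _ "adjoint f 1"]) auto
qed

text \<open>The sum of the points of a non-face lies in some maximal cone, where it is a nonnegative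
  integral combination of the generators; semi-positivity bounds the total weight of that
  combination, and the point \<open>0\<close> takes up the difference.\<close>

lemma nonface_relation_exists:
  assumes S: "i0 \<notin> S" "convex_cone hull (\<mu> ` S) \<notin> \<Sigma>"
  shows "\<exists>m :: 'n \<Rightarrow> nat. (\<chi> j. of_bool (j \<in> S) - int (m j)) \<in> dual_cone_lattice \<mu> (fan_triangulation \<Sigma>) - {0}"
proof -
  define x where "x = (\<Sum>j\<in>S. \<mu> j)"
  have sup: "(\<Sum>j\<in>F. \<mu> j) \<in> \<Union>\<Sigma>" for F by (rule sum_in_convex_cone[OF support_cone finite_class.finite point_in_support])
  obtain \<sigma> where \<sigma>: "\<sigma> \<in> \<Sigma>" "dim \<sigma> = DIM('a)" "x \<in> \<sigma>" using full_cones_cover[OF sup[of S]] unfolding x_def by blast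
  define G where "G = ray_generators \<Sigma> \<inter> \<sigma>"
  have basis: "lattice_basis G" and hullG: "\<sigma> = convex_cone hull G"
    using regular_fan_full_cone[OF regular \<sigma>(1,2)] unfolding G_def by auto
  have ind: "independent G" using basis unfolding lattice_basis_def by blast
  have fin: "finite G" using independent_bound[OF ind] by blast
  have "lattice_point (\<Sum>j\<in>S. \<mu> j)"
    unfolding lattice_point_def inner_sum_left
  proof (intro ballI Ints_sum)
    fix e :: 'a and j assume "e \<in> Basis" "j \<in> S"
    then show "\<mu> j \<bullet> e \<in> \<int>"
      using point_primitive[of j] S(1) unfolding primitive_def lattice_point_def by blast
  qed
  then obtain c :: "'a \<Rightarrow> int" where c: "x = (\<Sum>g\<in>G. of_int (c g) *\<^sub>R g)"
    using basis unfolding lattice_basis_def x_def by blast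
  obtain d where d: "\<forall>g\<in>G. 0 \<le> d g" "x = (\<Sum>g\<in>G. d g *\<^sub>R g)"
    using \<sigma>(3) convex_cone_hull_finite_iff[OF fin, of x] unfolding hullG by blast
  have "(\<Sum>g\<in>G. (of_int (c g) - d g) *\<^sub>R g) = 0" by (simp add: scaleR_diff_left sum_subtractf c[symmetric] d(2)[symmetric])
  then have cd: "of_int (c g) = d g" if "g \<in> G" for g using independentD[OF ind fin order_refl _ that, of "\<lambda>g. of_int (c g) - d g"] by simp
  define k where "k g = nat (c g)" for g
  have k: "real (k g) = d g" if "g \<in> G" for g
  proof -
    have "c g \<ge> 0" using cd[OF that] d(1) that by (metis of_int_0_le_iff)
    then show ?thesis using cd[OF that] by (simp add: k_def)
  qed
  have x: "x = (\<Sum>g\<in>G. real (k g) *\<^sub>R g)" unfolding d(2) by (rule sum.cong) (auto simp: k)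
  from support_function obtain \<alpha> where \<alpha>: "\<forall>\<sigma>\<in>\<Sigma>. \<exists>f. linear f \<and> (\<forall>x\<in>\<sigma>. \<alpha> x = f x)"
    "\<forall>j. j \<noteq> i0 \<longrightarrow> \<alpha> (\<mu> j) = 1" "\<alpha> 0 = (0::real)"
    "\<forall>x\<in>\<Union>\<Sigma>. \<forall>y\<in>\<Union>\<Sigma>. \<alpha> (x + y) \<le> \<alpha> x + \<alpha> y" by (elim exE conjE)
  obtain f where f: "linear f" "\<forall>x\<in>\<sigma>. \<alpha> x = f x" using bspec[OF \<alpha>(1) \<sigma>(1)] by (elim exE conjE)
  have G_points: "G \<subseteq> \<mu> ` (UNIV - {i0})" unfolding G_def rays by blast
  have "f g = 1" if g: "g \<in> G" for g
  proof -
    obtain j where "g = \<mu> j" "j \<noteq> i0" using g G_points by blast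
    then have "\<alpha> g = 1" using \<alpha>(2) by simp
    then show ?thesis using f(2) g unfolding G_def by simp
  qed
  then have "\<alpha> x = (\<Sum>g\<in>G. real (k g))"
    using f(2) \<sigma>(3) by (simp add: x linear_sum[OF f(1)] linear_scale[OF f(1)])
  moreover have "\<alpha> (\<Sum>j\<in>F. \<mu> j) \<le> real (card F)" if "F \<subseteq> S" for F
    using finite_subset[OF that finite_class.finite] that
  proof (induction F rule: finite_induct)
    case empty then show ?case by (simp add: \<alpha>(3))
  next
    case (insert j F)
    have "\<alpha> (\<mu> j + (\<Sum>j\<in>F. \<mu> j)) \<le> \<alpha> (\<mu> j) + \<alpha> (\<Sum>j\<in>F. \<mu> j)" by (rule bspec[OF bspec[OF \<alpha>(4) point_in_support] sup])
    moreover have "\<alpha> (\<mu> j) = 1" using insert.prems S(1) \<alpha>(2) by auto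
    ultimately show ?case using insert by simp
  qed
  from this[OF order_refl] have "\<alpha> x \<le> real (card S)" unfolding x_def .
  ultimately have "real (\<Sum>g\<in>G. k g) \<le> real (card S)" by simp
  then have le: "(\<Sum>g\<in>G. k g) \<le> card S" by (simp only: of_nat_le_iff)
  define m where "m j = (if j = i0 then card S - (\<Sum>g\<in>G. k g) else if \<mu> j \<in> G then k (\<mu> j) else 0)" for j
  define P where "P = {j. \<mu> j \<in> G}"
  have bij: "bij_betw \<mu> P G" unfolding bij_betw_def P_def using G_points inj_points by (auto simp: inj_on_def)
  have P0: "i0 \<notin> P" using ind dependent_zero apex unfolding P_def by auto
  have m_P: "m j = k (\<mu> j)" if "j \<in> P" for j using that P0 unfolding m_def P_def by auto
  have m_out: "m j = 0" if "j \<notin> P" "j \<noteq> i0" for j using that unfolding m_def P_def by auto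
  define l :: "int^'n" where "l = (\<chi> j. of_bool (j \<in> S) - int (m j))"
  have "(\<Sum>j\<in>UNIV. m j) = m i0 + (\<Sum>j\<in>UNIV - {i0}. m j)" by (simp add: sum.remove)
  also have "(\<Sum>j\<in>UNIV - {i0}. m j) = (\<Sum>j\<in>P. k (\<mu> j))"
    using P0 m_out by (subst sum.mono_neutral_right[of _ P]) (auto simp: m_P)
  also have "\<dots> = (\<Sum>g\<in>G. k g)" by (rule sum.reindex_bij_betw[OF bij])
  finally have sum_m: "(\<Sum>j\<in>UNIV. m j) = card S" using le by (simp add: m_def)
  have "(\<Sum>j\<in>UNIV. real (m j) *\<^sub>R \<mu> j) = (\<Sum>j\<in>P. real (k (\<mu> j)) *\<^sub>R \<mu> j)"
    using P0 m_out apex by (subst sum.mono_neutral_right[of _ P]) (auto simp: m_P)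
  also have "\<dots> = (\<Sum>g\<in>G. real (k g) *\<^sub>R g)" by (rule sum.reindex_bij_betw[OF bij])
  finally have sum_m\<mu>: "(\<Sum>j\<in>UNIV. real (m j) *\<^sub>R \<mu> j) = x" by (simp only: x)
  have lj: "real_of_int (l $ j) = of_bool (j \<in> S) - real (m j)" for j by (simp add: l_def)
  have "(\<Sum>j\<in>UNIV. real_of_int (l $ j) *\<^sub>R (1::real, \<mu> j)) = 0"
  proof -
    have a: "(\<Sum>j\<in>UNIV. real_of_int (l $ j)) = 0"
      unfolding lj sum_subtractf of_nat_sum[symmetric] sum_m by simp
    have "(\<Sum>j\<in>UNIV. of_bool (j \<in> S) *\<^sub>R \<mu> j) = x"
      unfolding x_def by (subst sum.mono_neutral_right[of UNIV S]) auto
    then have b: "(\<Sum>j\<in>UNIV. real_of_int (l $ j) *\<^sub>R \<mu> j) = 0"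
      unfolding lj scaleR_diff_left sum_subtractf sum_m\<mu> by simp
    show ?thesis using a b by (simp add: sum_prod zero_prod_def)
  qed
  then have L: "l \<in> relation_lattice \<mu>" unfolding relation_lattice_def by blast
  have "l \<in> dual_cone_lattice \<mu> (fan_triangulation \<Sigma>)"
  proof (rule relation_in_dual_cone[OF L \<sigma>(1,2)])
    fix j assume "j \<noteq> i0" "l $ j < 0"
    then have "j \<in> P" using m_out[of j] by (cases "j \<in> P") (auto simp: l_def of_bool_def split: if_splits)
    then show "\<mu> j \<in> \<sigma>" unfolding P_def G_def by blast
  qed
  moreover have "l \<noteq> 0"
  proof
    assume "l = 0"
    then have "m j = of_bool (j \<in> S)" for j using lj[of j] by (cases "j \<in> S") auto
    then have "j \<in> P" if "j \<in> S" for j using that m_out[of j] S(1) by force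
    then have "\<mu> ` S \<subseteq> G" unfolding P_def by blast
    then have "convex_cone hull (\<mu> ` S) face_of \<sigma>" unfolding hullG by (rule subcone_face_of[OF ind])
    then show False using face_in_fan[OF \<sigma>(1)] convex_cone_hull_nonempty S(2) by blast
  qed
  ultimately show ?thesis unfolding l_def by blast
qed

theorem toric_data_exists:
  "\<exists>\<psi>. toric_data \<mu> i0 {S. i0 \<notin> S \<and> convex_cone hull (\<mu> ` S) \<notin> \<Sigma>}
     (dual_cone_lattice \<mu> (fan_triangulation \<Sigma>)) \<psi>"
proof -
  from dual_cone_height obtain \<psi> where \<psi>: "\<forall>l\<in>dual_cone_lattice \<mu> (fan_triangulation \<Sigma>).
     (\<Sum>j\<in>UNIV. \<bar>real_of_int (l $ j)\<bar>) \<le> (\<Sum>j\<in>UNIV. of_int (l $ j) * \<psi> j)" ..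
  have "toric_data \<mu> i0 {S. i0 \<notin> S \<and> convex_cone hull (\<mu> ` S) \<notin> \<Sigma>}
     (dual_cone_lattice \<mu> (fan_triangulation \<Sigma>)) \<psi>"
  proof
    show "\<mu> i0 = 0" by (rule apex)
    show "dual_cone_lattice \<mu> (fan_triangulation \<Sigma>) \<subseteq> relation_lattice \<mu>" unfolding dual_cone_lattice_def by blast
    show "0 \<in> dual_cone_lattice \<mu> (fan_triangulation \<Sigma>)"
    proof -
      have 0: "0 \<in> relation_lattice \<mu>" unfolding relation_lattice_def
        by (intro CollectI sum.neutral ballI) (simp only: zero_index of_int_0 scaleR_zero_left)
      then show ?thesis unfolding dual_cone_lattice_def pl_cone_def by (auto simp: relation_functional_eq)
    qed
    show "l $ i0 \<le> 0" if "l \<in> dual_cone_lattice \<mu> (fan_triangulation \<Sigma>)" for l by (rule dual_cone_apex[OF that])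
    show "l \<in> dual_cone_lattice \<mu> (fan_triangulation \<Sigma>)"
      if "l \<in> relation_lattice \<mu>" "i0 \<notin> S" "S \<notin> {S. i0 \<notin> S \<and> convex_cone hull (\<mu> ` S) \<notin> \<Sigma>}"
        "{j. j \<noteq> i0 \<and> l $ j < 0} \<subseteq> S" for l S
      using that by (intro face_relation_in_dual_cone[of l S]) auto
    show "i0 \<notin> S" if "S \<in> {S. i0 \<notin> S \<and> convex_cone hull (\<mu> ` S) \<notin> \<Sigma>}" for S using that by blast
    show "\<exists>m :: 'n \<Rightarrow> nat. (\<chi> j. of_bool (j \<in> S) - int (m j)) \<in> dual_cone_lattice \<mu> (fan_triangulation \<Sigma>) - {0}"
      if "S \<in> {S. i0 \<notin> S \<and> convex_cone hull (\<mu> ` S) \<notin> \<Sigma>}" for S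
      using that by (intro nonface_relation_exists) auto
    show "(\<Sum>j\<in>UNIV. \<bar>real_of_int (l $ j)\<bar>) \<le> (\<Sum>j\<in>UNIV. of_int (l $ j) * \<psi> j)"
      if "l \<in> dual_cone_lattice \<mu> (fan_triangulation \<Sigma>)" for l using \<psi> that by blast
    show "\<exists>e. \<mu> j \<bullet> e = 1 \<and> (\<forall>i\<in>S - {j}. \<mu> i \<bullet> e = 0)"
      if "i0 \<notin> S" "S \<notin> {S. i0 \<notin> S \<and> convex_cone hull (\<mu> ` S) \<notin> \<Sigma>}" "j \<in> S" for S j
      using that by (intro points_of_face_dual) auto
  qed
  then show ?thesis by (intro exI[of _ \<psi>])
qed

end

section \<open>The enhanced fan\<close>

lemma lattice_point_Pair: "lattice_point (x, y) \<longleftrightarrow> lattice_point x \<and> lattice_point y"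
  unfolding lattice_point_def Basis_prod_def ball_Un by simp

lemma lattice_point_real: "lattice_point (r :: real) \<longleftrightarrow> r \<in> \<int>"
  unfolding lattice_point_def by simp

lemma primitive_embed: "primitive v \<Longrightarrow> primitive (v, 0 :: real)"
  unfolding primitive_def by (simp add: lattice_point_Pair lattice_point_real zero_prod_def)

lemma primitive_height_one:
  assumes "lattice_point x"
  shows "primitive (x, 1 :: real)"
proof -
  have False if t: "0 < t" "t < 1" "t \<in> \<int>" for t :: real
  proof -
    obtain k where "t = of_int k" using t(3) by (rule Ints_cases)
    then have "0 < k" "k < 1" using t by auto
    then show False by simp
  qed
  then show ?thesis using assms unfolding primitive_def
    by (auto simp: lattice_point_Pair lattice_point_real zero_prod_def)
qed

locale enhanced_fan_setting =
  fixes \<Delta> :: "(real^4) set" and q :: "real^4 \<Rightarrow> int" and \<Sigma> :: "(real^4) set set"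
  assumes regular_base: "regular_fan \<Sigma>"
    and complete_base: "complete_fan \<Sigma>"
    and base_rays: "ray_generators \<Sigma> = lattice_points \<Delta> - {0}"
    and regular_enhanced: "regular_fan (enhanced_fan \<Delta> q \<Sigma>)"
begin

abbreviation "w \<equiv> w1 \<Delta> q"
abbreviation "emb \<equiv> (\<lambda>v :: real^4. (v, 0 :: real))"
abbreviation "K \<equiv> cone_over_fan \<Sigma> w"
abbreviation "E \<equiv> enhanced_fan \<Delta> q \<Sigma>"

text \<open>A linearly independent set of generators of the cone over \<open>\<sigma>\<close>, in place of all points of \<open>\<sigma>\<close>.\<close>

definition gens :: "(real^4) set \<Rightarrow> ((real^4) \<times> real) set" where
  "gens \<sigma> = insert w (emb ` (ray_generators \<Sigma> \<inter> \<sigma>))"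

lemma linear_embed: "linear emb" "inj emb"
  by (auto intro!: linearI simp: inj_def)

lemma snd_w: "snd w = 1" by (simp add: w1_def)

lemma snd_w0: "snd w0 = 1" by (simp add: w0_def)

lemma primitive_w0: "primitive w0"
  unfolding w0_def by (rule primitive_height_one) (simp add: lattice_point_def)

lemma primitive_w: "primitive w"
  unfolding w1_def
proof (rule primitive_height_one)
  show "lattice_point (\<Sum>v\<in>lattice_points \<Delta>. of_int (q v) *\<^sub>R v)"
    unfolding lattice_point_def inner_sum_left inner_scaleR_left
    by (intro ballI Ints_sum Ints_mult Ints_of_int) (auto simp: lattice_points_def lattice_point_def)
qed

lemma base_cone:
  assumes "\<sigma> \<in> \<Sigma>"
  shows "independent (ray_generators \<Sigma> \<inter> \<sigma>)" "\<sigma> = convex_cone hull (ray_generators \<Sigma> \<inter> \<sigma>)"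
proof -
  from regular_fan_cone[OF regular_base assms] obtain B G where
    B: "lattice_basis B" "G \<subseteq> B" "\<sigma> = convex_cone hull G" and G: "G = ray_generators \<Sigma> \<inter> \<sigma>" by (elim exE conjE)
  show "\<sigma> = convex_cone hull (ray_generators \<Sigma> \<inter> \<sigma>)" using B(3) unfolding G[symmetric] .
  show "independent (ray_generators \<Sigma> \<inter> \<sigma>)"
    using B(1) independent_mono[OF _ B(2)] unfolding G[symmetric] lattice_basis_def by blast
qed

lemma gens_independent:
  assumes "\<sigma> \<in> \<Sigma>" shows "independent (gens \<sigma>)"
proof -
  let ?G = "emb ` (ray_generators \<Sigma> \<inter> \<sigma>)"
  have "independent ?G"
    by (rule linear_independent_injective_image[OF linear_embed(1) base_cone(1)[OF assms]])
       (simp add: inj_on_def)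
  moreover have "w \<notin> span ?G"
  proof
    assume "w \<in> span ?G"
    moreover have "span ?G \<subseteq> {x. snd x = 0}" by (rule span_minimal) (auto simp: subspace_def)
    ultimately show False using snd_w by auto
  qed
  ultimately show ?thesis unfolding gens_def by (rule independent_insertI[rotated])
qed

lemma gens_finite: "\<sigma> \<in> \<Sigma> \<Longrightarrow> finite (gens \<sigma>)"
  using gens_independent independent_bound by blast

lemma gens_primitive: "h \<in> gens \<sigma> \<Longrightarrow> primitive h"
  unfolding gens_def using primitive_w primitive_embed by (auto simp: ray_generators_def)

lemma cone_over_eq:
  assumes "\<sigma> \<in> \<Sigma>"
  shows "convex_cone hull (insert w (emb ` \<sigma>)) = convex_cone hull (gens \<sigma>)"
proof
  have "emb ` \<sigma> = convex_cone hull (emb ` (ray_generators \<Sigma> \<inter> \<sigma>))"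
    using base_cone(2)[OF assms] convex_cone_hull_linear_image[OF linear_embed(1), of "ray_generators \<Sigma> \<inter> \<sigma>"] by simp
  also have "\<dots> \<subseteq> convex_cone hull (gens \<sigma>)" by (rule hull_mono) (auto simp: gens_def)
  finally have "insert w (emb ` \<sigma>) \<subseteq> convex_cone hull (gens \<sigma>)" by (simp add: hull_inc gens_def)
  then show "convex_cone hull (insert w (emb ` \<sigma>)) \<subseteq> convex_cone hull (gens \<sigma>)"
    by (rule hull_minimal) (rule convex_cone_convex_cone_hull)
  show "convex_cone hull (gens \<sigma>) \<subseteq> convex_cone hull (insert w (emb ` \<sigma>))"
    by (rule hull_mono) (auto simp: gens_def)
qed

lemma K_iff: "\<tau> \<in> K \<longleftrightarrow> \<tau> \<noteq> {} \<and> (\<exists>\<sigma>\<in>\<Sigma>. \<tau> face_of convex_cone hull (gens \<sigma>))"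
  unfolding cone_over_fan_def using cone_over_eq by auto

lemma gens_subset_in_K: "\<sigma> \<in> \<Sigma> \<Longrightarrow> G \<subseteq> gens \<sigma> \<Longrightarrow> convex_cone hull G \<in> K"
  unfolding K_iff using subcone_face_of[OF gens_independent] convex_cone_hull_nonempty by blast

lemma E_iff: "\<rho> \<in> E \<longleftrightarrow> \<rho> \<in> K \<and> w0 \<notin> \<rho> \<or>
    (\<exists>\<tau>. \<rho> = convex_cone hull (insert w0 \<tau>) \<and> \<tau> \<in> K \<and> w0 \<notin> \<tau> \<and> (\<exists>\<sigma>\<in>K. insert w0 \<tau> \<subseteq> \<sigma>))"
  unfolding enhanced_fan_def star_subdivision_def by blast

text \<open>Subtracting the multiple of \<open>w\<close> with the same height leads to the base, where the fan is
  complete.\<close>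

lemma upper_half_space_covered:
  assumes "snd x \<ge> 0"
  shows "\<exists>\<sigma>\<in>\<Sigma>. x \<in> convex_cone hull (gens \<sigma>)"
proof -
  have "fst x - snd x *\<^sub>R fst w \<in> \<Union>\<Sigma>" using complete_base unfolding complete_fan_def by simp
  then obtain \<sigma> where \<sigma>: "\<sigma> \<in> \<Sigma>" "fst x - snd x *\<^sub>R fst w \<in> \<sigma>" by blast
  have "emb (fst x - snd x *\<^sub>R fst w) + snd x *\<^sub>R w \<in> convex_cone hull (insert w (emb ` \<sigma>))"
    using \<sigma>(2) assms by (intro convex_cone_hull_add convex_cone_hull_mul) (auto simp: hull_inc)
  moreover have "emb (fst x - snd x *\<^sub>R fst w) + snd x *\<^sub>R w = x"
    using snd_w by (simp add: prod_eq_iff)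
  ultimately show ?thesis using \<sigma>(1) cone_over_eq by auto
qed

lemma gens_hull_half_space: "convex_cone hull (gens \<sigma>) \<subseteq> {x. snd x \<ge> 0}"
  by (rule hull_minimal) (auto simp: gens_def snd_w convex_cone_iff)

lemma K_half_space: "\<tau> \<in> K \<Longrightarrow> \<tau> \<subseteq> {x. snd x \<ge> 0}"
  using K_iff face_of_imp_subset gens_hull_half_space by (meson order_trans)

text \<open>If the cone contains \<open>w0\<close>, subtract the largest possible multiple of \<open>w0\<close> from \<open>x\<close>: one of
  the coordinates that are positive on \<open>w0\<close> becomes \<open>0\<close>, and what remains of \<open>x\<close> lies in the facet
  of the cone on which this coordinate vanishes.\<close>

lemma upper_half_space_subdivided:
  assumes x: "snd x \<ge> 0"
  shows "x \<in> \<Union>E"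
proof -
  obtain \<sigma> where \<sigma>: "\<sigma> \<in> \<Sigma>" "x \<in> convex_cone hull (gens \<sigma>)" using upper_half_space_covered[OF x] by blast
  let ?H = "gens \<sigma>" and ?\<rho> = "convex_cone hull (gens \<sigma>)"
  have \<rho>: "?\<rho> \<in> K" by (rule gens_subset_in_K[OF \<sigma>(1) order_refl])
  show ?thesis
  proof (cases "w0 \<in> ?\<rho>")
    case False
    then have "?\<rho> \<in> E" unfolding E_iff using \<rho> by blast
    then show ?thesis using \<sigma>(2) by blast
  next
    case True
    have fin: "finite ?H" by (rule gens_finite[OF \<sigma>(1)])
    have ind: "independent ?H" by (rule gens_independent[OF \<sigma>(1)])
    obtain c where c: "\<forall>s\<in>?H. 0 \<le> c s" "w0 = (\<Sum>s\<in>?H. c s *\<^sub>R s)"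
      using True convex_cone_hull_finite_iff[OF fin, of w0] by blast
    obtain d where d: "\<forall>s\<in>?H. 0 \<le> d s" "x = (\<Sum>s\<in>?H. d s *\<^sub>R s)"
      using \<sigma>(2) convex_cone_hull_finite_iff[OF fin, of x] by blast
    define P where "P = {s\<in>?H. c s > 0}"
    have "P \<noteq> {}"
    proof
      assume "P = {}"
      have "c s = 0" if "s \<in> ?H" for s
      proof -
        have "\<not> 0 < c s" using \<open>P = {}\<close> that unfolding P_def by blast
        moreover have "0 \<le> c s" using c(1) that by blast
        ultimately show ?thesis by linarith
      qed
      then have "w0 = 0" unfolding c(2) by (intro sum.neutral) simp
      then show False using snd_w0 by simp
    qed
    define t where "t = Min ((\<lambda>s. d s / c s) ` P)"
    have finP: "finite P" using fin unfolding P_def by simp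
    have "t \<in> (\<lambda>s. d s / c s) ` P" unfolding t_def using finP \<open>P \<noteq> {}\<close> by (intro Min_in) auto
    then obtain g where g: "g \<in> P" "t = d g / c g" by blast
    have gH: "g \<in> ?H" "c g > 0" using g(1) unfolding P_def by auto
    have t0: "t \<ge> 0" unfolding g(2) using gH d(1) by simp
    have le: "t * c s \<le> d s" if s: "s \<in> ?H" for s
    proof (cases "s \<in> P")
      case True
      then have "t \<le> d s / c s" unfolding t_def using finP by (intro Min_le) auto
      then show ?thesis using True unfolding P_def by (simp add: pos_le_divide_eq)
    next
      case False
      then have "c s = 0" using s c(1) unfolding P_def by force
      then show ?thesis using d(1) s by simp
    qed
    define \<tau> where "\<tau> = convex_cone hull (?H - {g})"
    have \<tau>: "\<tau> \<in> K" unfolding \<tau>_def by (rule gens_subset_in_K[OF \<sigma>(1)]) blast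
    have "w0 \<notin> \<tau>"
    proof
      assume "w0 \<in> \<tau>"
      then obtain e where e: "w0 = (\<Sum>s\<in>?H - {g}. e s *\<^sub>R s)"
        unfolding \<tau>_def using convex_cone_hull_finite_iff[of "?H - {g}" w0] fin by blast
      have "w0 = (\<Sum>s\<in>?H. (if s = g then 0 else e s) *\<^sub>R s)"
        unfolding e using fin by (intro sum.mono_neutral_cong_left) auto
      then have "(\<Sum>s\<in>?H. (c s - (if s = g then 0 else e s)) *\<^sub>R s) = 0"
        using c(2) by (simp only: scaleR_diff_left sum_subtractf) simp
      from independentD[OF ind fin order_refl this gH(1)] show False using gH(2) by simp
    qed
    moreover have "insert w0 \<tau> \<subseteq> ?\<rho>" using True hull_mono[of "?H - {g}" ?H convex_cone] unfolding \<tau>_def by blast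
    ultimately have "convex_cone hull (insert w0 \<tau>) \<in> E" unfolding E_iff using \<tau> \<rho> by blast
    moreover have "x \<in> convex_cone hull (insert w0 \<tau>)"
    proof -
      have "(\<Sum>s\<in>?H - {g}. (d s - t * c s) *\<^sub>R s) \<in> \<tau>"
        unfolding \<tau>_def convex_cone_hull_finite_iff[OF finite_Diff[OF fin]]
        using le by (intro exI[of _ "\<lambda>s. d s - t * c s"]) auto
      moreover have "(\<Sum>s\<in>?H - {g}. (d s - t * c s) *\<^sub>R s) = (\<Sum>s\<in>?H. (d s - t * c s) *\<^sub>R s)"
        using fin gH g(2) by (intro sum.mono_neutral_left) auto
      moreover have "\<dots> = x - t *\<^sub>R w0"
        unfolding d(2) c(2) by (simp add: scaleR_diff_left sum_subtractf scaleR_sum_right)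
      ultimately have "x - t *\<^sub>R w0 \<in> \<tau>" by simp
      then have "(x - t *\<^sub>R w0) + t *\<^sub>R w0 \<in> convex_cone hull (insert w0 \<tau>)"
        using t0 by (intro convex_cone_hull_add convex_cone_hull_mul) (auto simp: hull_inc)
      then show ?thesis by simp
    qed
    ultimately show ?thesis by blast
  qed
qed

lemma enhanced_support: "\<Union>E = {x. snd x \<ge> 0}"
proof
  show "{x. snd x \<ge> 0} \<subseteq> \<Union>E" using upper_half_space_subdivided by blast
  have "\<rho> \<subseteq> {x. snd x \<ge> 0}" if \<rho>: "\<rho> \<in> E" for \<rho>
  proof -
    from \<rho> consider "\<rho> \<in> K" | \<tau> where "\<rho> = convex_cone hull (insert w0 \<tau>)" "\<tau> \<in> K"
      unfolding E_iff by blast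
    then show ?thesis
    proof cases
      case 1 then show ?thesis by (rule K_half_space)
    next
      case 2
      show ?thesis unfolding 2(1)
        using K_half_space[OF 2(2)] by (intro hull_minimal) (auto simp: snd_w0 convex_cone_iff)
    qed
  qed
  then show "\<Union>E \<subseteq> {x. snd x \<ge> 0}" by blast
qed

text \<open>The cones of smaller dimension are negligible, so the others are dense in the half-space, and
  their union is closed.\<close>

lemma enhanced_full_cones_cover:
  assumes x: "x \<in> \<Union>E"
  shows "\<exists>\<sigma>\<in>E. dim \<sigma> = DIM((real^4) \<times> real) \<and> x \<in> \<sigma>"
proof (rule ccontr)
  assume contra: "\<not> ?thesis"
  have fan: "fan E" using regular_enhanced unfolding regular_fan_def by (rule conjunct1)
  have fin: "finite E" using fan unfolding fan_def by (rule conjunct1)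
  have cone: "\<forall>\<sigma>\<in>E. strongly_convex_rational_cone \<sigma>" using fan unfolding fan_def by (elim conjE)
  define U where "U = \<Union>{\<sigma>\<in>E. dim \<sigma> = DIM((real^4) \<times> real)}"
  define L where "L = \<Union>{\<sigma>\<in>E. dim \<sigma> \<noteq> DIM((real^4) \<times> real)}"
  have "closed \<sigma>" if "\<sigma> \<in> E" for \<sigma>
  proof -
    from bspec[OF cone that] obtain S where S: "finite S" "\<sigma> = convex_cone hull S"
      unfolding strongly_convex_rational_cone_def by (elim exE conjE)
    show ?thesis unfolding S(2) by (rule closed_convex_cone_hull[OF S(1)])
  qed
  then have "closed U" unfolding U_def using fin by (intro closed_Union) auto
  have xU: "x \<notin> U" using contra unfolding U_def by blast
  have "negligible L" unfolding L_def
  proof (rule negligible_Union)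
    show "finite {\<sigma>\<in>E. dim \<sigma> \<noteq> DIM((real^4) \<times> real)}" using fin by simp
    fix \<sigma> assume "\<sigma> \<in> {\<sigma>\<in>E. dim \<sigma> \<noteq> DIM((real^4) \<times> real)}"
    then have "dim \<sigma> < DIM((real^4) \<times> real)" using dim_subset_UNIV[of \<sigma>] by simp
    then show "negligible \<sigma>" by (rule negligible_lowdim)
  qed
  define W where "W = - U \<inter> {y. snd y > 0}"
  have "open W" unfolding W_def using \<open>closed U\<close>
    by (intro open_Int open_Compl open_Collect_less continuous_intros)
  obtain e where e: "e > 0" "ball x e \<subseteq> - U" using \<open>closed U\<close> xU open_contains_ball[of "- U"] by blast
  have "x + (e/2) *\<^sub>R w0 \<in> ball x e"
    using e(1) by (simp add: dist_norm w0_def norm_Pair)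
  then have "x + (e/2) *\<^sub>R w0 \<in> W" using e x unfolding W_def enhanced_support by (auto simp: snd_w0)
  then have "W \<noteq> {}" by blast
  moreover have "W \<subseteq> L"
  proof
    fix y assume y: "y \<in> W"
    then have "y \<in> \<Union>E" unfolding enhanced_support W_def by auto
    then show "y \<in> L" using y unfolding W_def U_def L_def by blast
  qed
  then have "negligible W" using \<open>negligible L\<close> negligible_subset by blast
  ultimately show False using open_not_negligible \<open>open W\<close> by blast
qed

lemma zero_cone_in_base: "{0} \<in> \<Sigma>"
proof -
  have "0 \<in> \<Union>\<Sigma>" using complete_base unfolding complete_fan_def by simp
  then obtain \<sigma> where \<sigma>: "\<sigma> \<in> \<Sigma>" by blast
  have "convex_cone hull {} face_of \<sigma>"
    using subcone_face_of[OF base_cone(1)[OF \<sigma>], of "{}"] base_cone(2)[OF \<sigma>] by simp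
  then show ?thesis using regular_base \<sigma> unfolding regular_fan_def fan_def by simp
qed

text \<open>A ray of the star subdivision is extremal in a cone over the base fan, or it contains \<open>w0\<close>.\<close>

lemma enhanced_rays: "ray_generators E = enhanced_points \<Delta> q - {0}"
proof
  have w0_ray: "w0 \<in> ray_generators E"
  proof -
    have "{0} \<in> K" using gens_subset_in_K[OF zero_cone_in_base, of "{}"] by simp
    moreover obtain \<sigma> where "\<sigma> \<in> \<Sigma>" "w0 \<in> convex_cone hull (gens \<sigma>)" using upper_half_space_covered[of w0] snd_w0 by auto
    then have "\<exists>\<sigma>\<in>K. insert w0 {0} \<subseteq> \<sigma>"
      using gens_subset_in_K[of \<sigma>] convex_cone_hull_contains_0[of "gens \<sigma>"] by blast
    moreover have "w0 \<notin> {0}" using primitive_w0 unfolding primitive_def by simp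
    ultimately have "convex_cone hull (insert w0 {0}) \<in> E" unfolding E_iff by blast
    moreover have "convex_cone hull (insert w0 {0}) = convex_cone hull {w0}"
    proof
      show "convex_cone hull (insert w0 {0}) \<subseteq> convex_cone hull {w0}"
        by (rule hull_minimal) (auto simp: hull_inc convex_cone_hull_contains_0 convex_cone_convex_cone_hull)
      show "convex_cone hull {w0} \<subseteq> convex_cone hull (insert w0 {0})" by (rule hull_mono) auto
    qed
    ultimately show ?thesis unfolding ray_generators_def using primitive_w0 by simp
  qed
  have gen_ray: "h \<in> ray_generators E" if \<sigma>: "\<sigma> \<in> \<Sigma>" and h: "h \<in> gens \<sigma>" for \<sigma> h
  proof (cases "h = w0")
    case True then show ?thesis using w0_ray by simp
  next
    case False
    have "w0 \<notin> convex_cone hull {h}"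
    proof
      assume "w0 \<in> convex_cone hull {h}"
      then obtain t where "t \<ge> 0" "w0 = t *\<^sub>R h" using ray_member by blast
      then show False using primitive_multiple_eq[OF primitive_w0 gens_primitive[OF h]] False by blast
    qed
    then have "convex_cone hull {h} \<in> E" unfolding E_iff using gens_subset_in_K[OF \<sigma>, of "{h}"] h by blast
    then show ?thesis unfolding ray_generators_def using gens_primitive[OF h] by simp
  qed
  show "enhanced_points \<Delta> q - {0} \<subseteq> ray_generators E"
  proof
    fix y assume y: "y \<in> enhanced_points \<Delta> q - {0}"
    then consider "y = w0" | "y = w" | v where "v \<in> lattice_points \<Delta> - {0}" "y = emb v"
      unfolding enhanced_points_def by (auto simp: zero_prod_def)
    then show "y \<in> ray_generators E"
    proof cases
      case 1 then show ?thesis using w0_ray by simp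
    next
      case 2 then show ?thesis using gen_ray[OF zero_cone_in_base, of y] by (simp add: gens_def)
    next
      case 3
      then have v: "v \<in> ray_generators \<Sigma>" using base_rays by simp
      then have "convex_cone hull {v} \<in> \<Sigma>" unfolding ray_generators_def by simp
      moreover have "y \<in> gens (convex_cone hull {v})" using v 3(2) hull_inc[of v "{v}" convex_cone] unfolding gens_def by blast
      ultimately show ?thesis by (rule gen_ray)
    qed
  qed
  show "ray_generators E \<subseteq> enhanced_points \<Delta> q - {0}"
  proof
    fix v assume "v \<in> ray_generators E"
    then have v: "primitive v" "convex_cone hull {v} \<in> E" unfolding ray_generators_def by auto
    have v0: "v \<noteq> 0" using v(1) unfolding primitive_def by blast
    from v(2) consider "convex_cone hull {v} \<in> K" | \<tau> where "convex_cone hull {v} = convex_cone hull (insert w0 \<tau>)"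
      unfolding E_iff by blast
    then show "v \<in> enhanced_points \<Delta> q - {0}"
    proof cases
      case 1
      then obtain \<sigma> where \<sigma>: "\<sigma> \<in> \<Sigma>" "convex_cone hull {v} face_of convex_cone hull (gens \<sigma>)" unfolding K_iff by blast
      have "v \<in> gens \<sigma>"
        by (rule ray_generates_face[OF gens_finite[OF \<sigma>(1)] gens_primitive v(1) \<sigma>(2) order_refl]) (simp_all add: hull_inc)
      then show ?thesis using v0 unfolding gens_def enhanced_points_def base_rays by auto
    next
      case 2
      have "w0 \<in> convex_cone hull {v}" unfolding 2 by (simp add: hull_inc)
      then obtain t where "t \<ge> 0" "w0 = t *\<^sub>R v" using ray_member by blast
      then have "w0 = v" using primitive_multiple_eq[OF primitive_w0 v(1)] by blast
      then show ?thesis using v0 unfolding enhanced_points_def by auto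
    qed
  qed
qed

lemma enhanced_fan_configuration:
  fixes \<mu> :: "'n::finite \<Rightarrow> (real^4) \<times> real"
  assumes bij: "bij_betw \<mu> UNIV (enhanced_points \<Delta> q)" and apex: "\<mu> i0 = 0"
    and semi: "c1_semipositive E" and reg: "regular_triangulation \<mu> (fan_triangulation E)"
  shows "fan_configuration \<mu> i0 E"
proof
  show "x + y \<in> \<Union>E" if "x \<in> \<Union>E" "y \<in> \<Union>E" for x y using that unfolding enhanced_support by simp
  show "\<exists>\<sigma>\<in>E. dim \<sigma> = DIM((real^4) \<times> real) \<and> x \<in> \<sigma>" if "x \<in> \<Union>E" for x by (rule enhanced_full_cones_cover[OF that])
  show inj: "inj \<mu>" using bij by (rule bij_betw_imp_inj_on)
  have "\<mu> ` (UNIV - {i0}) = range \<mu> - {0}" using apex image_set_diff[OF inj, of UNIV "{i0}"] by simp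
  also have "range \<mu> = enhanced_points \<Delta> q" using bij by (rule bij_betw_imp_surj_on)
  finally show "ray_generators E = \<mu> ` (UNIV - {i0})" unfolding enhanced_rays by simp
qed (fact regular_enhanced apex semi reg)+

end

section \<open>The basis of solutions of the enhanced system\<close>

theorem corollary5p8:
  fixes \<Delta> :: "(real^4) set"
    and q :: "real^4 \<Rightarrow> int"
    and \<Sigma> :: "(real^4) set set"
    and \<Sigma>h T :: "((real^4) \<times> real) set set"
    and \<mu> :: "'n::finite \<Rightarrow> (real^4) \<times> real"
    and i0 :: 'n
    and J :: "'n cpoly set"
    and \<alpha> :: "'b \<Rightarrow> 'n cpoly"
    and I :: "'b set"
  assumes "integral_polytope \<Delta>" and "0 \<in> \<Delta>"
    and "(\<Sum>v\<in>lattice_points \<Delta>. q v) = 0"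
    and "regular_fan \<Sigma>" and "complete_fan \<Sigma>"
    and "ray_generators \<Sigma> = lattice_points \<Delta> - {0}"
    and "\<Sigma>h = enhanced_fan \<Delta> q \<Sigma>" and "regular_fan \<Sigma>h"
    and "bij_betw \<mu> UNIV (enhanced_points \<Delta> q)" and "\<mu> i0 = 0"
    and "T = fan_triangulation \<Sigma>h"
    and "J = fan_ideal i0 \<mu> \<Sigma>h"
    and "c1_semipositive \<Sigma>h"
    and "regular_triangulation \<mu> T"
    and "\<forall>i\<in>I. homogeneous (\<alpha> i)" and "basis_modulo J \<alpha> I"
  shows "\<exists>U w. open U \<and> connected U \<and> U \<noteq> {} \<and>
           (\<forall>a\<in>U. \<forall>i. negate_coord i0 a $ i \<notin> \<real>\<^sub>\<le>\<^sub>0) \<and>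
           (\<forall>a\<in>U. \<forall>m. B_term i0 (negate_coord i0 a) m summable_on dual_cone_lattice \<mu> T) \<and>
           (\<forall>a\<in>U. expansion_modulo J \<alpha> I (B_series i0 \<mu> T (negate_coord i0 a)) (\<lambda>i. w i a)) \<and>
           basis_of_gkz_solutions \<mu> (-1, 0) U w I"
proof -
  let ?N = "{S. i0 \<notin> S \<and> convex_cone hull (\<mu> ` S) \<notin> \<Sigma>h}"
  have setting: "enhanced_fan_setting \<Delta> q \<Sigma>"
    using assms(4,5,6,7,8) by (intro enhanced_fan_setting.intro) simp_all
  have "fan_configuration \<mu> i0 \<Sigma>h"
    using enhanced_fan_setting.enhanced_fan_configuration[OF setting assms(9,10)] assms(13,14)
    unfolding assms(11) assms(7) by blast
  from fan_configuration.toric_data_exists[OF this] obtain \<psi>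
    where data: "toric_data \<mu> i0 ?N (dual_cone_lattice \<mu> T) \<psi>" unfolding assms(11)[symmetric] by (elim exE)
  have "stanley_reisner_generators i0 \<mu> \<Sigma>h = (\<lambda>S. \<Prod>i\<in>S. pvar i) ` ?N"
    unfolding stanley_reisner_generators_def by blast
  then have J: "J = ideal_generated ((\<lambda>S. \<Prod>i\<in>S. pvar i) ` ?N \<union> linear_generators \<mu>)"
    unfolding assms(12) fan_ideal_def by (simp only:)
  have series: "B_series i0 \<mu> T a = (\<lambda>m. 1 / (a $ i0) * (\<Sum>\<^sub>\<infinity>l\<in>dual_cone_lattice \<mu> T. B_term i0 a m l))" for a
    by (rule ext) (simp only: B_series_def)
  show ?thesis
    unfolding series J
    by (rule toric_data.solutions_on_domain[OF data assms(16)[unfolded J] assms(15)])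
qed

end
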